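(* Let $d=3$, write $x,y,z$ for the three variables, and let $\varphi=M_\Xi$ be the trivariate piecewise linear box spline with $\Xi=\begin{bmatrix}1&0&0&1\\0&1&0&1\\0&0&1&1\end{bmatrix}$, so that $H=2^{-4}(1+x)(1+y)(1+z)(1+xyz)$. Define the Laurent polynomials $$H_{1,0,0}=-3x^2y^3z^3+5xy^3z^3-2x^2y^3z-2x^2yz^3-2y^3z^3+5xy^3z+5xyz^3-3x^2yz-3y^3z-3yz^3+45xyz-84yz+45x^{-1}yz-3yz^{-1}-3y^{-1}z-3x^{-2}yz+5x^{-1}yz^{-1}+5x^{-1}y^{-1}z-2y^{-1}z^{-1}-2x^{-2}yz^{-1}-2x^{-2}y^{-1}z+5x^{-1}y^{-1}z^{-1}-3x^{-2}y^{-1}z^{-1},$$ $$H_{1,1,0}=-3x^2y^2z^3-2x^2y^2z-2x^2z^3+10xyz^3-2y^2z^3-3x^2z+40xyz-3y^2z-3z^3+10xy^{-1}z-84z+10x^{-1}yz-3z^{-1}-3y^{-2}z+40x^{-1}y^{-1}z-3x^{-2}z-2y^{-2}z^{-1}+10x^{-1}y^{-1}z^{-1}-2x^{-2}z^{-1}-2x^{-2}y^{-2}z-3x^{-2}y^{-2}z^{-1},$$ $$H_{1,1,1}=-3x^2y^2z^2-2x^2y^2-2x^2z^2-2y^2z^2+45xyz-3x^2-3y^2-3z^2+5xyz^{-1}+5xy^{-1}z+5x^{-1}yz-84+5xy^{-1}z^{-1}+5x^{-1}yz^{-1}+5x^{-1}y^{-1}z-3z^{-2}-3y^{-2}-3x^{-2}+45x^{-1}y^{-1}z^{-1}-2y^{-2}z^{-2}-2x^{-2}z^{-2}-2x^{-2}y^{-2}-3x^{-2}y^{-2}z^{-2},$$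 and $H_{0,1,0}(x,y,z)=H_{1,0,0}(y,x,z)$, $H_{0,0,1}(x,y,z)=H_{1,0,0}(z,y,x)$, $H_{1,0,1}(x,y,z)=H_{1,1,0}(x,z,y)$, $H_{0,1,1}(x,y,z)=H_{1,1,0}(z,y,x)$. Then $\{H\}\cup\{H_s:s\in E\setminus\{0\}\}$ is a basis of $\mathcal{L}(\ell_1)$ over $\mathcal{L}_\downarrow(\ell_1)$ and $\langle H,H_s\rangle_\Phi=0$ for all $s\in E\setminus\{0\}$; consequently the compactly supported functions $\psi_s$ with masks $H_s$, $s\in E\setminus\{0\}$, are prewavelets for the multiresolution analysis generated by $\varphi$. The numbers of nonzero coefficients are $23$ for each of $H_{1,0,0},H_{0,1,0},H_{0,0,1},H_{1,1,1}$ and $21$ for each of $H_{1,1,0},H_{1,0,1},H_{0,1,1}$, in total $155$.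
   Context: $E=\{0,1\}^d$; $\mathbb{T}^d=\{\zeta\in\mathbb{C}^d:|\zeta_j|=1\}$. $\mathcal{L}(\ell_1)$ (resp. $\mathcal{L}(\ell_2)$) is the set of Laurent series $\sum_{k\in\mathbb{Z}^d}a_k\zeta^k$ with $a\in\ell_1(\mathbb{Z}^d)$ (resp. $\ell_2$), as functions on $\mathbb{T}^d$; $\mathcal{L}(\ell_1)$ is a ring and $\mathcal{L}_\downarrow(\ell_1)=\{F(\zeta^2):F\in\mathcal{L}(\ell_1)\}$, $\zeta^2=(\zeta_1^2,\dots,\zeta_d^2)$, is a subring. Conjugation: $\overline{\sum a_k\zeta^k}=\sum\overline{a_k}\zeta^{-k}$. Fourier transform: $\hat f(u)=\int f(x)e^{-iu^Tx}dx$. The box spline $M_\Xi$ of a full-rank integer matrix $\Xi=[\xi_1,\dots,\xi_\ell]\in\mathbb{Z}^{d\times\ell}$ is given by $\widehat{M}_\Xi(u)=\prod_{j=1}^\ell\frac{1-e^{-i\xi_j^Tu}}{i\xi_j^Tu}$, and $\hat\varphi(2u)=H(e^{-iu})\hat\varphi(u)$ for $\varphi=M_\Xi$ with $H(\zeta)=2^{-\ell}\prod_j(1+\zeta^{\xi_j})$. $\Phi(\zeta)=\sum_{k\in\mathbb{Z}^d}\tilde\varphi(k)\zeta^k$, where $\tilde\varphi(u)=\int\varphi(t)\overline{\varphi(t-u)}dt$; here $\Phi=\frac1{60}\big(24+3(xyz+x^{-1}y^{-1}z^{-1}+x+x^{-1}+y+y^{-1}+z+z^{-1})+2(xy+xz+yz+x^{-1}y^{-1}+x^{-1}z^{-1}+y^{-1}z^{-1})\big)$.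 $\langle F,G\rangle_\Phi(\zeta)=\sum_{s\in E}\Phi((-1)^s\zeta)F((-1)^s\zeta)\overline{G((-1)^s\zeta)}$ with $(-1)^s\zeta=((-1)^{s_1}\zeta_1,\dots,(-1)^{s_d}\zeta_d)$. $V_0=\{f\in L_2(\mathbb{R}^d):\hat f(u)=F(e^{-iu})\hat\varphi(u),\ F\in\mathcal{L}(\ell_2)\}$; $F$ is called the mask of $f$. $V_{-1}=\{f\in L_2(\mathbb{R}^d):\hat f(u)=\hat g(2u),\ g\in V_0\}\subset V_0$, and $W_0$ is the orthogonal complement of $V_{-1}$ in $V_0$. Functions $\psi_s\in W_0$, $s\in S$ ($S$ finite), are prewavelets if $\{\psi_s(\cdot-2k):s\in S,k\in\mathbb{Z}^d\}$ is a Riesz basis of $W_0$. *)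

theory Defs
  imports "HOL-Analysis.Analysis" "HOL-Library.Poly_Mapping"
begin

section \<open>Square-integrable functions and the Fourier transform\<close>

text \<open>
  Elements of \<open>L\<^sub>2\<close> are represented by Borel functions; two representatives that agree almost
  everywhere are not identified. The squared norm is an \<^typ>\<open>ennreal\<close>, so that it is
  infinite (and not \<open>0\<close>) for functions outside \<open>L\<^sub>2\<close>.
\<close>

definition L2_sqnorm :: "'a measure \<Rightarrow> ('a \<Rightarrow> complex) \<Rightarrow> ennreal" where
  "L2_sqnorm M f = (\<integral>\<^sup>+x. ennreal ((cmod (f x))\<^sup>2) \<partial>M)"

definition L2 :: "(real^'d::finite \<Rightarrow> complex) set" where
  "L2 = {f. f \<in> borel_measurable lborel \<and> L2_sqnorm lborel f < \<infinity>}"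

definition L2_inner :: "(real^'d::finite \<Rightarrow> complex) \<Rightarrow> (real^'d \<Rightarrow> complex) \<Rightarrow> complex" where
  "L2_inner f g = (LINT x|lborel. f x * cnj (g x))"

definition fourier :: "(real^'d::finite \<Rightarrow> complex) \<Rightarrow> real^'d \<Rightarrow> complex" where
  "fourier f u = (LINT x|lborel. f x * exp (- \<i> * of_real (u \<bullet> x)))"

text \<open>
  \<open>has_fourier_L2 f g\<close>: \<open>g\<close> represents the Fourier transform of \<open>f \<in> L\<^sub>2\<close>, which is the
  \<open>L\<^sub>2\<close> limit of the transforms of the (integrable) truncations of \<open>f\<close>.
\<close>

definition has_fourier_L2 :: "(real^'d::finite \<Rightarrow> complex) \<Rightarrow> (real^'d \<Rightarrow> complex) \<Rightarrow> bool" where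
  "has_fourier_L2 f g \<longleftrightarrow> f \<in> L2 \<and> g \<in> L2 \<and>
     (\<lambda>n. L2_sqnorm lborel
        (\<lambda>u. g u - fourier (\<lambda>x. indicat_real (cball 0 (real n)) x *\<^sub>R f x) u)) \<longlonglongrightarrow> 0"


section \<open>Laurent series on the torus\<close>

definition torus :: "(complex^'d::finite) set" where
  "torus = {\<zeta>. \<forall>j. cmod (\<zeta> $ j) = 1}"

definition zpow :: "complex^'d::finite \<Rightarrow> int^'d \<Rightarrow> complex" where
  "zpow \<zeta> k = (\<Prod>j\<in>UNIV. (\<zeta> $ j) powi (k $ j))"

definition laurent_series :: "(int^'d::finite \<Rightarrow> complex) \<Rightarrow> complex^'d \<Rightarrow> complex" where
  "laurent_series a \<zeta> = (\<Sum>\<^sub>\<infinity>k. a k * zpow \<zeta> k)"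

text \<open>
  Functions on the torus are represented by functions on the whole space whose values off the
  torus are irrelevant. All equations between them are therefore only required on \<^const>\<open>torus\<close>.
\<close>

definition Laurent_l1 :: "(complex^'d::finite \<Rightarrow> complex) set" where
  "Laurent_l1 = {F. \<exists>a. (\<lambda>k. cmod (a k)) summable_on UNIV \<and> (\<forall>\<zeta>\<in>torus. F \<zeta> = laurent_series a \<zeta>)}"

definition Laurent_l1_down :: "(complex^'d::finite \<Rightarrow> complex) set" where
  "Laurent_l1_down = {F. \<exists>G\<in>Laurent_l1. \<forall>\<zeta>\<in>torus. F \<zeta> = G (\<chi> j. (\<zeta> $ j)\<^sup>2)}"

definition torus_point :: "real^'d::finite \<Rightarrow> complex^'d" where
  "torus_point u = (\<chi> j. exp (- \<i> * of_real (u $ j)))"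

text \<open>Laurent series with square-summable coefficients converge in \<open>L\<^sub>2\<close> of the torus,
  parametrised here by the cube \<open>[0, 2\<pi>]\<^sup>d\<close>.\<close>

definition Laurent_l2 :: "(complex^'d::finite \<Rightarrow> complex) set" where
  "Laurent_l2 = {F. (\<lambda>u. F (torus_point u)) \<in> borel_measurable lborel \<and>
     (\<exists>a. (\<lambda>k. (cmod (a k))\<^sup>2) summable_on UNIV \<and>
       ((\<lambda>K. L2_sqnorm (restrict_space lborel (cbox 0 (\<chi> j. 2 * pi)))
               (\<lambda>u. F (torus_point u) - (\<Sum>k\<in>K. a k * zpow (torus_point u) k))) \<longlongrightarrow> 0)
         (finite_subsets_at_top UNIV))}"

text \<open>\<open>b\<close> is a basis, indexed by the finite set \<open>I\<close>, of the \<^const>\<open>Laurent_l1_down\<close>-module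
  \<^const>\<open>Laurent_l1\<close>.\<close>

definition is_Laurent_basis :: "'i set \<Rightarrow> ('i \<Rightarrow> complex^'d::finite \<Rightarrow> complex) \<Rightarrow> bool" where
  "is_Laurent_basis I b \<longleftrightarrow> finite I \<and> (\<forall>i\<in>I. b i \<in> Laurent_l1) \<and>
     (\<forall>F\<in>Laurent_l1. \<exists>G. (\<forall>i\<in>I. G i \<in> Laurent_l1_down) \<and>
        (\<forall>\<zeta>\<in>torus. F \<zeta> = (\<Sum>i\<in>I. G i \<zeta> * b i \<zeta>))) \<and>
     (\<forall>G. (\<forall>i\<in>I. G i \<in> Laurent_l1_down) \<and> (\<forall>\<zeta>\<in>torus. (\<Sum>i\<in>I. G i \<zeta> * b i \<zeta>) = 0) \<longrightarrow>
        (\<forall>i\<in>I. \<forall>\<zeta>\<in>torus. G i \<zeta> = 0))"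

text \<open>
  Laurent polynomials are finitely supported maps from exponents to coefficients; their product
  is the convolution product of \<^theory>\<open>HOL-Library.Poly_Mapping\<close>.
\<close>

definition laurent_poly :: "((int^'d::finite) \<Rightarrow>\<^sub>0 complex) \<Rightarrow> complex^'d \<Rightarrow> complex" where
  "laurent_poly P = laurent_series (Poly_Mapping.lookup P)"

text \<open>The substitution \<open>P(x\<^bsub>\<pi> 1\<^esub>, \<dots>, x\<^bsub>\<pi> d\<^esub>)\<close> for a permutation \<open>\<pi>\<close> of the variables.\<close>

definition permute_vars ::
    "('d \<Rightarrow> 'd) \<Rightarrow> ((int^'d::finite) \<Rightarrow>\<^sub>0 complex) \<Rightarrow> ((int^'d) \<Rightarrow>\<^sub>0 complex)" where
  "permute_vars \<pi> P = Poly_Mapping.map_key (\<lambda>k. \<chi> j. k $ \<pi> j) P"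


section \<open>Box splines\<close>

text \<open>
  A box spline is an integrable function with the prescribed transform and hence determined up to
  a null set; the value at zeros of \<open>\<xi>\<^sub>j\<^sup>T u\<close> is that of the continuous extension.
  By the Riemann-Lebesgue lemma no such function exists unless \<open>\<Xi>\<close> has full rank.
\<close>

definition box_factor :: "real \<Rightarrow> complex" where
  "box_factor t = (if t = 0 then 1 else (1 - exp (- \<i> * of_real t)) / (\<i> * of_real t))"

definition is_box_spline :: "int^'l::finite^'d::finite \<Rightarrow> (real^'d \<Rightarrow> complex) \<Rightarrow> bool" where
  "is_box_spline \<Xi> \<phi> \<longleftrightarrow> integrable lborel \<phi> \<and>
     (\<forall>u. fourier \<phi> u = (\<Prod>j\<in>UNIV. box_factor ((\<chi> i. of_int (column j \<Xi> $ i)) \<bullet> u)))"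

definition box_mask :: "int^'l::finite^'d::finite \<Rightarrow> ((int^'d) \<Rightarrow>\<^sub>0 complex)" where
  "box_mask \<Xi> = Poly_Mapping.single 0 (1 / 2 ^ CARD('l)) *
     (\<Prod>j\<in>UNIV. 1 + Poly_Mapping.single (column j \<Xi>) 1)"

definition int_point :: "int^'d::finite \<Rightarrow> real^'d" where
  "int_point k = (\<chi> j. of_int (k $ j))"

definition autocorrelation :: "(real^'d::finite \<Rightarrow> complex) \<Rightarrow> real^'d \<Rightarrow> complex" where
  "autocorrelation \<phi> u = (LINT t|lborel. \<phi> t * cnj (\<phi> (t - u)))"

definition Phi_symbol :: "(real^'d::finite \<Rightarrow> complex) \<Rightarrow> complex^'d \<Rightarrow> complex" where
  "Phi_symbol \<phi> = laurent_series (\<lambda>k. autocorrelation \<phi> (int_point k))"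

definition E01 :: "(nat^'d::finite) set" where
  "E01 = {s. \<forall>j. s $ j \<in> {0, 1}}"

definition sign_change :: "nat^'d::finite \<Rightarrow> complex^'d \<Rightarrow> complex^'d" where
  "sign_change s \<zeta> = (\<chi> j. (-1) ^ (s $ j) * \<zeta> $ j)"

definition Phi_inner :: "(real^'d::finite \<Rightarrow> complex) \<Rightarrow> (complex^'d \<Rightarrow> complex) \<Rightarrow>
    (complex^'d \<Rightarrow> complex) \<Rightarrow> complex^'d \<Rightarrow> complex" where
  "Phi_inner \<phi> F G \<zeta> = (\<Sum>s\<in>E01. Phi_symbol \<phi> (sign_change s \<zeta>) * F (sign_change s \<zeta>) *
     cnj (G (sign_change s \<zeta>)))"


section \<open>Prewavelets\<close>

definition has_mask ::
    "(real^'d::finite \<Rightarrow> complex) \<Rightarrow> (complex^'d \<Rightarrow> complex) \<Rightarrow> (real^'d \<Rightarrow> complex) \<Rightarrow> bool" where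
  "has_mask \<phi> F f \<longleftrightarrow> F \<in> Laurent_l2 \<and>
     has_fourier_L2 f (\<lambda>u. F (torus_point u) * fourier \<phi> u)"

definition V_zero :: "(real^'d::finite \<Rightarrow> complex) \<Rightarrow> (real^'d \<Rightarrow> complex) set" where
  "V_zero \<phi> = {f \<in> L2. \<exists>F. has_mask \<phi> F f}"

definition V_minus_one :: "(real^'d::finite \<Rightarrow> complex) \<Rightarrow> (real^'d \<Rightarrow> complex) set" where
  "V_minus_one \<phi> = {f \<in> L2. \<exists>g\<in>V_zero \<phi>. \<exists>g'. has_fourier_L2 g g' \<and>
     has_fourier_L2 f (\<lambda>u. g' (2 *\<^sub>R u))}"

definition W_zero :: "(real^'d::finite \<Rightarrow> complex) \<Rightarrow> (real^'d \<Rightarrow> complex) set" where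
  "W_zero \<phi> = {f \<in> V_zero \<phi>. \<forall>g\<in>V_minus_one \<phi>. L2_inner f g = 0}"

definition is_Riesz_basis ::
    "(real^'d::finite \<Rightarrow> complex) set \<Rightarrow> 'i set \<Rightarrow> ('i \<Rightarrow> real^'d \<Rightarrow> complex) \<Rightarrow> bool" where
  "is_Riesz_basis W I b \<longleftrightarrow> (\<forall>i\<in>I. b i \<in> W) \<and>
     (\<exists>A>0. \<exists>B>0. \<forall>J c. finite J \<and> J \<subseteq> I \<longrightarrow>
        ennreal (A * (\<Sum>i\<in>J. (cmod (c i))\<^sup>2)) \<le> L2_sqnorm lborel (\<lambda>x. \<Sum>i\<in>J. c i * b i x) \<and>
        L2_sqnorm lborel (\<lambda>x. \<Sum>i\<in>J. c i * b i x) \<le> ennreal (B * (\<Sum>i\<in>J. (cmod (c i))\<^sup>2))) \<and>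
     (\<forall>f\<in>W. \<forall>\<epsilon>>0. \<exists>J c. finite J \<and> J \<subseteq> I \<and>
        L2_sqnorm lborel (\<lambda>x. f x - (\<Sum>i\<in>J. c i * b i x)) < ennreal \<epsilon>)"

definition are_prewavelets ::
    "(real^'d::finite \<Rightarrow> complex) \<Rightarrow> 's set \<Rightarrow> ('s \<Rightarrow> real^'d \<Rightarrow> complex) \<Rightarrow> bool" where
  "are_prewavelets \<phi> S \<psi> \<longleftrightarrow> finite S \<and> (\<forall>s\<in>S. \<psi> s \<in> W_zero \<phi>) \<and>
     is_Riesz_basis (W_zero \<phi>) (S \<times> UNIV) (\<lambda>(s, k) x. \<psi> s (x - 2 *\<^sub>R int_point k))"

text \<open>Compact support is meant for classes of functions modulo null sets.\<close>

definition compactly_supported :: "(real^'d::finite \<Rightarrow> complex) \<Rightarrow> bool" where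
  "compactly_supported f \<longleftrightarrow> (\<exists>K. compact K \<and> (AE x in lborel. x \<notin> K \<longrightarrow> f x = 0))"


section \<open>The trivariate piecewise linear box spline\<close>

definition Xi :: "int^4^3" where
  "Xi = vector [vector [1, 0, 0, 1], vector [0, 1, 0, 1], vector [0, 0, 1, 1]]"

text \<open>The monomial \<open>x\<^sup>i y\<^sup>j z\<^sup>k\<close>.\<close>

definition lmon :: "int \<Rightarrow> int \<Rightarrow> int \<Rightarrow> ((int^3) \<Rightarrow>\<^sub>0 complex)" where
  "lmon i j k = Poly_Mapping.single (vector [i, j, k]) 1"

definition H100 :: "(int^3) \<Rightarrow>\<^sub>0 complex" where
  "H100 =
     - 3 * lmon 2 3 3 + 5 * lmon 1 3 3 - 2 * lmon 2 3 1 - 2 * lmon 2 1 3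
     - 2 * lmon 0 3 3 + 5 * lmon 1 3 1 + 5 * lmon 1 1 3 - 3 * lmon 2 1 1
     - 3 * lmon 0 3 1 - 3 * lmon 0 1 3 + 45 * lmon 1 1 1 - 84 * lmon 0 1 1
     + 45 * lmon (-1) 1 1 - 3 * lmon 0 1 (-1) - 3 * lmon 0 (-1) 1 - 3 * lmon (-2) 1 1
     + 5 * lmon (-1) 1 (-1) + 5 * lmon (-1) (-1) 1 - 2 * lmon 0 (-1) (-1) - 2 * lmon (-2) 1 (-1)
     - 2 * lmon (-2) (-1) 1 + 5 * lmon (-1) (-1) (-1) - 3 * lmon (-2) (-1) (-1)"

definition H110 :: "(int^3) \<Rightarrow>\<^sub>0 complex" where
  "H110 =
     - 3 * lmon 2 2 3 - 2 * lmon 2 2 1 - 2 * lmon 2 0 3 + 10 * lmon 1 1 3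
     - 2 * lmon 0 2 3 - 3 * lmon 2 0 1 + 40 * lmon 1 1 1 - 3 * lmon 0 2 1
     - 3 * lmon 0 0 3 + 10 * lmon 1 (-1) 1 - 84 * lmon 0 0 1 + 10 * lmon (-1) 1 1
     - 3 * lmon 0 0 (-1) - 3 * lmon 0 (-2) 1 + 40 * lmon (-1) (-1) 1 - 3 * lmon (-2) 0 1
     - 2 * lmon 0 (-2) (-1) + 10 * lmon (-1) (-1) (-1) - 2 * lmon (-2) 0 (-1) - 2 * lmon (-2) (-2) 1
     - 3 * lmon (-2) (-2) (-1)"

definition H111 :: "(int^3) \<Rightarrow>\<^sub>0 complex" where
  "H111 =
     - 3 * lmon 2 2 2 - 2 * lmon 2 2 0 - 2 * lmon 2 0 2 - 2 * lmon 0 2 2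
     + 45 * lmon 1 1 1 - 3 * lmon 2 0 0 - 3 * lmon 0 2 0 - 3 * lmon 0 0 2
     + 5 * lmon 1 1 (-1) + 5 * lmon 1 (-1) 1 + 5 * lmon (-1) 1 1 - 84 * lmon 0 0 0
     + 5 * lmon 1 (-1) (-1) + 5 * lmon (-1) 1 (-1) + 5 * lmon (-1) (-1) 1 - 3 * lmon 0 0 (-2)
     - 3 * lmon 0 (-2) 0 - 3 * lmon (-2) 0 0 + 45 * lmon (-1) (-1) (-1) - 2 * lmon 0 (-2) (-2)
     - 2 * lmon (-2) 0 (-2) - 2 * lmon (-2) (-2) 0 - 3 * lmon (-2) (-2) (-2)"

definition H010 :: "(int^3) \<Rightarrow>\<^sub>0 complex" where
  "H010 = permute_vars (Transposition.transpose 1 2) H100"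

definition H001 :: "(int^3) \<Rightarrow>\<^sub>0 complex" where
  "H001 = permute_vars (Transposition.transpose 1 3) H100"

definition H101 :: "(int^3) \<Rightarrow>\<^sub>0 complex" where
  "H101 = permute_vars (Transposition.transpose 2 3) H110"

definition H011 :: "(int^3) \<Rightarrow>\<^sub>0 complex" where
  "H011 = permute_vars (Transposition.transpose 1 3) H110"

definition wavelet_mask :: "nat^3 \<Rightarrow> ((int^3) \<Rightarrow>\<^sub>0 complex)" where
  "wavelet_mask s =
     (if s = vector [1, 0, 0] then H100
      else if s = vector [0, 1, 0] then H010
      else if s = vector [0, 0, 1] then H001
      else if s = vector [1, 1, 0] then H110
      else if s = vector [1, 0, 1] then H101
      else if s = vector [0, 1, 1] then H011
      else H111)"

end

theory Submission
  imports Defs "HOL-Probability.Characteristic_Functions"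
begin

text \<open>
  Split a Laurent series \<open>F\<close> into its eight polyphase components, carried by the exponents in a
  fixed class modulo \<open>2\<close>. The component of \<open>\<Phi>H\<close> at \<open>xyz\<close> is \<open>xyz (1 + \<Phi>(\<zeta>\<^sup>2)) / 16\<close>; call the one
  at \<open>\<zeta>^(1 - s)\<close>, \<open>s \<noteq> 0\<close>, \<open>\<zeta>^(1 - s) \<tau>\<^sub>s(\<zeta>\<^sup>2) / 960\<close>. The mask \<open>H\<^sub>s\<close> has only two components: \<open>xyz\<close> times
  the conjugate of \<open>\<tau>\<^sub>s(\<zeta>\<^sup>2)\<close>, and \<open>-60 \<zeta>^(1 - s) (1 + \<Phi>(\<zeta>\<^sup>2))\<close>. Parseval's identity for the group
  of sign changes then gives orthogonality to \<open>H\<close>, and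
  similarly \<open>\<langle>H, H\<rangle> = \<Phi>(\<zeta>\<^sup>2)\<close>.

  On the torus \<open>\<Phi>\<close> is \<open>1/5\<close> plus a sum of squares, so \<open>1 / \<Phi>\<close> and \<open>1 / (1 + \<Phi>)\<close> are absolutely
  convergent Laurent series. In an expansion of \<open>F\<close> the coefficient of \<open>H\<close> must be
  \<open>\<langle>F, H\<rangle> / \<Phi>(\<zeta>\<^sup>2)\<close>; once it is subtracted, the coefficient of \<open>H\<^sub>s\<close> is read off the component in which
  only \<open>H\<^sub>s\<close> survives. What remains lives on the component at \<open>xyz\<close> and is orthogonal to \<open>H\<close>, so it
  vanishes because \<open>1 + \<Phi> \<noteq> 0\<close>.

  For the functions, the \<open>L\<^sub>2\<close> Fourier transform is controlled through a Gaussian-regularised Parseval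
  identity. Since \<open>1/5 \<le> \<Phi> \<le> 1\<close>, norms of finite combinations of integer translates of \<open>\<phi>\<close> are
  comparable to those of their coefficients, which reduces the Riesz bounds to the torus, where they
  are again read off the polyphase components. An element \<open>f\<close> of \<open>W\<^sub>0\<close> is within \<open>\<epsilon>\<close> of some \<open>g + h\<close>
  with \<open>g\<close> in \<open>V\<close> at level \<open>-1\<close> and \<open>h\<close> a finite combination of wavelets; as \<open>f - h\<close> is orthogonal to
  \<open>g\<close>, dropping \<open>g\<close> only improves the approximation.
\<close>

section \<open>The Fourier transform\<close>

text \<open>The components of \<Phi>H at \<open>xyz\<close> and at \<zeta>^(1 - s) are proportional
  to 1 + \<Phi> and \<tau>_s. A mask carrying these two values interchanged, one of them with
  reversed sign and conjugated where necessary, is orthogonal to H because a single pair of terms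
  cancels. This is the origin of H_s; the factor 60 = 960 / 16 balances the two denominators and
  makes all coefficients integers. The obstacle is that elements of V_0 and V_-1 have masks that are
  only square summable and transforms that are L2 limits. The algebra is therefore done on finitely
  supported masks, where an inner product is a constant coefficient; series enter through the basis
  expansion and through density. Passing from convergence on the torus to convergence on the whole
  space rests on a bounded periodisation of the squared transform of the spline, which three of its
  four box factors provide. Norm comparisons for the transform hold up to constants: squared norms
  and (a + b)^2 \<le> 2 a^2 + 2 b^2 take the place of the triangle inequality, so that no roots of
  extended reals occur.\<close>

lemma
  fixes f :: "'d::finite \<Rightarrow> real \<Rightarrow> 'b::{real_normed_field,banach,second_countable_topology}"
  assumes f: "\<And>i. integrable lborel (f i)"
  shows integrable_lborel_prod_vec: "integrable lborel (\<lambda>x::real^'d. \<Prod>i\<in>UNIV. f i (x $ i))"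
    and integral_lborel_prod_vec:
      "(LINT x|lborel. (\<Prod>i\<in>UNIV. f i ((x::real^'d) $ i))) = (\<Prod>i\<in>UNIV. LINT t|lborel. f i t)"
proof -
  \<comment> \<open>Lebesgue measure on a Euclidean space is the image of a product measure indexed
    by \<open>Basis\<close>. \<open>ix\<close> inverts the enumeration of \<open>Basis\<close> by
    the vectors \<open>axis i 1\<close>, which turns the product over coordinates into one over
    \<open>Basis\<close>.\<close>
  define ix where "ix b = (THE i. b = axis i (1::real))" for b :: "real^'d"
  have ix [simp]: "ix (axis i 1) = i" for i
    unfolding ix_def by (rule the_equality) (auto simp: axis_eq_axis)
  have bij: "bij_betw (\<lambda>i. axis i (1::real)) UNIV (Basis::(real^'d) set)"
    unfolding bij_betw_def by (auto simp: Basis_vec_def inj_on_def axis_eq_axis)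
  interpret product_sigma_finite "\<lambda>b::real^'d. lborel :: real measure"
    by standard
  have comp: "(\<Sum>b\<in>Basis. h b *\<^sub>R b) $ i = h (axis i 1)" for h :: "real^'d \<Rightarrow> real" and i
  proof -
    have "axis i (1::real) \<in> Basis" by (auto simp: Basis_vec_def)
    then have "(\<Sum>b\<in>Basis. h b *\<^sub>R b) \<bullet> axis i 1 = h (axis i 1)"
      by simp
    then show ?thesis by (simp add: inner_axis)
  qed
  have eq: "(\<Prod>i\<in>UNIV. f i ((\<Sum>b\<in>Basis. h b *\<^sub>R b) $ i)) = (\<Prod>b\<in>Basis. f (ix b) (h b))" for h
    unfolding comp using bij by (subst prod.reindex_bij_betw[symmetric, OF bij]) simp
  have fm: "f i \<in> borel_measurable borel" for i
    using borel_measurable_integrable[OF f] by simp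
  have m1 [measurable]: "(\<lambda>x::real^'d. \<Prod>i\<in>UNIV. f i (x $ i)) \<in> borel_measurable borel"
    by (intro borel_measurable_prod measurable_compose[OF _ fm]) simp
  have m2: "(\<lambda>h. \<Sum>b\<in>Basis. h b *\<^sub>R b) \<in> borel_measurable (\<Pi>\<^sub>M b\<in>(Basis::(real^'d) set). (lborel :: real measure))"
    by measurable
  show "integrable lborel (\<lambda>x::real^'d. \<Prod>i\<in>UNIV. f i (x $ i))"
    by (subst lborel_eq, subst integrable_distr_eq[OF m2 m1], unfold eq)
       (intro product_integrable_prod f finite_Basis)
  have "(LINT x|lborel. (\<Prod>i\<in>UNIV. f i ((x::real^'d) $ i))) = (\<Prod>b\<in>(Basis::(real^'d) set). LINT t|lborel. f (ix b) t)"
    by (subst lborel_eq, subst integral_distr[OF m2 m1], unfold eq)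
       (intro product_integral_prod f finite_Basis)
  also have "\<dots> = (\<Prod>i\<in>UNIV. LINT t|lborel. f i t)"
    by (subst prod.reindex_bij_betw[symmetric, OF bij]) simp
  finally show "(LINT x|lborel. (\<Prod>i\<in>UNIV. f i ((x::real^'d) $ i))) = (\<Prod>i\<in>UNIV. LINT t|lborel. f i t)" .
qed

section \<open>Affine substitution and Fubini's theorem for Lebesgue measure\<close>

lemma cnj_measurable [measurable]: "cnj \<in> borel_measurable borel"
  by (intro borel_measurable_continuous_onI continuous_intros)

lemma nn_integral_lborel_affine:
  fixes f :: "'a::euclidean_space \<Rightarrow> ennreal"
  assumes [measurable]: "f \<in> borel_measurable borel" and "c \<noteq> 0"
  shows "(\<integral>\<^sup>+x. f x \<partial>lborel) = ennreal (\<bar>c\<bar> ^ DIM('a)) * (\<integral>\<^sup>+x. f (t + c *\<^sub>R x) \<partial>lborel)"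
  by (subst lborel_affine[OF assms(2), of t])
     (simp add: nn_integral_density nn_integral_distr nn_integral_cmult)

lemma integral_lborel_affine:
  fixes f :: "'a::euclidean_space \<Rightarrow> 'b::{banach,second_countable_topology}"
  assumes [measurable]: "f \<in> borel_measurable borel" and "c \<noteq> 0"
  shows "(LINT x|lborel. f x) = \<bar>c\<bar> ^ DIM('a) *\<^sub>R (LINT x|lborel. f (t + c *\<^sub>R x))"
  by (subst lborel_affine[OF assms(2), of t])
     (simp add: integral_density integral_distr)

lemma integrable_lborel_affine:
  fixes f :: "'a::euclidean_space \<Rightarrow> 'b::{banach,second_countable_topology}"
  assumes "integrable lborel f" and "c \<noteq> 0"
  shows "integrable lborel (\<lambda>x. f (t + c *\<^sub>R x))"
proof -
  have [measurable]: "f \<in> borel_measurable borel"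
    using borel_measurable_integrable[OF assms(1)] by simp
  have "integrable (density (distr lborel borel (\<lambda>x. t + c *\<^sub>R x)) (\<lambda>_. ennreal (\<bar>c\<bar> ^ DIM('a)))) f"
    using assms lborel_affine[OF assms(2), of t] by simp
  then have "integrable (distr lborel borel (\<lambda>x. t + c *\<^sub>R x)) (\<lambda>x. \<bar>c\<bar> ^ DIM('a) *\<^sub>R f x)"
    by (subst (asm) integrable_density) auto
  then have "integrable lborel (\<lambda>x. \<bar>c\<bar> ^ DIM('a) *\<^sub>R f (t + c *\<^sub>R x))"
    by (subst (asm) integrable_distr_eq) auto
  then have "integrable lborel (\<lambda>x. (1 / \<bar>c\<bar> ^ DIM('a)) *\<^sub>R \<bar>c\<bar> ^ DIM('a) *\<^sub>R f (t + c *\<^sub>R x))"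
    by (rule integrable_scaleR_right)
  then show ?thesis
    unfolding scaleR_scaleR using assms(2) by simp
qed

lemma AE_lborel_affine:
  fixes P :: "'a::euclidean_space \<Rightarrow> bool"
  assumes "AE x in lborel. P x" and "c \<noteq> 0"
  shows "AE x in lborel. P (t + c *\<^sub>R x)"
proof -
  from assms(1) obtain N where N: "{x. \<not> P x} \<subseteq> N" "N \<in> sets lborel" "emeasure lborel N = 0"
    by (auto elim: AE_E)
  have [measurable]: "N \<in> sets borel" using N by simp
  have "0 = ennreal (\<bar>c\<bar> ^ DIM('a)) * (\<integral>\<^sup>+x. indicator N (t + c *\<^sub>R x) \<partial>lborel)"
    using nn_integral_lborel_affine[of "indicator N" c t] assms(2) N by simp
  then have "(\<integral>\<^sup>+x. indicator N (t + c *\<^sub>R x) \<partial>lborel) = 0"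
    using assms(2) by simp
  then have "AE x in lborel. (indicator N (t + c *\<^sub>R x) :: ennreal) = 0"
    by (subst (asm) nn_integral_0_iff_AE) auto
  then show ?thesis
    by eventually_elim (use N in \<open>auto simp: indicator_def split: if_splits\<close>)
qed

lemma integrable_pair_mult:
  fixes f :: "'a::euclidean_space \<Rightarrow> complex" and g :: "'b::euclidean_space \<Rightarrow> complex"
  assumes f: "integrable lborel f" and g: "integrable lborel g"
  shows "integrable (lborel \<Otimes>\<^sub>M lborel) (\<lambda>(x, y). f x * g y)"
proof -
  have [measurable]: "f \<in> borel_measurable borel" "g \<in> borel_measurable borel"
    using borel_measurable_integrable[OF f] borel_measurable_integrable[OF g] by simp_all
  show ?thesis
  proof (rule lborel_pair.Fubini_integrable)
    show "integrable lborel (\<lambda>x. LINT y|lborel. norm (case (x, y) of (x, y) \<Rightarrow> f x * g y))"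
      using f by (simp add: norm_mult)
    show "AE x in lborel. integrable lborel (\<lambda>y. case (x, y) of (x, y) \<Rightarrow> f x * g y)"
      using g by simp
  qed measurable
qed

text \<open>Domination by a product of integrable functions of separate variables: the form in which
  the hypothesis of Fubini's theorem is verified for the double integrals below.\<close>

lemma integrable_pair_bound:
  fixes F :: "'a::euclidean_space \<times> 'b::euclidean_space \<Rightarrow> complex"
  assumes f: "integrable lborel f" and g: "integrable lborel g"
    and F: "F \<in> borel_measurable (lborel \<Otimes>\<^sub>M lborel)"
    and le: "\<And>x y. norm (F (x, y)) \<le> norm (f x :: complex) * norm (g y :: complex)"
  shows "integrable (lborel \<Otimes>\<^sub>M lborel) F"
proof (rule Bochner_Integration.integrable_bound[OF integrable_pair_mult[OF f g] F], rule AE_I2)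
  fix p :: "'a \<times> 'b"
  show "norm (F p) \<le> norm (case p of (x, y) \<Rightarrow> f x * g y)"
    using le[of "fst p" "snd p"] by (cases p) (simp add: norm_mult)
qed

subsection \<open>The Gaussian\<close>

text \<open>Chosen so that \<open>fourier\<close> reproduces it up to a constant. Dilated by
  \<open>1 / (n + 1)\<close> it becomes a damping factor that increases to 1.\<close>

definition gauss :: "real^'d::finite \<Rightarrow> real" where
  "gauss x = exp (- (norm x)\<^sup>2 / 2)"

lemma gauss_pos: "0 < gauss x" and gauss_le_1: "gauss x \<le> 1"
  by (simp_all add: gauss_def)

lemma gauss_measurable [measurable]: "gauss \<in> borel_measurable borel"
  unfolding gauss_def[abs_def] by measurable

lemma gauss_prod: "gauss x = (\<Prod>i\<in>UNIV. exp (- (x $ i)\<^sup>2 / 2))"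
proof -
  have "(norm x)\<^sup>2 = (\<Sum>i\<in>UNIV. (x $ i)\<^sup>2)"
    by (simp add: norm_vec_def L2_set_def sum_nonneg)
  then show ?thesis
    by (simp add: gauss_def exp_sum[symmetric] sum_divide_distrib sum_negf)
qed

text \<open>The transform is the characteristic function of the standard normal distribution at
  \<open>-t\<close>, rescaled by \<open>sqrt (2 * pi)\<close>.\<close>

lemma
  shows integrable_gauss_real: "integrable lborel (\<lambda>x::real. exp (- x\<^sup>2 / 2))"
    and integral_gauss_real: "(LINT x|lborel. exp (- x\<^sup>2 / 2)) = sqrt (2 * pi)"
    and fourier_gauss_real: "(LINT x|lborel. of_real (exp (- x\<^sup>2 / 2)) * exp (- \<i> * of_real (t * x)))
      = of_real (sqrt (2 * pi) * exp (- t\<^sup>2 / 2))"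
proof -
  have eq: "exp (- x\<^sup>2 / 2) = sqrt (2 * pi) * std_normal_density x" for x
    by (simp add: std_normal_density_def)
  show "integrable lborel (\<lambda>x::real. exp (- x\<^sup>2 / 2))"
    unfolding eq using integrable_normal_density[of 1 0] by simp
  show "(LINT x|lborel. exp (- x\<^sup>2 / 2)) = sqrt (2 * pi)"
    unfolding eq using integral_normal_density[of 1 0] by simp
  have "char std_normal_distribution (-t) = (LINT x|lborel. std_normal_density x *\<^sub>R iexp (- t * x))"
    unfolding char_def by (subst integral_density) auto
  then have c: "(LINT x|lborel. std_normal_density x *\<^sub>R iexp (- t * x)) = of_real (exp (- t\<^sup>2 / 2))"
    by (simp add: char_std_normal_distribution)
  have "(LINT x|lborel. of_real (exp (- x\<^sup>2 / 2)) * exp (- \<i> * of_real (t * x)))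
     = (LINT x|lborel. of_real (sqrt (2*pi)) * (std_normal_density x *\<^sub>R iexp (- t * x)))"
    unfolding eq by (intro Bochner_Integration.integral_cong) (auto simp: scaleR_conv_of_real)
  also have "\<dots> = of_real (sqrt (2 * pi) * exp (- t\<^sup>2 / 2))"
    using c by (subst integral_mult_right_zero) simp
  finally show "(LINT x|lborel. of_real (exp (- x\<^sup>2 / 2)) * exp (- \<i> * of_real (t * x)))
      = of_real (sqrt (2 * pi) * exp (- t\<^sup>2 / 2))" .
qed

lemma
  shows integrable_gauss: "integrable lborel (gauss :: real^'d::finite \<Rightarrow> real)"
    and integral_gauss: "(LINT x|lborel. gauss (x::real^'d)) = sqrt (2 * pi) ^ CARD('d)"
    and fourier_gauss: "fourier (\<lambda>x. of_real (gauss x)) t = of_real (sqrt (2 * pi) ^ CARD('d) * gauss (t::real^'d))"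
proof -
  show "integrable lborel (gauss :: real^'d::finite \<Rightarrow> real)"
    unfolding gauss_prod[abs_def] by (intro integrable_lborel_prod_vec integrable_gauss_real)
  show "(LINT x|lborel. gauss (x::real^'d)) = sqrt (2 * pi) ^ CARD('d)"
    unfolding gauss_prod by (subst integral_lborel_prod_vec[OF integrable_gauss_real]) (simp only: integral_gauss_real prod_constant)
  have i: "integrable lborel (\<lambda>x. of_real (exp (- x\<^sup>2 / 2)) * exp (- \<i> * of_real (s * x)))" for s
    by (rule Bochner_Integration.integrable_bound[OF integrable_gauss_real]) (auto simp: norm_mult)
  have e: "exp (- \<i> * of_real (t \<bullet> x)) = (\<Prod>i\<in>UNIV. exp (- \<i> * of_real (t $ i * x $ i)))" for x
    unfolding exp_sum[OF finite, symmetric] sum_distrib_left[symmetric] by (simp add: inner_vec_def)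
  have "fourier (\<lambda>x. of_real (gauss x)) t =
      (LINT x|lborel. (\<Prod>i\<in>UNIV. of_real (exp (- (x $ i)\<^sup>2 / 2)) * exp (- \<i> * of_real (t $ i * x $ i))))"
    unfolding fourier_def e by (simp only: gauss_prod prod.distrib of_real_prod)
  also have "\<dots> = (\<Prod>i\<in>UNIV. of_real (sqrt (2 * pi) * exp (- (t $ i)\<^sup>2 / 2)))"
    by (subst integral_lborel_prod_vec[OF i]) (simp only: fourier_gauss_real)
  also have "\<dots> = of_real (sqrt (2 * pi) ^ CARD('d) * gauss t)"
    by (simp add: gauss_prod prod.distrib)
  finally show "fourier (\<lambda>x. of_real (gauss x)) t = of_real (sqrt (2 * pi) ^ CARD('d) * gauss (t::real^'d))" .
qed

lemma fourier_gauss_scaled: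
  fixes t :: "real^'d::finite"
  assumes "0 < s"
  shows "fourier (\<lambda>x. of_real (gauss (s *\<^sub>R x))) t
    = of_real ((sqrt (2 * pi) / s) ^ CARD('d) * gauss ((1 / s) *\<^sub>R t))"
proof -
  have "fourier (\<lambda>x. of_real (gauss (s *\<^sub>R x))) t
     = \<bar>1/s\<bar> ^ CARD('d) *\<^sub>R fourier (\<lambda>x. of_real (gauss x)) ((1/s) *\<^sub>R t)"
    unfolding fourier_def using assms
    by (subst integral_lborel_affine[where c = "1/s" and t = 0]) auto
  also have "\<dots> = of_real ((sqrt (2 * pi) / s) ^ CARD('d) * gauss ((1 / s) *\<^sub>R t))"
    unfolding fourier_gauss using assms by (simp add: scaleR_conv_of_real field_simps)
  finally show ?thesis .
qed

subsection \<open>Parseval's identity for integrable functions\<close>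

lemma fourier_measurable [measurable]:
  assumes [measurable]: "f \<in> borel_measurable borel"
  shows "fourier f \<in> borel_measurable borel"
  unfolding fourier_def[abs_def] by measurable

lemma integrable_fourier_integrand:
  assumes "integrable lborel f"
  shows "integrable lborel (\<lambda>x. f x * exp (- \<i> * of_real (u \<bullet> x)))"
  using assms(1) by (rule Bochner_Integration.integrable_bound)
    (use borel_measurable_integrable[OF assms] in \<open>auto simp: norm_mult\<close>)

lemma norm_fourier_le:
  assumes "integrable lborel f"
  shows "norm (fourier f u) \<le> (LINT x|lborel. norm (f x))"
  unfolding fourier_def
  by (rule order_trans[OF integral_norm_bound]) (simp add: norm_mult)

lemma fourier_diff:
  assumes "integrable lborel f" "integrable lborel g"
  shows "fourier (\<lambda>x. f x - g x) u = fourier f u - fourier g u"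
  unfolding fourier_def left_diff_distrib
  by (intro Bochner_Integration.integral_diff integrable_fourier_integrand assms)

text \<open>The transform of an integrable \<open>f\<close> need not be integrable; the Gaussian
  factor makes Fubini's theorem applicable. Integrating the frequency out first leaves
  \<open>f\<close> paired with averages of \<open>cnj h\<close> against Gaussians that concentrate
  at a point. Continuity of \<open>h\<close> gives their pointwise limit, boundedness of
  \<open>h\<close> a dominating function.\<close>

lemma parseval_limit:
  fixes f h :: "real^'d::finite \<Rightarrow> complex"
  assumes f: "integrable lborel f" and h: "integrable lborel h"
    and hc: "continuous_on UNIV h" and hb: "\<And>x. norm (h x) \<le> B"
  shows "(\<lambda>n. LINT u|lborel. fourier f u * cnj (fourier h u) * of_real (gauss ((1 / real (Suc n)) *\<^sub>R u)))
    \<longlonglongrightarrow> of_real ((2 * pi) ^ CARD('d)) * (LINT x|lborel. f x * cnj (h x))"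
proof -
  have [measurable]: "f \<in> borel_measurable borel" "h \<in> borel_measurable borel"
    using borel_measurable_integrable[OF f] borel_measurable_integrable[OF h] by simp_all
  define D where "D = sqrt (2 * pi) ^ CARD('d)"
  \<comment> \<open>An average of \<open>cnj h\<close> around \<open>x\<close> on the scale
    \<open>1 / (n + 1)\<close>. One factor \<open>D\<close> comes from the transform of the
    Gaussian, another from its integral, hence the constant
    \<open>D * D = (2 * pi) ^ CARD('d)\<close> in the limit.\<close>
  define K where "K n x = (LINT t|lborel. cnj (h (x - (1 / real (Suc n)) *\<^sub>R t)) * of_real (D * gauss t))"
    for n and x :: "real^'d"
  have gs: "integrable lborel (\<lambda>u::real^'d. complex_of_real (gauss ((1 / real (Suc n)) *\<^sub>R u)))" for n
    using integrable_of_real[OF integrable_lborel_affine[OF integrable_gauss, of "1 / real (Suc n)" 0], where 'a = complex]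
    by (simp del: of_nat_Suc)
  have inner: "(LINT u|lborel. exp (- \<i> * of_real (u \<bullet> x)) * cnj (fourier h u) * of_real (gauss ((1 / real (Suc n)) *\<^sub>R u))) = K n x"
    for n x
  proof -
    let ?s = "1 / real (Suc n)"
    let ?F = "\<lambda>u y. cnj (h y) * (of_real (gauss (?s *\<^sub>R u)) * exp (- \<i> * of_real (u \<bullet> (x - y))))"
    have "(LINT u|lborel. exp (- \<i> * of_real (u \<bullet> x)) * cnj (fourier h u) * of_real (gauss (?s *\<^sub>R u)))
       = (LINT u|lborel. LINT y|lborel. ?F u y)"
    proof (intro Bochner_Integration.integral_cong refl)
      fix u :: "real^'d"
      have "exp (- \<i> * of_real (u \<bullet> x)) * cnj (fourier h u) * of_real (gauss (?s *\<^sub>R u))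
        = (exp (- \<i> * of_real (u \<bullet> x)) * of_real (gauss (?s *\<^sub>R u))) *
          (LINT y|lborel. cnj (h y * exp (- \<i> * of_real (u \<bullet> y))))"
        unfolding fourier_def by (simp add: mult_ac del: complex_cnj_mult)
      also have "\<dots> = (LINT y|lborel. (exp (- \<i> * of_real (u \<bullet> x)) * of_real (gauss (?s *\<^sub>R u))) *
           cnj (h y * exp (- \<i> * of_real (u \<bullet> y))))"
        by simp
      also have "\<dots> = (LINT y|lborel. ?F u y)"
        by (intro Bochner_Integration.integral_cong refl)
           (simp add: exp_cnj inner_diff_right algebra_simps exp_add exp_diff exp_minus field_simps)
      finally show "exp (- \<i> * of_real (u \<bullet> x)) * cnj (fourier h u) * of_real (gauss (?s *\<^sub>R u)) = (LINT y|lborel. ?F u y)" .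
    qed
    also have "\<dots> = (LINT y|lborel. LINT u|lborel. ?F u y)"
    proof (rule lborel_pair.Fubini_integral[symmetric])
      show "integrable (lborel \<Otimes>\<^sub>M lborel) (\<lambda>(u, y). ?F u y)"
      proof (rule integrable_pair_bound[OF gs[of n] h])
        show "(\<lambda>(u, y). ?F u y) \<in> borel_measurable (lborel \<Otimes>\<^sub>M lborel)"
          by measurable
      qed (simp add: norm_mult)
    qed
    also have "\<dots> = (LINT y|lborel. cnj (h y) * fourier (\<lambda>u. of_real (gauss (?s *\<^sub>R u))) (x - y))"
      unfolding fourier_def by (subst integral_mult_right_zero) (simp add: inner_commute)
    also have "\<dots> = (LINT y|lborel. cnj (h y) * of_real ((sqrt (2 * pi) / ?s) ^ CARD('d) * gauss ((1 / ?s) *\<^sub>R (x - y))))"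
      by (subst fourier_gauss_scaled) auto
    \<comment> \<open>Substitution \<open>y = x - ?s * t\<close>: its Jacobian cancels the powers of
      \<open>1 / ?s\<close> in the transform of the dilated Gaussian.\<close>
    also have "\<dots> = \<bar>-?s\<bar> ^ CARD('d) *\<^sub>R (LINT t|lborel. cnj (h (x + (- ?s) *\<^sub>R t)) *
         of_real ((sqrt (2 * pi) / ?s) ^ CARD('d) * gauss ((1 / ?s) *\<^sub>R (x - (x + (- ?s) *\<^sub>R t)))))"
      by (subst integral_lborel_affine[where c = "-?s" and t = x]) (auto simp del: of_nat_Suc)
    also have "\<dots> = K n x"
    proof -
      have a: "(1 / ?s) *\<^sub>R (x - (x + (- ?s) *\<^sub>R t)) = t" for t
        by (simp del: of_nat_Suc)
      have b: "\<bar>- ?s\<bar> ^ CARD('d) * (sqrt (2 * pi) / ?s) ^ CARD('d) = D"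
        unfolding D_def power_mult_distrib[symmetric] by simp
      show ?thesis
        unfolding K_def b[symmetric] integral_scaleR_right[symmetric] a
        by (intro Bochner_Integration.integral_cong refl) (simp add: scaleR_conv_of_real)
    qed
    finally show ?thesis .
  qed
  have outer: "(LINT u|lborel. fourier f u * cnj (fourier h u) * of_real (gauss ((1 / real (Suc n)) *\<^sub>R u)))
     = (LINT x|lborel. f x * K n x)" for n
  proof -
    let ?s = "1 / real (Suc n)"
    let ?F = "\<lambda>u x. f x * (exp (- \<i> * of_real (u \<bullet> x)) * cnj (fourier h u) * of_real (gauss (?s *\<^sub>R u)))"
    have "(LINT u|lborel. fourier f u * cnj (fourier h u) * of_real (gauss (?s *\<^sub>R u)))
       = (LINT u|lborel. LINT x|lborel. ?F u x)"
    proof (intro Bochner_Integration.integral_cong refl)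
      fix u :: "real^'d"
      have "fourier f u * cnj (fourier h u) * of_real (gauss (?s *\<^sub>R u))
        = (LINT x|lborel. (f x * exp (- \<i> * of_real (u \<bullet> x))) * (cnj (fourier h u) * of_real (gauss (?s *\<^sub>R u))))"
        by (subst integral_mult_left_zero) (simp add: fourier_def)
      also have "\<dots> = (LINT x|lborel. ?F u x)" by (simp only: mult_ac)
      finally show "fourier f u * cnj (fourier h u) * of_real (gauss (?s *\<^sub>R u)) = (LINT x|lborel. ?F u x)" .
    qed
    also have "\<dots> = (LINT x|lborel. LINT u|lborel. ?F u x)"
    proof (rule lborel_pair.Fubini_integral[symmetric])
      let ?C = "LINT x|lborel. norm (h x)"
      have C: "integrable lborel (\<lambda>u::real^'d. of_real ?C * complex_of_real (gauss (?s *\<^sub>R u)))"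
        using gs[of n] by simp
      show "integrable (lborel \<Otimes>\<^sub>M lborel) (\<lambda>(u, x). ?F u x)"
      proof (rule integrable_pair_bound[OF C f])
        fix u x :: "real^'d"
        have "norm (case (u, x) of (u, x) \<Rightarrow> ?F u x) = norm (f x) * (norm (fourier h u) * \<bar>gauss (?s *\<^sub>R u)\<bar>)"
          by (simp add: norm_mult)
        also have "\<dots> \<le> norm (f x) * (?C * \<bar>gauss (?s *\<^sub>R u)\<bar>)"
          by (intro mult_mono norm_fourier_le h) auto
        also have "\<dots> = norm (complex_of_real ?C * complex_of_real (gauss (?s *\<^sub>R u))) * norm (f x)"
          by (simp add: norm_mult)
        finally show "norm (case (u, x) of (u, x) \<Rightarrow> ?F u x) \<le> norm (complex_of_real ?C * complex_of_real (gauss (?s *\<^sub>R u))) * norm (f x)" .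
      qed measurable
    qed
    also have "\<dots> = (LINT x|lborel. f x * K n x)"
      by (subst integral_mult_right_zero) (simp only: inner)
    finally show ?thesis .
  qed
  have B0: "0 \<le> B" using hb[of 0] norm_ge_zero order_trans by blast
  have Dg: "integrable lborel (\<lambda>t::real^'d. B * (D * gauss t))"
    by (intro integrable_mult_right integrable_gauss)
  have D0: "0 \<le> D" by (simp add: D_def)
  have DD: "D * D = (2 * pi) ^ CARD('d)"
    unfolding D_def power_mult_distrib[symmetric] by simp
  have Kb: "norm (K n x) \<le> (LINT t|lborel. B * (D * gauss (t::real^'d)))" for n x
    unfolding K_def
    by (rule order_trans[OF Bochner_Integration.integral_norm_bound], rule integral_mono'[OF Dg])
       (auto simp: norm_mult abs_mult gauss_pos less_imp_le B0 D0 intro!: mult_right_mono hb mult_nonneg_nonneg)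
  have Kl: "(\<lambda>n. K n x) \<longlonglongrightarrow> (LINT t|lborel. cnj (h x) * of_real (D * gauss (t::real^'d)))" for x
    unfolding K_def
  proof (rule integral_dominated_convergence[OF _ _ Dg])
    show "AE t in lborel. (\<lambda>n. cnj (h (x - (1 / real (Suc n)) *\<^sub>R t)) * of_real (D * gauss t))
        \<longlonglongrightarrow> cnj (h x) * of_real (D * gauss t)"
    proof (rule AE_I2)
      fix t :: "real^'d"
      have "(\<lambda>n. x - (1 / real (Suc n)) *\<^sub>R t) \<longlonglongrightarrow> x - 0 *\<^sub>R t"
        using LIMSEQ_inverse_real_of_nat by (intro tendsto_intros) (simp add: inverse_eq_divide)
      then have "(\<lambda>n. h (x - (1 / real (Suc n)) *\<^sub>R t)) \<longlonglongrightarrow> h x"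
        using hc by (intro continuous_on_tendsto_compose[OF hc]) auto
      then show "(\<lambda>n. cnj (h (x - (1 / real (Suc n)) *\<^sub>R t)) * of_real (D * gauss t))
        \<longlonglongrightarrow> cnj (h x) * of_real (D * gauss t)"
        by (intro tendsto_intros)
    qed
    show "AE t in lborel. norm (cnj (h (x - (1 / real (Suc n)) *\<^sub>R t)) * of_real (D * gauss t)) \<le> B * (D * gauss t)" for n
      by (rule AE_I2) (auto simp: norm_mult abs_mult gauss_pos less_imp_le D0 intro!: mult_right_mono hb)
  qed measurable
  have Kl': "(LINT t|lborel. cnj (h x) * of_real (D * gauss (t::real^'d))) = of_real ((2 * pi) ^ CARD('d)) * cnj (h x)" for x
  proof -
    have "(LINT t|lborel. cnj (h x) * of_real (D * gauss (t::real^'d))) = cnj (h x) * of_real (D * D)"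
      by (simp add: integral_gauss D_def[symmetric])
    then show ?thesis by (simp only: DD mult.commute)
  qed
  have Km [measurable]: "K n \<in> borel_measurable borel" for n
    unfolding K_def[abs_def] by measurable
  have "(\<lambda>n. LINT x|lborel. f x * K n x) \<longlonglongrightarrow> (LINT x|lborel. f x * (of_real ((2 * pi) ^ CARD('d)) * cnj (h x)))"
  proof (rule integral_dominated_convergence)
    show "integrable lborel (\<lambda>x. norm (f x) * (LINT t|lborel. B * (D * gauss (t::real^'d))))"
      using f by simp
    show "AE x in lborel. (\<lambda>n. f x * K n x) \<longlonglongrightarrow> f x * (of_real ((2 * pi) ^ CARD('d)) * cnj (h x))"
      using Kl Kl' by (intro AE_I2 tendsto_intros) metis
    show "AE x in lborel. norm (f x * K n x) \<le> norm (f x) * (LINT t|lborel. B * (D * gauss (t::real^'d)))" for n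
      using Kb by (intro AE_I2) (simp only: norm_mult mult_left_mono norm_ge_zero)
  qed measurable
  also have "(LINT x|lborel. f x * (of_real ((2 * pi) ^ CARD('d)) * cnj (h x)))
     = of_real ((2 * pi) ^ CARD('d)) * (LINT x|lborel. f x * cnj (h x))"
    by (subst integral_mult_right_zero[symmetric]) (simp only: mult_ac)
  finally show ?thesis unfolding outer .
qed

subsection \<open>Plancherel's theorem\<close>

lemma L2_sqnorm_eq_integral:
  assumes "integrable M (\<lambda>x. (norm (f x))\<^sup>2)"
  shows "L2_sqnorm M f = ennreal (LINT x|M. (norm (f x))\<^sup>2)"
  unfolding L2_sqnorm_def by (rule nn_integral_eq_integral[OF assms]) simp

lemma L2_sqnorm_finite_iff:
  assumes "f \<in> borel_measurable M"
  shows "L2_sqnorm M f < \<infinity> \<longleftrightarrow> integrable M (\<lambda>x. (norm (f x))\<^sup>2)"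
proof
  assume "L2_sqnorm M f < \<infinity>"
  then show "integrable M (\<lambda>x. (norm (f x))\<^sup>2)"
    using assms by (intro integrableI_bounded) (auto simp: L2_sqnorm_def)
qed (auto simp: L2_sqnorm_eq_integral)

text \<open>Stands in for the triangle inequality: it involves squares alone, so it can be stated
  for extended nonnegative reals without roots, at the cost of a constant.\<close>

lemma L2_sqnorm_add_le:
  assumes [measurable]: "f \<in> borel_measurable M" "g \<in> borel_measurable M"
  shows "L2_sqnorm M (\<lambda>x. f x + g x) \<le> 2 * L2_sqnorm M f + 2 * L2_sqnorm M g"
proof -
  have "(norm (f x + g x))\<^sup>2 \<le> 2 * (norm (f x))\<^sup>2 + 2 * (norm (g x))\<^sup>2" for x
    using power_mono[OF norm_triangle_ineq[of "f x" "g x"], of 2] sum_squares_bound[of "norm (f x)" "norm (g x)"]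
    by (simp add: power2_sum algebra_simps)
  then have "L2_sqnorm M (\<lambda>x. f x + g x) \<le> (\<integral>\<^sup>+x. 2 * ennreal ((norm (f x))\<^sup>2) + 2 * ennreal ((norm (g x))\<^sup>2) \<partial>M)"
    unfolding L2_sqnorm_def
    by (intro nn_integral_mono)
       (simp add: ennreal_plus[symmetric] ennreal_mult''[symmetric] ennreal_numeral[symmetric] del: ennreal_plus ennreal_numeral)
  also have "\<dots> = 2 * L2_sqnorm M f + 2 * L2_sqnorm M g"
    unfolding L2_sqnorm_def by (subst nn_integral_add) (auto simp: nn_integral_cmult)
  finally show ?thesis .
qed

lemma L2_sqnorm_minus_commute: "L2_sqnorm M (\<lambda>x. f x - g x) = L2_sqnorm M (\<lambda>x. g x - f x)"
  by (simp add: L2_sqnorm_def norm_minus_commute)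

lemma L2_sqnorm_triangle:
  assumes [measurable]: "f \<in> borel_measurable M" "g \<in> borel_measurable M" "h \<in> borel_measurable M"
  shows "L2_sqnorm M (\<lambda>x. f x - h x) \<le> 2 * L2_sqnorm M (\<lambda>x. f x - g x) + 2 * L2_sqnorm M (\<lambda>x. g x - h x)"
  using L2_sqnorm_add_le[of "\<lambda>x. f x - g x" M "\<lambda>x. g x - h x"] by simp

lemma L2_sqnorm_cong_AE:
  assumes "AE x in M. f x = g x"
  shows "L2_sqnorm M f = L2_sqnorm M g"
  unfolding L2_sqnorm_def by (rule nn_integral_cong_AE) (use assms in eventually_elim, simp)

lemma L2_sqnorm_0_iff:
  assumes [measurable]: "f \<in> borel_measurable M"
  shows "L2_sqnorm M f = 0 \<longleftrightarrow> (AE x in M. f x = 0)"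
  unfolding L2_sqnorm_def by (subst nn_integral_0_iff_AE) auto

text \<open>The case \<open>h = f\<close> of \<open>parseval_limit\<close>. The Gaussian factors
  increase to 1, so monotone convergence identifies the limit with the full squared norm of the
  transform, whose finiteness comes out as part of the equation.\<close>

lemma plancherel_continuous:
  fixes f :: "real^'d::finite \<Rightarrow> complex"
  assumes f: "integrable lborel f" and fc: "continuous_on UNIV f" and fb: "\<And>x. norm (f x) \<le> B"
  shows "L2_sqnorm lborel (fourier f) = ennreal ((2 * pi) ^ CARD('d)) * L2_sqnorm lborel f"
proof -
  have [measurable]: "f \<in> borel_measurable borel"
    using borel_measurable_integrable[OF f] by simp
  let ?g = "\<lambda>n u. gauss ((1 / real (Suc n)) *\<^sub>R (u::real^'d))"
  define I where "I n = (LINT u|lborel. (norm (fourier f u))\<^sup>2 * ?g n u)" for n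
  have gs: "integrable lborel (?g n)" for n
    using integrable_lborel_affine[OF integrable_gauss, of "1 / real (Suc n)" 0]
    by (simp del: of_nat_Suc)
  define C where "C = (LINT x|lborel. norm (f x))"
  have int: "integrable lborel (\<lambda>u. (norm (fourier f u))\<^sup>2 * ?g n u)" for n
  proof (rule Bochner_Integration.integrable_bound)
    show "integrable lborel (\<lambda>u. C\<^sup>2 * ?g n u)"
      using gs by (intro integrable_mult_right)
    show "AE u in lborel. norm ((norm (fourier f u))\<^sup>2 * ?g n u) \<le> norm (C\<^sup>2 * ?g n u)"
      by (rule AE_I2) (auto simp: abs_mult C_def intro!: mult_right_mono power_mono norm_fourier_le f)
  qed measurable
  have f2: "integrable lborel (\<lambda>x. (norm (f x))\<^sup>2)"
  proof (rule Bochner_Integration.integrable_bound)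
    show "integrable lborel (\<lambda>x. B * norm (f x))" using f by simp
    show "AE x in lborel. norm ((norm (f x))\<^sup>2) \<le> norm (B * norm (f x))"
      proof (rule AE_I2)
      fix x
      show "norm ((norm (f x))\<^sup>2) \<le> norm (B * norm (f x))"
        using mult_right_mono[OF fb[of x] norm_ge_zero[of "f x"]] order_trans[OF norm_ge_zero fb[of x]]
        by (simp add: abs_mult power2_eq_square)
    qed
  qed measurable
  have "(\<lambda>n. complex_of_real (I n)) \<longlonglongrightarrow> of_real ((2 * pi) ^ CARD('d)) * (LINT x|lborel. f x * cnj (f x))"
  proof -
    have "complex_of_real (I n) = (LINT u|lborel. fourier f u * cnj (fourier f u) * of_real (?g n u))" for n
      unfolding I_def integral_complex_of_real[symmetric]
      by (intro Bochner_Integration.integral_cong refl) (simp only: of_real_mult complex_norm_square)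
    then show ?thesis using parseval_limit[OF f f fc fb] by (simp only:)
  qed
  also have "(LINT x|lborel. f x * cnj (f x)) = of_real (LINT x|lborel. (norm (f x))\<^sup>2)"
    unfolding integral_complex_of_real[symmetric]
    by (intro Bochner_Integration.integral_cong refl) (simp only: complex_norm_square)
  finally have "(\<lambda>n. complex_of_real (I n)) \<longlonglongrightarrow> of_real ((2 * pi) ^ CARD('d) * (LINT x|lborel. (norm (f x))\<^sup>2))"
    by simp
  then have Il: "I \<longlonglongrightarrow> (2 * pi) ^ CARD('d) * (LINT x|lborel. (norm (f x))\<^sup>2)"
    unfolding tendsto_of_real_iff .
  let ?L = "\<lambda>n u. ennreal ((norm (fourier f u))\<^sup>2 * ?g n u)"
  have mono: "incseq ?L"
  proof (intro incseq_SucI le_funI ennreal_leI mult_left_mono)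
    fix n and u :: "real^'d"
    have "norm ((1 / real (Suc (Suc n))) *\<^sub>R u) \<le> norm ((1 / real (Suc n)) *\<^sub>R u)"
      by (auto intro!: mult_right_mono simp: frac_le)
    then have "(norm ((1 / real (Suc (Suc n))) *\<^sub>R u))\<^sup>2 \<le> (norm ((1 / real (Suc n)) *\<^sub>R u))\<^sup>2"
      by (intro power_mono) auto
    then show "?g n u \<le> ?g (Suc n) u" unfolding gauss_def by simp
  qed simp
  have SUP: "(SUP n. ?L n u) = ennreal ((norm (fourier f u))\<^sup>2)" for u
  proof (rule LIMSEQ_unique)
    show "(\<lambda>n. ?L n u) \<longlonglongrightarrow> (SUP n. ?L n u)"
      using mono by (intro LIMSEQ_SUP) (auto simp: incseq_def le_fun_def)
    have "(\<lambda>n. exp (- (norm ((1 / real (Suc n)) *\<^sub>R u))\<^sup>2 / 2)) \<longlonglongrightarrow> exp (- (norm (0 *\<^sub>R u))\<^sup>2 / 2)"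
      using LIMSEQ_inverse_real_of_nat by (intro tendsto_intros) (simp_all add: inverse_eq_divide)
    then have "(\<lambda>n. (norm (fourier f u))\<^sup>2 * ?g n u) \<longlonglongrightarrow> (norm (fourier f u))\<^sup>2 * 1"
      unfolding gauss_def by (intro tendsto_intros) simp
    then show "(\<lambda>n. ?L n u) \<longlonglongrightarrow> ennreal ((norm (fourier f u))\<^sup>2)"
      by (intro tendsto_ennrealI) simp
  qed
  have "L2_sqnorm lborel (fourier f) = (SUP n. \<integral>\<^sup>+u. ?L n u \<partial>lborel)"
    unfolding L2_sqnorm_def SUP[symmetric] using mono by (rule nn_integral_monotone_convergence_SUP) measurable
  also have "\<dots> = (SUP n. ennreal (I n))"
    unfolding I_def by (subst nn_integral_eq_integral[OF int]) (auto intro!: AE_I2 mult_nonneg_nonneg less_imp_le[OF gauss_pos])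
  also have "\<dots> = ennreal ((2 * pi) ^ CARD('d) * (LINT x|lborel. (norm (f x))\<^sup>2))"
  proof (rule LIMSEQ_unique)
    show "(\<lambda>n. ennreal (I n)) \<longlonglongrightarrow> ennreal ((2 * pi) ^ CARD('d) * (LINT x|lborel. (norm (f x))\<^sup>2))"
      using Il by (rule tendsto_ennrealI)
    have "incseq I"
      unfolding I_def
    proof (intro incseq_SucI integral_mono int)
      fix n and u :: "real^'d"
      have "?L n u \<le> ?L (Suc n) u" using mono by (auto simp: incseq_Suc_iff le_fun_def)
      then show "(norm (fourier f u))\<^sup>2 * ?g n u \<le> (norm (fourier f u))\<^sup>2 * ?g (Suc n) u"
        by (subst (asm) ennreal_le_iff) (auto intro!: mult_nonneg_nonneg less_imp_le[OF gauss_pos])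
    qed
    then show "(\<lambda>n. ennreal (I n)) \<longlonglongrightarrow> (SUP n. ennreal (I n))"
      by (intro LIMSEQ_SUP) (auto simp: incseq_def intro!: ennreal_leI)
  qed
  also have "\<dots> = ennreal ((2 * pi) ^ CARD('d)) * L2_sqnorm lborel f"
    unfolding L2_sqnorm_eq_integral[OF f2] by (rule ennreal_mult) auto
  finally show ?thesis .
qed

text \<open>One approximating sequence has to converge in both senses: convergence in L1 controls
  the transforms uniformly, convergence in L2 controls the norms.\<close>

lemma dominated_L1_L2:
  fixes f :: "'a \<Rightarrow> complex"
  assumes [measurable]: "f \<in> borel_measurable M" "\<And>n::nat. g n \<in> borel_measurable M"
    and w: "integrable M w" "integrable M (\<lambda>x. (w x)\<^sup>2)"
    and lim: "AE x in M. (\<lambda>n. g n x) \<longlonglongrightarrow> f x"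
    and bd: "\<And>n. AE x in M. norm (g n x) \<le> w x"
  shows "(\<lambda>n. LINT x|M. norm (f x - g n x)) \<longlonglongrightarrow> 0"
    and "(\<lambda>n. L2_sqnorm M (\<lambda>x. f x - g n x)) \<longlonglongrightarrow> 0"
proof -
  have [measurable]: "w \<in> borel_measurable M" using w by auto
  have "AE x in M. \<forall>n. norm (g n x) \<le> w x"
    using bd by (simp add: AE_all_countable)
  then have bd2: "AE x in M. \<forall>n. norm (f x - g n x) \<le> 2 * w x"
    using lim
  proof eventually_elim
    case (elim x)
    have "norm (f x) \<le> w x"
      using elim by (intro tendsto_upperbound[OF tendsto_norm[OF elim(2)]]) auto
    show ?case
    proof
      fix n
      show "norm (f x - g n x) \<le> 2 * w x"
        using elim(1)[rule_format, of n] \<open>norm (f x) \<le> w x\<close> norm_triangle_ineq4[of "f x" "g n x"] by linarith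
    qed
  qed
  have lim0: "AE x in M. (\<lambda>n. norm (f x - g n x)) \<longlonglongrightarrow> 0"
    using lim
  proof eventually_elim
    case (elim x)
    show ?case using tendsto_norm[OF tendsto_diff[OF tendsto_const[of "f x"] elim]] by simp
  qed
  have "(\<lambda>n. LINT x|M. norm (f x - g n x)) \<longlonglongrightarrow> (LINT x|M. 0)"
  proof (rule integral_dominated_convergence)
    show "integrable M (\<lambda>x. 2 * w x)" using w by simp
    show "AE x in M. norm (norm (f x - g n x)) \<le> 2 * w x" for n
      using bd2 by eventually_elim simp
  qed (use lim0 in measurable)
  then show "(\<lambda>n. LINT x|M. norm (f x - g n x)) \<longlonglongrightarrow> 0" by simp
  have w4: "integrable M (\<lambda>x. 4 * (w x)\<^sup>2)" using w by simp
  have bd4: "AE x in M. norm ((norm (f x - g n x))\<^sup>2) \<le> 4 * (w x)\<^sup>2" for n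
    using bd2
  proof eventually_elim
    case (elim x)
    then have "(norm (f x - g n x))\<^sup>2 \<le> (2 * w x)\<^sup>2" by (intro power_mono) auto
    then show ?case by (simp add: power_mult_distrib)
  qed
  have "(\<lambda>n. LINT x|M. (norm (f x - g n x))\<^sup>2) \<longlonglongrightarrow> (LINT x|M. 0)"
  proof (rule integral_dominated_convergence[OF _ _ w4])
    show "AE x in M. (\<lambda>n. (norm (f x - g n x))\<^sup>2) \<longlonglongrightarrow> 0"
      using lim0 by eventually_elim (auto intro: tendsto_eq_intros)
  qed (use bd4 in \<open>measurable\<close>)
  then have "(\<lambda>n. ennreal (LINT x|M. (norm (f x - g n x))\<^sup>2)) \<longlonglongrightarrow> 0"
    using tendsto_ennrealI by fastforce
  moreover have "L2_sqnorm M (\<lambda>x. f x - g n x) = ennreal (LINT x|M. (norm (f x - g n x))\<^sup>2)" for n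
    by (rule L2_sqnorm_eq_integral, rule Bochner_Integration.integrable_bound[OF w4])
       (use bd4[of n] in \<open>auto elim: eventually_mono\<close>)
  ultimately show "(\<lambda>n. L2_sqnorm M (\<lambda>x. f x - g n x)) \<longlonglongrightarrow> 0" by simp
qed

lemma bounded_measurable_approx_continuous:
  fixes F :: "'a::euclidean_space \<Rightarrow> complex"
  assumes [measurable]: "F \<in> borel_measurable borel"
    and Fb: "\<And>x. norm (F x) \<le> r" and Fs: "\<And>x. r < norm x \<Longrightarrow> F x = 0" and r: "0 < r"
  obtains h where "\<And>n::nat. continuous_on UNIV (h n)" "\<And>n x. norm (h n x) \<le> r * indicat_real (cball 0 (r + 1)) x"
    "AE x in lborel. (\<lambda>n. h n x) \<longlonglongrightarrow> F x"
proof -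
  have "F measurable_on UNIV"
    by (intro lebesgue_measurable_imp_measurable_on) (auto intro!: measurable_completion)
  then obtain N g where N: "negligible N" and gc: "\<And>n::nat. continuous_on UNIV (g n)"
    and gl: "\<And>x. x \<notin> N \<Longrightarrow> (\<lambda>n. g n x) \<longlonglongrightarrow> F x"
    unfolding measurable_on_def by auto
  \<comment> \<open>The factor with \<open>min\<close> and \<open>max\<close> is a continuous
    cutoff, 1 for \<open>norm x \<le> r\<close> and 0 for \<open>norm x \<ge> r + 1\<close>;
    \<open>r / max r (norm (g n x))\<close> pulls values of larger modulus back to modulus
    \<open>r\<close>. Neither changes the limit, since \<open>F\<close> is bounded by
    \<open>r\<close> and vanishes outside the ball of radius \<open>r\<close>.\<close>
  define h where "h n x = of_real (max 0 (min 1 (r + 1 - norm x)) * r / max r (norm (g n x))) * g n x" for n x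
  show ?thesis
  proof (rule that[of h])
    show "continuous_on UNIV (h n)" for n
      unfolding h_def using r by (intro continuous_intros gc) (auto simp: max_def)
    show "norm (h n x) \<le> r * indicat_real (cball 0 (r + 1)) x" for n x
    proof -
      have "norm (h n x) = max 0 (min 1 (r + 1 - norm x)) * (r * (norm (g n x) / max r (norm (g n x))))"
      proof -
        have "norm (h n x) = \<bar>max 0 (min 1 (r + 1 - norm x)) * r / max r (norm (g n x))\<bar> * norm (g n x)"
          unfolding h_def norm_mult norm_of_real ..
        also have "\<bar>max 0 (min 1 (r + 1 - norm x)) * r / max r (norm (g n x))\<bar> = max 0 (min 1 (r + 1 - norm x)) * r / max r (norm (g n x))"
          using r by (intro abs_of_nonneg divide_nonneg_nonneg mult_nonneg_nonneg) auto
        finally show ?thesis by simp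
      qed
      also have "\<dots> \<le> max 0 (min 1 (r + 1 - norm x)) * (r * 1)"
        using r by (intro mult_left_mono) (auto simp: field_simps max_def)
      also have "\<dots> \<le> r * indicat_real (cball 0 (r + 1)) x"
        using r by (auto simp: indicator_def)
      finally show ?thesis .
    qed
    have "(\<lambda>n. h n x) \<longlonglongrightarrow> F x" if "x \<notin> N" for x
    proof -
      have "(\<lambda>n. h n x) \<longlonglongrightarrow> of_real (max 0 (min 1 (r + 1 - norm x)) * r / max r (norm (F x))) * F x"
        unfolding h_def using r gl[OF that] by (intro tendsto_intros) (auto simp: max_def)
      moreover have "of_real (max 0 (min 1 (r + 1 - norm x)) * r / max r (norm (F x))) * F x = F x"
        using r Fb[of x] Fs[of x] by (cases "r < norm x") (auto simp: max_def min_def)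
      ultimately show ?thesis by simp
    qed
    moreover have "AE x in lborel. x \<notin> N"
      using N AE_not_in[of N lebesgue] by (auto simp: negligible_iff_null_sets AE_completion_iff)
    ultimately show "AE x in lborel. (\<lambda>n. h n x) \<longlonglongrightarrow> F x"
      by (auto elim: eventually_mono)
  qed
qed

lemma integrable_indicator_cball: "integrable lborel (\<lambda>x. c * indicat_real (cball a r) (x::'a::euclidean_space))"
  using emeasure_lborel_cball_finite[of a r] by (intro integrable_mult_right integrable_real_indicator) auto

text \<open>Two stages: cut \<open>f\<close> off in both argument and value, then replace the
  bounded function so obtained by a continuous one. Two errors of \<open>e / 2\<close> in L1, or of
  \<open>e / 4\<close> in squared L2 norm, add up to \<open>e\<close>, because the inequality for
  squared norms doubles its terms.\<close>

lemma L1_L2_approx_continuous: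
  fixes f :: "'a::euclidean_space \<Rightarrow> complex"
  assumes f: "integrable lborel f" and f2: "L2_sqnorm lborel f < \<infinity>" and e: "0 < e"
  obtains h B where "continuous_on UNIV h" "\<And>x. norm (h x) \<le> B" "integrable lborel h"
    "(LINT x|lborel. norm (f x - h x)) < e" "L2_sqnorm lborel (\<lambda>x. f x - h x) < ennreal e"
proof -
  have fm [measurable]: "f \<in> borel_measurable borel"
    using borel_measurable_integrable[OF f] by simp
  define F where "F n x = (if norm x \<le> real (Suc n) \<and> norm (f x) \<le> real (Suc n) then f x else 0)" for n x
  have Fm [measurable]: "F n \<in> borel_measurable borel" for n
    unfolding F_def[abs_def] by measurable
  have Fl: "(\<lambda>n. F n x) \<longlonglongrightarrow> f x" for x
  proof (rule tendsto_eventually)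
    obtain n0 where n0: "max (norm x) (norm (f x)) \<le> real n0" using real_arch_simple by blast
    show "\<forall>\<^sub>F n in sequentially. F n x = f x"
      using eventually_ge_at_top[of n0] by eventually_elim (use n0 in \<open>auto simp: F_def\<close>)
  qed
  have F0: "norm (F n x) \<le> norm (f x)" for n x by (simp add: F_def)
  have w: "integrable lborel (\<lambda>x. norm (f x))" "integrable lborel (\<lambda>x. (norm (f x))\<^sup>2)"
    using f f2 L2_sqnorm_finite_iff[of f lborel] by auto
  note lims = dominated_L1_L2[of f lborel F, OF _ _ w]
  have "\<forall>\<^sub>F n in sequentially. (LINT x|lborel. norm (f x - F n x)) < e / 2"
    using lims(1) Fl F0 e by (intro order_tendstoD) auto
  moreover have "\<forall>\<^sub>F n in sequentially. L2_sqnorm lborel (\<lambda>x. f x - F n x) < ennreal (e / 4)"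
    using lims(2) Fl F0 e by (intro order_tendstoD) auto
  ultimately have "\<forall>\<^sub>F n in sequentially. (LINT x|lborel. norm (f x - F n x)) < e / 2 \<and>
      L2_sqnorm lborel (\<lambda>x. f x - F n x) < ennreal (e / 4)"
    by eventually_elim simp
  then obtain n where n: "(LINT x|lborel. norm (f x - F n x)) < e / 2"
    "L2_sqnorm lborel (\<lambda>x. f x - F n x) < ennreal (e / 4)"
    by (auto dest: eventually_happens)
  define r where "r = real (Suc n)"
  obtain h where hc: "\<And>k::nat. continuous_on UNIV (h k)"
    and hb: "\<And>k x. norm (h k x) \<le> r * indicat_real (cball 0 (r + 1)) x"
    and hl: "AE x in lborel. (\<lambda>k. h k x) \<longlonglongrightarrow> F n x"
    by (rule bounded_measurable_approx_continuous[of "F n" r]) (auto simp: F_def r_def)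
  have hm [measurable]: "h k \<in> borel_measurable borel" for k
    using hc by (intro borel_measurable_continuous_onI)
  have sq: "(r * indicat_real (cball 0 (r + 1)) x)\<^sup>2 = r\<^sup>2 * indicat_real (cball 0 (r + 1)) x" for x :: 'a
    by (simp add: indicator_def)
  have w2: "integrable lborel (\<lambda>x::'a. r * indicat_real (cball 0 (r + 1)) x)"
    "integrable lborel (\<lambda>x::'a. (r * indicat_real (cball 0 (r + 1)) x)\<^sup>2)"
    using integrable_indicator_cball[of r 0 "r+1"] integrable_indicator_cball[of "r\<^sup>2" 0 "r+1"]
    by (auto simp: sq)
  note lims2 = dominated_L1_L2[of "F n" lborel h, OF _ _ w2 hl]
  have "\<forall>\<^sub>F k in sequentially. (LINT x|lborel. norm (F n x - h k x)) < e / 2"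
    using lims2(1) hb e by (intro order_tendstoD) auto
  moreover have "\<forall>\<^sub>F k in sequentially. L2_sqnorm lborel (\<lambda>x. F n x - h k x) < ennreal (e / 4)"
    using lims2(2) hb e by (intro order_tendstoD) auto
  ultimately have "\<forall>\<^sub>F k in sequentially. (LINT x|lborel. norm (F n x - h k x)) < e / 2 \<and>
      L2_sqnorm lborel (\<lambda>x. F n x - h k x) < ennreal (e / 4)"
    by eventually_elim simp
  then obtain k where k: "(LINT x|lborel. norm (F n x - h k x)) < e / 2"
    "L2_sqnorm lborel (\<lambda>x. F n x - h k x) < ennreal (e / 4)"
    by (auto dest: eventually_happens)
  have hi: "integrable lborel (h k)"
    using hb[of k] by (intro Bochner_Integration.integrable_bound[OF w2(1)]) (auto intro!: AE_I2 order_trans[OF hb abs_ge_self])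
  have Fi: "integrable lborel (F n)"
    by (rule Bochner_Integration.integrable_bound[OF f]) (auto simp: F_def)
  show ?thesis
  proof (rule that[of "h k" r, OF hc _ hi])
    show "norm (h k x) \<le> r" for x
      by (rule order_trans[OF hb]) (simp add: indicator_def r_def)
    have "(LINT x|lborel. norm (f x - h k x)) \<le> (LINT x|lborel. norm (f x - F n x) + norm (F n x - h k x))"
      using f hi Fi by (intro integral_mono) (auto intro: norm_triangle_ineq[of "f x - F n x" "F n x - h k x" for x, simplified])
    also have "\<dots> < e"
      using f hi Fi n k by (subst Bochner_Integration.integral_add) auto
    finally show "(LINT x|lborel. norm (f x - h k x)) < e" .
    have "L2_sqnorm lborel (\<lambda>x. f x - h k x) \<le> 2 * L2_sqnorm lborel (\<lambda>x. f x - F n x) + 2 * L2_sqnorm lborel (\<lambda>x. F n x - h k x)"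
      by (rule L2_sqnorm_triangle) auto
    also have "\<dots> < 2 * ennreal (e/4) + 2 * ennreal (e/4)"
      using n(2) k(2) by (intro add_strict_mono ennreal_mult_strict_left_mono) auto
    also have "\<dots> = ennreal e"
      using e by (simp add: ennreal_plus[symmetric] ennreal_mult''[symmetric] ennreal_numeral[symmetric] del: ennreal_plus ennreal_numeral)
    finally show "L2_sqnorm lborel (\<lambda>x. f x - h k x) < ennreal e" .
  qed
qed

lemma pred_cball [measurable]: "Measurable.pred borel (\<lambda>x::'a::euclidean_space. x \<in> cball a r)"
  by (simp add: pred_def)

lemma fourier_diff_fun:
  assumes "integrable lborel f" "integrable lborel g"
  shows "fourier (\<lambda>x. f x - g x) = (\<lambda>u. fourier f u - fourier g u)"
  by (rule ext) (rule fourier_diff[OF assms])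

lemma L2_sqnorm_diff_le:
  assumes [measurable]: "f \<in> borel_measurable M" "g \<in> borel_measurable M"
  shows "L2_sqnorm M (\<lambda>x. f x - g x) \<le> 2 * L2_sqnorm M f + 2 * L2_sqnorm M g"
  using L2_sqnorm_add_le[of f M "\<lambda>x. - g x"] by (simp add: L2_sqnorm_def)

text \<open>Continuous approximants converge to \<open>f\<close> in L1, so their transforms converge
  at every point, and Fatou's lemma carries the bound from \<open>plancherel_continuous\<close> over
  to \<open>f\<close>. The factor 2 is the cost of estimating the norm of an approximant by that of
  \<open>f\<close>.\<close>

lemma L2_sqnorm_fourier_le:
  fixes f :: "real^'d::finite \<Rightarrow> complex"
  assumes f: "integrable lborel f" and f2: "L2_sqnorm lborel f < \<infinity>"
  shows "L2_sqnorm lborel (fourier f) \<le> 2 * (ennreal ((2 * pi) ^ CARD('d)) * L2_sqnorm lborel f)"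
proof -
  let ?c = "ennreal ((2 * pi) ^ CARD('d))"
  have fm [measurable]: "f \<in> borel_measurable borel"
    using borel_measurable_integrable[OF f] by simp
  have "\<exists>h. continuous_on UNIV h \<and> (\<exists>B. \<forall>x. norm (h x) \<le> B) \<and> integrable lborel h \<and>
    (LINT x|lborel. norm (f x - h x)) < 1 / real (Suc n) \<and> L2_sqnorm lborel (\<lambda>x. f x - h x) < ennreal (1 / real (Suc n))"
    (is "\<exists>h. ?Q n h") for n
  proof -
    have pos: "0 < 1 / real (Suc n)" by simp
    obtain h B where "continuous_on UNIV h" "\<And>x. norm (h x) \<le> B" "integrable lborel h"
      "(LINT x|lborel. norm (f x - h x)) < 1 / real (Suc n)" "L2_sqnorm lborel (\<lambda>x. f x - h x) < ennreal (1 / real (Suc n))"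
      by (rule L1_L2_approx_continuous[OF f f2 pos]) (rule that, assumption+)
    then show ?thesis by (intro exI[of _ h]) auto
  qed
  then have "\<exists>h. \<forall>n. ?Q n (h n)"
    by (intro choice allI)
  then obtain h where hQ: "\<forall>n. ?Q n (h n)" ..
  note h = hQ[THEN spec, THEN conjunct1] hQ[THEN spec, THEN conjunct2, THEN conjunct1]
    hQ[THEN spec, THEN conjunct2, THEN conjunct2, THEN conjunct1]
    hQ[THEN spec, THEN conjunct2, THEN conjunct2, THEN conjunct2, THEN conjunct1]
    hQ[THEN spec, THEN conjunct2, THEN conjunct2, THEN conjunct2, THEN conjunct2]
  have hm [measurable]: "h n \<in> borel_measurable borel" for n
    using h(1) by (intro borel_measurable_continuous_onI)
  have lim: "(\<lambda>n. ennreal ((norm (fourier (h n) u))\<^sup>2)) \<longlonglongrightarrow> ennreal ((norm (fourier f u))\<^sup>2)" for u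
  proof -
    have "norm (fourier (h n) u - fourier f u) \<le> 1 / real (Suc n)" for n
    proof -
      have "norm (fourier (h n) u - fourier f u) = norm (fourier (\<lambda>x. f x - h n x) u)"
        using f h(3) by (simp add: fourier_diff norm_minus_commute)
      also have "\<dots> \<le> (LINT x|lborel. norm (f x - h n x))"
        using f h(3) by (intro norm_fourier_le) simp
      finally show ?thesis using h(4)[of n] by simp
    qed
    then have "\<forall>\<^sub>F n in sequentially. norm (fourier (h n) u - fourier f u) \<le> inverse (real (Suc n))"
      unfolding inverse_eq_divide by (intro always_eventually allI)
    then have "(\<lambda>n. fourier (h n) u - fourier f u) \<longlonglongrightarrow> 0"
      by (rule Lim_null_comparison[OF _ LIMSEQ_inverse_real_of_nat])
    then have "(\<lambda>n. fourier (h n) u) \<longlonglongrightarrow> fourier f u"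
      by (rule LIM_zero_cancel)
    then show ?thesis
      by (intro tendsto_ennrealI tendsto_intros)
  qed
  have up: "L2_sqnorm lborel (fourier (h n)) \<le> ?c * (2 * L2_sqnorm lborel f + 2 * ennreal (1 / real (Suc n)))" for n
  proof -
    have "L2_sqnorm lborel (h n) = L2_sqnorm lborel (\<lambda>x. f x - (f x - h n x))" by simp
    also have "\<dots> \<le> 2 * L2_sqnorm lborel f + 2 * L2_sqnorm lborel (\<lambda>x. f x - h n x)"
      by (rule L2_sqnorm_diff_le) auto
    also have "\<dots> \<le> 2 * L2_sqnorm lborel f + 2 * ennreal (1 / real (Suc n))"
      using h(5)[of n] by (intro add_left_mono mult_left_mono) auto
    finally have le: "L2_sqnorm lborel (h n) \<le> 2 * L2_sqnorm lborel f + 2 * ennreal (1 / real (Suc n))" .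
    obtain B where "\<And>x. norm (h n x) \<le> B" using h(2)[of n] by auto
    from plancherel_continuous[OF h(3,1) this] le show ?thesis
      by (simp only: mult_left_mono zero_le)
  qed
  have "L2_sqnorm lborel (fourier f) = (\<integral>\<^sup>+u. liminf (\<lambda>n. ennreal ((norm (fourier (h n) u))\<^sup>2)) \<partial>lborel)"
    unfolding L2_sqnorm_def by (intro nn_integral_cong lim_imp_Liminf[symmetric] lim) simp
  also have "\<dots> \<le> liminf (\<lambda>n. L2_sqnorm lborel (fourier (h n)))"
    unfolding L2_sqnorm_def by (rule nn_integral_liminf) measurable
  also have "\<dots> \<le> liminf (\<lambda>n. ?c * (2 * L2_sqnorm lborel f + 2 * ennreal (1 / real (Suc n))))"
    by (intro Liminf_mono always_eventually allI up)
  also have "\<dots> = ?c * (2 * L2_sqnorm lborel f + 2 * ennreal 0)"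
    by (intro lim_imp_Liminf tendsto_intros ennreal_tendsto_cmult tendsto_add tendsto_ennrealI)
       (use LIMSEQ_inverse_real_of_nat in \<open>auto simp: inverse_eq_divide\<close>)
  finally show ?thesis by (simp add: mult_ac)
qed

lemma L2_sqnorm_le_fourier:
  fixes f :: "real^'d::finite \<Rightarrow> complex"
  assumes f: "integrable lborel f" and f2: "L2_sqnorm lborel f < \<infinity>"
  shows "ennreal ((2 * pi) ^ CARD('d)) * L2_sqnorm lborel f \<le> 4 * L2_sqnorm lborel (fourier f)"
proof (rule ennreal_le_epsilon)
  let ?c = "ennreal ((2 * pi) ^ CARD('d))"
  have fm [measurable]: "f \<in> borel_measurable borel"
    using borel_measurable_integrable[OF f] by simp
  fix e :: real assume "0 < e"
  \<comment> \<open>Replacing \<open>f\<close> by \<open>h\<close> costs \<open>2 * ?c * d\<close>,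
    replacing the transform of \<open>h\<close> by that of \<open>f\<close> another
    \<open>8 * ?c * d\<close>; together this is \<open>e\<close>.\<close>
  define d where "d = e / (10 * (2 * pi) ^ CARD('d))"
  have d: "0 < d" using \<open>0 < e\<close> by (simp add: d_def)
  obtain h B where h: "continuous_on UNIV h" "\<And>x. norm (h x) \<le> B" "integrable lborel h"
    "L2_sqnorm lborel (\<lambda>x. f x - h x) < ennreal d"
    by (rule L1_L2_approx_continuous[OF f f2 d]) (rule that, assumption+)
  have hm [measurable]: "h \<in> borel_measurable borel"
    using h(1) by (intro borel_measurable_continuous_onI)
  have tri: "L2_sqnorm lborel a \<le> 2 * L2_sqnorm lborel (\<lambda>x. a x - b x) + 2 * L2_sqnorm lborel b"
    if "a \<in> borel_measurable borel" "b \<in> borel_measurable borel" for a b :: "real^'d \<Rightarrow> complex"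
    using L2_sqnorm_triangle[of a lborel b "\<lambda>_. 0"] that by simp
  have fh: "L2_sqnorm lborel (\<lambda>x. fourier h x - fourier f x) \<le> 2 * (?c * ennreal d)"
  proof -
    have "L2_sqnorm lborel (\<lambda>x. fourier h x - fourier f x) = L2_sqnorm lborel (fourier (\<lambda>x. f x - h x))"
      using f h(3) by (subst L2_sqnorm_minus_commute) (simp add: fourier_diff_fun)
    also have "\<dots> \<le> 2 * (?c * L2_sqnorm lborel (\<lambda>x. f x - h x))"
      using f h(3,4) by (intro L2_sqnorm_fourier_le) (auto intro: less_trans)
    also have "\<dots> \<le> 2 * (?c * ennreal d)"
      using h(4) by (intro mult_left_mono) auto
    finally show ?thesis .
  qed
  have "?c * L2_sqnorm lborel f \<le> ?c * (2 * ennreal d + 2 * L2_sqnorm lborel h)"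
    using h(4) by (intro mult_left_mono order_trans[OF tri[of f h]] add_mono) auto
  also have "\<dots> = 2 * ?c * ennreal d + 2 * (?c * L2_sqnorm lborel h)"
    by (simp add: algebra_simps)
  also have "?c * L2_sqnorm lborel h = L2_sqnorm lborel (fourier h)"
    by (rule plancherel_continuous[symmetric, OF h(3,1,2)])
  also have "2 * ?c * ennreal d + 2 * L2_sqnorm lborel (fourier h)
     \<le> 2 * ?c * ennreal d + 2 * (2 * (2 * (?c * ennreal d)) + 2 * L2_sqnorm lborel (fourier f))"
    by (intro add_left_mono mult_left_mono order_trans[OF tri[of "fourier h" "fourier f"]] add_mono fh) auto
  also have "\<dots> = 4 * L2_sqnorm lborel (fourier f) + 10 * (?c * ennreal d)"
  proof -
    have "10 * a = 2 * a + 8 * a" for a :: ennreal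
      by (simp flip: distrib_right)
    then have "2 * a + 2 * (2 * (2 * a) + 2 * F) = 4 * F + 10 * a" for a F :: ennreal
      by (simp add: distrib_left mult.assoc[symmetric] add_ac)
    then show ?thesis by (simp only: mult.assoc)
  qed
  also have "10 * (?c * ennreal d) = ennreal e"
    using d \<open>0 < e\<close>
    by (simp add: d_def ennreal_mult[symmetric] ennreal_numeral[symmetric] del: ennreal_numeral)
  finally show "?c * L2_sqnorm lborel f \<le> 4 * L2_sqnorm lborel (fourier f) + ennreal e" .
qed

text \<open>An integrable \<open>f\<close> need not lie in L2, so Plancherel's theorem does not
  apply. Instead \<open>f\<close> is tested against its own phase on a ball. The phase is a bounded
  limit of continuous functions, against which \<open>parseval_limit\<close> gives 0, so
  \<open>norm f\<close> has integral 0 over the ball.\<close>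

lemma fourier_unique:
  fixes f :: "real^'d::finite \<Rightarrow> complex"
  assumes f: "integrable lborel f" and f0: "\<And>u. fourier f u = 0"
  shows "AE x in lborel. f x = 0"
proof -
  have fm [measurable]: "f \<in> borel_measurable borel"
    using borel_measurable_integrable[OF f] by simp
  have "AE x in lborel. x \<in> cball 0 (real (Suc n)) \<longrightarrow> f x = 0" for n
  proof -
    define r where "r = real (Suc n)"
    define F where "F x = (if norm x \<le> r \<and> f x \<noteq> 0 then f x / of_real (norm (f x)) else 0)" for x
    have Fm [measurable]: "F \<in> borel_measurable borel" unfolding F_def[abs_def] by measurable
    obtain h where hc: "\<And>k::nat. continuous_on UNIV (h k)"
      and hb: "\<And>k x. norm (h k x) \<le> r * indicat_real (cball 0 (r + 1)) x"
      and hl: "AE x in lborel. (\<lambda>k. h k x) \<longlonglongrightarrow> F x"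
      by (rule bounded_measurable_approx_continuous[of F r]) (auto simp: F_def r_def norm_divide)
    have hm [measurable]: "h k \<in> borel_measurable borel" for k
      using hc by (intro borel_measurable_continuous_onI)
    have hb': "norm (h k x) \<le> r" for k x
      by (rule order_trans[OF hb]) (simp add: indicator_def r_def)
    have hi: "integrable lborel (h k)" for k
      using integrable_indicator_cball[of r 0 "r + 1"]
      by (rule Bochner_Integration.integrable_bound) (auto intro!: AE_I2 order_trans[OF hb abs_ge_self])
    have h0: "(LINT x|lborel. f x * cnj (h k x)) = 0" for k
      using parseval_limit[OF f hi[of k] hc[of k] hb'[of k]] by (simp add: f0 LIMSEQ_const_iff)
    have "(\<lambda>k. LINT x|lborel. f x * cnj (h k x)) \<longlonglongrightarrow> (LINT x|lborel. f x * cnj (F x))"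
    proof (rule integral_dominated_convergence)
      show "integrable lborel (\<lambda>x. norm (f x) * r)" using f by simp
      show "AE x in lborel. (\<lambda>k. f x * cnj (h k x)) \<longlonglongrightarrow> f x * cnj (F x)"
        using hl by eventually_elim (intro tendsto_intros)
      show "AE x in lborel. norm (f x * cnj (h k x)) \<le> norm (f x) * r" for k
        by (rule AE_I2) (auto simp: norm_mult intro!: mult_left_mono hb')
    qed measurable
    then have "(LINT x|lborel. f x * cnj (F x)) = 0"
      by (simp add: h0 LIMSEQ_const_iff)
    moreover have "f x * cnj (F x) = of_real (indicat_real (cball 0 r) x * norm (f x))" for x
      by (simp add: F_def indicator_def complex_norm_square[symmetric] power2_eq_square)
    ultimately have "(LINT x|lborel. indicat_real (cball 0 r) x * norm (f x)) = 0"
      by (simp only: integral_complex_of_real of_real_eq_0_iff)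
    moreover have "integrable lborel (\<lambda>x. indicat_real (cball 0 r) x * norm (f x))"
      by (rule Bochner_Integration.integrable_bound[OF f]) (auto simp: indicator_def)
    ultimately have "AE x in lborel. indicat_real (cball 0 r) x * norm (f x) = 0"
      by (subst (asm) integral_nonneg_eq_0_iff_AE) auto
    then show ?thesis
      unfolding r_def[symmetric] by eventually_elim (auto simp: indicator_def)
  qed
  then have "AE x in lborel. \<forall>n. x \<in> cball 0 (real (Suc n)) \<longrightarrow> f x = 0"
    by (intro iffD2[OF AE_all_countable] allI)
  then show ?thesis
  proof eventually_elim
    case (elim x)
    obtain n where "norm x \<le> real n" using real_arch_simple by blast
    then show ?case using elim[rule_format, of n] by simp
  qed
qed

subsection \<open>The Fourier transform on square-integrable functions\<close>

lemma trunc_L1_L2: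
  fixes f :: "real^'d::finite \<Rightarrow> complex"
  assumes "f \<in> L2"
  shows "integrable lborel (\<lambda>x. indicat_real (cball 0 r) x *\<^sub>R f x)"
    and "L2_sqnorm lborel (\<lambda>x. indicat_real (cball 0 r) x *\<^sub>R f x) < \<infinity>"
proof -
  have fm [measurable]: "f \<in> borel_measurable borel" and f2: "integrable lborel (\<lambda>x. (norm (f x))\<^sup>2)"
    using assms L2_sqnorm_finite_iff[of f lborel] by (auto simp: L2_def)
  show "integrable lborel (\<lambda>x. indicat_real (cball 0 r) x *\<^sub>R f x)"
  proof (rule Bochner_Integration.integrable_bound)
    show "integrable lborel (\<lambda>x. 1 * indicat_real (cball 0 r) x + (norm (f x))\<^sup>2)"
      by (intro Bochner_Integration.integrable_add integrable_indicator_cball f2)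
    have "t \<le> 1 + t\<^sup>2" for t :: real
      using sum_squares_bound[of t 1] zero_le_power2[of t] unfolding power_one by linarith
    then show "AE x in lborel. norm (indicat_real (cball 0 r) x *\<^sub>R f x) \<le> norm (1 * indicat_real (cball 0 r) x + (norm (f x))\<^sup>2)"
      by (intro AE_I2) (auto simp: indicator_def)
  qed measurable
  have "integrable lborel (\<lambda>x. (norm (indicat_real (cball 0 r) x *\<^sub>R f x))\<^sup>2)"
    by (rule Bochner_Integration.integrable_bound[OF f2]) (auto simp: indicator_def)
  then show "L2_sqnorm lborel (\<lambda>x. indicat_real (cball 0 r) x *\<^sub>R f x) < \<infinity>"
    by (subst L2_sqnorm_finite_iff) auto
qed

lemma L2_sqnorm_trunc_tendsto:
  fixes f :: "real^'d::finite \<Rightarrow> complex"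
  assumes "f \<in> L2"
  shows "(\<lambda>n. L2_sqnorm lborel (\<lambda>x. f x - indicat_real (cball 0 (real n)) x *\<^sub>R f x)) \<longlonglongrightarrow> 0"
proof -
  have fm [measurable]: "f \<in> borel_measurable borel" and f2: "integrable lborel (\<lambda>x. (norm (f x))\<^sup>2)"
    using assms L2_sqnorm_finite_iff[of f lborel] by (auto simp: L2_def)
  have eq: "L2_sqnorm lborel (\<lambda>x. f x - indicat_real (cball 0 (real n)) x *\<^sub>R f x) =
     ennreal (LINT x|lborel. indicat_real (- cball 0 (real n)) x * (norm (f x))\<^sup>2)" for n
  proof -
    have "(norm (f x - indicat_real (cball 0 (real n)) x *\<^sub>R f x))\<^sup>2 = indicat_real (- cball 0 (real n)) x * (norm (f x))\<^sup>2" for x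
      by (simp add: indicator_def)
    moreover have "integrable lborel (\<lambda>x. indicat_real (- cball 0 (real n)) x * (norm (f x))\<^sup>2)"
      by (rule Bochner_Integration.integrable_bound[OF f2]) (auto simp: indicator_def)
    ultimately show ?thesis by (subst L2_sqnorm_eq_integral) auto
  qed
  have "(\<lambda>n. LINT x|lborel. indicat_real (- cball 0 (real n)) x * (norm (f x))\<^sup>2) \<longlonglongrightarrow> (LINT x|(lborel::(real^'d) measure). 0)"
  proof (rule integral_dominated_convergence[OF _ _ f2])
    show "AE x in lborel. (\<lambda>n. indicat_real (- cball 0 (real n)) x * (norm (f x))\<^sup>2) \<longlonglongrightarrow> 0"
    proof (intro AE_I2 tendsto_eventually)
      fix x :: "real^'d"
      obtain n0 where n0: "norm x \<le> real n0" using real_arch_simple by blast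
      show "\<forall>\<^sub>F n in sequentially. indicat_real (- cball 0 (real n)) x * (norm (f x))\<^sup>2 = 0"
        using eventually_ge_at_top[of n0] by eventually_elim (use n0 in \<open>auto simp: indicator_def\<close>)
    qed
  qed (auto simp: indicator_def)
  then show ?thesis unfolding eq using tendsto_ennrealI by fastforce
qed

text \<open>The pointwise transform satisfies the definition by truncations because
  \<open>L2_sqnorm_fourier_le\<close> applies to the discarded tails.\<close>

lemma has_fourier_L2_fourier:
  fixes f :: "real^'d::finite \<Rightarrow> complex"
  assumes f: "integrable lborel f" and f2: "L2_sqnorm lborel f < \<infinity>"
  shows "has_fourier_L2 f (fourier f)"
proof -
  have fm [measurable]: "f \<in> borel_measurable borel"
    using borel_measurable_integrable[OF f] by simp
  have fL: "f \<in> L2" using f2 by (simp add: L2_def)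
  let ?c = "ennreal ((2 * pi) ^ CARD('d))"
  let ?t = "\<lambda>n x. indicat_real (cball 0 (real n)) x *\<^sub>R f x"
  have "L2_sqnorm lborel (fourier f) \<le> 2 * (?c * L2_sqnorm lborel f)"
    by (rule L2_sqnorm_fourier_le[OF f f2])
  also have "\<dots> < \<infinity>" using f2 by (simp add: ennreal_mult_less_top)
  finally have gL: "fourier f \<in> L2" by (simp add: L2_def)
  have le: "L2_sqnorm lborel (\<lambda>u. fourier f u - fourier (?t n) u) \<le> 2 * (?c * L2_sqnorm lborel (\<lambda>x. f x - ?t n x))" for n
  proof -
    have "L2_sqnorm lborel (\<lambda>x. f x - ?t n x) \<le> 2 * L2_sqnorm lborel f + 2 * L2_sqnorm lborel (?t n)"
      by (rule L2_sqnorm_diff_le) auto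
    also have "\<dots> < \<infinity>" using f2 trunc_L1_L2(2)[OF fL, of "real n"] by (simp add: ennreal_mult_less_top)
    finally show ?thesis
      using L2_sqnorm_fourier_le[of "\<lambda>x. f x - ?t n x"] trunc_L1_L2(1)[OF fL, of "real n"] f
      by (simp add: fourier_diff_fun)
  qed
  have "(\<lambda>n. 2 * (?c * L2_sqnorm lborel (\<lambda>x. f x - ?t n x))) \<longlonglongrightarrow> 2 * (?c * 0)"
    by (intro ennreal_tendsto_cmult L2_sqnorm_trunc_tendsto fL) auto
  then have lim0: "(\<lambda>n. 2 * (?c * L2_sqnorm lborel (\<lambda>x. f x - ?t n x))) \<longlonglongrightarrow> 0"
    by simp
  have "(\<lambda>n. L2_sqnorm lborel (\<lambda>u. fourier f u - fourier (?t n) u)) \<longlonglongrightarrow> 0"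
    by (rule tendsto_sandwich[OF _ _ tendsto_const lim0]) (simp, intro always_eventually allI le)
  then show ?thesis using fL gL by (simp add: has_fourier_L2_def)
qed

text \<open>The bridge from the frequency side back to functions. The truncations of
  \<open>f\<close> are integrable, so \<open>L2_sqnorm_le_fourier\<close> applies to their
  difference with \<open>h\<close>; as the radius grows the truncation errors vanish. The constant
  is 2 * 4 * 2: a factor 2 for each of two triangle inequalities and the 4 of that lemma.\<close>

lemma has_fourier_L2_dist:
  fixes f h :: "real^'d::finite \<Rightarrow> complex"
  assumes fg: "has_fourier_L2 f g" and h: "integrable lborel h" and h2: "L2_sqnorm lborel h < \<infinity>"
  shows "ennreal ((2 * pi) ^ CARD('d)) * L2_sqnorm lborel (\<lambda>x. f x - h x) \<le> 16 * L2_sqnorm lborel (\<lambda>u. g u - fourier h u)"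
proof -
  let ?c = "ennreal ((2 * pi) ^ CARD('d))"
  let ?t = "\<lambda>n x. indicat_real (cball 0 (real n)) x *\<^sub>R f x"
  have fL: "f \<in> L2" and gL: "g \<in> L2" using fg by (auto simp: has_fourier_L2_def)
  have [measurable]: "f \<in> borel_measurable borel" "g \<in> borel_measurable borel" "h \<in> borel_measurable borel"
    using fL gL borel_measurable_integrable[OF h] by (auto simp: L2_def)
  let ?G = "L2_sqnorm lborel (\<lambda>u. g u - fourier h u)"
  have le: "?c * L2_sqnorm lborel (\<lambda>x. f x - h x) \<le> 2 * (?c * L2_sqnorm lborel (\<lambda>x. f x - ?t n x)) +
      (16 * L2_sqnorm lborel (\<lambda>u. g u - fourier (?t n) u) + 16 * ?G)" for n
  proof -
    have "L2_sqnorm lborel (\<lambda>x. ?t n x - h x) \<le> 2 * L2_sqnorm lborel (?t n) + 2 * L2_sqnorm lborel h"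
      by (rule L2_sqnorm_diff_le) auto
    also have "\<dots> < \<infinity>" using h2 trunc_L1_L2(2)[OF fL, of "real n"] by (simp add: ennreal_mult_less_top)
    finally have "?c * L2_sqnorm lborel (\<lambda>x. ?t n x - h x) \<le> 4 * L2_sqnorm lborel (\<lambda>u. fourier (?t n) u - fourier h u)"
      using L2_sqnorm_le_fourier[of "\<lambda>x. ?t n x - h x"] trunc_L1_L2(1)[OF fL, of "real n"] h
      by (simp add: fourier_diff_fun)
    also have "\<dots> \<le> 4 * (2 * L2_sqnorm lborel (\<lambda>u. fourier (?t n) u - g u) + 2 * ?G)"
      by (intro mult_left_mono L2_sqnorm_triangle) auto
    also have "\<dots> = 8 * L2_sqnorm lborel (\<lambda>u. g u - fourier (?t n) u) + 8 * ?G"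
      by (subst L2_sqnorm_minus_commute) (simp add: algebra_simps)
    finally have 1: "?c * L2_sqnorm lborel (\<lambda>x. ?t n x - h x) \<le> 8 * L2_sqnorm lborel (\<lambda>u. g u - fourier (?t n) u) + 8 * ?G" .
    have "?c * L2_sqnorm lborel (\<lambda>x. f x - h x) \<le> ?c * (2 * L2_sqnorm lborel (\<lambda>x. f x - ?t n x) + 2 * L2_sqnorm lborel (\<lambda>x. ?t n x - h x))"
      by (intro mult_left_mono L2_sqnorm_triangle) auto
    also have "\<dots> = 2 * (?c * L2_sqnorm lborel (\<lambda>x. f x - ?t n x)) + 2 * (?c * L2_sqnorm lborel (\<lambda>x. ?t n x - h x))"
      by (simp add: algebra_simps)
    also have "\<dots> \<le> 2 * (?c * L2_sqnorm lborel (\<lambda>x. f x - ?t n x)) + 2 * (8 * L2_sqnorm lborel (\<lambda>u. g u - fourier (?t n) u) + 8 * ?G)"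
      by (intro add_left_mono mult_left_mono 1) auto
    finally show ?thesis by (simp add: algebra_simps)
  qed
  have "(\<lambda>n. 2 * (?c * L2_sqnorm lborel (\<lambda>x. f x - ?t n x)) +
      (16 * L2_sqnorm lborel (\<lambda>u. g u - fourier (?t n) u) + 16 * ?G)) \<longlonglongrightarrow> 2 * (?c * 0) + (16 * 0 + 16 * ?G)"
    using fg by (intro tendsto_add ennreal_tendsto_cmult L2_sqnorm_trunc_tendsto fL tendsto_const)
      (auto simp: has_fourier_L2_def)
  then have "?c * L2_sqnorm lborel (\<lambda>x. f x - h x) \<le> 2 * (?c * 0) + (16 * 0 + 16 * ?G)"
    by (rule LIMSEQ_le_const) (use le in blast)
  then show ?thesis by simp
qed

lemma has_fourier_L2_unique:
  assumes "has_fourier_L2 f g" "has_fourier_L2 f g'"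
  shows "AE u in lborel. g u = g' u"
proof -
  have [measurable]: "f \<in> borel_measurable borel" "g \<in> borel_measurable borel" "g' \<in> borel_measurable borel"
    using assms by (auto simp: has_fourier_L2_def L2_def)
  let ?t = "\<lambda>n. fourier (\<lambda>x. indicat_real (cball 0 (real n)) x *\<^sub>R f x)"
  have le: "L2_sqnorm lborel (\<lambda>u. g u - g' u) \<le>
      2 * L2_sqnorm lborel (\<lambda>u. g u - ?t n u) + 2 * L2_sqnorm lborel (\<lambda>u. g' u - ?t n u)" for n
    using L2_sqnorm_triangle[of g lborel "?t n" g'] by (simp add: L2_sqnorm_minus_commute[of _ g'])
  have "(\<lambda>n. 2 * L2_sqnorm lborel (\<lambda>u. g u - ?t n u) + 2 * L2_sqnorm lborel (\<lambda>u. g' u - ?t n u)) \<longlonglongrightarrow> 2 * 0 + 2 * 0"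
    using assms by (intro tendsto_add ennreal_tendsto_cmult) (auto simp: has_fourier_L2_def)
  then have "L2_sqnorm lborel (\<lambda>u. g u - g' u) \<le> 2 * 0 + 2 * 0"
    by (rule LIMSEQ_le_const) (use le in blast)
  then show ?thesis
    by (simp add: L2_sqnorm_0_iff)
qed

text \<open>Representatives that agree almost everywhere are distinct objects in \<open>L2\<close>,
  so invariance has to be proved. Measurability does not pass along equality almost everywhere for
  Borel sets, hence the two measurability hypotheses.\<close>

lemma has_fourier_L2_cong_AE:
  assumes "has_fourier_L2 f g" and "AE x in lborel. f x = f' x" and "AE u in lborel. g u = g' u"
    and m [measurable]: "f' \<in> borel_measurable lborel" "g' \<in> borel_measurable lborel"
  shows "has_fourier_L2 f' g'"
proof -
  have [measurable]: "f \<in> borel_measurable borel" "g \<in> borel_measurable borel"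
    using assms by (auto simp: has_fourier_L2_def L2_def)
  have "fourier (\<lambda>x. indicat_real (cball 0 (real n)) x *\<^sub>R f' x) u = fourier (\<lambda>x. indicat_real (cball 0 (real n)) x *\<^sub>R f x) u" for n u
    unfolding fourier_def using m by (intro integral_cong_AE) (use assms(2) in \<open>auto elim: eventually_mono\<close>)
  moreover have "L2_sqnorm lborel (\<lambda>u. g' u - h u) = L2_sqnorm lborel (\<lambda>u. g u - h u)" for h
    by (rule L2_sqnorm_cong_AE) (use assms(3) in eventually_elim, simp)
  moreover have "L2_sqnorm lborel f' = L2_sqnorm lborel f" "L2_sqnorm lborel g' = L2_sqnorm lborel g"
    by (rule L2_sqnorm_cong_AE, use assms(2,3) in eventually_elim, simp)+
  ultimately show ?thesis
    using assms(1) by (simp add: has_fourier_L2_def L2_def)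
qed

section \<open>The trivariate piecewise linear box spline\<close>

lemma prod_UNIV_3: "prod f (UNIV::3 set) = f 1 * f 2 * f 3"
  unfolding UNIV_3 by (simp add: mult_ac)

section \<open>An explicit representative of the box spline and its transform\<close>

definition ind01 :: "real \<Rightarrow> complex" where
  "ind01 t = of_real (indicat_real {0..1} t)"

lemma ind01_measurable [measurable]: "ind01 \<in> borel_measurable borel"
  unfolding ind01_def[abs_def] by measurable

lemma integrable_ind01: "integrable lborel ind01"
  unfolding ind01_def[abs_def] by (intro integrable_of_real) auto

lemma norm_ind01_le: "norm (ind01 t) \<le> 1" and ind01_eq: "ind01 t = (if 0 \<le> t \<and> t \<le> 1 then 1 else 0)"
  by (auto simp: ind01_def indicator_def)

lemma integrable_ind01_shift: "integrable lborel (\<lambda>t. ind01 (t - r))"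
  using integrable_lborel_affine[OF integrable_ind01, of 1 "-r"] by simp

lemma integral_ind01_exp: "(LINT t|lborel. ind01 t * exp (- \<i> * of_real (u * t))) = box_factor u"
proof (cases "u = 0")
  case True
  have "(LINT t|lborel. ind01 t) = of_real (LINT t|lborel. indicat_real {0..1} (t::real))"
    unfolding ind01_def by (rule integral_complex_of_real)
  then show ?thesis using True by (simp add: box_factor_def)
next
  case False
  let ?F = "\<lambda>t. exp (- \<i> * of_real (u * t)) / (- \<i> * of_real u)"
  have "(LINT t|lborel. indicator {0..1} t *\<^sub>R exp (- \<i> * of_real (u * t))) = ?F 1 - ?F 0"
  proof (rule integral_FTC_atLeastAtMost)
    show "(?F has_vector_derivative exp (- \<i> * of_real (u * t))) (at t within {0..1})" for t
    proof -
      have "((\<lambda>z. exp (- \<i> * (of_real u * z)) / (- \<i> * of_real u)) has_field_derivative exp (- \<i> * (of_real u * of_real t))) (at (of_real t))"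
        using False by (auto intro!: derivative_eq_intros simp: field_simps)
      from has_vector_derivative_real_field[OF this] show ?thesis by simp
    qed
  qed (auto intro!: continuous_intros)
  moreover have "indicator {0..1} t *\<^sub>R exp (- \<i> * of_real (u * t)) = ind01 t * exp (- \<i> * of_real (u * t))" for t
    by (auto simp: ind01_def indicator_def)
  ultimately show ?thesis using False by (simp add: box_factor_def field_simps)
qed

lemma integral_ind01_shift_exp:
  "(LINT t|lborel. ind01 (t - r) * exp (- \<i> * of_real (u * t))) = exp (- \<i> * of_real (u * r)) * box_factor u"
proof -
  have "(LINT t|lborel. ind01 (t - r) * exp (- \<i> * of_real (u * t))) =
     (LINT t|lborel. exp (- \<i> * of_real (u * r)) * (ind01 t * exp (- \<i> * of_real (u * t))))"
  proof (subst lborel_integral_real_affine[where c = 1 and t = r])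
    have "exp (- \<i> * of_real (u * (r + t))) = exp (- \<i> * of_real (u * r)) * exp (- \<i> * of_real (u * t))" for t
      by (simp add: exp_add[symmetric] algebra_simps)
    then show "\<bar>1\<bar> *\<^sub>R (LINT t|lborel. ind01 (r + 1 * t - r) * exp (- \<i> * of_real (u * (r + 1 * t)))) =
      (LINT t|lborel. exp (- \<i> * of_real (u * r)) * (ind01 t * exp (- \<i> * of_real (u * t))))"
      by (simp add: mult_ac)
  qed simp
  then show ?thesis unfolding integral_mult_right_zero integral_ind01_exp .
qed

text \<open>The autocorrelation of the indicator of the unit interval
  (\<open>integral_ind01_mult\<close>), equivalently the density of the difference of two
  independent uniform variables.\<close>

definition hat :: "real \<Rightarrow> real" where
  "hat t = max 0 (1 - \<bar>t\<bar>)"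

lemma hat_measurable [measurable]: "hat \<in> borel_measurable borel"
  unfolding hat_def[abs_def] by measurable

lemma integral_ind01_mult: "(LINT t|lborel. ind01 (t - a) * ind01 (t - b)) = of_real (hat (b - a))"
proof -
  have eq: "ind01 (t - a) * ind01 (t - b) = of_real (indicat_real {max a b..min a b + 1} t)" for t
    by (auto simp: ind01_def indicator_def)
  have "measure lborel {max a b..min a b + 1} = hat (b - a)"
    by (cases "max a b \<le> min a b + 1"; cases "a \<le> b") (auto simp: hat_def)
  then show ?thesis unfolding eq integral_complex_of_real by simp
qed

text \<open>The convolution of the unit cube with the segment from \<open>0\<close> to \<open>(1, 1, 1)\<close>.\<close>

definition PL_box :: "real^3 \<Rightarrow> complex" where
  "PL_box x = (LINT r|lborel. ind01 r * (\<Prod>j\<in>UNIV. ind01 (x $ j - r)))"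

lemma vec_nth_measurable [measurable (raw)]:
  "f \<in> M \<rightarrow>\<^sub>M borel \<Longrightarrow> (\<lambda>x. (f x :: real^'d::finite) $ j) \<in> M \<rightarrow>\<^sub>M borel"
  by (rule measurable_compose[of f M borel "\<lambda>x. x $ j"]) simp_all

lemma PL_box_measurable [measurable]: "PL_box \<in> borel_measurable borel"
  unfolding PL_box_def[abs_def] by measurable

lemma norm_prod_ind01_le: "norm (\<Prod>j\<in>(UNIV::'d::finite set). ind01 (f j)) \<le> 1"
  unfolding prod_norm[symmetric] by (intro prod_le_1) (auto simp: norm_ind01_le)

lemma norm_PL_box_le: "norm (PL_box x) \<le> 1"
proof -
  have "norm (PL_box x) \<le> (LINT r|lborel. norm (ind01 r * (\<Prod>j\<in>UNIV. ind01 (x $ j - r))))"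
    unfolding PL_box_def by (rule integral_norm_bound)
  also have "\<dots> \<le> (LINT r|lborel. indicat_real {0..1} (r::real))"
  proof (rule Bochner_Integration.integral_mono')
    show "norm (ind01 r * (\<Prod>j\<in>UNIV. ind01 (x $ j - r))) \<le> indicat_real {0..1} r" for r
      using norm_prod_ind01_le[of "\<lambda>j. x $ j - r"] by (simp add: norm_mult ind01_def indicator_def)
  qed auto
  finally show ?thesis by simp
qed

lemma PL_box_support: "PL_box x = 0" if "\<not> (\<forall>j. 0 \<le> x $ j \<and> x $ j \<le> 2)"
proof -
  from that obtain j where j: "x $ j < 0 \<or> 2 < x $ j" by (auto simp: not_le)
  have "ind01 r * (\<Prod>j\<in>UNIV. ind01 (x $ j - r)) = 0" for r
    using j by (auto simp: ind01_eq intro!: exI[of _ j])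
  then show ?thesis unfolding PL_box_def by (simp only: integral_zero)
qed

definition box2 :: "real^3 \<Rightarrow> complex" where
  "box2 x = (\<Prod>j\<in>UNIV. ind01 (x $ j / 2))"

lemma box2_eq: "box2 x = (if \<forall>j. 0 \<le> x $ j \<and> x $ j \<le> 2 then 1 else 0)"
  by (auto simp: box2_def ind01_eq)

lemma integrable_box2: "integrable lborel box2"
  unfolding box2_def[abs_def]
  using integrable_lborel_affine[OF integrable_ind01, of "1/2" 0] by (intro integrable_lborel_prod_vec) simp

text \<open>For \<open>r\<close> in the unit interval the product vanishes unless every coordinate
  of \<open>x\<close> lies between 0 and 2. This separates the variables in the dominating function
  for Fubini's theorem.\<close>

lemma ind01_prod_le_box2: "norm (ind01 r * (\<Prod>j\<in>UNIV. ind01 (x $ j - r))) \<le> norm (ind01 r) * norm (box2 x)"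
proof (cases "0 \<le> r \<and> r \<le> 1 \<and> \<not> (\<forall>j. 0 \<le> x $ j \<and> x $ j \<le> 2)")
  case True
  then obtain j where j: "x $ j < 0 \<or> 2 < x $ j" by (auto simp: not_le)
  then have "\<exists>j\<in>UNIV. ind01 (x $ j - r) = 0"
    using True by (auto simp: ind01_eq intro!: exI[of _ j])
  then have h: "(\<Prod>j\<in>UNIV. ind01 (x $ j - r)) = 0"
    by (rule prod_zero[OF finite])
  show ?thesis unfolding h by simp
next
  case False
  then show ?thesis using norm_prod_ind01_le[of "\<lambda>j. x $ j - r"] by (auto simp: box2_eq norm_mult ind01_eq)
qed

lemma integrable_PL_box: "integrable lborel PL_box"
proof (rule Bochner_Integration.integrable_bound[OF integrable_box2])
  show "AE x in lborel. norm (PL_box x) \<le> norm (box2 x)"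
    using norm_PL_box_le PL_box_support by (intro AE_I2) (auto simp: box2_eq)
qed measurable

text \<open>With the integrals exchanged, the integral over \<open>x\<close> factors by coordinates.
  Each coordinate, shifted by \<open>r\<close>, contributes a phase; the phases combine to the
  frequency \<open>u $ 1 + u $ 2 + u $ 3\<close> in \<open>r\<close>, and integrating over
  \<open>r\<close> yields the fourth box factor.\<close>

lemma fourier_PL_box:
  "fourier PL_box u = box_factor (u $ 1) * box_factor (u $ 2) * box_factor (u $ 3) * box_factor (u $ 1 + u $ 2 + u $ 3)"
proof -
  let ?F = "\<lambda>r x. ind01 r * (\<Prod>j\<in>UNIV. ind01 (x $ j - r)) * exp (- \<i> * of_real (u \<bullet> x))"
  have e: "exp (- \<i> * of_real (u \<bullet> x)) = (\<Prod>j\<in>UNIV. exp (- \<i> * of_real (u $ j * x $ j)))" for x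
    unfolding exp_sum[OF finite, symmetric] sum_distrib_left[symmetric] by (simp add: inner_vec_def)
  have i: "integrable lborel (\<lambda>t. ind01 (t - r) * exp (- \<i> * of_real (s * t)))" for r s
    by (rule Bochner_Integration.integrable_bound[OF integrable_ind01_shift[of r]]) (auto simp: norm_mult)
  have "fourier PL_box u = (LINT x|lborel. LINT r|lborel. ?F r x)"
    unfolding fourier_def PL_box_def by (simp only: integral_mult_left_zero)
  also have "\<dots> = (LINT r|lborel. LINT x|lborel. ?F r x)"
  proof (rule lborel_pair.Fubini_integral)
    show "integrable (lborel \<Otimes>\<^sub>M lborel) (\<lambda>(r, x). ?F r x)"
    proof (rule integrable_pair_bound[OF integrable_ind01 integrable_box2])
      show "norm (case (r, x) of (r, x) \<Rightarrow> ?F r x) \<le> norm (ind01 r) * norm (box2 x)" for r x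
        using ind01_prod_le_box2[of r x] by (simp add: norm_mult)
    qed measurable
  qed
  also have "\<dots> = (LINT r|lborel. (\<Prod>j\<in>UNIV. box_factor (u $ j)) * (ind01 r * exp (- \<i> * of_real ((\<Sum>j\<in>UNIV. u $ j) * r))))"
  proof (intro Bochner_Integration.integral_cong refl)
    fix r :: real
    have "(LINT x|lborel. ?F r x) = (LINT x|lborel. ind01 r * (\<Prod>j\<in>UNIV. ind01 (x $ j - r) * exp (- \<i> * of_real (u $ j * x $ j))))"
      unfolding e by (simp only: prod.distrib mult_ac)
    also have "\<dots> = ind01 r * (\<Prod>j\<in>UNIV. exp (- \<i> * of_real (u $ j * r)) * box_factor (u $ j))"
      by (subst integral_mult_right_zero, subst integral_lborel_prod_vec[OF i]) (simp only: integral_ind01_shift_exp)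
    also have "\<dots> = ind01 r * ((\<Prod>j\<in>UNIV. exp (- \<i> * of_real (u $ j * r))) * (\<Prod>j\<in>UNIV. box_factor (u $ j)))"
      by (simp only: prod.distrib)
    also have "(\<Prod>j\<in>UNIV. exp (- \<i> * of_real (u $ j * r))) = exp (- \<i> * of_real ((\<Sum>j\<in>UNIV. u $ j) * r))"
      unfolding exp_sum[OF finite, symmetric] sum_distrib_left[symmetric] sum_distrib_right of_real_sum ..
    finally show "(LINT x|lborel. ?F r x) = (\<Prod>j\<in>UNIV. box_factor (u $ j)) * (ind01 r * exp (- \<i> * of_real ((\<Sum>j\<in>UNIV. u $ j) * r)))"
      by (simp only: mult_ac)
  qed
  also have "\<dots> = (\<Prod>j\<in>UNIV. box_factor (u $ j)) * box_factor (\<Sum>j\<in>UNIV. u $ j)"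
    by (simp only: integral_mult_right_zero integral_ind01_exp)
  finally show ?thesis by (simp add: prod_UNIV_3 sum_3)
qed

lemma vector_4:
  "(vector [a, b, c, d] :: 'a::zero^4) $ 1 = a" "(vector [a, b, c, d] :: 'a^4) $ 2 = b"
  "(vector [a, b, c, d] :: 'a^4) $ 3 = c" "(vector [a, b, c, d] :: 'a^4) $ 4 = d"
  by (simp_all add: vector_def)

lemma is_box_spline_PL_box: "is_box_spline Xi PL_box"
proof -
  have "(\<Prod>j\<in>UNIV. box_factor ((\<chi> i. of_int (column j Xi $ i)) \<bullet> u)) = fourier PL_box u" for u
    unfolding fourier_PL_box UNIV_4
    by (simp add: column_def Xi_def inner_vec_def sum_3 vector_4 vector_3)
  then show ?thesis
    by (simp add: is_box_spline_def integrable_PL_box)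
qed

text \<open>Reduces statements about an arbitrary box spline to the explicit \<open>PL_box\<close>:
  bound, support and autocorrelation are computed there and transferred.\<close>

lemma is_box_spline_unique:
  assumes "is_box_spline \<Xi> \<phi>" "is_box_spline \<Xi> \<psi>"
  shows "AE x in lborel. \<phi> x = \<psi> x"
proof -
  have "AE x in lborel. \<phi> x - \<psi> x = 0"
    using assms by (intro fourier_unique) (auto simp: is_box_spline_def fourier_diff)
  then show ?thesis by eventually_elim simp
qed

subsection \<open>The autocorrelation\<close>

text \<open>The double integral is the expectation of \<open>q\<close> at the difference of two
  independent uniform variables, whose density is \<open>hat\<close>.\<close>

lemma integral_ind01_correlation:
  fixes q :: "real \<Rightarrow> real"
  assumes [measurable]: "q \<in> borel_measurable borel" and qb: "\<And>t. \<bar>q t\<bar> \<le> 1"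
  shows "(LINT r|lborel. LINT s|lborel. ind01 r * ind01 s * of_real (q (s - r))) = of_real (LINT t|lborel. hat t * q t)"
proof -
  have i2: "integrable lborel (\<lambda>t. ind01 (t / 2 + 1 / 2))"
    using integrable_lborel_affine[OF integrable_ind01, of "1/2" "1/2"] by (simp add: add.commute)
  have "(LINT r|lborel. LINT s|lborel. ind01 r * ind01 s * of_real (q (s - r)))
     = (LINT r|lborel. LINT t|lborel. ind01 r * ind01 (t + r) * of_real (q t))"
  proof (rule Bochner_Integration.integral_cong[OF refl])
    fix r
    show "(LINT s|lborel. ind01 r * ind01 s * of_real (q (s - r))) = (LINT t|lborel. ind01 r * ind01 (t + r) * of_real (q t))"
      by (subst lborel_integral_real_affine[where c = 1 and t = r]) (simp_all add: add.commute)
  qed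
  also have "\<dots> = (LINT t|lborel. LINT r|lborel. ind01 r * ind01 (t + r) * of_real (q t))"
  proof (rule lborel_pair.Fubini_integral[symmetric])
    show "integrable (lborel \<Otimes>\<^sub>M lborel) (\<lambda>(r, t). ind01 r * ind01 (t + r) * of_real (q t))"
    proof (rule integrable_pair_bound[OF integrable_ind01 i2])
      show "norm (case (r, t) of (r, t) \<Rightarrow> ind01 r * ind01 (t + r) * of_real (q t)) \<le> norm (ind01 r) * norm (ind01 (t / 2 + 1 / 2))" for r t
        using qb[of t] by (auto simp: ind01_eq norm_mult)
    qed measurable
  qed
  also have "\<dots> = (LINT t|lborel. of_real (hat t * q t))"
  proof (intro Bochner_Integration.integral_cong refl)
    fix t
    show "(LINT r|lborel. ind01 r * ind01 (t + r) * of_real (q t)) = of_real (hat t * q t)"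
      using integral_ind01_mult[of 0 "-t"] by (simp add: add.commute hat_def)
  qed
  finally show ?thesis by (simp only: integral_complex_of_real)
qed

lemma hat_bounds: "0 \<le> hat t" "hat t \<le> 1" "\<bar>hat t\<bar> \<le> 1"
  by (auto simp: hat_def)

text \<open>With both factors written as integrals along the diagonal segment, with parameters
  \<open>r\<close> and \<open>s\<close>, the integral over space splits into one-dimensional
  autocorrelations \<open>hat\<close>. They depend on \<open>s - r\<close> alone, which reduces two
  parameters to one.\<close>

lemma autocorrelation_PL_box_integral:
  "autocorrelation PL_box k = of_real (LINT t|lborel. hat t * (\<Prod>j\<in>UNIV. hat (k $ j + t)))"
proof -
  have cnj_PL: "cnj (PL_box x) = PL_box x" for x
  proof -
    have c: "cnj (ind01 t) = ind01 t" for t by (simp add: ind01_def)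
    have "cnj (PL_box x) = (LINT r|lborel. cnj (ind01 r * (\<Prod>j\<in>UNIV. ind01 (x $ j - r))))"
      unfolding PL_box_def by (rule Bochner_Integration.integral_cnj[symmetric])
    then show ?thesis by (simp only: complex_cnj_mult cnj_prod c PL_box_def)
  qed
  let ?P = "\<lambda>x r. (\<Prod>j\<in>UNIV. ind01 ((x::real^3) $ j - r))"
  have "autocorrelation PL_box k = (LINT x|lborel. LINT r|lborel. ind01 r * ?P x r * PL_box (x - k))"
    unfolding autocorrelation_def cnj_PL by (simp add: PL_box_def)
  also have "\<dots> = (LINT r|lborel. LINT x|lborel. ind01 r * ?P x r * PL_box (x - k))"
  proof (rule lborel_pair.Fubini_integral)
    show "integrable (lborel \<Otimes>\<^sub>M lborel) (\<lambda>(r, x). ind01 r * ?P x r * PL_box (x - k))"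
    proof (rule integrable_pair_bound[OF integrable_ind01 integrable_box2])
      show "norm (case (r, x) of (r, x) \<Rightarrow> ind01 r * ?P x r * PL_box (x - k)) \<le> norm (ind01 r) * norm (box2 x)" for r x
        using mult_mono[OF ind01_prod_le_box2[of r x] norm_PL_box_le[of "x - k"]] by (simp add: norm_mult)
    qed measurable
  qed
  also have "\<dots> = (LINT r|lborel. LINT s|lborel. ind01 r * ind01 s * of_real (\<Prod>j\<in>UNIV. hat (k $ j + (s - r))))"
  proof (intro Bochner_Integration.integral_cong refl)
    fix r
    have ir: "integrable lborel (\<lambda>x::real^3. ?P x r)"
      by (intro integrable_lborel_prod_vec integrable_ind01_shift)
    have ij: "integrable lborel (\<lambda>t. ind01 (t - r) * ind01 (t - (c + s)))" for c s
      by (rule Bochner_Integration.integrable_bound[OF integrable_ind01_shift[of r]]) (auto simp: norm_mult ind01_eq)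
    have "(LINT x|lborel. ind01 r * ?P x r * PL_box (x - k))
       = (LINT x|lborel. LINT s|lborel. ind01 r * ?P x r * (ind01 s * ?P (x - k) s))"
      by (simp add: PL_box_def)
    also have "\<dots> = (LINT s|lborel. LINT x|lborel. ind01 r * ?P x r * (ind01 s * ?P (x - k) s))"
    proof (rule lborel_pair.Fubini_integral)
      show "integrable (lborel \<Otimes>\<^sub>M lborel) (\<lambda>(s, x). ind01 r * ?P x r * (ind01 s * ?P (x - k) s))"
      proof (rule integrable_pair_bound[OF integrable_ind01 ir])
        show "norm (case (s, x) of (s, x) \<Rightarrow> ind01 r * ?P x r * (ind01 s * ?P (x - k) s)) \<le> norm (ind01 s) * norm (?P x r)" for s x
          using mult_mono[OF mult_mono[OF norm_ind01_le[of r] norm_prod_ind01_le[of "\<lambda>j. (x - k) $ j - s"]] order_refl[of "norm (ind01 s) * norm (?P x r)"]]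
          by (simp add: norm_mult mult_ac)
      qed measurable
    qed
    also have "\<dots> = (LINT s|lborel. ind01 r * ind01 s * of_real (\<Prod>j\<in>UNIV. hat (k $ j + (s - r))))"
    proof (intro Bochner_Integration.integral_cong refl)
      fix s
      have "(LINT x|lborel. ind01 r * ?P x r * (ind01 s * ?P (x - k) s)) =
          (LINT x|lborel. (ind01 r * ind01 s) * (\<Prod>j\<in>UNIV. ind01 (x $ j - r) * ind01 (x $ j - (k $ j + s))))"
        by (simp only: prod.distrib mult_ac vector_minus_component diff_diff_eq)
      also have "\<dots> = ind01 r * ind01 s * (\<Prod>j\<in>UNIV. of_real (hat (k $ j + s - r)))"
        by (subst integral_mult_right_zero, subst integral_lborel_prod_vec[OF ij]) (simp only: integral_ind01_mult)
      finally show "(LINT x|lborel. ind01 r * ?P x r * (ind01 s * ?P (x - k) s)) = ind01 r * ind01 s * of_real (\<Prod>j\<in>UNIV. hat (k $ j + (s - r)))"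
        by (simp add: add_diff_eq)
    qed
    finally show "(LINT x|lborel. ind01 r * ?P x r * PL_box (x - k)) =
       (LINT s|lborel. ind01 r * ind01 s * of_real (\<Prod>j\<in>UNIV. hat (k $ j + (s - r))))" .
  qed
  also have "\<dots> = of_real (LINT t|lborel. hat t * (\<Prod>j\<in>UNIV. hat (k $ j + t)))"
  proof (rule integral_ind01_correlation)
    show "\<bar>\<Prod>j\<in>UNIV. hat (k $ j + t)\<bar> \<le> 1" for t
      unfolding abs_prod by (intro prod_le_1) (auto simp: hat_bounds)
  qed measurable
  finally show ?thesis .
qed

lemma autocorrelation_cong_AE:
  assumes "AE x in lborel. \<phi> x = \<psi> x" and "\<phi> \<in> borel_measurable borel" "\<psi> \<in> borel_measurable borel"
  shows "autocorrelation \<phi> u = autocorrelation \<psi> u"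
proof -
  have [measurable]: "\<phi> \<in> borel_measurable borel" "\<psi> \<in> borel_measurable borel"
    using assms by auto
  have "AE t in lborel. \<phi> (- u + 1 *\<^sub>R t) = \<psi> (- u + 1 *\<^sub>R t)"
    using AE_lborel_affine[OF assms(1), of 1 "-u"] by simp
  then have "AE t in lborel. \<phi> (t - u) = \<psi> (t - u)" by simp
  then have "AE t in lborel. \<phi> t * cnj (\<phi> (t - u)) = \<psi> t * cnj (\<psi> (t - u))"
    using assms(1) by eventually_elim simp
  then show ?thesis
    unfolding autocorrelation_def by (intro integral_cong_AE) measurable
qed

text \<open>The polynomial with which \<open>hat (k + t)\<close> agrees for
  \<open>0 < t < 1\<close>; only the translates by 0 and -1 meet that interval.\<close>

definition hatp :: "int \<Rightarrow> real \<Rightarrow> real" where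
  "hatp k t = (if k = 0 then 1 - t else if k = -1 then t else 0)"

lemma hat_hatp: "0 < t \<Longrightarrow> t < 1 \<Longrightarrow> hat (of_int k + t) = hatp k t"
proof -
  assume t: "0 < t" "t < 1"
  consider "k = 0" | "k = -1" | "1 \<le> k" | "k \<le> -2" by linarith
  then show ?thesis
  proof cases
    case 3
    then have "1 \<le> real_of_int k" by linarith
    then show ?thesis using t 3 by (auto simp: hat_def hatp_def)
  next
    case 4
    then have "real_of_int k \<le> -2" by linarith
    then show ?thesis using t 4 by (auto simp: hat_def hatp_def)
  qed (use t in \<open>auto simp: hat_def hatp_def\<close>)
qed

text \<open>The factor \<open>hat t\<close> confines \<open>t\<close> to the interval from -1 to 1.
  On the negative half, reflection of \<open>t\<close> and evenness of \<open>hat\<close> exchange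
  \<open>k\<close> for \<open>-k\<close>, so that both halves become polynomial integrals over the
  unit interval.\<close>

lemma integral_hat_split:
  fixes k :: "int^3"
  shows "(LINT t|lborel. hat t * (\<Prod>j\<in>UNIV. hat (of_int (k $ j) + t))) =
    (LINT t|lborel. indicat_real {0..1} t *\<^sub>R ((1 - t) * (\<Prod>j\<in>UNIV. hatp (k $ j) t))) +
    (LINT t|lborel. indicat_real {0..1} t *\<^sub>R ((1 - t) * (\<Prod>j\<in>UNIV. hatp (- k $ j) t)))"
proof -
  let ?G = "\<lambda>k t. indicat_real {0..1} t *\<^sub>R ((1 - t) * (\<Prod>j\<in>UNIV. hatp ((k::int^3) $ j) t))"
  have hc: "continuous_on S (hatp i)" for S i
    unfolding hatp_def by (cases "i = 0"; cases "i = -1") (auto intro!: continuous_intros)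
  have Gi: "integrable lborel (?G k)" for k
    by (rule borel_integrable_atLeastAtMost'[unfolded set_integrable_def]) (intro continuous_intros hc)
  have Gi': "integrable lborel (\<lambda>t. ?G k (- t))" for k
    using integrable_lborel_affine[OF Gi[of k], of "-1" 0] by simp
  have m [measurable]: "?G k \<in> borel_measurable borel" for k
    using borel_measurable_integrable[OF Gi] by simp
  have sym: "hat (of_int i - t) = hat (of_int (- i) + t)" for i t
    by (simp add: hat_def abs_if)
  have "AE t in lborel. hat t * (\<Prod>j\<in>UNIV. hat (of_int (k $ j) + t)) = ?G k t + ?G (- k) (- t)"
    \<comment> \<open>At 0 both halves would be counted; the kinks -1, 0, 1 form a null set.\<close>
    using AE_lborel_singleton[of 0] AE_lborel_singleton[of 1] AE_lborel_singleton[of "-1"]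
  proof eventually_elim
    case (elim t)
    consider "t < -1" | "-1 < t" "t < 0" | "0 < t" "t < 1" | "1 < t" using elim by linarith
    then show ?case
    proof cases
      case 2
      have "hat (of_int (k $ j) + t) = hatp ((- k) $ j) (- t)" for j
        using hat_hatp[of "-t" "- k $ j"] sym[of "- (k $ j)" "t"] 2 sym[of "k $ j" "- t"] by (simp add: hat_def abs_if)
      then show ?thesis using 2 by (simp add: hat_def)
    next
      case 3
      then show ?thesis by (simp add: hat_def hat_hatp[unfolded hat_def])
    qed (auto simp: hat_def)
  qed
  then have "(LINT t|lborel. hat t * (\<Prod>j\<in>UNIV. hat (of_int (k $ j) + t))) = (LINT t|lborel. ?G k t + ?G (- k) (- t))"
    by (intro integral_cong_AE) measurable
  also have "\<dots> = (LINT t|lborel. ?G k t) + (LINT t|lborel. ?G (- k) (- t))"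
    by (intro Bochner_Integration.integral_add Gi Gi')
  also have "(LINT t|lborel. ?G (- k) (- t)) = (LINT t|lborel. ?G (- k) t)"
    by (subst lborel_integral_real_affine[where c = "-1" and t = 0 and f = "?G (- k)"]) simp_all
  finally show ?thesis by simp
qed

text \<open>Beta integrals \<open>m! (4 - m)! / 5!\<close>, where \<open>m\<close> counts the
  factors \<open>t\<close>. The different orders of the factors are listed because they arise from a
  product over the three coordinates.\<close>

lemma integral_beta_values:
  "(LINT t|lborel. indicat_real {0..1} t *\<^sub>R ((1 - t::real) * ((1 - t) * (1 - t) * (1 - t)))) = 1 / 5"
  "(LINT t|lborel. indicat_real {0..1} t *\<^sub>R ((1 - t::real) * (t * (1 - t) * (1 - t)))) = 1 / 20"
  "(LINT t|lborel. indicat_real {0..1} t *\<^sub>R ((1 - t::real) * ((1 - t) * t * (1 - t)))) = 1 / 20"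
  "(LINT t|lborel. indicat_real {0..1} t *\<^sub>R ((1 - t::real) * ((1 - t) * (1 - t) * t))) = 1 / 20"
  "(LINT t|lborel. indicat_real {0..1} t *\<^sub>R ((1 - t::real) * (t * t * (1 - t)))) = 1 / 30"
  "(LINT t|lborel. indicat_real {0..1} t *\<^sub>R ((1 - t::real) * (t * (1 - t) * t))) = 1 / 30"
  "(LINT t|lborel. indicat_real {0..1} t *\<^sub>R ((1 - t::real) * ((1 - t) * t * t))) = 1 / 30"
  "(LINT t|lborel. indicat_real {0..1} t *\<^sub>R ((1 - t::real) * (t * t * t))) = 1 / 20"
proof -
  have ftc: "(LINT t|lborel. indicat_real {0..1} t *\<^sub>R f t) = F 1 - F 0"
    if "\<And>t. (F has_real_derivative f t) (at t)" "continuous_on UNIV f" for f F :: "real \<Rightarrow> real"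
    using that by (intro integral_FTC_atLeastAtMost)
      (auto intro: has_vector_derivative_at_within continuous_on_subset simp: has_real_derivative_iff_has_vector_derivative)
  note d = derivative_eq_intros
  show "(LINT t|lborel. indicat_real {0..1} t *\<^sub>R ((1 - t::real) * ((1 - t) * (1 - t) * (1 - t)))) = 1 / 5"
    by (subst ftc[of "\<lambda>t. t - 2 * t^2 + 2 * t^3 - t^4 + t^5 / 5"]) (auto intro!: d continuous_intros simp: power_numeral_reduce algebra_simps)
  have a: "(LINT t|lborel. indicat_real {0..1} t *\<^sub>R ((1 - t::real)^3 * t)) = 1 / 20"
    by (subst ftc[of "\<lambda>t. t^2 / 2 - t^3 + 3 * t^4 / 4 - t^5 / 5"]) (auto intro!: d continuous_intros simp: power_numeral_reduce algebra_simps)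
  have b: "(LINT t|lborel. indicat_real {0..1} t *\<^sub>R ((1 - t::real)^2 * t^2)) = 1 / 30"
    by (subst ftc[of "\<lambda>t. t^3 / 3 - t^4 / 2 + t^5 / 5"]) (auto intro!: d continuous_intros simp: power_numeral_reduce algebra_simps)
  have c: "(LINT t|lborel. indicat_real {0..1} t *\<^sub>R ((1 - t::real) * t^3)) = 1 / 20"
    by (subst ftc[of "\<lambda>t. t^4 / 4 - t^5 / 5"]) (auto intro!: d continuous_intros simp: power_numeral_reduce algebra_simps)
  show "(LINT t|lborel. indicat_real {0..1} t *\<^sub>R ((1 - t::real) * (t * (1 - t) * (1 - t)))) = 1 / 20"
    "(LINT t|lborel. indicat_real {0..1} t *\<^sub>R ((1 - t::real) * ((1 - t) * t * (1 - t)))) = 1 / 20"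
    "(LINT t|lborel. indicat_real {0..1} t *\<^sub>R ((1 - t::real) * ((1 - t) * (1 - t) * t))) = 1 / 20"
    by (simp_all only: a[symmetric] power3_eq_cube mult_ac)
  show "(LINT t|lborel. indicat_real {0..1} t *\<^sub>R ((1 - t::real) * (t * t * (1 - t)))) = 1 / 30"
    "(LINT t|lborel. indicat_real {0..1} t *\<^sub>R ((1 - t::real) * (t * (1 - t) * t))) = 1 / 30"
    "(LINT t|lborel. indicat_real {0..1} t *\<^sub>R ((1 - t::real) * ((1 - t) * t * t))) = 1 / 30"
    by (simp_all only: b[symmetric] power2_eq_square mult_ac)
  show "(LINT t|lborel. indicat_real {0..1} t *\<^sub>R ((1 - t::real) * (t * t * t))) = 1 / 20"
    by (simp only: c[symmetric] power3_eq_cube mult_ac)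
qed

text \<open>The coefficients of \<Phi>. At the origin both halves of
  \<open>integral_hat_split\<close> contribute 1/5, giving 24/60; at the other listed exponents only
  one half does, giving 3/60 or 2/60.\<close>

definition phi_acf :: "int \<Rightarrow> int \<Rightarrow> int \<Rightarrow> real" where
  "phi_acf i j k = (if (i, j, k) = (0, 0, 0) then 24
     else if (i, j, k) \<in> {(1,1,1), (1,0,0), (0,1,0), (0,0,1), (-1,-1,-1), (-1,0,0), (0,-1,0), (0,0,-1)} then 3
     else if (i, j, k) \<in> {(1,1,0), (1,0,1), (0,1,1), (-1,-1,0), (-1,0,-1), (0,-1,-1)} then 2 else 0) / 60"

lemma autocorrelation_box_spline:
  assumes "is_box_spline Xi \<phi>"
  shows "autocorrelation \<phi> (int_point k) = of_real (phi_acf (k $ 1) (k $ 2) (k $ 3))"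
proof -
  define I where "I a b c = (LINT t|lborel. indicat_real {0..1} t *\<^sub>R ((1 - t) * (hatp a t * hatp b t * hatp c t)))" for a b c
  have I0: "I a b c = 0" if "\<not> (a \<in> {0, -1} \<and> b \<in> {0, -1} \<and> c \<in> {0, -1})" for a b c
  proof -
    have h: "hatp a t * hatp b t * hatp c t = 0" for t
      using that by (auto simp: hatp_def)
    show ?thesis unfolding I_def h by simp
  qed
  have Iv: "I 0 0 0 = 1/5" "I (-1) 0 0 = 1/20" "I 0 (-1) 0 = 1/20" "I 0 0 (-1) = 1/20"
    "I (-1) (-1) 0 = 1/30" "I (-1) 0 (-1) = 1/30" "I 0 (-1) (-1) = 1/30" "I (-1) (-1) (-1) = 1/20"
    unfolding I_def hatp_def using integral_beta_values by simp_all
  have "autocorrelation \<phi> (int_point k) = autocorrelation PL_box (int_point k)"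
    using assms borel_measurable_integrable[of lborel \<phi>]
    by (intro autocorrelation_cong_AE is_box_spline_unique[OF assms is_box_spline_PL_box])
       (auto simp: is_box_spline_def)
  also have "\<dots> = of_real (I (k $ 1) (k $ 2) (k $ 3) + I (- k $ 1) (- k $ 2) (- k $ 3))"
    using integral_hat_split[of k]
    unfolding autocorrelation_PL_box_integral int_point_def I_def by (simp only: prod_UNIV_3 vec_lambda_beta)
  also have "I i j l + I (- i) (- j) (- l) = phi_acf i j l" for i j l
  \<comment> \<open>\<open>I\<close> vanishes unless all its arguments are 0 or -1, so only
    exponents in these two cubes contribute; the cubes meet at the origin.\<close>
  proof (cases "i \<in> {0, -1} \<and> j \<in> {0, -1} \<and> l \<in> {0, -1} \<or> i \<in> {0, 1} \<and> j \<in> {0, 1} \<and> l \<in> {0, 1}")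
    case True
    then have "(i, j, l) \<in> {0, -1} \<times> {0, -1} \<times> {0, -1} \<union> {0, 1} \<times> {0, 1} \<times> {0, 1}"
      by blast
    also have "\<dots> \<subseteq> {(0, 0, 0)} \<union> {(1,1,1), (1,0,0), (0,1,0), (0,0,1), (1,1,0), (1,0,1), (0,1,1)} \<union>
        {(-1,-1,-1), (-1,0,0), (0,-1,0), (0,0,-1), (-1,-1,0), (-1,0,-1), (0,-1,-1)}"
      by (simp add: Sigma_Un_distrib1 insert_Times_insert)
    finally consider "(i, j, l) \<in> {(0, 0, 0)}" | "(i, j, l) \<in> {(1,1,1), (1,0,0), (0,1,0), (0,0,1), (1,1,0), (1,0,1), (0,1,1)}"
      | "(i, j, l) \<in> {(-1,-1,-1), (-1,0,0), (0,-1,0), (0,0,-1), (-1,-1,0), (-1,0,-1), (0,-1,-1)}"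
      by (elim UnE) (erule that)+
    then show ?thesis
    proof cases
      case 1
      then show ?thesis by (elim insertE emptyE) (simp_all add: Iv I0 phi_acf_def)
    next
      case 2
      then show ?thesis by (elim insertE emptyE) (simp_all add: Iv I0 phi_acf_def)
    next
      case 3
      then show ?thesis by (elim insertE emptyE) (simp_all add: Iv I0 phi_acf_def)
    qed
  next
    case False
    have e: "- a \<in> {0, -1} \<longleftrightarrow> a \<in> {0, 1}" for a :: int by auto
    have "\<not> (- i \<in> {0, -1} \<and> - j \<in> {0, -1} \<and> - l \<in> {0, -1})"
      unfolding e using False by blast
    then have I2: "I (- i) (- j) (- l) = 0" by (rule I0)
    have I1: "I i j l = 0" by (rule I0) (use False in blast)
    have "(i, j, l) \<notin> {0, -1} \<times> {0, -1} \<times> {0, -1} \<union> {0, 1} \<times> {0, 1} \<times> {0, 1}"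
      using False by blast
    moreover have "{(0,0,0), (1,1,1), (1,0,0), (0,1,0), (0,0,1), (-1,-1,-1), (-1,0,0), (0,-1,0), (0,0,-1),
        (1,1,0), (1,0,1), (0,1,1), (-1,-1,0), (-1,0,-1), (0,-1,-1)}
      \<subseteq> {0, -1} \<times> {0, -1} \<times> {0, -1} \<union> {0, 1} \<times> {0, 1} \<times> {0, 1::int}"
      by simp
    ultimately have "(i, j, l) \<notin> {(0,0,0), (1,1,1), (1,0,0), (0,1,0), (0,0,1), (-1,-1,-1), (-1,0,0), (0,-1,0), (0,0,-1),
        (1,1,0), (1,0,1), (0,1,1), (-1,-1,0), (-1,0,-1), (0,-1,-1)}"
      by (rule contra_subsetD[rotated])
    then have "phi_acf i j l = 0"
      unfolding phi_acf_def by (simp only: insert_iff empty_iff de_Morgan_disj if_False simp_thms divide_eq_0_iff)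
    then show ?thesis using I1 I2 by simp
  qed
  finally show ?thesis .
qed

section \<open>Laurent polynomials and series on the torus\<close>

lemma torus_nonzero: "\<zeta> \<in> torus \<Longrightarrow> \<zeta> $ j \<noteq> 0"
  by (auto simp: torus_def dest!: spec[of _ j])

lemma zpow_0 [simp]: "zpow \<zeta> 0 = 1"
  by (simp add: zpow_def)

lemma zpow_add: "\<zeta> \<in> torus \<Longrightarrow> zpow \<zeta> (k + l) = zpow \<zeta> k * zpow \<zeta> l"
  by (simp add: zpow_def power_int_add torus_nonzero prod.distrib)

lemma norm_zpow: "\<zeta> \<in> torus \<Longrightarrow> norm (zpow \<zeta> k) = 1"
  by (simp add: zpow_def prod_norm[symmetric] norm_power_int torus_def)

lemma cnj_zpow: "\<zeta> \<in> torus \<Longrightarrow> cnj (zpow \<zeta> k) = zpow \<zeta> (- k)"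
  using zpow_add[of \<zeta> k "-k"] complex_norm_square[of "zpow \<zeta> k"] norm_zpow[of \<zeta> k]
  by (metis add.right_inverse mult_cancel_left norm_zero of_real_1 power_one zero_neq_one zpow_0)

lemma torus_point_in_torus [simp]: "torus_point u \<in> torus"
  by (simp add: torus_def torus_point_def)

lemma zpow_torus_point: "zpow (torus_point u) k = exp (- \<i> * of_real (u \<bullet> int_point k))"
proof -
  have "zpow (torus_point u) k = (\<Prod>j\<in>UNIV. exp (of_int (k $ j) * (- \<i> * of_real (u $ j))))"
    unfolding zpow_def torus_point_def by (simp add: exp_power_int)
  also have "\<dots> = exp (\<Sum>j\<in>UNIV. of_int (k $ j) * (- \<i> * of_real (u $ j)))"
    by (rule exp_sum[OF finite, symmetric])
  finally show ?thesis
    by (simp add: inner_vec_def int_point_def sum_distrib_left mult_ac sum_negf)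
qed

lemma laurent_poly_eq_sum:
  assumes "finite K" "Poly_Mapping.keys P \<subseteq> K"
  shows "laurent_poly P \<zeta> = (\<Sum>k\<in>K. Poly_Mapping.lookup P k * zpow \<zeta> k)"
proof -
  have "laurent_poly P \<zeta> = (\<Sum>\<^sub>\<infinity>k\<in>K. Poly_Mapping.lookup P k * zpow \<zeta> k)"
    unfolding laurent_poly_def laurent_series_def using assms(2)
    by (intro infsum_cong_neutral) (auto simp: in_keys_iff)
  then show ?thesis using assms(1) by simp
qed

lemma poly_mapping_sum_single: "(\<Sum>k\<in>Poly_Mapping.keys P. Poly_Mapping.single k (Poly_Mapping.lookup P k)) = P"
  by (rule poly_mapping_eqI) (simp add: lookup_sum lookup_single when_def in_keys_iff if_distrib sum.delta' cong: if_cong)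

lemma laurent_poly_0 [simp]: "laurent_poly 0 \<zeta> = 0"
  using laurent_poly_eq_sum[of "{}" 0 \<zeta>] by simp

lemma laurent_poly_single [simp]: "laurent_poly (Poly_Mapping.single k c) \<zeta> = c * zpow \<zeta> k"
  using laurent_poly_eq_sum[of "{k}" "Poly_Mapping.single k c" \<zeta>] by (auto split: if_splits)

lemma laurent_poly_add [simp]: "laurent_poly (P + Q) \<zeta> = laurent_poly P \<zeta> + laurent_poly Q \<zeta>"
proof -
  let ?K = "Poly_Mapping.keys P \<union> Poly_Mapping.keys Q"
  have "laurent_poly P \<zeta> = (\<Sum>k\<in>?K. Poly_Mapping.lookup P k * zpow \<zeta> k)"
    "laurent_poly Q \<zeta> = (\<Sum>k\<in>?K. Poly_Mapping.lookup Q k * zpow \<zeta> k)"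
    "laurent_poly (P + Q) \<zeta> = (\<Sum>k\<in>?K. Poly_Mapping.lookup (P + Q) k * zpow \<zeta> k)"
    by (intro laurent_poly_eq_sum; use keys_add[of P Q] in simp)+
  then show ?thesis by (simp add: lookup_add distrib_right sum.distrib)
qed

lemma laurent_poly_uminus [simp]: "laurent_poly (- P) \<zeta> = - laurent_poly P \<zeta>"
  using laurent_poly_add[of P "- P" \<zeta>] by (simp add: add_eq_0_iff)

lemma laurent_poly_diff [simp]: "laurent_poly (P - Q) \<zeta> = laurent_poly P \<zeta> - laurent_poly Q \<zeta>"
  using laurent_poly_add[of P "- Q" \<zeta>] by simp

lemma laurent_poly_sum: "laurent_poly (\<Sum>i\<in>A. P i) \<zeta> = (\<Sum>i\<in>A. laurent_poly (P i) \<zeta>)"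
  by (induction A rule: infinite_finite_induct) auto

text \<open>Points of the torus have nonzero coordinates, so \<open>zpow\<close> turns sums of
  exponents into products; at a zero coordinate, opposite exponents would break this.\<close>

lemma laurent_poly_mult:
  assumes "\<zeta> \<in> torus"
  shows "laurent_poly (P * Q) \<zeta> = laurent_poly P \<zeta> * laurent_poly Q \<zeta>"
proof -
  have "P * Q = (\<Sum>k\<in>Poly_Mapping.keys P. Poly_Mapping.single k (Poly_Mapping.lookup P k)) *
     (\<Sum>l\<in>Poly_Mapping.keys Q. Poly_Mapping.single l (Poly_Mapping.lookup Q l))"
    by (simp only: poly_mapping_sum_single)
  also have "\<dots> = (\<Sum>k\<in>Poly_Mapping.keys P. \<Sum>l\<in>Poly_Mapping.keys Q.
      Poly_Mapping.single (k + l) (Poly_Mapping.lookup P k * Poly_Mapping.lookup Q l))"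
    by (simp add: sum_product mult_single)
  finally have "laurent_poly (P * Q) \<zeta> = (\<Sum>k\<in>Poly_Mapping.keys P. \<Sum>l\<in>Poly_Mapping.keys Q.
      (Poly_Mapping.lookup P k * zpow \<zeta> k) * (Poly_Mapping.lookup Q l * zpow \<zeta> l))"
    by (simp add: laurent_poly_sum zpow_add[OF assms] mult_ac)
  then show ?thesis
    by (simp add: sum_product laurent_poly_eq_sum[OF finite_keys order_refl])
qed

lemma laurent_poly_1 [simp]: "laurent_poly 1 \<zeta> = 1"
  using laurent_poly_single[of 0 1 \<zeta>] by simp

lemma laurent_poly_numeral [simp]: "laurent_poly (numeral n) \<zeta> = numeral n"
  using laurent_poly_single[of 0 "numeral n" \<zeta>] by (simp del: laurent_poly_single)

lemma laurent_poly_power: "\<zeta> \<in> torus \<Longrightarrow> laurent_poly (P ^ n) \<zeta> = laurent_poly P \<zeta> ^ n"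
  by (induction n) (auto simp: laurent_poly_mult)

lemma lookup_mult_single:
  fixes A :: "(int^'d::finite) \<Rightarrow>\<^sub>0 complex"
  shows "Poly_Mapping.lookup (A * Poly_Mapping.single n c) m = Poly_Mapping.lookup A (m - n) * c"
proof -
  have "A * Poly_Mapping.single n c = (\<Sum>k\<in>Poly_Mapping.keys A. Poly_Mapping.single (k + n) (Poly_Mapping.lookup A k * c))"
    by (subst poly_mapping_sum_single[of A, symmetric]) (simp add: sum_distrib_right mult_single)
  also have "Poly_Mapping.lookup \<dots> m = (\<Sum>k\<in>Poly_Mapping.keys A. if k + n = m then Poly_Mapping.lookup A k * c else 0)"
    by (simp add: lookup_sum lookup_single when_def)
  also have "\<dots> = (\<Sum>k\<in>Poly_Mapping.keys A. if k = m - n then Poly_Mapping.lookup A k * c else 0)"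
    by (simp only: eq_diff_eq)
  also have "\<dots> = (if m - n \<in> Poly_Mapping.keys A then Poly_Mapping.lookup A (m - n) * c else 0)"
    by (rule sum.delta[OF finite_keys])
  also have "\<dots> = Poly_Mapping.lookup A (m - n) * c"
    by (auto simp: in_keys_iff)
  finally show ?thesis .
qed

text \<open>Conjugation on the torus as an operation on coefficients. Squared moduli and inner
  products thereby stay Laurent polynomials, and their means can be read off as
  coefficients.\<close>

definition laurent_star :: "((int^'d::finite) \<Rightarrow>\<^sub>0 complex) \<Rightarrow> ((int^'d) \<Rightarrow>\<^sub>0 complex)" where
  "laurent_star P = (\<Sum>k\<in>Poly_Mapping.keys P. Poly_Mapping.single (- k) (cnj (Poly_Mapping.lookup P k)))"

lemma laurent_poly_star: "\<zeta> \<in> torus \<Longrightarrow> laurent_poly (laurent_star P) \<zeta> = cnj (laurent_poly P \<zeta>)"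
  unfolding laurent_poly_eq_sum[OF finite_keys order_refl, of P]
  by (simp add: laurent_star_def laurent_poly_sum cnj_zpow)

text \<open>The sesquilinear form whose Toeplitz matrix is given by \<open>A\<close>. For
  \<open>A = Phi_poly\<close> it becomes the L2 inner product of two combinations of integer
  translates of the spline, the matrix entries being inner products of translates.\<close>

lemma lookup_mult_star:
  fixes A :: "(int^'d::finite) \<Rightarrow>\<^sub>0 complex"
  shows "Poly_Mapping.lookup (A * (P * laurent_star Q)) 0 = (\<Sum>k\<in>Poly_Mapping.keys P. \<Sum>l\<in>Poly_Mapping.keys Q.
     Poly_Mapping.lookup P k * cnj (Poly_Mapping.lookup Q l) * Poly_Mapping.lookup A (l - k))"
proof -
  have "P * laurent_star Q = (\<Sum>k\<in>Poly_Mapping.keys P. \<Sum>l\<in>Poly_Mapping.keys Q.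
     Poly_Mapping.single (k - l) (Poly_Mapping.lookup P k * cnj (Poly_Mapping.lookup Q l)))"
    by (subst poly_mapping_sum_single[of P, symmetric]) (simp add: sum_product mult_single laurent_star_def)
  then have "A * (P * laurent_star Q) = (\<Sum>k\<in>Poly_Mapping.keys P. \<Sum>l\<in>Poly_Mapping.keys Q.
     A * Poly_Mapping.single (k - l) (Poly_Mapping.lookup P k * cnj (Poly_Mapping.lookup Q l)))"
    by (simp add: sum_distrib_left)
  then show ?thesis
    by (simp add: lookup_sum lookup_mult_single mult_ac)
qed

definition laurent_sqnorm :: "((int^'d::finite) \<Rightarrow>\<^sub>0 complex) \<Rightarrow> real" where
  "laurent_sqnorm P = (\<Sum>k\<in>Poly_Mapping.keys P. (cmod (Poly_Mapping.lookup P k))\<^sup>2)"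

lemma lookup_mult_star_self: "Poly_Mapping.lookup (P * laurent_star P) 0 = of_real (laurent_sqnorm P)"
proof -
  have "Poly_Mapping.lookup (P * laurent_star P) 0 = (\<Sum>k\<in>Poly_Mapping.keys P. Poly_Mapping.lookup P k * cnj (Poly_Mapping.lookup P k))"
    using lookup_mult_star[of 1 P P] by (simp add: lookup_one when_def if_distrib cong: if_cong)
  also have "\<dots> = of_real (laurent_sqnorm P)"
    by (simp add: laurent_sqnorm_def complex_norm_square del: of_real_power)
  finally show ?thesis .
qed

subsection \<open>The mean over the torus\<close>

lemma integral_exp_period:
  "(LINT t|lborel. indicat_real {0..2 * pi} t *\<^sub>R exp (- \<i> * of_real (t * of_int n))) = (if n = 0 then 2 * pi else 0)"
proof (cases "n = 0")
  case False
  let ?F = "\<lambda>t. exp (- \<i> * (of_real t * of_int n)) / (- \<i> * of_int n)"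
  have "(LINT t|lborel. indicat_real {0..2 * pi} t *\<^sub>R exp (- \<i> * of_real (t * of_int n))) = ?F (2 * pi) - ?F 0"
  proof (rule integral_FTC_atLeastAtMost)
    fix t :: real
    have "((\<lambda>z. exp (- \<i> * (z * of_int n)) / (- \<i> * of_int n)) has_field_derivative exp (- \<i> * (of_real t * of_int n))) (at (of_real t))"
      using False by (auto intro!: derivative_eq_intros simp: field_simps)
    from has_vector_derivative_real_field[OF this]
    show "(?F has_vector_derivative exp (- \<i> * of_real (t * of_int n))) (at t within {0..2 * pi})" by simp
  qed (auto intro!: continuous_intros)
  also have "exp (- \<i> * (of_real (2 * pi) * of_int n)) = 1"
    using exp_eq_1[of "- \<i> * (of_real (2 * pi) * of_int n)"] by (auto intro!: exI[of _ "-n"])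
  finally show ?thesis using False by simp
qed (simp add: scaleR_conv_of_real)

lemma indicator_cbox_vec: "indicat_real (cbox 0 (\<chi> j. c)) (u :: real^'d::finite) = (\<Prod>j\<in>UNIV. indicat_real {0..c} (u $ j))"
proof (cases "\<forall>j. u $ j \<in> {0..c}")
  case False
  then obtain j where "u $ j \<notin> {0..c}" by auto
  then have "(\<Prod>j\<in>UNIV. indicat_real {0..c} (u $ j)) = 0"
    by (intro prod_zero finite bexI[of _ j]) (auto simp: indicator_def)
  then show ?thesis using False by (auto simp: mem_box_cart)
qed (auto simp: mem_box_cart)

definition torus_mean :: "(complex^'d::finite \<Rightarrow> complex) \<Rightarrow> complex" where
  "torus_mean F = (LINT u|lborel. indicat_real (cbox 0 (\<chi> j. 2 * pi)) u *\<^sub>R F (torus_point u)) / of_real ((2 * pi) ^ CARD('d))"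

text \<open>The integrand is a product over coordinates, which reduces both claims to exponentials
  on a single period.\<close>

lemma
  fixes k :: "int^'d::finite"
  shows integrable_zpow: "integrable lborel (\<lambda>u. indicat_real (cbox 0 (\<chi> j. 2 * pi)) u *\<^sub>R zpow (torus_point u) k)"
    and torus_mean_zpow: "torus_mean (\<lambda>\<zeta>. zpow \<zeta> k) = (if k = 0 then 1 else 0)"
proof -
  have eq: "indicat_real (cbox 0 (\<chi> j. 2 * pi)) u *\<^sub>R zpow (torus_point u) k =
     (\<Prod>j\<in>UNIV. indicat_real {0..2 * pi} (u $ j) *\<^sub>R exp (- \<i> * of_real (u $ j * of_int (k $ j))))" for u :: "real^'d"
  proof -
    have "zpow (torus_point u) k = (\<Prod>j\<in>UNIV. exp (- \<i> * of_real (u $ j * of_int (k $ j))))"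
      unfolding zpow_torus_point inner_vec_def of_real_sum sum_distrib_left exp_sum[OF finite]
      by (simp add: int_point_def)
    then show ?thesis
      by (simp only: indicator_cbox_vec scaleR_conv_of_real of_real_prod prod.distrib)
  qed
  have i: "integrable lborel (\<lambda>t. indicat_real {0..2 * pi} t *\<^sub>R exp (- \<i> * of_real (t * of_int n)))" for n
    by (rule borel_integrable_atLeastAtMost'[unfolded set_integrable_def]) (intro continuous_intros)
  show "integrable lborel (\<lambda>u. indicat_real (cbox 0 (\<chi> j. 2 * pi)) u *\<^sub>R zpow (torus_point u) k)"
    unfolding eq by (rule integrable_lborel_prod_vec[OF i])
  have "(LINT u|lborel. indicat_real (cbox 0 (\<chi> j. 2 * pi)) u *\<^sub>R zpow (torus_point u) k) =
     (\<Prod>j\<in>UNIV. if k $ j = 0 then complex_of_real (2 * pi) else 0)"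
    unfolding eq integral_lborel_prod_vec[OF i] integral_exp_period by (intro prod.cong) auto
  also have "\<dots> = (if k = 0 then of_real ((2 * pi) ^ CARD('d)) else 0)"
    by (auto simp: vec_eq_iff)
  finally show "torus_mean (\<lambda>\<zeta>. zpow \<zeta> k) = (if k = 0 then 1 else 0)"
    by (simp add: torus_mean_def)
qed

lemma
  fixes P :: "(int^'d::finite) \<Rightarrow>\<^sub>0 complex"
  shows integrable_laurent_poly: "integrable lborel (\<lambda>u. indicat_real (cbox 0 (\<chi> j. 2 * pi)) u *\<^sub>R laurent_poly P (torus_point u))"
    and torus_mean_laurent_poly: "torus_mean (laurent_poly P) = Poly_Mapping.lookup P 0"
proof -
  have eq: "indicat_real (cbox 0 (\<chi> j. 2 * pi)) u *\<^sub>R laurent_poly P (torus_point u) =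
    (\<Sum>k\<in>Poly_Mapping.keys P. Poly_Mapping.lookup P k * (indicat_real (cbox 0 (\<chi> j. 2 * pi)) u *\<^sub>R zpow (torus_point u) k))" for u
    by (simp add: laurent_poly_eq_sum[OF finite_keys order_refl] scaleR_sum_right)
  show "integrable lborel (\<lambda>u. indicat_real (cbox 0 (\<chi> j. 2 * pi)) u *\<^sub>R laurent_poly P (torus_point u))"
    unfolding eq by (intro Bochner_Integration.integrable_sum integrable_mult_right integrable_zpow)
  have "torus_mean (laurent_poly P) = (\<Sum>k\<in>Poly_Mapping.keys P. Poly_Mapping.lookup P k * torus_mean (\<lambda>\<zeta>. zpow \<zeta> k))"
    unfolding torus_mean_def eq
    by (subst Bochner_Integration.integral_sum[OF integrable_mult_right[OF integrable_zpow]])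
       (simp only: integral_mult_right_zero sum_divide_distrib times_divide_eq_right)
  then show "torus_mean (laurent_poly P) = Poly_Mapping.lookup P 0"
    by (auto simp: torus_mean_zpow in_keys_iff if_distrib cong: if_cong split: if_splits)
qed

text \<open>The constant coefficient is the mean over the torus. This converts pointwise
  inequalities between Laurent polynomials into inequalities between coefficient norms; the norm
  comparisons of masks below rest on it.\<close>

lemma lookup_0_nonneg:
  fixes P :: "(int^'d::finite) \<Rightarrow>\<^sub>0 complex"
  assumes "\<And>\<zeta>. \<zeta> \<in> torus \<Longrightarrow> 0 \<le> Re (laurent_poly P \<zeta>)"
  shows "0 \<le> Re (Poly_Mapping.lookup P 0)"
proof -
  have "Re (Poly_Mapping.lookup P 0) = (LINT u|lborel. Re (indicat_real (cbox 0 (\<chi> j. 2 * pi)) u *\<^sub>R laurent_poly P (torus_point u))) / (2 * pi) ^ CARD('d)"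
    unfolding torus_mean_laurent_poly[symmetric] torus_mean_def
    by (simp only: Re_divide_of_real integral_Re[OF integrable_laurent_poly])
  also have "\<dots> \<ge> 0"
    using assms by (intro divide_nonneg_nonneg integral_nonneg_AE AE_I2) auto
  finally show ?thesis .
qed

text \<open>Parseval's identity: the mean of \<open>c^2 |Q|^2 - |P|^2\<close> is the difference of
  the two sides.\<close>

lemma laurent_sqnorm_le:
  fixes P Q :: "(int^'d::finite) \<Rightarrow>\<^sub>0 complex"
  assumes "\<And>\<zeta>. \<zeta> \<in> torus \<Longrightarrow> norm (laurent_poly P \<zeta>) \<le> c * norm (laurent_poly Q \<zeta>)"
  shows "laurent_sqnorm P \<le> c\<^sup>2 * laurent_sqnorm Q"
proof -
  have "0 \<le> Re (Poly_Mapping.lookup (Q * laurent_star Q * Poly_Mapping.single 0 (of_real (c\<^sup>2)) - P * laurent_star P) 0)"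
  proof (rule lookup_0_nonneg)
    fix \<zeta> :: "complex^'d" assume t: "\<zeta> \<in> torus"
    have "(norm (laurent_poly P \<zeta>))\<^sup>2 \<le> (c * norm (laurent_poly Q \<zeta>))\<^sup>2"
      using assms[OF t] by (intro power_mono) auto
    moreover have "laurent_poly (Q * laurent_star Q * Poly_Mapping.single 0 (of_real (c\<^sup>2)) - P * laurent_star P) \<zeta> =
       of_real ((norm (laurent_poly Q \<zeta>))\<^sup>2) * of_real (c\<^sup>2) - of_real ((norm (laurent_poly P \<zeta>))\<^sup>2)"
      unfolding complex_norm_square by (simp add: laurent_poly_mult t laurent_poly_star)
    ultimately show "0 \<le> Re (laurent_poly (Q * laurent_star Q * Poly_Mapping.single 0 (of_real (c\<^sup>2)) - P * laurent_star P) \<zeta>)"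
      by (simp add: power_mult_distrib mult.commute del: of_real_power)
  qed
  then show ?thesis
    by (simp add: lookup_minus lookup_mult_single lookup_mult_star_self mult.commute del: of_real_power)
qed

section \<open>Algebra of the masks\<close>

lemma E01_eq: "(E01 :: (nat^3) set) = {vector [0,0,0], vector [1,0,0], vector [0,1,0], vector [0,0,1],
    vector [1,1,0], vector [1,0,1], vector [0,1,1], vector [1,1,1]}"
proof -
  have *: "s \<in> E01 \<longleftrightarrow> s $ 1 \<in> {0, 1} \<and> s $ 2 \<in> {0, 1} \<and> s $ 3 \<in> {0, 1}" for s :: "nat^3"
    by (simp add: E01_def forall_3)
  have **: "s = vector [a, b, c] \<longleftrightarrow> s $ 1 = a \<and> s $ 2 = b \<and> s $ 3 = c" for s :: "nat^3" and a b c
    by (simp add: vec_eq_iff forall_3)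
  show ?thesis
    by (rule set_eqI) (simp only: * insert_iff empty_iff **, blast)
qed

lemma vector3_eq_iff: "(vector [a, b, c] :: 'a::zero^3) = vector [a', b', c'] \<longleftrightarrow> a = a' \<and> b = b' \<and> c = c'"
  by (simp add: vec_eq_iff forall_3)

lemma vector3_0: "(0 :: 'a::zero^3) = vector [0, 0, 0]"
  by (simp add: vec_eq_iff forall_3)

lemma finite_E01 [simp]: "finite (E01 :: (nat^3) set)"
  by (simp add: E01_eq)

lemma sum_E01: "sum f (E01 :: (nat^3) set) = f (vector [0,0,0]) + f (vector [1,0,0]) + f (vector [0,1,0]) + f (vector [0,0,1])
    + f (vector [1,1,0]) + f (vector [1,0,1]) + f (vector [0,1,1]) + f (vector [1,1,1])" for f :: "nat^3 \<Rightarrow> 'a::comm_monoid_add"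
  by (simp add: E01_eq vector3_eq_iff add.assoc)

lemma E01_minus_0: "(E01 :: (nat^3) set) - {0} = {vector [1,0,0], vector [0,1,0], vector [0,0,1],
    vector [1,1,0], vector [1,0,1], vector [0,1,1], vector [1,1,1]}"
  by (auto simp: E01_eq vector3_0 vector3_eq_iff)

text \<open>The characters of the group of sign changes; exponents modulo 2 form the dual
  group.\<close>

definition parity_char :: "nat^3 \<Rightarrow> nat^3 \<Rightarrow> complex" where
  "parity_char s e = (-1) ^ (s $ 1 * e $ 1 + s $ 2 * e $ 2 + s $ 3 * e $ 3)"

text \<open>The part of \<open>F\<close> carried by the exponents congruent to \<open>e\<close> modulo \<open>2\<close>.\<close>

definition polyphase :: "(complex^3 \<Rightarrow> complex) \<Rightarrow> nat^3 \<Rightarrow> complex^3 \<Rightarrow> complex" where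
  "polyphase F e \<zeta> = (\<Sum>s\<in>E01. parity_char s e * F (sign_change s \<zeta>)) / 8"

lemma parity_char_orth:
  assumes "e \<in> E01" "e' \<in> E01"
  shows "(\<Sum>s\<in>E01. parity_char s e * parity_char s e') = (if e = e' then 8 else 0)"
  using assms by (auto simp: sum_E01 E01_eq parity_char_def vector3_eq_iff)

lemma parity_char_commute: "parity_char s e = parity_char e s"
  by (simp add: parity_char_def mult.commute)

lemma cnj_parity_char [simp]: "cnj (parity_char s e) = parity_char s e"
  by (simp add: parity_char_def)

lemma sign_change_0 [simp]: "sign_change 0 \<zeta> = \<zeta>"
  by (simp add: sign_change_def)

lemma sign_change_torus: "\<zeta> \<in> torus \<Longrightarrow> sign_change s \<zeta> \<in> torus"
  by (simp add: torus_def sign_change_def norm_mult norm_power)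

lemma polyphase_sum:
  assumes "s \<in> E01"
  shows "F (sign_change s \<zeta>) = (\<Sum>e\<in>E01. parity_char s e * polyphase F e \<zeta>)"
proof -
  have "(\<Sum>e\<in>E01. parity_char s e * polyphase F e \<zeta>)
     = (\<Sum>t\<in>E01. (\<Sum>e\<in>E01. parity_char e s * parity_char e t) * F (sign_change t \<zeta>)) / 8"
    unfolding polyphase_def
    by (simp add: sum_divide_distrib[symmetric] sum_distrib_left sum_distrib_right)
       (subst sum.swap, simp add: parity_char_commute mult_ac)
  also have "\<dots> = (\<Sum>t\<in>E01. (if s = t then 8 * F (sign_change t \<zeta>) else 0)) / 8"
    by (rule arg_cong[where f = "\<lambda>x. x / 8"], rule sum.cong[OF refl]) (simp add: parity_char_orth[OF assms])
  also have "\<dots> = F (sign_change s \<zeta>)"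
    using assms by simp
  finally show ?thesis ..
qed

lemma polyphase_parseval:
  "(\<Sum>s\<in>E01. F (sign_change s \<zeta>) * cnj (G (sign_change s \<zeta>))) = 8 * (\<Sum>e\<in>E01. polyphase F e \<zeta> * cnj (polyphase G e \<zeta>))"
proof -
  have "(\<Sum>s\<in>E01. F (sign_change s \<zeta>) * cnj (G (sign_change s \<zeta>)))
    = (\<Sum>s\<in>E01. \<Sum>e\<in>E01. \<Sum>e'\<in>E01. (parity_char s e * parity_char s e') * (polyphase F e \<zeta> * cnj (polyphase G e' \<zeta>)))"
    by (intro sum.cong refl, subst polyphase_sum, assumption, subst polyphase_sum[of _ G], assumption)
       (simp add: sum_product mult_ac)
  also have "\<dots> = (\<Sum>e\<in>E01. \<Sum>e'\<in>E01. (\<Sum>s\<in>E01. parity_char s e * parity_char s e') * (polyphase F e \<zeta> * cnj (polyphase G e' \<zeta>)))"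
    by (subst sum.swap, rule sum.cong[OF refl], subst sum.swap) (simp add: sum_distrib_right)
  also have "\<dots> = (\<Sum>e\<in>E01. \<Sum>e'\<in>E01. if e = e' then 8 * (polyphase F e \<zeta> * cnj (polyphase G e' \<zeta>)) else 0)"
    by (intro sum.cong refl) (simp add: parity_char_orth)
  finally show ?thesis by (simp add: sum_distrib_left)
qed

text \<open>By orthogonality of characters the decomposition in \<open>polyphase_sum\<close> is
  unique, so components can be identified from any expansion of the right shape.\<close>

lemma polyphase_eqI:
  assumes "\<And>s. s \<in> E01 \<Longrightarrow> F (sign_change s \<zeta>) = (\<Sum>e\<in>E01. parity_char s e * f e)" and "e \<in> E01"
  shows "polyphase F e \<zeta> = f e"
proof -
  have "polyphase F e \<zeta> = (\<Sum>s\<in>E01. \<Sum>e'\<in>E01. (parity_char s e * parity_char s e') * f e') / 8"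
    unfolding polyphase_def by (simp add: assms(1) sum_distrib_left mult_ac)
  also have "\<dots> = (\<Sum>e'\<in>E01. (\<Sum>s\<in>E01. parity_char s e * parity_char s e') * f e') / 8"
    by (subst sum.swap) (simp add: sum_distrib_right)
  also have "(\<Sum>e'\<in>E01. (\<Sum>s\<in>E01. parity_char s e * parity_char s e') * f e') = (\<Sum>e'\<in>E01. if e = e' then 8 * f e' else 0)"
    by (intro sum.cong refl) (simp add: parity_char_orth[OF assms(2)])
  also have "\<dots> / 8 = f e" using assms(2) by simp
  finally show ?thesis .
qed

lemma polyphase_add: "polyphase (\<lambda>\<zeta>. F \<zeta> + G \<zeta>) e \<zeta> = polyphase F e \<zeta> + polyphase G e \<zeta>"
  by (simp add: polyphase_def distrib_left sum.distrib add_divide_distrib)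

lemma polyphase_diff: "polyphase (\<lambda>\<zeta>. F \<zeta> - G \<zeta>) e \<zeta> = polyphase F e \<zeta> - polyphase G e \<zeta>"
  by (simp add: polyphase_def right_diff_distrib sum_subtractf diff_divide_distrib)

lemma polyphase_sum_fun: "polyphase (\<lambda>\<zeta>. \<Sum>i\<in>I. F i \<zeta>) e \<zeta> = (\<Sum>i\<in>I. polyphase (F i) e \<zeta>)"
  by (induction I rule: infinite_finite_induct) (simp_all add: polyphase_add, simp_all add: polyphase_def)

lemma polyphase_mult_even:
  assumes "\<And>s. s \<in> E01 \<Longrightarrow> G (sign_change s \<zeta>) = G \<zeta>"
  shows "polyphase (\<lambda>\<zeta>. G \<zeta> * F \<zeta>) e \<zeta> = G \<zeta> * polyphase F e \<zeta>"
  unfolding polyphase_def by (simp add: assms sum_distrib_left mult_ac)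

lemma sq_sign_change: "(\<chi> j. (sign_change s \<zeta> $ j)\<^sup>2) = (\<chi> j. (\<zeta> $ j)\<^sup>2)"
  by (simp add: sign_change_def power_mult_distrib vec_eq_iff)
     (simp add: power_mult[symmetric] mult.commute[of _ 2] power_mult)

lemma Laurent_l1_down_even:
  "F \<in> Laurent_l1_down \<Longrightarrow> \<zeta> \<in> torus \<Longrightarrow> F (sign_change s \<zeta>) = F \<zeta>"
  by (auto simp: Laurent_l1_down_def sq_sign_change sign_change_torus)

subsection \<open>The masks as functions\<close>

definition Phi_fun :: "complex \<Rightarrow> complex \<Rightarrow> complex \<Rightarrow> complex" where
  "Phi_fun x y z = (24 + 3 * (x * y * z + 1 / (x * y * z) + x + 1 / x + y + 1 / y + z + 1 / z)
     + 2 * (x * y + x * z + y * z + 1 / (x * y) + 1 / (x * z) + 1 / (y * z))) / 60"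

definition H_fun :: "complex \<Rightarrow> complex \<Rightarrow> complex \<Rightarrow> complex" where
  "H_fun x y z = (1 + x) * (1 + y) * (1 + z) * (1 + x * y * z) / 16"

text \<open>Up to monomials, the polyphase components of \<open>960 \<Phi> H\<close> at \<open>(1, 1, 1) - s\<close>, as functions of \<open>\<zeta>\<^sup>2\<close>, where \<open>s\<close> has one, two or three ones.\<close>

definition tau1 :: "complex \<Rightarrow> complex \<Rightarrow> complex \<Rightarrow> complex" where
  "tau1 x y z = 45 * (1 + x) + 5 * (1 / (y * z) + 1 / y + 1 / z + x * z + x * y + x * y * z)"

definition tau2 :: "complex \<Rightarrow> complex \<Rightarrow> complex \<Rightarrow> complex" where
  "tau2 x y z = 40 * (1 + x * y) + 10 * (1 / z + x + y + x * y * z)"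

definition tau3 :: "complex \<Rightarrow> complex \<Rightarrow> complex \<Rightarrow> complex" where
  "tau3 x y z = 45 * (1 + x * y * z) + 5 * (x + y + z + x * y + x * z + y * z)"

text \<open>The factor 960 = 60 * 16 clears both denominators. Collecting the product by parity of
  exponents isolates the eight components; the one at \<open>xyz\<close> reproduces \<Phi> itself in
  the squared variables.\<close>

lemma Phi_mult_H:
  assumes "x \<noteq> 0" "y \<noteq> 0" "z \<noteq> 0"
  shows "960 * (Phi_fun x y z * H_fun x y z) = 60 * (x * y * z * (1 + Phi_fun (x\<^sup>2) (y\<^sup>2) (z\<^sup>2)))
    + y * z * tau1 (x\<^sup>2) (y\<^sup>2) (z\<^sup>2) + x * z * tau1 (y\<^sup>2) (x\<^sup>2) (z\<^sup>2) + x * y * tau1 (z\<^sup>2) (y\<^sup>2) (x\<^sup>2)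
    + z * tau2 (x\<^sup>2) (y\<^sup>2) (z\<^sup>2) + y * tau2 (x\<^sup>2) (z\<^sup>2) (y\<^sup>2) + x * tau2 (z\<^sup>2) (y\<^sup>2) (x\<^sup>2)
    + tau3 (x\<^sup>2) (y\<^sup>2) (z\<^sup>2)"
proof -
  \<comment> \<open>Reciprocals become separate variables subject to \<open>x * x' = 1\<close> and
    its analogues. The identity is then polynomial modulo these relations and within reach of
    \<open>algebra\<close>.\<close>
  define x' y' z' where d: "x' = 1 / x" "y' = 1 / y" "z' = 1 / z"
  have i: "x * x' = 1" "y * y' = 1" "z * z' = 1" using assms by (auto simp: d)
  have c: "x * (x' * a) = a" "x\<^sup>2 * (x' * a) = x * a" "x\<^sup>2 * (x'\<^sup>2 * a) = a" "x * (x'\<^sup>2 * a) = x' * a"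
    "y * (y' * a) = a" "y\<^sup>2 * (y' * a) = y * a" "y\<^sup>2 * (y'\<^sup>2 * a) = a" "y * (y'\<^sup>2 * a) = y' * a"
    "z * (z' * a) = a" "z\<^sup>2 * (z' * a) = z * a" "z\<^sup>2 * (z'\<^sup>2 * a) = a" "z * (z'\<^sup>2 * a) = z' * a" for a
    using assms by (simp_all add: d field_simps power2_eq_square)
  have r: "1 / (x * y * z) = x' * (y' * z')" "1 / x = x'" "1 / y = y'" "1 / z = z'" "1 / (x * y) = x' * y'"
    "1 / (x * z) = x' * z'" "1 / (y * z) = y' * z'"
    by (simp_all add: d)
  have r2: "1 / (x\<^sup>2 * y\<^sup>2 * z\<^sup>2) = x'\<^sup>2 * (y'\<^sup>2 * z'\<^sup>2)" "1 / x\<^sup>2 = x'\<^sup>2" "1 / y\<^sup>2 = y'\<^sup>2" "1 / z\<^sup>2 = z'\<^sup>2"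
    "1 / (x\<^sup>2 * y\<^sup>2) = x'\<^sup>2 * y'\<^sup>2" "1 / (x\<^sup>2 * z\<^sup>2) = x'\<^sup>2 * z'\<^sup>2" "1 / (y\<^sup>2 * z\<^sup>2) = y'\<^sup>2 * z'\<^sup>2"
    "1 / (y\<^sup>2 * x\<^sup>2) = x'\<^sup>2 * y'\<^sup>2" "1 / (z\<^sup>2 * x\<^sup>2) = x'\<^sup>2 * z'\<^sup>2" "1 / (z\<^sup>2 * y\<^sup>2) = y'\<^sup>2 * z'\<^sup>2"
    by (simp_all add: d power2_eq_square)
  have p: "Phi_fun x y z * 60 = 24 + 3 * (x * y * z + x' * (y' * z') + x + x' + y + y' + z + z')
     + 2 * (x * y + x * z + y * z + x' * y' + x' * z' + y' * z')"
    by (simp add: Phi_fun_def r)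
  have p2: "Phi_fun (x\<^sup>2) (y\<^sup>2) (z\<^sup>2) * 60 = 24 + 3 * (x\<^sup>2 * y\<^sup>2 * z\<^sup>2 + x'\<^sup>2 * (y'\<^sup>2 * z'\<^sup>2) + x\<^sup>2 + x'\<^sup>2 + y\<^sup>2 + y'\<^sup>2 + z\<^sup>2 + z'\<^sup>2)
     + 2 * (x\<^sup>2 * y\<^sup>2 + x\<^sup>2 * z\<^sup>2 + y\<^sup>2 * z\<^sup>2 + x'\<^sup>2 * y'\<^sup>2 + x'\<^sup>2 * z'\<^sup>2 + y'\<^sup>2 * z'\<^sup>2)"
    by (simp add: Phi_fun_def r2)
  have h: "H_fun x y z * 16 = (1 + x) * (1 + y) * (1 + z) * (1 + x * y * z)"
    by (simp add: H_fun_def)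
  have "960 * (Phi_fun x y z * H_fun x y z) = (Phi_fun x y z * 60) * (H_fun x y z * 16)"
    by simp
  also have "\<dots> = x * y * z * (60 + Phi_fun (x\<^sup>2) (y\<^sup>2) (z\<^sup>2) * 60)
    + y * z * tau1 (x\<^sup>2) (y\<^sup>2) (z\<^sup>2) + x * z * tau1 (y\<^sup>2) (x\<^sup>2) (z\<^sup>2) + x * y * tau1 (z\<^sup>2) (y\<^sup>2) (x\<^sup>2)
    + z * tau2 (x\<^sup>2) (y\<^sup>2) (z\<^sup>2) + y * tau2 (x\<^sup>2) (z\<^sup>2) (y\<^sup>2) + x * tau2 (z\<^sup>2) (y\<^sup>2) (x\<^sup>2)
    + tau3 (x\<^sup>2) (y\<^sup>2) (z\<^sup>2)"
    unfolding p p2 h tau1_def tau2_def tau3_def r2 using i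
    by algebra
  finally show ?thesis by (simp add: algebra_simps)
qed

lemma H_fun_phases:
  "16 * H_fun x y z = 2 * (x * y * z) + y * z * (1 + x\<^sup>2) + x * z * (1 + y\<^sup>2) + x * y * (1 + z\<^sup>2)
    + z * (1 + x\<^sup>2 * y\<^sup>2) + y * (1 + x\<^sup>2 * z\<^sup>2) + x * (1 + y\<^sup>2 * z\<^sup>2) + (1 + x\<^sup>2 * y\<^sup>2 * z\<^sup>2)"
  by (simp add: H_fun_def algebra_simps power2_eq_square)

text \<open>This is \<open>\<langle>H, H\<rangle>\<^sub>\<Phi> = \<Phi>(\<zeta>\<^sup>2)\<close> in terms of polyphase components.\<close>

lemma Phi_refine:
  assumes "x \<noteq> 0" "y \<noteq> 0" "z \<noteq> 0"
  shows "120 * (1 + Phi_fun x y z) + tau1 x y z * (1 + 1 / x) + tau1 y x z * (1 + 1 / y) + tau1 z y x * (1 + 1 / z)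
    + tau2 x y z * (1 + 1 / (x * y)) + tau2 x z y * (1 + 1 / (x * z)) + tau2 z y x * (1 + 1 / (y * z))
    + tau3 x y z * (1 + 1 / (x * y * z)) = 1920 * Phi_fun x y z"
  using assms by (simp add: Phi_fun_def tau1_def tau2_def tau3_def field_simps)

text \<open>One square for each of the six edge paths from \<open>(0, 0, 0)\<close> to \<open>(1, 1, 1)\<close> in the unit cube.\<close>

lemma Phi_fun_sum_of_squares:
  assumes "cmod x = 1" "cmod y = 1" "cmod z = 1"
  shows "Phi_fun x y z = 1 / 5 + of_real ((cmod (1 + x + x * y + x * y * z))\<^sup>2 + (cmod (1 + x + x * z + x * y * z))\<^sup>2
    + (cmod (1 + y + x * y + x * y * z))\<^sup>2 + (cmod (1 + y + y * z + x * y * z))\<^sup>2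
    + (cmod (1 + z + x * z + x * y * z))\<^sup>2 + (cmod (1 + z + y * z + x * y * z))\<^sup>2) / 120"
proof -
  have nz: "x \<noteq> 0" "y \<noteq> 0" "z \<noteq> 0" using assms by auto
  have c: "cnj x = 1 / x" "cnj y = 1 / y" "cnj z = 1 / z"
    using assms nz complex_norm_square[of x] complex_norm_square[of y] complex_norm_square[of z]
    by (simp_all add: nonzero_eq_divide_eq mult.commute)
  show ?thesis
    unfolding of_real_add complex_norm_square complex_cnj_add complex_cnj_mult complex_cnj_one c Phi_fun_def
    using nz by (simp add: field_simps)
qed

subsection \<open>The ring of absolutely convergent Laurent series\<close>

lemma laurent_series_has_sum:
  assumes "(\<lambda>k. cmod (a k)) summable_on UNIV" "\<zeta> \<in> torus"
  shows "((\<lambda>k. a k * zpow \<zeta> k) has_sum laurent_series a \<zeta>) UNIV"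
    and "(\<lambda>k. norm (a k * zpow \<zeta> k)) summable_on UNIV"
proof -
  have eq: "norm (a k * zpow \<zeta> k) = cmod (a k)" for k
    by (simp add: norm_mult norm_zpow assms(2))
  show n: "(\<lambda>k. norm (a k * zpow \<zeta> k)) summable_on UNIV"
    unfolding eq by (rule assms(1))
  show "((\<lambda>k. a k * zpow \<zeta> k) has_sum laurent_series a \<zeta>) UNIV"
    unfolding laurent_series_def by (rule has_sum_infsum, rule abs_summable_summable, rule n)
qed

lemma Laurent_l1I:
  assumes "(\<lambda>k. cmod (a k)) summable_on UNIV" "\<And>\<zeta>. \<zeta> \<in> torus \<Longrightarrow> F \<zeta> = laurent_series a \<zeta>"
  shows "F \<in> Laurent_l1"
  using assms by (auto simp: Laurent_l1_def)

lemma laurent_poly_in_Laurent_l1: "laurent_poly P \<in> Laurent_l1"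
proof (rule Laurent_l1I[of "Poly_Mapping.lookup P"])
  have "(\<lambda>k. cmod (Poly_Mapping.lookup P k)) summable_on Poly_Mapping.keys P"
    by simp
  then show "(\<lambda>k. cmod (Poly_Mapping.lookup P k)) summable_on UNIV"
    by (rule summable_on_cong_neutral[THEN iffD1, rotated -1]) (auto simp: in_keys_iff)
qed (simp add: laurent_poly_def)

lemma Laurent_l1_add:
  assumes "F \<in> Laurent_l1" "G \<in> Laurent_l1"
  shows "(\<lambda>\<zeta>. F \<zeta> + G \<zeta>) \<in> Laurent_l1"
proof -
  obtain a b where a: "(\<lambda>k. cmod (a k)) summable_on UNIV" "\<And>\<zeta>. \<zeta> \<in> torus \<Longrightarrow> F \<zeta> = laurent_series a \<zeta>"
    and b: "(\<lambda>k. cmod (b k)) summable_on UNIV" "\<And>\<zeta>. \<zeta> \<in> torus \<Longrightarrow> G \<zeta> = laurent_series b \<zeta>"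
    using assms by (auto simp: Laurent_l1_def)
  show ?thesis
  proof (rule Laurent_l1I[of "\<lambda>k. a k + b k"])
    show "(\<lambda>k. cmod (a k + b k)) summable_on UNIV"
      by (rule summable_on_comparison_test[OF summable_on_add[OF a(1) b(1)]]) (auto intro: norm_triangle_ineq)
    fix \<zeta> :: "complex^'a" assume t: "\<zeta> \<in> torus"
    show "F \<zeta> + G \<zeta> = laurent_series (\<lambda>k. a k + b k) \<zeta>"
      using has_sum_add[OF laurent_series_has_sum(1)[OF a(1) t] laurent_series_has_sum(1)[OF b(1) t]] a(2)[OF t] b(2)[OF t]
      by (simp add: distrib_right[symmetric] laurent_series_def infsumI)
  qed
qed

text \<open>The Cauchy product. Absolute summability over pairs permits the change of indices from
  \<open>(k, l)\<close> to \<open>(l, k - l)\<close> and summation in either order; the inner sums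
  are the convolution coefficients \<open>c k\<close>.\<close>

lemma Laurent_l1_mult:
  assumes "F \<in> Laurent_l1" "G \<in> Laurent_l1"
  shows "(\<lambda>\<zeta>. F \<zeta> * G \<zeta>) \<in> Laurent_l1"
proof -
  obtain a b where a: "(\<lambda>k. cmod (a k)) summable_on UNIV" "\<And>\<zeta>. \<zeta> \<in> torus \<Longrightarrow> F \<zeta> = laurent_series a \<zeta>"
    and b: "(\<lambda>k. cmod (b k)) summable_on UNIV" "\<And>\<zeta>. \<zeta> \<in> torus \<Longrightarrow> G \<zeta> = laurent_series b \<zeta>"
    using assms by (auto simp: Laurent_l1_def)
  have prod: "(\<lambda>(k, l). norm (f k * g l)) summable_on UNIV \<times> UNIV"
    if "(\<lambda>k. norm (f k)) summable_on UNIV" "(\<lambda>k. norm (g k)) summable_on UNIV" for f g :: "int^'a \<Rightarrow> complex"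
    using Infinite_Sum.abs_summable_on_Sigma_iff[where f = "\<lambda>(k, l). f k * g l" and A = UNIV and B = "\<lambda>_. UNIV"] that
    by (simp add: norm_mult abs_mult infsum_nonneg summable_on_cmult_right summable_on_cmult_left infsum_cmult_right' split_def)
  have bij: "bij_betw (\<lambda>(k, l). (l, k - l)) UNIV (UNIV :: ((int^'a) \<times> (int^'a)) set)"
    by (rule bij_betwI[where g = "\<lambda>(l, m). (l + m, l)"]) auto
  define c where "c k = (\<Sum>\<^sub>\<infinity>l. a l * b (k - l))" for k
  have ab: "(\<lambda>(k, l). norm (a l * b (k - l))) summable_on UNIV \<times> UNIV"
    using summable_on_reindex_bij_betw[OF bij, of "\<lambda>(k, l). norm (a k * b l)"] prod[OF a(1) b(1)]
    by (simp add: split_def)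
  show ?thesis
  proof (rule Laurent_l1I[of c])
    have s: "\<And>k. (\<lambda>l. norm (a l * b (k - l))) summable_on UNIV" "(\<lambda>k. \<Sum>\<^sub>\<infinity>l. norm (a l * b (k - l))) summable_on UNIV"
      using Infinite_Sum.abs_summable_on_Sigma_iff[where f = "\<lambda>(k, l). a l * b (k - l)" and A = UNIV and B = "\<lambda>_. UNIV"] ab
      by (simp_all add: split_def infsum_nonneg)
    show "(\<lambda>k. cmod (c k)) summable_on UNIV"
      by (rule summable_on_comparison_test[OF s(2)]) (auto simp: c_def intro!: norm_infsum_bound s(1))
    fix \<zeta> :: "complex^'a" assume t: "\<zeta> \<in> torus"
    let ?f = "\<lambda>k. a k * zpow \<zeta> k" and ?g = "\<lambda>k. b k * zpow \<zeta> k"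
    note fs = laurent_series_has_sum[OF a(1) t] and gs = laurent_series_has_sum[OF b(1) t]
    have S: "(\<lambda>(k, l). ?f k * ?g l) summable_on UNIV \<times> UNIV"
      using prod[OF fs(2) gs(2)] by (intro abs_summable_summable[of "\<lambda>(k, l). ?f k * ?g l"]) (simp only: split_def)
    have "F \<zeta> * G \<zeta> = (\<Sum>\<^sub>\<infinity>k. ?f k) * (\<Sum>\<^sub>\<infinity>l. ?g l)"
      using a(2)[OF t] b(2)[OF t] by (simp add: laurent_series_def)
    also have "\<dots> = (\<Sum>\<^sub>\<infinity>k. \<Sum>\<^sub>\<infinity>l. ?f k * ?g l)"
      by (simp only: infsum_cmult_left' infsum_cmult_right')
    also have "\<dots> = (\<Sum>\<^sub>\<infinity>(k, l)\<in>UNIV \<times> UNIV. ?f k * ?g l)"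
      by (rule infsum_Sigma'_banach[OF S])
    also have "\<dots> = (\<Sum>\<^sub>\<infinity>(k, l). ?f l * ?g (k - l))"
      using infsum_reindex_bij_betw[OF bij, of "\<lambda>(k, l). ?f k * ?g l"] by (simp add: split_def)
    also have "\<dots> = (\<Sum>\<^sub>\<infinity>k. \<Sum>\<^sub>\<infinity>l. ?f l * ?g (k - l))"
    proof -
      have "(\<lambda>(k, l). ?f l * ?g (k - l)) summable_on UNIV \<times> UNIV"
        using summable_on_reindex_bij_betw[OF bij, of "\<lambda>(k, l). ?f k * ?g l"] S by (simp add: split_def)
      from infsum_Sigma'_banach[OF this] show ?thesis by simp
    qed
    also have "\<dots> = (\<Sum>\<^sub>\<infinity>k. \<Sum>\<^sub>\<infinity>l. (a l * b (k - l)) * zpow \<zeta> k)"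
    proof (intro infsum_cong)
      fix k l :: "int^'a"
      have "zpow \<zeta> k = zpow \<zeta> l * zpow \<zeta> (k - l)"
        using zpow_add[OF t, of l "k - l"] by simp
      then show "?f l * ?g (k - l) = (a l * b (k - l)) * zpow \<zeta> k" by simp
    qed
    finally show "F \<zeta> * G \<zeta> = laurent_series c \<zeta>"
      by (simp only: infsum_cmult_left' laurent_series_def c_def)
  qed
qed

lemma torus_square: "\<zeta> \<in> torus \<Longrightarrow> (\<chi> j. (\<zeta> $ j)\<^sup>2) \<in> torus"
  by (simp add: torus_def norm_power)

lemma Laurent_l1_downI:
  assumes "G \<in> Laurent_l1" "\<And>\<zeta>. \<zeta> \<in> torus \<Longrightarrow> F \<zeta> = G (\<chi> j. (\<zeta> $ j)\<^sup>2)"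
  shows "F \<in> Laurent_l1_down"
  using assms by (auto simp: Laurent_l1_down_def)

lemma Laurent_l1_down_mult:
  assumes "F \<in> Laurent_l1_down" "G \<in> Laurent_l1_down"
  shows "(\<lambda>\<zeta>. F \<zeta> * G \<zeta>) \<in> Laurent_l1_down"
proof -
  obtain F' G' where "F' \<in> Laurent_l1" "\<And>\<zeta>. \<zeta> \<in> torus \<Longrightarrow> F \<zeta> = F' (\<chi> j. (\<zeta> $ j)\<^sup>2)"
    "G' \<in> Laurent_l1" "\<And>\<zeta>. \<zeta> \<in> torus \<Longrightarrow> G \<zeta> = G' (\<chi> j. (\<zeta> $ j)\<^sup>2)"
    using assms by (auto simp: Laurent_l1_down_def)
  then show ?thesis
    by (intro Laurent_l1_downI[of "\<lambda>\<zeta>. F' \<zeta> * G' \<zeta>"] Laurent_l1_mult) auto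
qed

subsection \<open>Wiener's lemma for Laurent polynomials\<close>

lemma card_int_cube:
  shows "finite {k::int^'d::finite. \<forall>j. \<bar>k $ j\<bar> \<le> int N}"
    and "card {k::int^'d::finite. \<forall>j. \<bar>k $ j\<bar> \<le> int N} \<le> (2 * N + 1) ^ CARD('d)"
proof -
  let ?A = "PiE (UNIV::'d set) (\<lambda>_. {- int N..int N})"
  have sub: "{k::int^'d. \<forall>j. \<bar>k $ j\<bar> \<le> int N} \<subseteq> vec_lambda ` ?A"
  proof
    fix k :: "int^'d" assume k: "k \<in> {k. \<forall>j. \<bar>k $ j\<bar> \<le> int N}"
    then have "(\<lambda>j. k $ j) \<in> ?A" by (auto simp: abs_le_iff PiE_def extensional_def) (metis minus_le_iff)
    then show "k \<in> vec_lambda ` ?A" by (metis image_eqI vec_nth_inverse)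
  qed
  have fin: "finite ?A" by (intro finite_PiE) auto
  then show "finite {k::int^'d. \<forall>j. \<bar>k $ j\<bar> \<le> int N}"
    using sub by (meson finite_imageI finite_subset)
  have "card {k::int^'d. \<forall>j. \<bar>k $ j\<bar> \<le> int N} \<le> card ?A"
    using sub fin by (meson card_image_le card_mono finite_imageI le_trans)
  also have "card ?A = (2 * N + 1) ^ CARD('d)"
    by (simp add: card_PiE nat_add_distrib nat_mult_distrib)
  finally show "card {k::int^'d. \<forall>j. \<bar>k $ j\<bar> \<le> int N} \<le> (2 * N + 1) ^ CARD('d)" .
qed

lemma keys_power_bound:
  fixes P :: "(int^'d::finite) \<Rightarrow>\<^sub>0 complex"
  assumes "\<And>k j. k \<in> Poly_Mapping.keys P \<Longrightarrow> \<bar>k $ j\<bar> \<le> int m"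
  shows "k \<in> Poly_Mapping.keys (P ^ n) \<Longrightarrow> \<bar>k $ j\<bar> \<le> int (n * m)"
proof (induction n arbitrary: k j)
  case 0
  then show ?case by simp
next
  case (Suc n)
  then obtain a b where ab: "k = a + b" "a \<in> Poly_Mapping.keys P" "b \<in> Poly_Mapping.keys (P ^ n)"
    using keys_mult[of P "P ^ n"] by auto
  have "\<bar>k $ j\<bar> \<le> \<bar>a $ j\<bar> + \<bar>b $ j\<bar>" by (simp add: ab(1))
  also have "\<dots> \<le> int m + int (n * m)" by (intro add_mono assms Suc.IH ab)
  finally show ?case by simp
qed

text \<open>The core of the Wiener argument. The powers of \<open>P\<close> are supported in cubes
  whose size grows polynomially in \<open>n\<close>, so the Cauchy-Schwarz inequality bounds the l1
  norm of the coefficients by a polynomial factor times their l2 norm, which is at most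
  \<open>q ^ n\<close> by Parseval.\<close>

lemma laurent_l1_power_bound:
  fixes P :: "(int^'d::finite) \<Rightarrow>\<^sub>0 complex"
  assumes m: "\<And>k j. k \<in> Poly_Mapping.keys P \<Longrightarrow> \<bar>k $ j\<bar> \<le> int m"
    and q: "0 \<le> q" "\<And>\<zeta>. \<zeta> \<in> torus \<Longrightarrow> norm (laurent_poly P \<zeta>) \<le> q"
  shows "(\<Sum>k\<in>Poly_Mapping.keys (P ^ n). cmod (Poly_Mapping.lookup (P ^ n) k)) \<le> (2 * (real n * real m) + 1) ^ CARD('d) * q ^ n"
proof -
  let ?K = "Poly_Mapping.keys (P ^ n)"
  have "laurent_sqnorm (P ^ n) \<le> (q ^ n)\<^sup>2 * laurent_sqnorm (1 :: (int^'d) \<Rightarrow>\<^sub>0 complex)"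
    by (rule laurent_sqnorm_le) (auto simp: laurent_poly_power norm_power intro!: power_mono q)
  then have s: "laurent_sqnorm (P ^ n) \<le> (q ^ n)\<^sup>2"
    by (simp add: laurent_sqnorm_def lookup_one when_def)
  have "?K \<subseteq> {k. \<forall>j. \<bar>k $ j\<bar> \<le> int (n * m)}"
    using keys_power_bound[OF m] by blast
  then have "card ?K \<le> (2 * (n * m) + 1) ^ CARD('d)"
    by (rule order_trans[OF card_mono[OF card_int_cube(1)] card_int_cube(2)])
  then have c: "real (card ?K) \<le> (2 * (real n * real m) + 1) ^ CARD('d)"
    using of_nat_mono[of "card ?K" "(2 * (n * m) + 1) ^ CARD('d)", where 'a = real] by (simp add: add.commute)
  \<comment> \<open>Weakens the bound on \<open>card ?K\<close> to its square, so that the whole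
    estimate is one between squares.\<close>
  have C1: "1 \<le> (2 * (real n * real m) + 1) ^ CARD('d)"
    by (intro one_le_power) simp
  have "(\<Sum>k\<in>?K. cmod (Poly_Mapping.lookup (P ^ n) k))\<^sup>2 \<le> real (card ?K) * laurent_sqnorm (P ^ n)"
    using Cauchy_Schwarz_ineq_sum[of "\<lambda>_. 1" "\<lambda>k. cmod (Poly_Mapping.lookup (P ^ n) k)" ?K]
    by (simp add: laurent_sqnorm_def)
  also have "\<dots> \<le> ((2 * (real n * real m) + 1) ^ CARD('d))\<^sup>2 * (q ^ n)\<^sup>2"
  proof (rule mult_mono[OF _ s])
    show "real (card ?K) \<le> ((2 * (real n * real m) + 1) ^ CARD('d))\<^sup>2"
    proof (rule order_trans[OF c])
      show "(2 * (real n * real m) + 1) ^ CARD('d) \<le> ((2 * (real n * real m) + 1) ^ CARD('d))\<^sup>2"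
        unfolding power2_eq_square using mult_left_mono[OF C1, of "(2 * (real n * real m) + 1) ^ CARD('d)"] by simp
    qed
  qed (auto simp: laurent_sqnorm_def intro: sum_nonneg)
  finally have "(\<Sum>k\<in>?K. cmod (Poly_Mapping.lookup (P ^ n) k))\<^sup>2 \<le> ((2 * (real n * real m) + 1) ^ CARD('d) * q ^ n)\<^sup>2"
    by (simp only: power_mult_distrib)
  then show ?thesis
    by (rule power2_le_imp_le) (use q in auto)
qed

text \<open>Ratio test: the polynomial factor grows by at most \<open>(1 + 1 / n) ^ d\<close> in a
  step, which \<open>q\<close> eventually outweighs. The ratio \<open>c\<close> halfway between
  \<open>q\<close> and 1 leaves room for this.\<close>

lemma summable_poly_times_geometric:
  fixes q :: real
  assumes "0 \<le> q" "q < 1"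
  shows "summable (\<lambda>n. (2 * (real n * real m) + 1) ^ d * q ^ n)"
proof -
  define c where "c = (1 + q) / 2"
  have c: "q < c" "c < 1" using assms by (auto simp: c_def)
  have "(\<lambda>n. (1 + inverse (real (Suc n))) ^ d * q) \<longlonglongrightarrow> (1 + 0) ^ d * q"
    by (intro tendsto_intros LIMSEQ_inverse_real_of_nat)
  then have "\<forall>\<^sub>F n in sequentially. (1 + inverse (real (Suc n))) ^ d * q < c"
    using c by (intro order_tendstoD) auto
  then obtain N where N: "\<And>n. n \<ge> N \<Longrightarrow> (1 + inverse (real (Suc n))) ^ d * q < c"
    by (auto simp: eventually_sequentially)
  show ?thesis
  proof (rule summable_ratio_test[OF c(2), of "Suc N"])
    fix n assume n: "Suc N \<le> n"
    then obtain n' where n': "n = Suc n'" "N \<le> n'" by (cases n) auto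
    have "2 * (real (Suc n) * real m) + 1 \<le> (1 + inverse (real n)) * (2 * (real n * real m) + 1)"
    proof -
      have "0 < real n" using n'(1) by simp
      then have "(1 + inverse (real n)) * (2 * (real n * real m) + 1) = 2 * (real (Suc n) * real m) + 1 + inverse (real n)"
        by (simp add: field_simps)
      then show ?thesis by simp
    qed
    then have "(2 * (real (Suc n) * real m) + 1) ^ d \<le> ((1 + inverse (real n)) * (2 * (real n * real m) + 1)) ^ d"
      by (intro power_mono) auto
    then have "(2 * (real (Suc n) * real m) + 1) ^ d * q ^ Suc n \<le> ((1 + inverse (real n)) * (2 * (real n * real m) + 1)) ^ d * q ^ Suc n"
      using assms by (intro mult_right_mono) auto
    also have "\<dots> = ((1 + inverse (real n)) ^ d * q) * ((2 * (real n * real m) + 1) ^ d * q ^ n)"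
      by (simp add: power_mult_distrib)
    also have "\<dots> \<le> c * ((2 * (real n * real m) + 1) ^ d * q ^ n)"
      using N[OF n'(2)] assms n'(1) by (intro mult_right_mono) auto
    finally show "norm ((2 * (real (Suc n) * real m) + 1) ^ d * q ^ Suc n) \<le> c * norm ((2 * (real n * real m) + 1) ^ d * q ^ n)"
      using assms by simp
  qed
qed

lemma keys_bounded:
  fixes P :: "(int^'d::finite) \<Rightarrow>\<^sub>0 complex"
  obtains m where "\<And>k j. k \<in> Poly_Mapping.keys P \<Longrightarrow> \<bar>k $ j\<bar> \<le> int m"
proof -
  let ?S = "(\<lambda>(k, j). \<bar>k $ j\<bar>) ` (Poly_Mapping.keys P \<times> (UNIV::'d set))"
  have "finite ?S" by simp
  then have "\<bar>k $ j\<bar> \<le> int (nat (Max (insert 0 ?S)))" if "k \<in> Poly_Mapping.keys P" for k j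
  proof -
    have "\<bar>k $ j\<bar> \<in> ?S" using that by force
    then have "\<bar>k $ j\<bar> \<le> Max (insert 0 ?S)" by (intro Max_ge) auto
    then show ?thesis by linarith
  qed
  then show ?thesis using that by blast
qed

text \<open>The Neumann series for \<open>1 / (1 - B)\<close> with \<open>B = 1 - P\<close>. By
  \<open>laurent_l1_power_bound\<close> the coefficients of all powers of \<open>B\<close> are
  jointly summable, so they may be collected by exponent.\<close>

lemma wiener_laurent_poly:
  fixes P :: "(int^'d::finite) \<Rightarrow>\<^sub>0 complex"
  assumes q: "0 \<le> q" "q < 1" "\<And>\<zeta>. \<zeta> \<in> torus \<Longrightarrow> norm (1 - laurent_poly P \<zeta>) \<le> q"
  shows "(\<lambda>\<zeta>. 1 / laurent_poly P \<zeta>) \<in> Laurent_l1"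
proof -
  define B where "B = 1 - P"
  have Bq: "norm (laurent_poly B \<zeta>) \<le> q" if "\<zeta> \<in> torus" for \<zeta>
    using q(3)[OF that] by (simp add: B_def)
  obtain m where m: "\<And>k j. k \<in> Poly_Mapping.keys B \<Longrightarrow> \<bar>k $ j\<bar> \<le> int m"
    using keys_bounded[of B] by blast
  let ?b = "\<lambda>n k. Poly_Mapping.lookup (B ^ n) k"
  have inner: "((\<lambda>k. norm (?b n k)) has_sum (\<Sum>k\<in>Poly_Mapping.keys (B ^ n). norm (?b n k))) UNIV" for n
    by (rule has_sum_cong_neutral[THEN iffD1, OF _ _ _ has_sum_finite[OF finite_keys]]) (auto simp: in_keys_iff)
  have outer: "(\<lambda>n. \<Sum>k\<in>Poly_Mapping.keys (B ^ n). norm (?b n k)) summable_on UNIV"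
  proof (rule norm_summable_imp_summable_on)
    show "summable (\<lambda>n. norm (\<Sum>k\<in>Poly_Mapping.keys (B ^ n). norm (?b n k)))"
      by (rule summable_comparison_test'[OF summable_poly_times_geometric[OF q(1,2), of m "CARD('d)"], of 0])
         (use laurent_l1_power_bound[OF m q(1) Bq] in \<open>simp add: sum_nonneg\<close>)
  qed
  have abs: "(\<lambda>(n, k). norm (?b n k)) summable_on UNIV \<times> UNIV"
    using Infinite_Sum.abs_summable_on_Sigma_iff[where f = "\<lambda>(n, k). ?b n k" and A = UNIV and B = "\<lambda>_. UNIV"] outer inner
    by (simp add: split_def infsumI[OF inner] has_sum_imp_summable[OF inner] sum_nonneg)
  have bij: "bij_betw prod.swap UNIV (UNIV :: (nat \<times> (int^'d)) set)"
    by (rule bij_betwI[where g = prod.swap]) auto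
  have abs': "(\<lambda>(k, n). norm (?b n k)) summable_on UNIV \<times> UNIV"
    using summable_on_reindex_bij_betw[OF bij, of "\<lambda>(n, k). norm (?b n k)"] abs by (simp add: split_def)
  have s: "\<And>k. (\<lambda>n. norm (?b n k)) summable_on UNIV" "(\<lambda>k. \<Sum>\<^sub>\<infinity>n. norm (?b n k)) summable_on UNIV"
    using Infinite_Sum.abs_summable_on_Sigma_iff[where f = "\<lambda>(k, n). ?b n k" and A = UNIV and B = "\<lambda>_. UNIV"] abs'
    by (simp_all add: split_def infsum_nonneg)
  define a where "a k = (\<Sum>\<^sub>\<infinity>n. ?b n k)" for k
  show ?thesis
  proof (rule Laurent_l1I[of a])
    show "(\<lambda>k. cmod (a k)) summable_on UNIV"
      by (rule summable_on_comparison_test[OF s(2)]) (auto simp: a_def intro!: norm_infsum_bound s(1))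
    fix \<zeta> :: "complex^'d" assume t: "\<zeta> \<in> torus"
    have S: "(\<lambda>(n, k). ?b n k * zpow \<zeta> k) summable_on UNIV \<times> UNIV"
    proof (rule abs_summable_summable)
      show "(\<lambda>x. norm (case x of (n, k) \<Rightarrow> ?b n k * zpow \<zeta> k)) summable_on UNIV \<times> UNIV"
        using abs by (simp add: split_def norm_mult norm_zpow t)
    qed
    have "laurent_series a \<zeta> = (\<Sum>\<^sub>\<infinity>k. \<Sum>\<^sub>\<infinity>n. ?b n k * zpow \<zeta> k)"
      by (simp only: laurent_series_def a_def infsum_cmult_left')
    also have "\<dots> = (\<Sum>\<^sub>\<infinity>n. \<Sum>\<^sub>\<infinity>k. ?b n k * zpow \<zeta> k)"
      by (rule infsum_swap_banach[symmetric, OF S])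
    also have "\<dots> = (\<Sum>\<^sub>\<infinity>n. laurent_poly (B ^ n) \<zeta>)"
      by (simp only: laurent_poly_def laurent_series_def)
    also have "\<dots> = (\<Sum>\<^sub>\<infinity>n. laurent_poly B \<zeta> ^ n)"
      by (simp only: laurent_poly_power[OF t])
    also have "\<dots> = 1 / (1 - laurent_poly B \<zeta>)"
    proof (rule infsumI, rule norm_summable_imp_has_sum)
      have n1: "norm (laurent_poly B \<zeta>) < 1" using Bq[OF t] q(2) by simp
      then show "summable (\<lambda>n. norm (laurent_poly B \<zeta> ^ n))"
        by (simp add: norm_power summable_geometric)
      show "(\<lambda>n. laurent_poly B \<zeta> ^ n) sums (1 / (1 - laurent_poly B \<zeta>))"
        by (rule geometric_sums[OF n1])
    qed
    finally show "1 / laurent_poly P \<zeta> = laurent_series a \<zeta>"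
      by (simp add: B_def)
  qed
qed

subsection \<open>Polyphase form of the masks\<close>

definition xmon :: "nat^3 \<Rightarrow> complex^3 \<Rightarrow> complex" where
  "xmon e \<zeta> = (\<zeta> $ 1) ^ (e $ 1) * (\<zeta> $ 2) ^ (e $ 2) * (\<zeta> $ 3) ^ (e $ 3)"

text \<open>The class \<open>1 - s\<close> that distinguishes the mask of index \<open>s\<close>
  from the others. Subtraction is that of natural numbers, so this is an involution on 0/1 vectors
  only.\<close>

definition compl3 :: "nat^3 \<Rightarrow> nat^3" where
  "compl3 e = vector [1 - e $ 1, 1 - e $ 2, 1 - e $ 3]"

abbreviation one3 :: "nat^3" where
  "one3 \<equiv> vector [1, 1, 1]"

abbreviation sq :: "complex^3 \<Rightarrow> complex^3" where
  "sq \<zeta> \<equiv> (\<chi> j. (\<zeta> $ j)\<^sup>2)"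

lemma xmon_sign_change: "xmon e (sign_change s \<zeta>) = parity_char s e * xmon e \<zeta>"
  by (simp add: xmon_def sign_change_def parity_char_def power_mult_distrib power_add power_mult[symmetric] mult_ac)

lemma xmon_nonzero: "\<zeta> \<in> torus \<Longrightarrow> xmon e \<zeta> \<noteq> 0"
  by (simp add: xmon_def torus_nonzero)

lemma xmon_mult_cnj: "\<zeta> \<in> torus \<Longrightarrow> xmon e \<zeta> * cnj (xmon e \<zeta>) = 1"
  unfolding complex_norm_square[symmetric] by (simp add: xmon_def norm_mult norm_power torus_def)

lemma polyphase_expand:
  assumes F: "\<And>\<zeta>. \<zeta> \<in> torus \<Longrightarrow> F \<zeta> = (\<Sum>e\<in>E01. xmon e \<zeta> * c e (sq \<zeta>))" and "\<zeta> \<in> torus" "e \<in> E01"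
  shows "polyphase F e \<zeta> = xmon e \<zeta> * c e (sq \<zeta>)"
  by (rule polyphase_eqI)
     (simp_all add: F sign_change_torus assms xmon_sign_change sq_sign_change mult.assoc)

lemma zpow3: "zpow (\<zeta> :: complex^3) k = (\<zeta> $ 1) powi (k $ 1) * (\<zeta> $ 2) powi (k $ 2) * (\<zeta> $ 3) powi (k $ 3)"
  by (simp add: zpow_def prod_UNIV_3)

lemma laurent_poly_lmon: "laurent_poly (lmon i j k) \<zeta> = (\<zeta> $ 1) powi i * (\<zeta> $ 2) powi j * (\<zeta> $ 3) powi k"
  by (simp add: lmon_def zpow3)

lemma prod_UNIV_4: "prod f (UNIV::4 set) = f 1 * f 2 * f 3 * f 4"
  unfolding UNIV_4 by (simp add: mult_ac)

lemma box_mask_Xi: "box_mask Xi = Poly_Mapping.single 0 (1 / 2 ^ 4) *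
   ((1 + lmon 1 0 0) * (1 + lmon 0 1 0) * (1 + lmon 0 0 1) * (1 + lmon 1 1 1))"
proof -
  have "column 1 Xi = vector [1, 0, 0]" "column 2 Xi = vector [0, 1, 0]" "column 3 Xi = vector [0, 0, 1]" "column 4 Xi = vector [1, 1, 1]"
    by (simp_all add: column_def Xi_def vec_eq_iff forall_3 vector_4)
  then show ?thesis
    by (simp only: box_mask_def prod_UNIV_4 lmon_def) simp
qed

lemma laurent_poly_box_mask: "\<zeta> \<in> torus \<Longrightarrow> laurent_poly (box_mask Xi) \<zeta> = H_fun (\<zeta> $ 1) (\<zeta> $ 2) (\<zeta> $ 3)"
  by (simp add: box_mask_Xi laurent_poly_mult laurent_poly_lmon H_fun_def)

text \<open>Exponents and variables are permuted by the same rule, so monomials correspond and the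
  sum is reindexed by the induced bijection of exponents.\<close>

lemma laurent_poly_permute_vars:
  fixes \<pi> :: "'d::finite \<Rightarrow> 'd"
  assumes "bij \<pi>"
  shows "laurent_poly (permute_vars \<pi> P) \<zeta> = laurent_poly P (\<chi> j. \<zeta> $ \<pi> j)"
proof -
  let ?f = "\<lambda>k::int^'d. \<chi> j. k $ \<pi> j"
  have bij: "bij ?f"
    by (rule bij_betwI[where g = "\<lambda>k. \<chi> j. k $ inv \<pi> j"])
       (use assms in \<open>auto simp: vec_eq_iff bij_is_surj surj_f_inv_f bij_is_inj inv_f_f\<close>)
  have z: "zpow \<zeta> k = zpow (\<chi> j. \<zeta> $ \<pi> j) (?f k)" for k
    unfolding zpow_def using prod.reindex_bij_betw[OF assms, of "\<lambda>j. (\<zeta> $ j) powi (k $ j)"] by simp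
  have "laurent_poly (permute_vars \<pi> P) \<zeta> = (\<Sum>\<^sub>\<infinity>k. Poly_Mapping.lookup P (?f k) * zpow (\<chi> j. \<zeta> $ \<pi> j) (?f k))"
    unfolding laurent_poly_def laurent_series_def permute_vars_def z
    using bij_is_inj[OF bij] by (simp add: map_key.rep_eq)
  also have "\<dots> = laurent_poly P (\<chi> j. \<zeta> $ \<pi> j)"
    unfolding laurent_poly_def laurent_series_def by (rule infsum_reindex_bij_betw[OF bij])
  finally show ?thesis .
qed

text \<open>The arguments are permuted exactly as the variables in the definitions of the masks; the
  final branch serves \<open>s = one3\<close>.\<close>

definition tau_fun :: "nat^3 \<Rightarrow> complex^3 \<Rightarrow> complex" where
  "tau_fun s w = (if s = vector [1,0,0] then tau1 (w $ 1) (w $ 2) (w $ 3)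
    else if s = vector [0,1,0] then tau1 (w $ 2) (w $ 1) (w $ 3)
    else if s = vector [0,0,1] then tau1 (w $ 3) (w $ 2) (w $ 1)
    else if s = vector [1,1,0] then tau2 (w $ 1) (w $ 2) (w $ 3)
    else if s = vector [1,0,1] then tau2 (w $ 1) (w $ 3) (w $ 2)
    else if s = vector [0,1,1] then tau2 (w $ 3) (w $ 2) (w $ 1)
    else tau3 (w $ 1) (w $ 2) (w $ 3))"

definition Phi_vec :: "complex^3 \<Rightarrow> complex" where
  "Phi_vec w = Phi_fun (w $ 1) (w $ 2) (w $ 3)"

text \<open>Here \<open>y * z\<close> is \<zeta>^(1 - s) for \<open>s = (1, 0, 0)\<close>, and
  inverting the arguments of \<open>tau1\<close> amounts to conjugation on the torus. Reciprocals
  are again treated as variables of their own.\<close>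

lemma H100_fun:
  assumes "x \<noteq> 0" "y \<noteq> 0" "z \<noteq> (0::complex)"
  shows "- 3 * (x^2 * y^3 * z^3) + 5 * (x * y^3 * z^3) - 2 * (x^2 * y^3 * z) - 2 * (x^2 * y * z^3)
     - 2 * (y^3 * z^3) + 5 * (x * y^3 * z) + 5 * (x * y * z^3) - 3 * (x^2 * y * z)
     - 3 * (y^3 * z) - 3 * (y * z^3) + 45 * (x * y * z) - 84 * (y * z)
     + 45 * (inverse x * y * z) - 3 * (y * inverse z) - 3 * (inverse y * z) - 3 * (inverse x^2 * y * z)
     + 5 * (inverse x * y * inverse z) + 5 * (inverse x * inverse y * z) - 2 * (inverse y * inverse z) - 2 * (inverse x^2 * y * inverse z)
     - 2 * (inverse x^2 * inverse y * z) + 5 * (inverse x * inverse y * inverse z) - 3 * (inverse x^2 * inverse y * inverse z)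
   = - 60 * (y * z * (1 + Phi_fun (x\<^sup>2) (y\<^sup>2) (z\<^sup>2))) + x * y * z * tau1 ((inverse x)\<^sup>2) ((inverse y)\<^sup>2) ((inverse z)\<^sup>2)"
proof -
  define x' y' z' where d: "x' = inverse x" "y' = inverse y" "z' = inverse z"
  have i: "x * x' = 1" "y * y' = 1" "z * z' = 1" using assms by (auto simp: d)
  have p: "60 * Phi_fun (x\<^sup>2) (y\<^sup>2) (z\<^sup>2) = 24 + 3 * (x\<^sup>2 * y\<^sup>2 * z\<^sup>2 + x'\<^sup>2 * (y'\<^sup>2 * z'\<^sup>2) + x\<^sup>2 + x'\<^sup>2 + y\<^sup>2 + y'\<^sup>2 + z\<^sup>2 + z'\<^sup>2)
     + 2 * (x\<^sup>2 * y\<^sup>2 + x\<^sup>2 * z\<^sup>2 + y\<^sup>2 * z\<^sup>2 + x'\<^sup>2 * y'\<^sup>2 + x'\<^sup>2 * z'\<^sup>2 + y'\<^sup>2 * z'\<^sup>2)"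
    by (simp add: Phi_fun_def d inverse_eq_divide power2_eq_square)
  have t: "tau1 (x'\<^sup>2) (y'\<^sup>2) (z'\<^sup>2) = 45 * (1 + x'\<^sup>2) + 5 * (y\<^sup>2 * z\<^sup>2 + y\<^sup>2 + z\<^sup>2 + x'\<^sup>2 * z'\<^sup>2 + x'\<^sup>2 * y'\<^sup>2 + x'\<^sup>2 * y'\<^sup>2 * z'\<^sup>2)"
    by (simp add: tau1_def d inverse_eq_divide power2_eq_square)
  have "- 60 * (y * z * (1 + Phi_fun (x\<^sup>2) (y\<^sup>2) (z\<^sup>2))) = - (y * z * (60 + 60 * Phi_fun (x\<^sup>2) (y\<^sup>2) (z\<^sup>2)))"
    by (simp add: algebra_simps)
  then show ?thesis
    unfolding d[symmetric] p t using i by algebra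
qed

lemma H110_fun:
  assumes "x \<noteq> 0" "y \<noteq> 0" "z \<noteq> (0::complex)"
  shows "- 3 * (x^2 * y^2 * z^3) - 2 * (x^2 * y^2 * z) - 2 * (x^2 * z^3) + 10 * (x * y * z^3)
     - 2 * (y^2 * z^3) - 3 * (x^2 * z) + 40 * (x * y * z) - 3 * (y^2 * z)
     - 3 * z^3 + 10 * (x * inverse y * z) - 84 * z + 10 * (inverse x * y * z)
     - 3 * inverse z - 3 * (inverse y^2 * z) + 40 * (inverse x * inverse y * z) - 3 * (inverse x^2 * z)
     - 2 * (inverse y^2 * inverse z) + 10 * (inverse x * inverse y * inverse z) - 2 * (inverse x^2 * inverse z) - 2 * (inverse x^2 * inverse y^2 * z)
     - 3 * (inverse x^2 * inverse y^2 * inverse z)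
   = - 60 * (z * (1 + Phi_fun (x\<^sup>2) (y\<^sup>2) (z\<^sup>2))) + x * y * z * tau2 ((inverse x)\<^sup>2) ((inverse y)\<^sup>2) ((inverse z)\<^sup>2)"
proof -
  define x' y' z' where d: "x' = inverse x" "y' = inverse y" "z' = inverse z"
  have i: "x * x' = 1" "y * y' = 1" "z * z' = 1" using assms by (auto simp: d)
  have p: "60 * Phi_fun (x\<^sup>2) (y\<^sup>2) (z\<^sup>2) = 24 + 3 * (x\<^sup>2 * y\<^sup>2 * z\<^sup>2 + x'\<^sup>2 * (y'\<^sup>2 * z'\<^sup>2) + x\<^sup>2 + x'\<^sup>2 + y\<^sup>2 + y'\<^sup>2 + z\<^sup>2 + z'\<^sup>2)
     + 2 * (x\<^sup>2 * y\<^sup>2 + x\<^sup>2 * z\<^sup>2 + y\<^sup>2 * z\<^sup>2 + x'\<^sup>2 * y'\<^sup>2 + x'\<^sup>2 * z'\<^sup>2 + y'\<^sup>2 * z'\<^sup>2)"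
    by (simp add: Phi_fun_def d inverse_eq_divide power2_eq_square)
  have t: "tau2 (x'\<^sup>2) (y'\<^sup>2) (z'\<^sup>2) = 40 * (1 + x'\<^sup>2 * y'\<^sup>2) + 10 * (z\<^sup>2 + x'\<^sup>2 + y'\<^sup>2 + x'\<^sup>2 * y'\<^sup>2 * z'\<^sup>2)"
    by (simp add: tau2_def d inverse_eq_divide power2_eq_square)
  have "- 60 * (z * (1 + Phi_fun (x\<^sup>2) (y\<^sup>2) (z\<^sup>2))) = - (z * (60 + 60 * Phi_fun (x\<^sup>2) (y\<^sup>2) (z\<^sup>2)))"
    by (simp add: algebra_simps)
  then show ?thesis
    unfolding d[symmetric] p t using i by algebra
qed

lemma H111_fun:
  assumes "x \<noteq> 0" "y \<noteq> 0" "z \<noteq> (0::complex)"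
  shows "- 3 * (x^2 * y^2 * z^2) - 2 * (x^2 * y^2) - 2 * (x^2 * z^2) - 2 * (y^2 * z^2)
     + 45 * (x * y * z) - 3 * x^2 - 3 * y^2 - 3 * z^2
     + 5 * (x * y * inverse z) + 5 * (x * inverse y * z) + 5 * (inverse x * y * z) - 84
     + 5 * (x * inverse y * inverse z) + 5 * (inverse x * y * inverse z) + 5 * (inverse x * inverse y * z) - 3 * inverse z^2
     - 3 * inverse y^2 - 3 * inverse x^2 + 45 * (inverse x * inverse y * inverse z) - 2 * (inverse y^2 * inverse z^2)
     - 2 * (inverse x^2 * inverse z^2) - 2 * (inverse x^2 * inverse y^2) - 3 * (inverse x^2 * inverse y^2 * inverse z^2)
   = - 60 * (1 + Phi_fun (x\<^sup>2) (y\<^sup>2) (z\<^sup>2)) + x * y * z * tau3 ((inverse x)\<^sup>2) ((inverse y)\<^sup>2) ((inverse z)\<^sup>2)"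
proof -
  define x' y' z' where d: "x' = inverse x" "y' = inverse y" "z' = inverse z"
  have i: "x * x' = 1" "y * y' = 1" "z * z' = 1" using assms by (auto simp: d)
  have p: "60 * Phi_fun (x\<^sup>2) (y\<^sup>2) (z\<^sup>2) = 24 + 3 * (x\<^sup>2 * y\<^sup>2 * z\<^sup>2 + x'\<^sup>2 * (y'\<^sup>2 * z'\<^sup>2) + x\<^sup>2 + x'\<^sup>2 + y\<^sup>2 + y'\<^sup>2 + z\<^sup>2 + z'\<^sup>2)
     + 2 * (x\<^sup>2 * y\<^sup>2 + x\<^sup>2 * z\<^sup>2 + y\<^sup>2 * z\<^sup>2 + x'\<^sup>2 * y'\<^sup>2 + x'\<^sup>2 * z'\<^sup>2 + y'\<^sup>2 * z'\<^sup>2)"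
    by (simp add: Phi_fun_def d inverse_eq_divide power2_eq_square)
  have "- 60 * (1 + Phi_fun (x\<^sup>2) (y\<^sup>2) (z\<^sup>2)) = - (60 + 60 * Phi_fun (x\<^sup>2) (y\<^sup>2) (z\<^sup>2))"
    by (simp add: algebra_simps)
  then show ?thesis
    unfolding d[symmetric] p tau3_def using i by algebra
qed

lemma powi_small:
  fixes x :: complex
  shows "x powi (-1) = inverse x" "x powi (-2) = inverse x ^ 2" "x powi 2 = x ^ 2" "x powi 3 = x ^ 3"
  by (simp_all add: power_int_def)

lemma cnj_torus: "\<zeta> \<in> torus \<Longrightarrow> cnj (\<zeta> $ j) = inverse (\<zeta> $ j)"
  using torus_nonzero[of \<zeta> j] complex_norm_square[of "\<zeta> $ j"]
  by (simp add: torus_def field_simps)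

lemma laurent_poly_H100:
  assumes "\<zeta> \<in> torus"
  shows "laurent_poly H100 \<zeta> = - 60 * (\<zeta> $ 2 * \<zeta> $ 3 * (1 + Phi_vec (sq \<zeta>))) + \<zeta> $ 1 * \<zeta> $ 2 * \<zeta> $ 3 * cnj (tau1 ((\<zeta> $ 1)\<^sup>2) ((\<zeta> $ 2)\<^sup>2) ((\<zeta> $ 3)\<^sup>2))"
  using H100_fun[of "\<zeta> $ 1" "\<zeta> $ 2" "\<zeta> $ 3"] assms
  by (simp add: H100_def laurent_poly_mult laurent_poly_lmon torus_nonzero powi_small Phi_vec_def cnj_torus tau1_def)

lemma laurent_poly_H110:
  assumes "\<zeta> \<in> torus"
  shows "laurent_poly H110 \<zeta> = - 60 * (\<zeta> $ 3 * (1 + Phi_vec (sq \<zeta>))) + \<zeta> $ 1 * \<zeta> $ 2 * \<zeta> $ 3 * cnj (tau2 ((\<zeta> $ 1)\<^sup>2) ((\<zeta> $ 2)\<^sup>2) ((\<zeta> $ 3)\<^sup>2))"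
  using H110_fun[of "\<zeta> $ 1" "\<zeta> $ 2" "\<zeta> $ 3"] assms
  by (simp add: H110_def laurent_poly_mult laurent_poly_lmon torus_nonzero powi_small Phi_vec_def cnj_torus tau2_def)

lemma laurent_poly_H111:
  assumes "\<zeta> \<in> torus"
  shows "laurent_poly H111 \<zeta> = - 60 * (1 + Phi_vec (sq \<zeta>)) + \<zeta> $ 1 * \<zeta> $ 2 * \<zeta> $ 3 * cnj (tau3 ((\<zeta> $ 1)\<^sup>2) ((\<zeta> $ 2)\<^sup>2) ((\<zeta> $ 3)\<^sup>2))"
  using H111_fun[of "\<zeta> $ 1" "\<zeta> $ 2" "\<zeta> $ 3"] assms
  by (simp add: H111_def laurent_poly_mult laurent_poly_lmon torus_nonzero powi_small Phi_vec_def cnj_torus tau3_def)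

lemma permute_torus: "\<zeta> \<in> torus \<Longrightarrow> (\<chi> j. \<zeta> $ \<pi> j) \<in> torus"
  by (simp add: torus_def)

lemma Phi_fun_permute: "Phi_fun y x z = Phi_fun x y z" "Phi_fun x z y = Phi_fun x y z" "Phi_fun z y x = Phi_fun x y z"
  by (simp_all add: Phi_fun_def ac_simps)

lemma transpose3:
  "Transposition.transpose 1 2 (1::3) = 2" "Transposition.transpose 1 2 (2::3) = 1" "Transposition.transpose 1 2 (3::3) = 3"
  "Transposition.transpose 1 3 (1::3) = 3" "Transposition.transpose 1 3 (2::3) = 2" "Transposition.transpose 1 3 (3::3) = 1"
  "Transposition.transpose 2 3 (1::3) = 1" "Transposition.transpose 2 3 (2::3) = 3" "Transposition.transpose 2 3 (3::3) = 2"
  by (simp_all add: Transposition.transpose_def)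

text \<open>Permuting variables reduces the seven masks to \<open>H100\<close>, \<open>H110\<close>
  and \<open>H111\<close>, because \<Phi> is symmetric in its variables.\<close>

lemma laurent_poly_wavelet_mask:
  assumes t: "\<zeta> \<in> torus" and s: "s \<in> E01 - {0}"
  shows "laurent_poly (wavelet_mask s) \<zeta> = - 60 * (xmon (compl3 s) \<zeta> * (1 + Phi_vec (sq \<zeta>))) + xmon one3 \<zeta> * cnj (tau_fun s (sq \<zeta>))"
  using s unfolding E01_minus_0
  by (elim insertE emptyE)
     (simp_all add: wavelet_mask_def tau_fun_def vector3_eq_iff H010_def H001_def H101_def H011_def
        laurent_poly_permute_vars bij_swap laurent_poly_H100 laurent_poly_H110 laurent_poly_H111 t permute_torus transpose3
        xmon_def compl3_def Phi_vec_def Phi_fun_permute mult_ac)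

lemma xmon_explicit [simp]:
  "xmon (vector [a, b, c]) \<zeta> = (\<zeta> $ 1) ^ a * (\<zeta> $ 2) ^ b * (\<zeta> $ 3) ^ c"
  by (simp add: xmon_def)

lemma compl3_explicit [simp]: "compl3 (vector [a, b, c]) = vector [1 - a, 1 - b, 1 - c]"
  by (simp add: compl3_def)

lemma compl3_E01: "s \<in> E01 \<Longrightarrow> compl3 s \<in> E01" "s \<in> E01 \<Longrightarrow> compl3 (compl3 s) = s"
  "s \<in> E01 \<Longrightarrow> compl3 s = one3 \<longleftrightarrow> s = 0"
  by (auto simp: E01_eq vector3_eq_iff vector3_0)

lemma one3_E01 [simp]: "one3 \<in> E01" and zero_E01 [simp]: "0 \<in> (E01 :: (nat^3) set)"
  by (simp_all add: E01_eq vector3_0)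

lemma sum_E01_compl:
  "(\<Sum>e\<in>E01. f e) = f one3 + (\<Sum>s\<in>E01 - {0}. f (compl3 s))" for f :: "nat^3 \<Rightarrow> complex"
  by (simp add: sum_E01 E01_minus_0 vector3_eq_iff)

lemma polyphase_H:
  assumes "\<zeta> \<in> torus" "e \<in> E01"
  shows "polyphase (laurent_poly (box_mask Xi)) e \<zeta> = xmon e \<zeta> * ((1 + xmon (compl3 e) (sq \<zeta>)) / 16)"
proof (rule polyphase_expand[OF _ assms])
  fix \<zeta> :: "complex^3" assume t: "\<zeta> \<in> torus"
  have "16 * (\<Sum>e\<in>E01. xmon e \<zeta> * ((1 + xmon (compl3 e) (sq \<zeta>)) / 16)) = 16 * H_fun (\<zeta> $ 1) (\<zeta> $ 2) (\<zeta> $ 3)"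
    unfolding H_fun_phases by (simp add: sum_E01 field_simps)
  then show "laurent_poly (box_mask Xi) \<zeta> = (\<Sum>e\<in>E01. xmon e \<zeta> * ((1 + xmon (compl3 e) (sq \<zeta>)) / 16))"
    using laurent_poly_box_mask[OF t] by simp
qed

lemma polyphase_Phi_H:
  assumes "\<zeta> \<in> torus" "e \<in> E01"
  shows "polyphase (\<lambda>\<zeta>. Phi_vec \<zeta> * laurent_poly (box_mask Xi) \<zeta>) e \<zeta>
    = xmon e \<zeta> * (if e = one3 then (1 + Phi_vec (sq \<zeta>)) / 16 else tau_fun (compl3 e) (sq \<zeta>) / 960)"
proof (rule polyphase_expand[OF _ assms])
  fix \<zeta> :: "complex^3" assume t: "\<zeta> \<in> torus"
  have "960 * (\<Sum>e\<in>E01. xmon e \<zeta> * (if e = one3 then (1 + Phi_vec (sq \<zeta>)) / 16 else tau_fun (compl3 e) (sq \<zeta>) / 960))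
     = 960 * (Phi_fun (\<zeta> $ 1) (\<zeta> $ 2) (\<zeta> $ 3) * H_fun (\<zeta> $ 1) (\<zeta> $ 2) (\<zeta> $ 3))"
    unfolding Phi_mult_H[OF torus_nonzero[OF t] torus_nonzero[OF t] torus_nonzero[OF t]]
    by (simp add: sum_E01 vector3_eq_iff tau_fun_def Phi_vec_def distrib_left)
  then show "Phi_vec \<zeta> * laurent_poly (box_mask Xi) \<zeta> = (\<Sum>e\<in>E01. xmon e \<zeta> * (if e = one3 then (1 + Phi_vec (sq \<zeta>)) / 16 else tau_fun (compl3 e) (sq \<zeta>) / 960))"
    using laurent_poly_box_mask[OF t] by (simp add: Phi_vec_def)
qed

lemma polyphase_wavelet_mask:
  assumes "\<zeta> \<in> torus" "e \<in> E01" "s \<in> E01 - {0}"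
  shows "polyphase (laurent_poly (wavelet_mask s)) e \<zeta>
    = xmon e \<zeta> * (if e = one3 then cnj (tau_fun s (sq \<zeta>)) else if e = compl3 s then - 60 * (1 + Phi_vec (sq \<zeta>)) else 0)"
proof (rule polyphase_expand[OF _ assms(1,2)])
  fix \<zeta> :: "complex^3" assume t: "\<zeta> \<in> torus"
  show "laurent_poly (wavelet_mask s) \<zeta> = (\<Sum>e\<in>E01. xmon e \<zeta> *
     (if e = one3 then cnj (tau_fun s (sq \<zeta>)) else if e = compl3 s then - 60 * (1 + Phi_vec (sq \<zeta>)) else 0))"
    unfolding laurent_poly_wavelet_mask[OF t assms(3)]
    using assms(3) unfolding E01_minus_0
    by (elim insertE emptyE) (simp_all add: sum_E01 vector3_eq_iff algebra_simps)
qed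

text \<open>The sum of squares gives the lower bound. Each of the six squares is at most 16, and 1/5
  + 96/120 = 1 is the upper bound. The witness \<open>r\<close> records that \<Phi> is real on the
  torus.\<close>

lemma Phi_vec_bounds:
  assumes "\<zeta> \<in> torus"
  obtains r where "Phi_vec \<zeta> = of_real r" "1 / 5 \<le> r" "r \<le> 1"
proof -
  have n: "cmod (\<zeta> $ j) = 1" for j using assms by (simp add: torus_def)
  have b: "(cmod (1 + a + b + c))\<^sup>2 \<le> 16" if "cmod a = 1" "cmod b = 1" "cmod c = 1" for a b c
  proof -
    have "cmod (1 + a + b + c) \<le> 4"
      using norm_triangle_ineq[of "1 + a + b" c] norm_triangle_ineq[of "1 + a" b] norm_triangle_ineq[of 1 a] that by simp
    then have "(cmod (1 + a + b + c))\<^sup>2 \<le> 4\<^sup>2" by (intro power_mono) auto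
    then show ?thesis by simp
  qed
  let ?x = "\<zeta> $ 1" and ?y = "\<zeta> $ 2" and ?z = "\<zeta> $ 3"
  define S where "S = (cmod (1 + ?x + ?x * ?y + ?x * ?y * ?z))\<^sup>2 + (cmod (1 + ?x + ?x * ?z + ?x * ?y * ?z))\<^sup>2
    + (cmod (1 + ?y + ?x * ?y + ?x * ?y * ?z))\<^sup>2 + (cmod (1 + ?y + ?y * ?z + ?x * ?y * ?z))\<^sup>2
    + (cmod (1 + ?z + ?x * ?z + ?x * ?y * ?z))\<^sup>2 + (cmod (1 + ?z + ?y * ?z + ?x * ?y * ?z))\<^sup>2"
  have "0 \<le> S" unfolding S_def by (intro add_nonneg_nonneg zero_le_power2)
  moreover have "S \<le> 16 + 16 + 16 + 16 + 16 + 16"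
    unfolding S_def by (intro add_mono b) (simp_all add: norm_mult n)
  moreover have "Phi_vec \<zeta> = of_real (1 / 5 + S / 120)"
    unfolding Phi_vec_def Phi_fun_sum_of_squares[OF n n n] S_def[symmetric] by simp
  ultimately show ?thesis by (intro that[of "1 / 5 + S / 120"]) auto
qed

lemma cnj_Phi_vec: "\<zeta> \<in> torus \<Longrightarrow> cnj (Phi_vec \<zeta>) = Phi_vec \<zeta>"
  by (metis Phi_vec_bounds complex_cnj_complex_of_real)

lemma Phi_vec_nonzero:
  assumes "\<zeta> \<in> torus"
  shows "Phi_vec \<zeta> \<noteq> 0" "1 + Phi_vec \<zeta> \<noteq> 0"
proof -
  obtain r where r: "Phi_vec \<zeta> = of_real r" "1 / 5 \<le> r" using Phi_vec_bounds[OF assms] by blast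
  then show "Phi_vec \<zeta> \<noteq> 0" by auto
  have "1 + Phi_vec \<zeta> = of_real (1 + r)" by (simp add: r)
  then show "1 + Phi_vec \<zeta> \<noteq> 0" using r(2) by (simp only: of_real_eq_0_iff)
qed

lemma inner_H_H:
  assumes t: "\<zeta> \<in> torus"
  shows "(\<Sum>s\<in>E01. Phi_vec (sign_change s \<zeta>) * laurent_poly (box_mask Xi) (sign_change s \<zeta>) * cnj (laurent_poly (box_mask Xi) (sign_change s \<zeta>)))
    = Phi_vec (sq \<zeta>)"
proof -
  let ?T = "\<lambda>\<zeta>. Phi_vec \<zeta> * laurent_poly (box_mask Xi) \<zeta>"
  define c where "c e = (if e = one3 then (1 + Phi_vec (sq \<zeta>)) / 16 else tau_fun (compl3 e) (sq \<zeta>) / 960)" for e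
  have "polyphase ?T e \<zeta> * cnj (polyphase (laurent_poly (box_mask Xi)) e \<zeta>)
     = (c e / 16) * (1 + cnj (xmon (compl3 e) (sq \<zeta>)))" if "e \<in> E01" for e
  proof -
    have "polyphase ?T e \<zeta> * cnj (polyphase (laurent_poly (box_mask Xi)) e \<zeta>)
      = (xmon e \<zeta> * cnj (xmon e \<zeta>)) * ((c e / 16) * (1 + cnj (xmon (compl3 e) (sq \<zeta>))))"
      unfolding polyphase_Phi_H[OF t that] polyphase_H[OF t that] c_def[symmetric] by simp
    then show ?thesis by (simp add: xmon_mult_cnj[OF t])
  qed
  then have "(\<Sum>e\<in>E01. polyphase ?T e \<zeta> * cnj (polyphase (laurent_poly (box_mask Xi)) e \<zeta>))
     = (\<Sum>e\<in>E01. (c e / 16) * (1 + cnj (xmon (compl3 e) (sq \<zeta>))))"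
    by (intro sum.cong refl)
  also have "\<dots> = Phi_vec (sq \<zeta>) / 8"
  proof -
    let ?x = "(\<zeta> $ 1)\<^sup>2" and ?y = "(\<zeta> $ 2)\<^sup>2" and ?z = "(\<zeta> $ 3)\<^sup>2"
    have nz: "?x \<noteq> 0" "?y \<noteq> 0" "?z \<noteq> 0" using torus_nonzero[OF t] by auto
    have cn: "cnj (\<zeta> $ j) = 1 / \<zeta> $ j" for j using cnj_torus[OF t] by (simp add: inverse_eq_divide)
    \<comment> \<open>15360 = 16 * 960 clears the denominators of both components. The quotient 1920
      / 15360 = 1/8 is offset by the factor 8 in \<open>polyphase_parseval\<close>.\<close>
    have "1920 * Phi_vec (sq \<zeta>) = 15360 * (\<Sum>e\<in>E01. (c e / 16) * (1 + cnj (xmon (compl3 e) (sq \<zeta>))))"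
      unfolding Phi_vec_def vec_lambda_beta Phi_refine[OF nz, symmetric]
      by (simp add: sum_E01 c_def vector3_eq_iff tau_fun_def cn power_divide Phi_vec_def)
    then show ?thesis by simp
  qed
  finally show ?thesis
    using polyphase_parseval[of ?T \<zeta> "laurent_poly (box_mask Xi)"] by (simp add: mult.commute)
qed

text \<open>Only the classes \<open>one3\<close> and \<open>compl3 s\<close> contribute, as the mask
  has no other components. Their terms \<open>(1 + \<Phi>) / 16 * \<tau>\<close> and
  \<open>- 60 * (1 + \<Phi>) * \<tau> / 960\<close> cancel; reality of \<Phi> removes the conjugate
  from the second.\<close>

lemma inner_H_wavelet_mask:
  assumes t: "\<zeta> \<in> torus" and s: "s \<in> E01 - {0}"
  shows "(\<Sum>t\<in>E01. Phi_vec (sign_change t \<zeta>) * laurent_poly (box_mask Xi) (sign_change t \<zeta>) * cnj (laurent_poly (wavelet_mask s) (sign_change t \<zeta>))) = 0"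
proof -
  let ?T = "\<lambda>\<zeta>. Phi_vec \<zeta> * laurent_poly (box_mask Xi) \<zeta>"
  define A where "A = 1 + Phi_vec (sq \<zeta>)"
  have A: "cnj A = A" using cnj_Phi_vec[OF torus_square[OF t]] by (simp add: A_def)
  have sE: "s \<in> E01" "s \<noteq> 0" using s by auto
  have c1: "compl3 s' = one3 \<longleftrightarrow> s' = 0" "compl3 (compl3 s') = s'" if "s' \<in> E01" for s'
    using compl3_E01[OF that] compl3_E01(3)[OF that] by auto
  have inj: "compl3 s' = compl3 s \<longleftrightarrow> s' = s" if "s' \<in> E01" for s'
    using c1(2)[OF that] c1(2)[OF sE(1)] by metis
  have x: "xmon e \<zeta> * a * cnj (xmon e \<zeta> * b) = a * cnj b" for e a b
    using xmon_mult_cnj[OF t, of e] by (simp add: mult_ac)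
  have "(\<Sum>e\<in>E01. polyphase ?T e \<zeta> * cnj (polyphase (laurent_poly (wavelet_mask s)) e \<zeta>))
     = A / 16 * tau_fun s (sq \<zeta>) + (\<Sum>s'\<in>E01 - {0}. if s' = s then - 60 * A * (tau_fun s (sq \<zeta>) / 960) else 0)"
    unfolding sum_E01_compl
  proof (intro arg_cong2[where f = "(+)"] sum.cong refl)
    show "polyphase ?T one3 \<zeta> * cnj (polyphase (laurent_poly (wavelet_mask s)) one3 \<zeta>) = A / 16 * tau_fun s (sq \<zeta>)"
      unfolding polyphase_Phi_H[OF t one3_E01] polyphase_wavelet_mask[OF t one3_E01 s] x by (simp add: A_def)
    fix s' :: "nat^3" assume s': "s' \<in> E01 - {0}"
    then have s'E: "s' \<in> E01" "s' \<noteq> 0" by auto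
    show "polyphase ?T (compl3 s') \<zeta> * cnj (polyphase (laurent_poly (wavelet_mask s)) (compl3 s') \<zeta>) =
       (if s' = s then - 60 * A * (tau_fun s (sq \<zeta>) / 960) else 0)"
    proof -
      have ne: "compl3 s' \<noteq> one3" using compl3_E01(3)[OF s'E(1)] s'E(2) by blast
      show ?thesis
        unfolding polyphase_Phi_H[OF t compl3_E01(1)[OF s'E(1)]] polyphase_wavelet_mask[OF t compl3_E01(1)[OF s'E(1)] s] x
          if_not_P[OF ne] inj[OF s'E(1)] c1(2)[OF s'E(1)]
        using A by (simp add: A_def)
    qed
  qed
  also have "\<dots> = 0" using s by simp
  finally show ?thesis
    using polyphase_parseval[of ?T \<zeta> "laurent_poly (wavelet_mask s)"] by simp
qed

section \<open>The symbol \<Phi> as a finitely supported coefficient map\<close>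

definition Phi_keys :: "(int^3) set" where
  "Phi_keys = {vector [0,0,0], vector [1,1,1], vector [1,0,0], vector [0,1,0], vector [0,0,1],
     vector [-1,-1,-1], vector [-1,0,0], vector [0,-1,0], vector [0,0,-1],
     vector [1,1,0], vector [1,0,1], vector [0,1,1], vector [-1,-1,0], vector [-1,0,-1], vector [0,-1,-1]}"

definition Phi_poly :: "(int^3) \<Rightarrow>\<^sub>0 complex" where
  "Phi_poly = (\<Sum>k\<in>Phi_keys. Poly_Mapping.single k (of_real (phi_acf (k $ 1) (k $ 2) (k $ 3))))"

lemma lookup_Phi_poly: "Poly_Mapping.lookup Phi_poly k = of_real (phi_acf (k $ 1) (k $ 2) (k $ 3))"
proof -
  have fin: "finite Phi_keys" by (simp add: Phi_keys_def)
  have "Poly_Mapping.lookup Phi_poly k = (if k \<in> Phi_keys then of_real (phi_acf (k $ 1) (k $ 2) (k $ 3)) else 0)"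
    unfolding Phi_poly_def lookup_sum lookup_single when_def using fin by (rule sum.delta)
  moreover have "phi_acf (k $ 1) (k $ 2) (k $ 3) = 0" if "k \<notin> Phi_keys"
  proof -
    have "k = vector [k $ 1, k $ 2, k $ 3]" by (simp add: vec_eq_iff forall_3)
    then have "vector [k $ 1, k $ 2, k $ 3] \<notin> Phi_keys" using that by simp
    then show ?thesis
      unfolding Phi_keys_def phi_acf_def
      by (simp only: insert_iff empty_iff vector3_eq_iff prod.inject de_Morgan_disj simp_thms if_False divide_eq_0_iff)
  qed
  ultimately show ?thesis by simp
qed

lemma laurent_poly_Phi_poly:
  assumes "\<zeta> \<in> torus"
  shows "laurent_poly Phi_poly \<zeta> = Phi_vec \<zeta>"
proof -
  have "laurent_poly Phi_poly \<zeta> = (\<Sum>k\<in>Phi_keys. of_real (phi_acf (k $ 1) (k $ 2) (k $ 3)) * zpow \<zeta> k)"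
    by (simp add: Phi_poly_def laurent_poly_sum)
  also have "\<dots> = Phi_vec \<zeta>"
    using torus_nonzero[OF assms]
    by (simp add: Phi_keys_def vector3_eq_iff zpow3 phi_acf_def powi_small Phi_vec_def Phi_fun_def inverse_eq_divide add_divide_distrib)
  finally show ?thesis .
qed

lemma Phi_symbol_eq:
  assumes "is_box_spline Xi \<phi>" "\<zeta> \<in> torus"
  shows "Phi_symbol \<phi> \<zeta> = Phi_vec \<zeta>"
  using laurent_poly_Phi_poly[OF assms(2)]
  by (simp add: Phi_symbol_def laurent_poly_def autocorrelation_box_spline[OF assms(1)] lookup_Phi_poly[abs_def])

lemma Phi_inner_eq_0:
  assumes "is_box_spline Xi \<phi>" "\<zeta> \<in> torus" "s \<in> E01 - {0}"
  shows "Phi_inner \<phi> (laurent_poly (box_mask Xi)) (laurent_poly (wavelet_mask s)) \<zeta> = 0"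
  unfolding Phi_inner_def using inner_H_wavelet_mask[OF assms(2,3)]
  by (simp add: Phi_symbol_eq[OF assms(1)] sign_change_torus[OF assms(2)])

subsection \<open>The basis property\<close>

lemma has_sum_finite_sum:
  fixes f :: "'i \<Rightarrow> 'a \<Rightarrow> complex"
  assumes "finite I" "\<And>i. i \<in> I \<Longrightarrow> (f i has_sum S i) A"
  shows "((\<lambda>x. \<Sum>i\<in>I. f i x) has_sum (\<Sum>i\<in>I. S i)) A"
  using assms by (induction I rule: finite_induct) (auto intro: has_sum_add)

text \<open>Averaging over sign changes annihilates every exponent with an odd coordinate and keeps
  the others. What survives is indexed by \<open>2 k\<close>, hence a series in \<zeta>^2 whose
  coefficients form a subfamily of a summable one.\<close>

lemma Laurent_l1_down_polyphase_0:
  assumes "F \<in> Laurent_l1"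
  shows "polyphase F 0 \<in> Laurent_l1_down"
proof -
  obtain a where a: "(\<lambda>k. cmod (a k)) summable_on UNIV" "\<And>\<zeta>. \<zeta> \<in> torus \<Longrightarrow> F \<zeta> = laurent_series a \<zeta>"
    using assms by (auto simp: Laurent_l1_def)
  let ?d = "\<lambda>k::int^3. \<chi> j. 2 * k $ j"
  have inj: "inj ?d" by (rule injI) (simp add: vec_eq_iff)
  show ?thesis
  proof (rule Laurent_l1_downI)
    have "(\<lambda>k. cmod (a k)) summable_on range ?d"
      using a(1) by (rule summable_on_subset_banach) simp
    then have s: "(\<lambda>k. cmod (a (?d k))) summable_on UNIV"
      using summable_on_reindex[OF inj, of "\<lambda>k. cmod (a k)"] by (simp add: o_def)
    then show "laurent_series (\<lambda>k. a (?d k)) \<in> Laurent_l1"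
      by (rule Laurent_l1I) simp
    fix \<zeta> :: "complex^3" assume t: "\<zeta> \<in> torus"
    define \<epsilon> where "\<epsilon> s k = zpow (sign_change s (\<chi> j. 1)) k" for s and k :: "int^3"
    have z: "zpow (sign_change s \<zeta>) k = \<epsilon> s k * zpow \<zeta> k" for s k
      by (simp add: zpow_def \<epsilon>_def sign_change_def power_int_mult_distrib prod.distrib)
    have \<epsilon>: "(\<Sum>s\<in>E01. \<epsilon> s k) = (if k \<in> range ?d then 8 else 0)" for k
    proof -
      have r: "k \<in> range ?d \<longleftrightarrow> even (k $ 1) \<and> even (k $ 2) \<and> even (k $ 3)"
      proof
        assume "even (k $ 1) \<and> even (k $ 2) \<and> even (k $ 3)"
        then have "k = ?d (\<chi> j. k $ j div 2)" by (simp add: vec_eq_iff forall_3)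
        then show "k \<in> range ?d" by blast
      qed auto
      have p: "(-1 :: complex) powi n = (if even n then 1 else -1)" for n :: int
        by (simp add: power_int_minus_left)
      show ?thesis
        unfolding r by (simp add: sum_E01 \<epsilon>_def zpow3 sign_change_def p)
    qed
    have "((\<lambda>k. (\<Sum>s\<in>E01. a k * zpow (sign_change s \<zeta>) k)) has_sum (\<Sum>s\<in>E01. F (sign_change s \<zeta>))) UNIV"
      using laurent_series_has_sum(1)[OF a(1) sign_change_torus[OF t]] a(2)[OF sign_change_torus[OF t]]
      by (intro has_sum_finite_sum) auto
    moreover have "(\<Sum>s\<in>E01. a k * zpow (sign_change s \<zeta>) k) = (if k \<in> range ?d then 8 * (a k * zpow \<zeta> k) else 0)" for k
    proof -
      have "(\<Sum>s\<in>E01. a k * zpow (sign_change s \<zeta>) k) = (\<Sum>s\<in>E01. \<epsilon> s k) * (a k * zpow \<zeta> k)"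
        by (simp add: z sum_distrib_left sum_distrib_right mult_ac)
      then show ?thesis by (simp add: \<epsilon>)
    qed
    ultimately have "((\<lambda>k. if k \<in> range ?d then 8 * (a k * zpow \<zeta> k) else 0) has_sum (\<Sum>s\<in>E01. F (sign_change s \<zeta>))) UNIV"
      by simp
    then have "((\<lambda>k. 8 * (a k * zpow \<zeta> k)) has_sum (\<Sum>s\<in>E01. F (sign_change s \<zeta>))) (range ?d)"
      by (rule has_sum_cong_neutral[THEN iffD1, rotated -1]) auto
    then have h1: "((\<lambda>k. 8 * (a (?d k) * zpow \<zeta> (?d k))) has_sum (\<Sum>s\<in>E01. F (sign_change s \<zeta>))) UNIV"
      using has_sum_reindex[OF inj, of "\<lambda>k. 8 * (a k * zpow \<zeta> k)"] by (simp add: o_def)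
    have zd: "zpow \<zeta> (?d k) = zpow (sq \<zeta>) k" for k
      by (simp add: zpow_def power_int_mult[symmetric] power_int_mult)
    have "((\<lambda>k. 8 * (a (?d k) * zpow \<zeta> (?d k))) has_sum 8 * laurent_series (\<lambda>k. a (?d k)) (sq \<zeta>)) UNIV"
      unfolding zd by (intro has_sum_cmult_right laurent_series_has_sum(1)[OF s torus_square[OF t]])
    from has_sum_unique[OF h1 this]
    show "polyphase F 0 \<zeta> = laurent_series (\<lambda>k. a (?d k)) (sq \<zeta>)"
      by (simp add: polyphase_def parity_char_def)
  qed
qed

text \<open>Multiplication by the inverse monomial moves the class of \<open>e\<close> to the even
  class, where \<open>Laurent_l1_down_polyphase_0\<close> applies.\<close>

lemma Laurent_l1_down_polyphase:
  assumes "F \<in> Laurent_l1"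
  shows "(\<lambda>\<zeta>. polyphase F e \<zeta> / xmon e \<zeta>) \<in> Laurent_l1_down"
proof -
  let ?M = "laurent_poly (lmon (- int (e $ 1)) (- int (e $ 2)) (- int (e $ 3)))"
  have M: "?M \<zeta> = 1 / xmon e \<zeta>" for \<zeta>
    by (simp add: laurent_poly_lmon xmon_def power_int_minus inverse_eq_divide)
  have "polyphase (\<lambda>\<zeta>. F \<zeta> * ?M \<zeta>) 0 \<in> Laurent_l1_down"
    by (intro Laurent_l1_down_polyphase_0 Laurent_l1_mult assms laurent_poly_in_Laurent_l1)
  moreover have "polyphase (\<lambda>\<zeta>. F \<zeta> * ?M \<zeta>) 0 = (\<lambda>\<zeta>. polyphase F e \<zeta> / xmon e \<zeta>)"
  proof
    fix \<zeta>
    have "parity_char s 0 * (F (sign_change s \<zeta>) * ?M (sign_change s \<zeta>)) = parity_char s e * F (sign_change s \<zeta>) / xmon e \<zeta>" for s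
      unfolding M xmon_sign_change by (auto simp: parity_char_def minus_one_power_iff)
    then show "polyphase (\<lambda>\<zeta>. F \<zeta> * ?M \<zeta>) 0 \<zeta> = polyphase F e \<zeta> / xmon e \<zeta>"
      by (simp add: polyphase_def sum_divide_distrib mult.commute)
  qed
  ultimately show ?thesis by simp
qed

lemma inverse_Phi_down:
  shows "(\<lambda>\<zeta>. 1 / Phi_vec (sq \<zeta>)) \<in> Laurent_l1_down"
    and "(\<lambda>\<zeta>. 1 / (- 60 * (1 + Phi_vec (sq \<zeta>)))) \<in> Laurent_l1_down"
proof -
  have "(\<lambda>\<zeta>. 1 / laurent_poly Phi_poly \<zeta>) \<in> Laurent_l1"
  proof (rule wiener_laurent_poly[of "4 / 5"])
    fix \<zeta> :: "complex^3" assume t: "\<zeta> \<in> torus"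
    obtain r where r: "Phi_vec \<zeta> = of_real r" "1 / 5 \<le> r" "r \<le> 1" using Phi_vec_bounds[OF t] by blast
    have "1 - laurent_poly Phi_poly \<zeta> = of_real (1 - r)" by (simp add: laurent_poly_Phi_poly[OF t] r)
    then show "norm (1 - laurent_poly Phi_poly \<zeta>) \<le> 4 / 5" using r by (simp only: norm_of_real)
  qed auto
  then show "(\<lambda>\<zeta>. 1 / Phi_vec (sq \<zeta>)) \<in> Laurent_l1_down"
    by (rule Laurent_l1_downI) (simp add: laurent_poly_Phi_poly torus_square)
  \<comment> \<open>The values of 1 + \<Phi> lie between 6/5 and 2, possibly at distance 1 from 1.
    Halving brings them between 3/5 and 1, where the Neumann series converges.\<close>
  let ?P = "Poly_Mapping.single 0 (1 / 2) * (1 + Phi_poly)"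
  have P: "laurent_poly ?P \<zeta> = (1 + Phi_vec \<zeta>) / 2" if "\<zeta> \<in> torus" for \<zeta>
    using that by (simp add: laurent_poly_mult laurent_poly_Phi_poly)
  have "(\<lambda>\<zeta>. 1 / laurent_poly ?P \<zeta>) \<in> Laurent_l1"
  proof (rule wiener_laurent_poly[of "4 / 5"])
    fix \<zeta> :: "complex^3" assume t: "\<zeta> \<in> torus"
    obtain r where r: "Phi_vec \<zeta> = of_real r" "1 / 5 \<le> r" "r \<le> 1" using Phi_vec_bounds[OF t] by blast
    have "1 - laurent_poly ?P \<zeta> = of_real ((1 - r) / 2)" unfolding P[OF t] by (simp add: r field_simps)
    then have "norm (1 - laurent_poly ?P \<zeta>) = \<bar>(1 - r) / 2\<bar>" by (simp only: norm_of_real)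
    then show "norm (1 - laurent_poly ?P \<zeta>) \<le> 4 / 5" using r(2,3) by simp
  qed auto
  then have "(\<lambda>\<zeta>. laurent_poly (Poly_Mapping.single 0 (- 1 / 120)) \<zeta> * (1 / laurent_poly ?P \<zeta>)) \<in> Laurent_l1"
    by (intro Laurent_l1_mult laurent_poly_in_Laurent_l1)
  then show "(\<lambda>\<zeta>. 1 / (- 60 * (1 + Phi_vec (sq \<zeta>)))) \<in> Laurent_l1_down"
  proof (rule Laurent_l1_downI)
    fix \<zeta> :: "complex^3" assume "\<zeta> \<in> torus"
    then have q: "sq \<zeta> \<in> torus" by (rule torus_square)
    have "1 / (- 60 * a) = - 1 / 120 * (1 / (a / 2))" for a :: complex
      by (cases "a = 0") (simp_all add: field_simps)
    then show "1 / (- 60 * (1 + Phi_vec (sq \<zeta>))) = laurent_poly (Poly_Mapping.single 0 (- 1 / 120)) (sq \<zeta>) * (1 / laurent_poly ?P (sq \<zeta>))"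
      unfolding P[OF q] laurent_poly_single zpow_0 mult_1_right .
  qed
qed

abbreviation (input) basis_mask :: "nat^3 \<Rightarrow> ((int^3) \<Rightarrow>\<^sub>0 complex)" where
  "basis_mask s \<equiv> (if s = 0 then box_mask Xi else wavelet_mask s)"

lemma sum_E01_0: "(\<Sum>s\<in>E01. f s) = f 0 + (\<Sum>s\<in>E01 - {0}. f s)" for f :: "nat^3 \<Rightarrow> complex"
  by (rule sum.remove) auto

text \<open>Coefficients invariant under sign changes leave the sum, after which orthogonality keeps
  \<open>i = 0\<close> only. The conjugate appears because the form is conjugate linear in its
  second argument.\<close>

lemma inner_H_combination:
  assumes t: "\<zeta> \<in> torus" and ev: "\<And>i s. i \<in> E01 \<Longrightarrow> s \<in> E01 \<Longrightarrow> G i (sign_change s \<zeta>) = G i \<zeta>"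
  shows "(\<Sum>s\<in>E01. Phi_vec (sign_change s \<zeta>) * laurent_poly (box_mask Xi) (sign_change s \<zeta>) *
      cnj (\<Sum>i\<in>E01. G i (sign_change s \<zeta>) * laurent_poly (basis_mask i) (sign_change s \<zeta>))) = cnj (G 0 \<zeta>) * Phi_vec (sq \<zeta>)"
proof -
  let ?T = "\<lambda>s. Phi_vec (sign_change s \<zeta>) * laurent_poly (box_mask Xi) (sign_change s \<zeta>)"
  have "(\<Sum>s\<in>E01. ?T s * cnj (\<Sum>i\<in>E01. G i (sign_change s \<zeta>) * laurent_poly (basis_mask i) (sign_change s \<zeta>)))
    = (\<Sum>s\<in>E01. \<Sum>i\<in>E01. cnj (G i \<zeta>) * (?T s * cnj (laurent_poly (basis_mask i) (sign_change s \<zeta>))))"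
    by (intro sum.cong refl) (simp add: ev sum_distrib_left mult_ac cong: sum.cong)
  also have "\<dots> = (\<Sum>i\<in>E01. cnj (G i \<zeta>) * (\<Sum>s\<in>E01. ?T s * cnj (laurent_poly (basis_mask i) (sign_change s \<zeta>))))"
    by (subst sum.swap) (simp add: sum_distrib_left)
  also have "\<dots> = cnj (G 0 \<zeta>) * Phi_vec (sq \<zeta>)"
    unfolding sum_E01_0[of "\<lambda>i. cnj (G i \<zeta>) * _ i"] using inner_H_H[OF t] inner_H_wavelet_mask[OF t] by simp
  finally show ?thesis .
qed

text \<open>Among the wavelet masks only that of index \<open>s\<close> has a component in the class
  \<open>compl3 s\<close>, so a combination reveals \<open>G s\<close> there.\<close>

lemma polyphase_combination:
  assumes t: "\<zeta> \<in> torus" and ev: "\<And>i s. i \<in> E01 \<Longrightarrow> s \<in> E01 \<Longrightarrow> G i (sign_change s \<zeta>) = G i \<zeta>" and s: "s \<in> E01 - {0}"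
  shows "polyphase (\<lambda>\<zeta>. \<Sum>i\<in>E01 - {0}. G i \<zeta> * laurent_poly (wavelet_mask i) \<zeta>) (compl3 s) \<zeta>
    = G s \<zeta> * (xmon (compl3 s) \<zeta> * (- 60 * (1 + Phi_vec (sq \<zeta>))))"
proof -
  have sE: "s \<in> E01" "s \<noteq> 0" "compl3 s \<noteq> one3" using s compl3_E01(3) by auto
  have "polyphase (\<lambda>\<zeta>. \<Sum>i\<in>E01 - {0}. G i \<zeta> * laurent_poly (wavelet_mask i) \<zeta>) (compl3 s) \<zeta>
    = (\<Sum>i\<in>E01 - {0}. G i \<zeta> * polyphase (laurent_poly (wavelet_mask i)) (compl3 s) \<zeta>)"
    unfolding polyphase_sum_fun by (intro sum.cong refl polyphase_mult_even) (simp add: ev)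
  also have "\<dots> = (\<Sum>i\<in>E01 - {0}. if i = s then G s \<zeta> * (xmon (compl3 s) \<zeta> * (- 60 * (1 + Phi_vec (sq \<zeta>)))) else 0)"
  proof (intro sum.cong refl)
    fix i :: "nat^3" assume i: "i \<in> E01 - {0}"
    have "compl3 s = compl3 i \<longleftrightarrow> i = s" using i sE compl3_E01(2) by (metis DiffD1)
    then show "G i \<zeta> * polyphase (laurent_poly (wavelet_mask i)) (compl3 s) \<zeta> =
       (if i = s then G s \<zeta> * (xmon (compl3 s) \<zeta> * (- 60 * (1 + Phi_vec (sq \<zeta>)))) else 0)"
      unfolding polyphase_wavelet_mask[OF t compl3_E01(1)[OF sE(1)] i] using sE by simp
  qed
  also have "\<dots> = G s \<zeta> * (xmon (compl3 s) \<zeta> * (- 60 * (1 + Phi_vec (sq \<zeta>))))"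
    using s by simp
  finally show ?thesis .
qed

lemma Laurent_l1_down_add:
  assumes "F \<in> Laurent_l1_down" "G \<in> Laurent_l1_down"
  shows "(\<lambda>\<zeta>. F \<zeta> + G \<zeta>) \<in> Laurent_l1_down"
proof -
  obtain F' G' where "F' \<in> Laurent_l1" "\<And>\<zeta>. \<zeta> \<in> torus \<Longrightarrow> F \<zeta> = F' (\<chi> j. (\<zeta> $ j)\<^sup>2)"
    "G' \<in> Laurent_l1" "\<And>\<zeta>. \<zeta> \<in> torus \<Longrightarrow> G \<zeta> = G' (\<chi> j. (\<zeta> $ j)\<^sup>2)"
    using assms by (auto simp: Laurent_l1_down_def)
  then show ?thesis
    by (intro Laurent_l1_downI[of "\<lambda>\<zeta>. F' \<zeta> + G' \<zeta>"] Laurent_l1_add) auto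
qed

lemma Laurent_l1_down_diff:
  assumes "F \<in> Laurent_l1_down" "G \<in> Laurent_l1_down"
  shows "(\<lambda>\<zeta>. F \<zeta> - G \<zeta>) \<in> Laurent_l1_down"
proof -
  have "(\<lambda>\<zeta>. laurent_poly (- 1) \<zeta>) \<in> Laurent_l1_down"
    by (rule Laurent_l1_downI[OF laurent_poly_in_Laurent_l1[of "-1"]]) simp
  from Laurent_l1_down_add[OF assms(1) Laurent_l1_down_mult[OF this assms(2)]]
  show ?thesis by simp
qed

lemma polyphase_eq_0_imp:
  assumes "\<And>e. e \<in> E01 \<Longrightarrow> polyphase F e \<zeta> = 0"
  shows "F \<zeta> = 0"
  using polyphase_sum[of 0 F \<zeta>] assms by simp

lemma masks_span:
  assumes F: "F \<in> Laurent_l1"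
  obtains G where "\<And>i. i \<in> E01 \<Longrightarrow> G i \<in> Laurent_l1_down"
    "\<And>\<zeta>. \<zeta> \<in> torus \<Longrightarrow> F \<zeta> = (\<Sum>i\<in>E01. G i \<zeta> * laurent_poly (basis_mask i) \<zeta>)"
proof -
  let ?H = "laurent_poly (box_mask Xi)"
  \<comment> \<open>The factor 8 undoes the averaging in \<open>polyphase\<close>, so that the even
    component of \<open>K\<close> is the full sum that defines \<langle>F, H\<rangle>.\<close>
  define K where "K \<zeta> = F \<zeta> * laurent_poly (Poly_Mapping.single 0 8 * (Phi_poly * laurent_star (box_mask Xi))) \<zeta>" for \<zeta>
  define G0 where "G0 \<zeta> = polyphase K 0 \<zeta> * (1 / Phi_vec (sq \<zeta>))" for \<zeta>
    \<comment> \<open>this is \<open>\<langle>F, H\<rangle>\<^sub>\<Phi> / \<langle>H, H\<rangle>\<^sub>\<Phi>\<close>\<close>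
  define Gs where "Gs s \<zeta> = (polyphase F (compl3 s) \<zeta> / xmon (compl3 s) \<zeta> - G0 \<zeta> * (polyphase ?H (compl3 s) \<zeta> / xmon (compl3 s) \<zeta>))
     * (1 / (- 60 * (1 + Phi_vec (sq \<zeta>))))" for s \<zeta>
  define G where "G i = (if i = 0 then G0 else Gs i)" for i
  have K: "K \<in> Laurent_l1"
    unfolding K_def[abs_def] by (intro Laurent_l1_mult F laurent_poly_in_Laurent_l1)
  have G0: "G0 \<in> Laurent_l1_down"
    unfolding G0_def[abs_def] by (intro Laurent_l1_down_mult Laurent_l1_down_polyphase_0 K inverse_Phi_down)
  have Gs: "Gs s \<in> Laurent_l1_down" for s
    unfolding Gs_def[abs_def]
    by (intro Laurent_l1_down_mult[OF Laurent_l1_down_diff[OF _ Laurent_l1_down_mult] inverse_Phi_down(2)]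
        Laurent_l1_down_polyphase F G0 laurent_poly_in_Laurent_l1)
  have G: "G i \<in> Laurent_l1_down" for i by (simp add: G_def G0 Gs)
  have main: "F \<zeta> = (\<Sum>i\<in>E01. G i \<zeta> * laurent_poly (basis_mask i) \<zeta>)" if t: "\<zeta> \<in> torus" for \<zeta>
  proof -
    have ev: "G i (sign_change s \<zeta>) = G i \<zeta>" for i s
      by (rule Laurent_l1_down_even[OF G t])
    have ev0: "G0 (sign_change s \<zeta>) = G0 \<zeta>" for s
      by (rule Laurent_l1_down_even[OF G0 t])
    note tq = torus_square[OF t]
    let ?W = "\<lambda>\<zeta>. \<Sum>i\<in>E01 - {0}. G i \<zeta> * laurent_poly (wavelet_mask i) \<zeta>"
    define Q where "Q \<zeta> = F \<zeta> - G0 \<zeta> * ?H \<zeta> - ?W \<zeta>" for \<zeta>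
    have sumG: "(\<Sum>i\<in>E01. G i \<zeta> * laurent_poly (basis_mask i) \<zeta>) = G0 \<zeta> * ?H \<zeta> + ?W \<zeta>" for \<zeta>
      unfolding sum_E01_0 by (simp add: G_def)
    have ppQ: "polyphase Q e \<zeta> = polyphase F e \<zeta> - G0 \<zeta> * polyphase ?H e \<zeta> - polyphase ?W e \<zeta>" for e
      unfolding Q_def[abs_def] polyphase_diff by (simp add: polyphase_mult_even[of G0, OF ev0])
    have Q0: "polyphase Q e \<zeta> = 0" if e: "e \<in> E01" "e \<noteq> one3" for e
    proof -
      define s where "s = compl3 e"
      have s: "s \<in> E01 - {0}" "compl3 s = e"
        using e compl3_E01[of e] compl3_E01(3)[of "compl3 e"] by (auto simp: s_def)
      have x: "xmon (compl3 s) \<zeta> \<noteq> 0" by (rule xmon_nonzero[OF t])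
      have A: "1 + Phi_vec (sq \<zeta>) \<noteq> 0" by (rule Phi_vec_nonzero[OF tq])
      have "Gs s \<zeta> * (xmon (compl3 s) \<zeta> * (- 60 * (1 + Phi_vec (sq \<zeta>)))) = polyphase F (compl3 s) \<zeta> - G0 \<zeta> * polyphase ?H (compl3 s) \<zeta>"
      proof -
        have "(p / x - g * (h / x)) * (1 / B) * (x * B) = p - g * h" if "x \<noteq> 0" "B \<noteq> 0" for p x g h B :: complex
          using that by (simp add: field_simps)
        moreover have "- 60 * (1 + Phi_vec (sq \<zeta>)) \<noteq> 0" using A by (simp only: mult_eq_0_iff) simp
        ultimately show ?thesis unfolding Gs_def using x by blast
      qed
      then show ?thesis
        using s polyphase_combination[where G = G, OF t ev s(1)] unfolding ppQ by (simp add: G_def)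
    qed
    have "(\<Sum>s\<in>E01. Phi_vec (sign_change s \<zeta>) * ?H (sign_change s \<zeta>) * cnj (Q (sign_change s \<zeta>))) = 0"
    proof -
      have a: "(\<Sum>s\<in>E01. Phi_vec (sign_change s \<zeta>) * ?H (sign_change s \<zeta>) * cnj (F (sign_change s \<zeta>))) = cnj (G0 \<zeta>) * Phi_vec (sq \<zeta>)"
      proof -
        have "cnj (polyphase K 0 \<zeta>) = (\<Sum>s\<in>E01. Phi_vec (sign_change s \<zeta>) * ?H (sign_change s \<zeta>) * cnj (F (sign_change s \<zeta>)))"
          unfolding polyphase_def K_def using sign_change_torus[OF t]
          by (simp add: parity_char_def laurent_poly_mult laurent_poly_star laurent_poly_Phi_poly cnj_Phi_vec sum_divide_distrib mult_ac)
        then show ?thesis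
          using Phi_vec_nonzero(1)[OF tq] cnj_Phi_vec[OF tq] by (simp add: G0_def)
      qed
      have b: "(\<Sum>s\<in>E01. Phi_vec (sign_change s \<zeta>) * ?H (sign_change s \<zeta>) *
          cnj (G0 (sign_change s \<zeta>) * ?H (sign_change s \<zeta>) + ?W (sign_change s \<zeta>))) = cnj (G0 \<zeta>) * Phi_vec (sq \<zeta>)"
        using inner_H_combination[where G = G, OF t ev] unfolding sumG by (simp add: G_def)
      have "Phi_vec (sign_change s \<zeta>) * ?H (sign_change s \<zeta>) * cnj (Q (sign_change s \<zeta>)) =
         Phi_vec (sign_change s \<zeta>) * ?H (sign_change s \<zeta>) * cnj (F (sign_change s \<zeta>))
         - Phi_vec (sign_change s \<zeta>) * ?H (sign_change s \<zeta>) * cnj (G0 (sign_change s \<zeta>) * ?H (sign_change s \<zeta>) + ?W (sign_change s \<zeta>))" for s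
        unfolding Q_def complex_cnj_diff complex_cnj_add by (simp add: algebra_simps)
      then show ?thesis by (simp only: sum_subtractf a b) simp
    qed
    then have "(\<Sum>e\<in>E01. polyphase (\<lambda>\<zeta>. Phi_vec \<zeta> * ?H \<zeta>) e \<zeta> * cnj (polyphase Q e \<zeta>)) = 0"
      using polyphase_parseval[of "\<lambda>\<zeta>. Phi_vec \<zeta> * ?H \<zeta>" \<zeta> Q] by simp
    moreover have "(\<Sum>e\<in>E01. polyphase (\<lambda>\<zeta>. Phi_vec \<zeta> * ?H \<zeta>) e \<zeta> * cnj (polyphase Q e \<zeta>))
      = polyphase (\<lambda>\<zeta>. Phi_vec \<zeta> * ?H \<zeta>) one3 \<zeta> * cnj (polyphase Q one3 \<zeta>)"
      by (subst sum.remove[OF finite_E01 one3_E01]) (simp add: Q0)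
    moreover have "polyphase (\<lambda>\<zeta>. Phi_vec \<zeta> * ?H \<zeta>) one3 \<zeta> \<noteq> 0"
      unfolding polyphase_Phi_H[OF t one3_E01] using xmon_nonzero[OF t, of one3] Phi_vec_nonzero(2)[OF tq] by simp
    ultimately have Q1: "polyphase Q one3 \<zeta> = 0"
      by simp
    have "Q \<zeta> = 0"
    proof (rule polyphase_eq_0_imp)
      fix e :: "nat^3" assume e: "e \<in> E01"
      show "polyphase Q e \<zeta> = 0"
      proof (cases "e = one3")
        case True
        then show ?thesis by (simp only: Q1)
      qed (rule Q0[OF e])
    qed
    then show ?thesis unfolding sumG by (simp only: Q_def diff_diff_eq right_minus_eq)
  qed
  show ?thesis by (rule that[of G]) (auto intro: G main)
qed

theorem is_Laurent_basis_masks: "is_Laurent_basis E01 (\<lambda>s. laurent_poly (basis_mask s))"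
  unfolding is_Laurent_basis_def
proof (intro conjI ballI allI impI)
  fix F :: "complex^3 \<Rightarrow> complex" assume "F \<in> Laurent_l1"
  then obtain G where "\<And>i. i \<in> E01 \<Longrightarrow> G i \<in> Laurent_l1_down"
    "\<And>\<zeta>. \<zeta> \<in> torus \<Longrightarrow> F \<zeta> = (\<Sum>i\<in>E01. G i \<zeta> * laurent_poly (basis_mask i) \<zeta>)"
    by (rule masks_span) (rule that, assumption+)
  then show "\<exists>G. (\<forall>i\<in>E01. G i \<in> Laurent_l1_down) \<and> (\<forall>\<zeta>\<in>torus. F \<zeta> = (\<Sum>i\<in>E01. G i \<zeta> * laurent_poly (basis_mask i) \<zeta>))"
    by (intro exI[of _ G]) simp
next
  fix G :: "nat^3 \<Rightarrow> complex^3 \<Rightarrow> complex" and i :: "nat^3" and \<zeta> :: "complex^3"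
  assume G: "(\<forall>i\<in>E01. G i \<in> Laurent_l1_down) \<and> (\<forall>\<zeta>\<in>torus. (\<Sum>i\<in>E01. G i \<zeta> * laurent_poly (basis_mask i) \<zeta>) = 0)"
    and i: "i \<in> E01" and t: "\<zeta> \<in> torus"
  have ev: "G i (sign_change s \<zeta>) = G i \<zeta>" if "i \<in> E01" for i s
    using G that t by (intro Laurent_l1_down_even) auto
  have z: "(\<Sum>i\<in>E01. G i (sign_change s \<zeta>) * laurent_poly (basis_mask i) (sign_change s \<zeta>)) = 0" for s
    using G sign_change_torus[OF t] by blast
  have "cnj (G 0 \<zeta>) * Phi_vec (sq \<zeta>) = 0"
    using inner_H_combination[where G = G, OF t ev] unfolding z by simp
  then have G0: "G 0 \<zeta> = 0" using Phi_vec_nonzero(1)[OF torus_square[OF t]] by simp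
  show "G i \<zeta> = 0"
  proof (cases "i = 0")
    case False
    then have i0: "i \<in> E01 - {0}" using i by simp
    have "(\<Sum>i\<in>E01 - {0}. G i (sign_change s \<zeta>) * laurent_poly (wavelet_mask i) (sign_change s \<zeta>)) = 0" if "s \<in> E01" for s
      using z[of s] unfolding sum_E01_0 using ev[OF zero_E01, of s] G0 by simp
    then have "polyphase (\<lambda>\<zeta>. \<Sum>i\<in>E01 - {0}. G i \<zeta> * laurent_poly (wavelet_mask i) \<zeta>) (compl3 i) \<zeta> = 0"
      unfolding polyphase_def by simp
    then show ?thesis
      using polyphase_combination[where G = G, OF t ev i0] xmon_nonzero[OF t, of "compl3 i"] Phi_vec_nonzero(2)[OF torus_square[OF t]]
      by (auto simp: add_eq_0_iff)
  qed (use G0 in simp)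
qed (auto intro: laurent_poly_in_Laurent_l1)

section \<open>Integer translates of the box spline\<close>

text \<open>For the box spline this is the function whose mask is the Laurent polynomial
  \<open>P\<close>, see \<open>has_mask_shift_sum\<close>.\<close>

definition shift_sum :: "(real^'d::finite \<Rightarrow> complex) \<Rightarrow> ((int^'d) \<Rightarrow>\<^sub>0 complex) \<Rightarrow> real^'d \<Rightarrow> complex" where
  "shift_sum \<phi> P x = (\<Sum>k\<in>Poly_Mapping.keys P. Poly_Mapping.lookup P k * \<phi> (x - int_point k))"

lemma int_point_0 [simp]: "int_point 0 = 0"
  and int_point_add: "int_point (k + l) = int_point k + int_point l"
  and int_point_diff: "int_point (k - l) = int_point k - int_point l"
  by (simp_all add: int_point_def vec_eq_iff)

lemma shift_sum_eq:
  assumes "finite K" "Poly_Mapping.keys P \<subseteq> K"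
  shows "shift_sum \<phi> P x = (\<Sum>k\<in>K. Poly_Mapping.lookup P k * \<phi> (x - int_point k))"
  unfolding shift_sum_def using assms by (intro sum.mono_neutral_left) (auto simp: in_keys_iff)

lemma shift_sum_add: "shift_sum \<phi> (P + Q) x = shift_sum \<phi> P x + shift_sum \<phi> Q x"
proof -
  let ?K = "Poly_Mapping.keys P \<union> Poly_Mapping.keys Q"
  have "shift_sum \<phi> P x = (\<Sum>k\<in>?K. Poly_Mapping.lookup P k * \<phi> (x - int_point k))"
    "shift_sum \<phi> Q x = (\<Sum>k\<in>?K. Poly_Mapping.lookup Q k * \<phi> (x - int_point k))"
    "shift_sum \<phi> (P + Q) x = (\<Sum>k\<in>?K. Poly_Mapping.lookup (P + Q) k * \<phi> (x - int_point k))"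
    by (intro shift_sum_eq; use keys_add[of P Q] in simp)+
  then show ?thesis by (simp add: lookup_add distrib_right sum.distrib)
qed

lemma shift_sum_0 [simp]: "shift_sum \<phi> 0 x = 0"
  by (simp add: shift_sum_def)

lemma shift_sum_sum: "shift_sum \<phi> (\<Sum>i\<in>A. P i) x = (\<Sum>i\<in>A. shift_sum \<phi> (P i) x)"
  by (induction A rule: infinite_finite_induct) (auto simp: shift_sum_add)

lemma shift_sum_single: "shift_sum \<phi> (Poly_Mapping.single k c) x = c * \<phi> (x - int_point k)"
  using shift_sum_eq[of "{k}" "Poly_Mapping.single k c"] by (auto split: if_splits)

lemma shift_sum_uminus: "shift_sum \<phi> (- P) x = - shift_sum \<phi> P x"
  using shift_sum_add[of \<phi> P "- P" x] by (simp add: add_eq_0_iff)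

lemma shift_sum_diff: "shift_sum \<phi> (P - Q) x = shift_sum \<phi> P x - shift_sum \<phi> Q x"
  using shift_sum_add[of \<phi> P "- Q" x] by (simp add: shift_sum_uminus)

lemma shift_sum_mult_single:
  "shift_sum \<phi> (Poly_Mapping.single k c * P) x = c * shift_sum \<phi> P (x - int_point k)"
proof -
  have "Poly_Mapping.single k c * P = (\<Sum>l\<in>Poly_Mapping.keys P. Poly_Mapping.single (k + l) (c * Poly_Mapping.lookup P l))"
    by (subst poly_mapping_sum_single[of P, symmetric]) (simp add: sum_distrib_left mult_single)
  then show ?thesis
    by (simp only: shift_sum_sum shift_sum_single int_point_add shift_sum_def[of _ P] sum_distrib_left diff_diff_eq mult.assoc)
qed

lemma integrable_shift:
  assumes "integrable lborel (\<phi> :: real^'d::finite \<Rightarrow> complex)"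
  shows "integrable lborel (\<lambda>x. \<phi> (x - a))"
  using integrable_lborel_affine[OF assms, of 1 "- a"] by simp

lemma integrable_shift_sum:
  assumes "integrable lborel \<phi>"
  shows "integrable lborel (shift_sum \<phi> P)"
  unfolding shift_sum_def[abs_def] by (intro Bochner_Integration.integrable_sum integrable_mult_right integrable_shift assms)

lemma fourier_shift:
  assumes i: "integrable lborel (\<phi> :: real^'d::finite \<Rightarrow> complex)"
  shows "fourier (\<lambda>x. \<phi> (x - int_point k)) u = zpow (torus_point u) k * fourier \<phi> u"
proof -
  have [measurable]: "\<phi> \<in> borel_measurable borel" using borel_measurable_integrable[OF i] by simp
  have "fourier (\<lambda>x. \<phi> (x - int_point k)) u = (LINT x|lborel. \<phi> x * exp (- \<i> * of_real (u \<bullet> (int_point k + x))))"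
    unfolding fourier_def by (subst integral_lborel_affine[where c = 1 and t = "int_point k"]) auto
  also have "\<dots> = (LINT x|lborel. zpow (torus_point u) k * (\<phi> x * exp (- \<i> * of_real (u \<bullet> x))))"
    unfolding zpow_torus_point inner_add_right
    by (intro Bochner_Integration.integral_cong refl) (simp add: distrib_left exp_add exp_diff exp_minus field_simps)
  finally show ?thesis by (simp add: fourier_def)
qed

lemma fourier_shift_sum:
  assumes i: "integrable lborel \<phi>"
  shows "fourier (shift_sum \<phi> P) u = laurent_poly P (torus_point u) * fourier \<phi> u"
proof -
  have "fourier (shift_sum \<phi> P) u = (LINT x|lborel. (\<Sum>k\<in>Poly_Mapping.keys P. Poly_Mapping.lookup P k * (\<phi> (x - int_point k) * exp (- \<i> * of_real (u \<bullet> x)))))"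
    unfolding fourier_def shift_sum_def by (simp only: sum_distrib_right mult.assoc)
  also have "\<dots> = (\<Sum>k\<in>Poly_Mapping.keys P. Poly_Mapping.lookup P k * fourier (\<lambda>x. \<phi> (x - int_point k)) u)"
    unfolding fourier_def
    by (subst Bochner_Integration.integral_sum)
       (auto intro!: integrable_mult_right integrable_fourier_integrand[simplified] integrable_shift i)
  also have "\<dots> = laurent_poly P (torus_point u) * fourier \<phi> u"
    by (simp add: fourier_shift[OF i] laurent_poly_eq_sum[OF finite_keys order_refl] sum_distrib_right mult.assoc)
  finally show ?thesis .
qed

lemma box_spline_AE_bound:
  assumes "is_box_spline Xi \<phi>"
  shows "AE x in lborel. norm (\<phi> x) \<le> 1"
  using is_box_spline_unique[OF assms is_box_spline_PL_box] by eventually_elim (simp add: norm_PL_box_le)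

lemma box_spline_measurable:
  assumes "is_box_spline Xi \<phi>"
  shows "integrable lborel \<phi>" "\<phi> \<in> borel_measurable borel"
  using assms borel_measurable_integrable[of lborel \<phi>] by (auto simp: is_box_spline_def)

text \<open>Since \<phi> is bounded by 1 almost everywhere, one of the two translates dominates the
  product.\<close>

lemma integrable_mult_shift:
  assumes b: "is_box_spline Xi \<phi>"
  shows "integrable lborel (\<lambda>x. \<phi> (x - a) * cnj (\<phi> (x - b)))"
proof (rule Bochner_Integration.integrable_bound[OF integrable_shift[OF box_spline_measurable(1)[OF b], of a]])
  have [measurable]: "\<phi> \<in> borel_measurable borel" by (rule box_spline_measurable(2)[OF b])
  show "(\<lambda>x. \<phi> (x - a) * cnj (\<phi> (x - b))) \<in> borel_measurable lborel" by measurable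
  have "AE x in lborel. norm (\<phi> (x - b)) \<le> 1"
    using AE_lborel_affine[OF box_spline_AE_bound[OF b], of 1 "- b"] by simp
  then show "AE x in lborel. norm (\<phi> (x - a) * cnj (\<phi> (x - b))) \<le> norm (\<phi> (x - a))"
    by eventually_elim (simp add: norm_mult mult_left_le)
qed

lemma integral_mult_shift:
  assumes b: "is_box_spline Xi \<phi>"
  shows "(LINT x|lborel. \<phi> (x - int_point k) * cnj (\<phi> (x - int_point l))) = Poly_Mapping.lookup Phi_poly (l - k)"
proof -
  have [measurable]: "\<phi> \<in> borel_measurable borel" by (rule box_spline_measurable(2)[OF b])
  have "(LINT x|lborel. \<phi> (x - int_point k) * cnj (\<phi> (x - int_point l))) = autocorrelation \<phi> (int_point (l - k))"
    unfolding autocorrelation_def int_point_diff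
    by (subst integral_lborel_affine[where c = 1 and t = "int_point k"]) (auto simp: algebra_simps)
  then show ?thesis by (simp add: autocorrelation_box_spline[OF b] lookup_Phi_poly)
qed

lemma
  assumes b: "is_box_spline Xi \<phi>"
  shows integrable_shift_sum_mult: "integrable lborel (\<lambda>x. shift_sum \<phi> P x * cnj (shift_sum \<phi> Q x))"
    and L2_inner_shift_sum: "L2_inner (shift_sum \<phi> P) (shift_sum \<phi> Q) = Poly_Mapping.lookup (Phi_poly * (P * laurent_star Q)) 0"
proof -
  have eq: "shift_sum \<phi> P x * cnj (shift_sum \<phi> Q x) = (\<Sum>k\<in>Poly_Mapping.keys P. \<Sum>l\<in>Poly_Mapping.keys Q.
     Poly_Mapping.lookup P k * cnj (Poly_Mapping.lookup Q l) * (\<phi> (x - int_point k) * cnj (\<phi> (x - int_point l))))" for x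
    by (simp add: shift_sum_def sum_product mult_ac)
  show "integrable lborel (\<lambda>x. shift_sum \<phi> P x * cnj (shift_sum \<phi> Q x))"
    unfolding eq by (intro Bochner_Integration.integrable_sum integrable_mult_right integrable_mult_shift b)
  have "L2_inner (shift_sum \<phi> P) (shift_sum \<phi> Q) = (\<Sum>k\<in>Poly_Mapping.keys P. \<Sum>l\<in>Poly_Mapping.keys Q.
     Poly_Mapping.lookup P k * cnj (Poly_Mapping.lookup Q l) * (LINT x|lborel. \<phi> (x - int_point k) * cnj (\<phi> (x - int_point l))))"
    unfolding L2_inner_def eq
    by (simp add: Bochner_Integration.integral_sum Bochner_Integration.integrable_sum integrable_mult_right integrable_mult_shift[OF b])
  then show "L2_inner (shift_sum \<phi> P) (shift_sum \<phi> Q) = Poly_Mapping.lookup (Phi_poly * (P * laurent_star Q)) 0"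
    by (simp add: integral_mult_shift[OF b] lookup_mult_star)
qed

lemma
  assumes b: "is_box_spline Xi \<phi>"
  shows L2_sqnorm_shift_sum: "L2_sqnorm lborel (shift_sum \<phi> P) = ennreal (Re (Poly_Mapping.lookup (Phi_poly * (P * laurent_star P)) 0))"
    and shift_sum_in_L2: "shift_sum \<phi> P \<in> L2"
proof -
  have [measurable]: "shift_sum \<phi> P \<in> borel_measurable borel"
    using borel_measurable_integrable[OF integrable_shift_sum[OF box_spline_measurable(1)[OF b]]] by simp
  have eq: "(norm (shift_sum \<phi> P x))\<^sup>2 = Re (shift_sum \<phi> P x * cnj (shift_sum \<phi> P x))" for x
    by (simp add: complex_norm_square[symmetric])
  have i: "integrable lborel (\<lambda>x. (norm (shift_sum \<phi> P x))\<^sup>2)"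
    unfolding eq by (intro integrable_Re integrable_shift_sum_mult b)
  show "L2_sqnorm lborel (shift_sum \<phi> P) = ennreal (Re (Poly_Mapping.lookup (Phi_poly * (P * laurent_star P)) 0))"
    unfolding L2_sqnorm_eq_integral[OF i] L2_inner_shift_sum[OF b, symmetric] L2_inner_def
    using integral_Re[OF integrable_shift_sum_mult[OF b, of P P]] by (simp only: eq)
  show "shift_sum \<phi> P \<in> L2"
    using i by (simp add: L2_def L2_sqnorm_eq_integral)
qed

lemma laurent_sqnorm_nonneg: "0 \<le> laurent_sqnorm P"
  by (simp add: laurent_sqnorm_def sum_nonneg)

text \<open>The squared norm is the mean of \<open>\<Phi> |P|^2\<close> over the torus, to be
  compared with the mean of \<open>|P|^2\<close>; the nonnegative polynomials are
  \<open>(\<Phi> - 1/5) |P|^2\<close> and \<open>(1 - \<Phi>) |P|^2\<close>.\<close>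

lemma L2_sqnorm_shift_sum_bounds:
  assumes b: "is_box_spline Xi \<phi>"
  shows "ennreal (laurent_sqnorm P / 5) \<le> L2_sqnorm lborel (shift_sum \<phi> P)"
    and "L2_sqnorm lborel (shift_sum \<phi> P) \<le> ennreal (laurent_sqnorm P)"
proof -
  have pt: "laurent_poly (Phi_poly * (P * laurent_star P)) \<zeta> = Phi_vec \<zeta> * of_real ((norm (laurent_poly P \<zeta>))\<^sup>2)"
    "laurent_poly (P * laurent_star P) \<zeta> = of_real ((norm (laurent_poly P \<zeta>))\<^sup>2)" if "\<zeta> \<in> torus" for \<zeta>
    unfolding complex_norm_square using that by (simp_all add: laurent_poly_mult laurent_poly_Phi_poly laurent_poly_star)
  have "0 \<le> Re (Poly_Mapping.lookup (Phi_poly * (P * laurent_star P) - P * laurent_star P * Poly_Mapping.single 0 (1 / 5)) 0)"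
  proof (rule lookup_0_nonneg)
    fix \<zeta> :: "complex^3" assume t: "\<zeta> \<in> torus"
    obtain r where r: "Phi_vec \<zeta> = of_real r" "1 / 5 \<le> r" "r \<le> 1" using Phi_vec_bounds[OF t] by blast
    have "laurent_poly (Phi_poly * (P * laurent_star P) - P * laurent_star P * Poly_Mapping.single 0 (1 / 5)) \<zeta>
       = of_real ((r - 1 / 5) * (norm (laurent_poly P \<zeta>))\<^sup>2)"
      by (simp only: laurent_poly_diff pt[OF t] r laurent_poly_mult[OF t, of "P * laurent_star P"]) (simp add: algebra_simps)
    then show "0 \<le> Re (laurent_poly (Phi_poly * (P * laurent_star P) - P * laurent_star P * Poly_Mapping.single 0 (1 / 5)) \<zeta>)"
      using r(2) by simp
  qed
  then show "ennreal (laurent_sqnorm P / 5) \<le> L2_sqnorm lborel (shift_sum \<phi> P)"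
    unfolding L2_sqnorm_shift_sum[OF b] by (intro ennreal_leI) (simp add: lookup_minus lookup_mult_single lookup_mult_star_self)
  have "0 \<le> Re (Poly_Mapping.lookup (P * laurent_star P - Phi_poly * (P * laurent_star P)) 0)"
  proof (rule lookup_0_nonneg)
    fix \<zeta> :: "complex^3" assume t: "\<zeta> \<in> torus"
    obtain r where r: "Phi_vec \<zeta> = of_real r" "1 / 5 \<le> r" "r \<le> 1" using Phi_vec_bounds[OF t] by blast
    have "laurent_poly (P * laurent_star P - Phi_poly * (P * laurent_star P)) \<zeta> = of_real ((1 - r) * (norm (laurent_poly P \<zeta>))\<^sup>2)"
      by (simp only: laurent_poly_diff pt[OF t] r) (simp add: algebra_simps)
    then show "0 \<le> Re (laurent_poly (P * laurent_star P - Phi_poly * (P * laurent_star P)) \<zeta>)"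
      using r(3) by simp
  qed
  then show "L2_sqnorm lborel (shift_sum \<phi> P) \<le> ennreal (laurent_sqnorm P)"
    unfolding L2_sqnorm_shift_sum[OF b] by (intro ennreal_leI) (simp add: lookup_minus lookup_mult_star_self)
qed

subsection \<open>Averaging over sign changes\<close>

lemma card_E01: "card (E01 :: (nat^3) set) = 8"
  by (simp add: E01_eq vector3_eq_iff)

text \<open>The sign change \<open>s\<close> on the level of coefficients: each is multiplied by the
  sign that its monomial acquires, and the constant coefficient is unchanged.\<close>

definition laurent_twist :: "nat^3 \<Rightarrow> ((int^3) \<Rightarrow>\<^sub>0 complex) \<Rightarrow> ((int^3) \<Rightarrow>\<^sub>0 complex)" where
  "laurent_twist s P = (\<Sum>k\<in>Poly_Mapping.keys P. Poly_Mapping.single k (zpow (sign_change s (\<chi> j. 1)) k * Poly_Mapping.lookup P k))"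

lemma laurent_poly_twist: "laurent_poly (laurent_twist s P) \<zeta> = laurent_poly P (sign_change s \<zeta>)"
proof -
  have "zpow (sign_change s \<zeta>) k = zpow (sign_change s (\<chi> j. 1)) k * zpow \<zeta> k" for k
    by (simp add: zpow_def sign_change_def power_int_mult_distrib prod.distrib)
  then show ?thesis
    by (simp add: laurent_twist_def laurent_poly_sum laurent_poly_eq_sum[OF finite_keys order_refl, of P] mult_ac)
qed

lemma lookup_twist_0: "Poly_Mapping.lookup (laurent_twist s P) 0 = Poly_Mapping.lookup P 0"
proof -
  have "Poly_Mapping.lookup (laurent_twist s P) 0 = (\<Sum>k\<in>Poly_Mapping.keys P. if k = 0 then Poly_Mapping.lookup P 0 else 0)"
    unfolding laurent_twist_def lookup_sum lookup_single when_def by (intro sum.cong) auto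
  then show ?thesis by (simp add: in_keys_iff)
qed

text \<open>The constant coefficient is the mean over the torus, which sign changes preserve.\<close>

lemma lookup_0_nonneg_average:
  fixes P Q :: "(int^3) \<Rightarrow>\<^sub>0 complex"
  assumes "\<And>\<zeta>. \<zeta> \<in> torus \<Longrightarrow> 0 \<le> Re (laurent_poly Q \<zeta> + (\<Sum>s\<in>E01. laurent_poly P (sign_change s \<zeta>)))"
  shows "0 \<le> Re (Poly_Mapping.lookup Q 0) + 8 * Re (Poly_Mapping.lookup P 0)"
proof -
  have "0 \<le> Re (Poly_Mapping.lookup (Q + (\<Sum>s\<in>E01. laurent_twist s P)) 0)"
    by (rule lookup_0_nonneg) (use assms in \<open>simp add: laurent_poly_sum laurent_poly_twist\<close>)
  then show ?thesis by (simp add: lookup_add lookup_sum lookup_twist_0 card_E01)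
qed

text \<open>Serves the exact orthogonality relations, where a statement about real parts would lose
  the imaginary part.\<close>

lemma lookup_0_eq_0_average:
  fixes P :: "(int^3) \<Rightarrow>\<^sub>0 complex"
  assumes "\<And>\<zeta>. \<zeta> \<in> torus \<Longrightarrow> (\<Sum>s\<in>E01. laurent_poly P (sign_change s \<zeta>)) = 0"
  shows "Poly_Mapping.lookup P 0 = 0"
proof -
  have "8 * Poly_Mapping.lookup P 0 = Poly_Mapping.lookup (\<Sum>s\<in>E01. laurent_twist s P) 0"
    by (simp add: lookup_sum lookup_twist_0 card_E01)
  also have "\<dots> = torus_mean (laurent_poly (\<Sum>s\<in>E01. laurent_twist s P))"
    by (rule torus_mean_laurent_poly[symmetric])
  also have "\<dots> = 0"
    unfolding torus_mean_def laurent_poly_sum laurent_poly_twist by (simp add: assms)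
  finally show ?thesis by simp
qed

text \<open>Substitution of \<zeta>^2. Multiplying a mask by the result corresponds to combining
  translates by even integer vectors, see \<open>shift_sum_up_mult\<close>.\<close>

definition laurent_up :: "((int^'d::finite) \<Rightarrow>\<^sub>0 complex) \<Rightarrow> ((int^'d) \<Rightarrow>\<^sub>0 complex)" where
  "laurent_up P = (\<Sum>k\<in>Poly_Mapping.keys P. Poly_Mapping.single (\<chi> j. 2 * k $ j) (Poly_Mapping.lookup P k))"

lemma laurent_poly_up: "laurent_poly (laurent_up P) \<zeta> = laurent_poly P (\<chi> j. (\<zeta> $ j)\<^sup>2)"
proof -
  have "zpow \<zeta> (\<chi> j. 2 * k $ j) = zpow (\<chi> j. (\<zeta> $ j)\<^sup>2) k" for k
    by (simp add: zpow_def power_int_mult)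
  then show ?thesis
    by (simp add: laurent_up_def laurent_poly_sum laurent_poly_eq_sum[OF finite_keys order_refl, of P])
qed

lemma laurent_sqnorm_up: "laurent_sqnorm (laurent_up P) = laurent_sqnorm P"
proof -
  let ?d = "\<lambda>k::int^'a. \<chi> j. 2 * k $ j"
  have inj: "inj ?d" by (rule injI) (simp add: vec_eq_iff)
  have l: "Poly_Mapping.lookup (laurent_up P) (?d k) = Poly_Mapping.lookup P k" for k
  proof -
    have "Poly_Mapping.lookup (laurent_up P) (?d k) = (\<Sum>l\<in>Poly_Mapping.keys P. if l = k then Poly_Mapping.lookup P k else 0)"
      unfolding laurent_up_def lookup_sum lookup_single when_def inj_eq[OF inj] by (intro sum.cong) auto
    then show ?thesis by (simp add: in_keys_iff)
  qed
  have k: "Poly_Mapping.keys (laurent_up P) \<subseteq> ?d ` Poly_Mapping.keys P"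
    unfolding laurent_up_def by (rule order_trans[OF keys_sum]) (auto split: if_splits)
  have "laurent_sqnorm (laurent_up P) = (\<Sum>k\<in>?d ` Poly_Mapping.keys P. (cmod (Poly_Mapping.lookup (laurent_up P) k))\<^sup>2)"
    unfolding laurent_sqnorm_def using k by (intro sum.mono_neutral_left) (auto simp: in_keys_iff)
  also have "\<dots> = laurent_sqnorm P"
    unfolding laurent_sqnorm_def by (subst sum.reindex) (use inj in \<open>auto simp: l intro: inj_on_subset\<close>)
  finally show ?thesis .
qed

lemma shift_sum_up_mult:
  "shift_sum \<phi> (laurent_up P * Q) x = (\<Sum>k\<in>Poly_Mapping.keys P. Poly_Mapping.lookup P k * shift_sum \<phi> Q (x - 2 *\<^sub>R int_point k))"
proof -
  have "int_point (\<chi> j. 2 * k $ j) = 2 *\<^sub>R int_point k" for k :: "int^'a"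
    by (simp add: int_point_def vec_eq_iff)
  then show ?thesis
    by (simp add: laurent_up_def sum_distrib_right shift_sum_sum shift_sum_mult_single)
qed

text \<open>Factors in \<zeta>^2 are invariant under sign changes, so the sum of the integrand over
  all sign changes contains \<langle>H, H_s\<rangle> = 0 as a factor.\<close>

lemma L2_inner_coarse_wavelet:
  assumes b: "is_box_spline Xi \<phi>" and s: "s \<in> E01 - {0}"
  shows "L2_inner (shift_sum \<phi> (laurent_up P * box_mask Xi)) (shift_sum \<phi> (laurent_up Q * wavelet_mask s)) = 0"
  unfolding L2_inner_shift_sum[OF b]
proof (rule lookup_0_eq_0_average)
  fix \<zeta> :: "complex^3" assume t: "\<zeta> \<in> torus"
  have "(\<Sum>t\<in>E01. laurent_poly (Phi_poly * (laurent_up P * box_mask Xi * laurent_star (laurent_up Q * wavelet_mask s))) (sign_change t \<zeta>))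
    = (\<Sum>t\<in>E01. (laurent_poly P (sq \<zeta>) * cnj (laurent_poly Q (sq \<zeta>))) *
      (Phi_vec (sign_change t \<zeta>) * laurent_poly (box_mask Xi) (sign_change t \<zeta>) * cnj (laurent_poly (wavelet_mask s) (sign_change t \<zeta>))))"
    using sign_change_torus[OF t]
    by (intro sum.cong refl) (simp add: laurent_poly_mult laurent_poly_Phi_poly laurent_poly_star laurent_poly_up sq_sign_change mult_ac)
  also have "\<dots> = 0"
    unfolding sum_distrib_left[symmetric] inner_H_wavelet_mask[OF t s] by simp
  finally show "(\<Sum>t\<in>E01. laurent_poly (Phi_poly * (laurent_up P * box_mask Xi * laurent_star (laurent_up Q * wavelet_mask s))) (sign_change t \<zeta>)) = 0" .
qed

section \<open>Masks in \<open>L\<^sub>2\<close>\<close>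

lemma norm_box_factor_le_1: "norm (box_factor t) \<le> 1"
proof -
  have "norm (box_factor t) \<le> (LINT x|lborel. norm (ind01 x * exp (- \<i> * of_real (t * x))))"
    unfolding integral_ind01_exp[symmetric] by (rule integral_norm_bound)
  also have "\<dots> = (LINT x|lborel. indicat_real {0..1} (x::real))"
    by (intro Bochner_Integration.integral_cong refl) (simp add: norm_mult ind01_def)
  finally show ?thesis by simp
qed

lemma norm_box_factor_mult_le: "norm (box_factor t) * \<bar>t\<bar> \<le> 2"
proof (cases "t = 0")
  case False
  then have "norm (box_factor t) * \<bar>t\<bar> = norm (1 - exp (- \<i> * of_real t))"
    by (simp add: box_factor_def norm_divide norm_mult)
  also have "\<dots> \<le> 2" using norm_triangle_ineq4[of 1 "exp (- \<i> * of_real t)"] by simp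
  finally show ?thesis .
qed simp

text \<open>A bound for the squared box factor on the translate of a period by
  \<open>2 * pi * i\<close>. Its points have modulus at least
  \<open>2 * pi * (\<bar>i\<bar> - 1)\<close>, hence the shift by one; for
  \<open>\<bar>i\<bar> \<le> 1\<close> this degenerates and the trivial bound 1 is used.\<close>

definition period_weight :: "int \<Rightarrow> real" where
  "period_weight i = (if \<bar>i\<bar> \<le> 1 then 1 else 1 / (of_int \<bar>i\<bar> - 1)\<^sup>2)"

lemma period_weight_nonneg: "0 \<le> period_weight i"
  by (simp add: period_weight_def)

lemma box_factor_period_le:
  assumes "0 \<le> t" "t \<le> 2 * pi"
  shows "(norm (box_factor (t + 2 * pi * of_int i)))\<^sup>2 \<le> period_weight i"
proof (cases "\<bar>i\<bar> \<le> 1")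
  case True
  then show ?thesis using power_mono[OF norm_box_factor_le_1, of _ 2] by (simp add: period_weight_def)
next
  case False
  define m where "m = real_of_int \<bar>i\<bar> - 1"
  have m: "1 \<le> m" using False by (simp add: m_def)
  have "2 * m \<le> 2 * pi * m" using m pi_ge_two by (intro mult_right_mono) auto
  also have "\<dots> \<le> \<bar>t + 2 * pi * of_int i\<bar>"
  proof (cases "0 \<le> i")
    case True
    have "2 * pi * m \<le> 2 * pi * of_int i" using True by (intro mult_left_mono) (auto simp: m_def)
    then show ?thesis using assms(1) by linarith
  next
    case False
    have "2 * pi * m = - (2 * pi * of_int i) - 2 * pi" using False by (simp add: m_def algebra_simps)
    then show ?thesis using assms(2) by linarith
  qed
  finally have "norm (box_factor (t + 2 * pi * of_int i)) * (2 * m) \<le> 2"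
    using norm_box_factor_mult_le[of "t + 2 * pi * of_int i"] by (meson mult_left_mono norm_ge_zero order_trans)
  then have "norm (box_factor (t + 2 * pi * of_int i)) \<le> 1 / m"
    using m by (simp add: field_simps)
  then have "(norm (box_factor (t + 2 * pi * of_int i)))\<^sup>2 \<le> (1 / m)\<^sup>2"
    by (intro power_mono) auto
  then show ?thesis using False by (simp add: period_weight_def m_def power_divide)
qed

text \<open>The terms with \<open>\<bar>i\<bar> \<le> 2\<close> sum to 5. The others are twice the
  sum of \<open>1 / m^2\<close> over \<open>m \<ge> 2\<close>, dominated by the telescoping
  \<open>1 / ((m - 1) * m)\<close>, and so contribute at most 2.\<close>

lemma sum_period_weight: "(\<Sum>i\<in>{- int n..int n}. period_weight i) \<le> 7"
proof -
  have step: "(\<Sum>i\<in>{- int (Suc n)..int (Suc n)}. period_weight i) = (\<Sum>i\<in>{- int n..int n}. period_weight i) + 2 * period_weight (int (Suc n))" for n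
  proof -
    have "{- int (Suc n)..int (Suc n)} = insert (int (Suc n)) (insert (- int (Suc n)) {- int n..int n})"
      by auto
    then show ?thesis by (simp add: period_weight_def)
  qed
  have "(\<Sum>i\<in>{- int (Suc (Suc n))..int (Suc (Suc n))}. period_weight i) \<le> 7 - 2 / real (Suc n)" for n
  proof (induction n)
    case 0
    have "(\<Sum>i\<in>{- int 0..int 0}. period_weight i) = 1" by (simp add: period_weight_def)
    then show ?case unfolding step by (simp add: period_weight_def)
  next
    case (Suc n)
    have "period_weight (int (Suc (Suc (Suc n)))) = 1 / (real (Suc (Suc n)))\<^sup>2"
      by (simp add: period_weight_def)
    also have "\<dots> \<le> 1 / (real (Suc n) * real (Suc (Suc n)))"
      unfolding power2_eq_square by (intro divide_left_mono mult_right_mono) auto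
    also have "\<dots> = 1 / real (Suc n) - 1 / real (Suc (Suc n))"
      by (simp add: field_simps)
    finally show ?case unfolding step[of "Suc (Suc n)"] using Suc.IH by simp
  qed
  then have "(\<Sum>i\<in>{- int (Suc (Suc n))..int (Suc (Suc n))}. period_weight i) \<le> 7"
    by (rule order_trans) simp
  moreover have "(\<Sum>i\<in>{- int n..int n}. period_weight i) \<le> (\<Sum>i\<in>{- int (Suc (Suc n))..int (Suc (Suc n))}. period_weight i)"
    by (intro sum_mono2) (auto simp: period_weight_nonneg)
  ultimately show ?thesis by linarith
qed

lemma fourier_box_spline:
  assumes "is_box_spline Xi \<phi>"
  shows "fourier \<phi> = fourier PL_box"
  using assms is_box_spline_PL_box by (auto simp: is_box_spline_def)

lemma fourier_PL_box_period_le: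
  assumes u: "u \<in> cbox 0 (\<chi> j. 2 * pi)"
  shows "(norm (fourier PL_box (u + (2 * pi) *\<^sub>R int_point k)))\<^sup>2 \<le> period_weight (k $ 1) * period_weight (k $ 2) * period_weight (k $ 3)"
proof -
  have u: "0 \<le> u $ j" "u $ j \<le> 2 * pi" for j using u by (auto simp: mem_box_cart)
  have "(norm (fourier PL_box (u + (2 * pi) *\<^sub>R int_point k)))\<^sup>2 \<le>
     (norm (box_factor (u $ 1 + 2 * pi * of_int (k $ 1))))\<^sup>2 * (norm (box_factor (u $ 2 + 2 * pi * of_int (k $ 2))))\<^sup>2 *
     (norm (box_factor (u $ 3 + 2 * pi * of_int (k $ 3))))\<^sup>2 * 1\<^sup>2"
    unfolding fourier_PL_box norm_mult power_mult_distrib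
    by (intro mult_mono power_mono norm_box_factor_le_1) (auto simp: int_point_def)
  also have "\<dots> \<le> period_weight (k $ 1) * period_weight (k $ 2) * period_weight (k $ 3) * 1\<^sup>2"
    by (intro mult_mono box_factor_period_le u mult_nonneg_nonneg period_weight_nonneg) auto
  finally show ?thesis by simp
qed

definition int_cube :: "nat \<Rightarrow> (int^3) set" where
  "int_cube N = (\<lambda>(a, b, c). vector [a, b, c]) ` ({- int N..int N} \<times> {- int N..int N} \<times> {- int N..int N})"

lemma sum_int_cube_weight: "(\<Sum>k\<in>int_cube N. period_weight (k $ 1) * period_weight (k $ 2) * period_weight (k $ 3)) \<le> 343"
proof -
  let ?I = "{- int N..int N}"
  let ?S = "\<Sum>i\<in>?I. period_weight i"
  have "(\<Sum>k\<in>int_cube N. period_weight (k $ 1) * period_weight (k $ 2) * period_weight (k $ 3)) =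
    (\<Sum>(a, b, c)\<in>?I \<times> ?I \<times> ?I. period_weight a * period_weight b * period_weight c)"
    unfolding int_cube_def by (subst sum.reindex) (auto simp: inj_on_def vector3_eq_iff intro!: sum.cong)
  also have "\<dots> = ?S * (?S * ?S)"
    by (simp add: sum.cartesian_product[symmetric] sum_distrib_left sum_distrib_right mult_ac)
  also have "\<dots> \<le> 7 * (7 * 7)"
    by (intro mult_mono sum_period_weight sum_nonneg mult_nonneg_nonneg) (auto simp: period_weight_nonneg)
  finally show ?thesis by simp
qed

lemma torus_point_period: "torus_point (u + (2 * pi) *\<^sub>R int_point k) = torus_point u"
proof -
  have "exp (- \<i> * of_real (u $ j + 2 * pi * of_int (k $ j))) = exp (- \<i> * of_real (u $ j))" for j
  proof -
    have "exp (- \<i> * of_real (u $ j + 2 * pi * of_int (k $ j))) = exp (- \<i> * of_real (u $ j) + \<i> * (of_int (- (k $ j)) * (of_real pi * 2)))"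
      by (simp add: algebra_simps)
    also have "\<dots> = exp (- \<i> * of_real (u $ j))"
      by (rule exp_plus_2pin)
    finally show ?thesis .
  qed
  then show ?thesis by (simp add: torus_point_def vec_eq_iff int_point_def)
qed

text \<open>The integral is distributed over the translates of one period cube, on each of which
  \<open>G\<close> repeats and the squared transform is at most a product of three weights; these
  add up to at most 7^3 = 343. The cutoff in \<open>g\<close> keeps the number of translates finite,
  and Fatou's lemma removes it.\<close>

lemma nn_integral_periodic_le:
  assumes G [measurable]: "G \<in> borel_measurable borel" and per: "\<And>u k. G (u + (2 * pi) *\<^sub>R int_point k) = G u"
  shows "(\<integral>\<^sup>+u. G u * ennreal ((norm (fourier PL_box u))\<^sup>2) \<partial>lborel) \<le> 343 * (\<integral>\<^sup>+u. G u * indicator (cbox 0 (\<chi> j. 2 * pi)) u \<partial>lborel)"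
proof -
  let ?C = "cbox 0 (\<chi> j. 2 * pi) :: (real^3) set"
  let ?p = "\<lambda>u. ennreal ((norm (fourier PL_box u))\<^sup>2)"
  let ?X = "\<integral>\<^sup>+u. G u * indicator ?C u \<partial>lborel"
  define g where "g N u = (if \<forall>j. \<bar>u $ j\<bar> \<le> 2 * pi * real N then G u * ?p u else 0)" for N and u :: "real^3"
  have fin: "finite (int_cube N)" for N by (simp add: int_cube_def)
  have gN: "(\<integral>\<^sup>+u. g N u \<partial>lborel) \<le> 343 * ?X" for N
  proof -
    have "g N u \<le> (\<Sum>k\<in>int_cube N. G u * ?p u * indicator ?C (u - (2 * pi) *\<^sub>R int_point k))" for u
    proof (cases "\<forall>j. \<bar>u $ j\<bar> \<le> 2 * pi * real N")
      case True
      \<comment> \<open>One translate containing \<open>u\<close> is enough: the closed cubes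
        overlap on their faces, which an upper bound tolerates.\<close>
      define k :: "int^3" where "k = (\<chi> j. \<lfloor>u $ j / (2 * pi)\<rfloor>)"
      have k1: "u - (2 * pi) *\<^sub>R int_point k \<in> ?C"
      proof -
        have "2 * pi * of_int \<lfloor>u $ j / (2 * pi)\<rfloor> \<le> u $ j" "u $ j \<le> 2 * pi * of_int \<lfloor>u $ j / (2 * pi)\<rfloor> + 2 * pi" for j
          using mult_left_mono[OF of_int_floor_le[of "u $ j / (2 * pi)"], of "2 * pi"]
            floor_correct[of "u $ j / (2 * pi)"] by (auto simp: field_simps)
        then show ?thesis by (simp add: mem_box_cart k_def int_point_def algebra_simps)
      qed
      have "- int N \<le> k $ j \<and> k $ j \<le> int N" for j
      proof -
        have "- real N \<le> u $ j / (2 * pi)" "u $ j / (2 * pi) \<le> real N"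
          using True[rule_format, of j] by (auto simp: field_simps abs_le_iff)
        then show ?thesis unfolding k_def by (simp add: le_floor_iff) (metis floor_mono floor_of_nat)
      qed
      moreover have "k = vector [k $ 1, k $ 2, k $ 3]" by (simp add: vec_eq_iff forall_3)
      ultimately have k2: "k \<in> int_cube N" unfolding int_cube_def by (intro image_eqI[of _ _ "(k $ 1, k $ 2, k $ 3)"]) auto
      have "g N u = G u * ?p u * indicator ?C (u - (2 * pi) *\<^sub>R int_point k)" using True k1 by (simp add: g_def)
      also have "\<dots> \<le> (\<Sum>k\<in>int_cube N. G u * ?p u * indicator ?C (u - (2 * pi) *\<^sub>R int_point k))"
        by (rule member_le_sum[OF k2]) (auto simp: fin)
      finally show ?thesis .
    next
      case False
      then have "g N u = 0" unfolding g_def by (rule if_not_P)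
      then show ?thesis by simp
    qed
    then have "(\<integral>\<^sup>+u. g N u \<partial>lborel) \<le> (\<integral>\<^sup>+u. (\<Sum>k\<in>int_cube N. G u * ?p u * indicator ?C (u - (2 * pi) *\<^sub>R int_point k)) \<partial>lborel)"
      by (intro nn_integral_mono)
    also have "\<dots> = (\<Sum>k\<in>int_cube N. \<integral>\<^sup>+u. G u * ?p u * indicator ?C (u - (2 * pi) *\<^sub>R int_point k) \<partial>lborel)"
      by (intro nn_integral_sum) measurable
    also have "\<dots> \<le> (\<Sum>k\<in>int_cube N. ennreal (period_weight (k $ 1) * period_weight (k $ 2) * period_weight (k $ 3)) * ?X)"
    proof (rule sum_mono)
      fix k :: "int^3"
      have "(\<integral>\<^sup>+u. G u * ?p u * indicator ?C (u - (2 * pi) *\<^sub>R int_point k) \<partial>lborel) =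
        (\<integral>\<^sup>+u. G u * ?p (u + (2 * pi) *\<^sub>R int_point k) * indicator ?C u \<partial>lborel)"
        by (subst nn_integral_lborel_affine[where c = 1 and t = "(2 * pi) *\<^sub>R int_point k"])
           (simp_all add: add.commute per)
      also have "\<dots> \<le> (\<integral>\<^sup>+u. ennreal (period_weight (k $ 1) * period_weight (k $ 2) * period_weight (k $ 3)) * (G u * indicator ?C u) \<partial>lborel)"
      proof (rule nn_integral_mono)
        fix u :: "real^3"
        have "?p (u + (2 * pi) *\<^sub>R int_point k) \<le> ennreal (period_weight (k $ 1) * period_weight (k $ 2) * period_weight (k $ 3))" if "u \<in> ?C"
          by (intro ennreal_leI fourier_PL_box_period_le that)
        then show "G u * ?p (u + (2 * pi) *\<^sub>R int_point k) * indicator ?C u \<le>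
            ennreal (period_weight (k $ 1) * period_weight (k $ 2) * period_weight (k $ 3)) * (G u * indicator ?C u)"
          by (cases "u \<in> ?C") (simp_all add: mult_left_mono mult.commute)
      qed
      also have "\<dots> = ennreal (period_weight (k $ 1) * period_weight (k $ 2) * period_weight (k $ 3)) * ?X"
        by (rule nn_integral_cmult) measurable
      finally show "(\<integral>\<^sup>+u. G u * ?p u * indicator ?C (u - (2 * pi) *\<^sub>R int_point k) \<partial>lborel) \<le>
        ennreal (period_weight (k $ 1) * period_weight (k $ 2) * period_weight (k $ 3)) * ?X" .
    qed
    also have "\<dots> = ennreal (\<Sum>k\<in>int_cube N. period_weight (k $ 1) * period_weight (k $ 2) * period_weight (k $ 3)) * ?X"
      by (simp add: sum_distrib_right[symmetric] sum_ennreal period_weight_nonneg)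
    also have "\<dots> \<le> ennreal 343 * ?X"
      by (intro mult_right_mono ennreal_leI sum_int_cube_weight) auto
    finally show ?thesis by simp
  qed
  have lim: "(\<lambda>N. g N u) \<longlonglongrightarrow> G u * ?p u" for u
  proof (rule tendsto_eventually)
    obtain n0 where n0: "norm u \<le> real n0" using real_arch_simple by blast
    show "\<forall>\<^sub>F N in sequentially. g N u = G u * ?p u"
      using eventually_ge_at_top[of n0]
    proof eventually_elim
      case (elim N)
      have "\<bar>u $ j\<bar> \<le> 2 * pi * real N" for j
      proof -
        have "\<bar>u $ j\<bar> \<le> 1 * real N" using component_le_norm_cart[of u j] n0 elim by simp
        also have "\<dots> \<le> 2 * pi * real N" using pi_ge_two by (intro mult_right_mono) auto
        finally show ?thesis .
      qed
      then show ?case by (simp add: g_def)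
    qed
  qed
  have "(\<integral>\<^sup>+u. G u * ?p u \<partial>lborel) = (\<integral>\<^sup>+u. liminf (\<lambda>N. g N u) \<partial>lborel)"
    by (intro nn_integral_cong lim_imp_Liminf[symmetric] lim) simp
  also have "\<dots> \<le> liminf (\<lambda>N. \<integral>\<^sup>+u. g N u \<partial>lborel)"
    by (rule nn_integral_liminf) (unfold g_def, measurable)
  also have "\<dots> \<le> liminf (\<lambda>N::nat. 343 * ?X)"
    by (intro Liminf_mono always_eventually allI gN)
  also have "\<dots> = 343 * ?X"
    by (simp add: Liminf_const)
  finally show ?thesis .
qed

lemma laurent_poly_torus_measurable [measurable]:
  "(\<lambda>u. laurent_poly P (torus_point u)) \<in> borel_measurable borel"
  unfolding laurent_poly_eq_sum[OF finite_keys order_refl] zpow_torus_point by measurable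

text \<open>The difference of the two transforms is a periodic function times the transform of the
  spline, so convergence of the series on one period cube gives convergence on the whole space, at
  the cost of the factor 343.\<close>

lemma Laurent_l2_approx:
  fixes F :: "complex^3 \<Rightarrow> complex"
  assumes F: "F \<in> Laurent_l2" and e: "0 < e"
  obtains P where "L2_sqnorm lborel (\<lambda>u. F (torus_point u) * fourier PL_box u - laurent_poly P (torus_point u) * fourier PL_box u) < ennreal e"
proof -
  let ?C = "cbox 0 (\<chi> j. 2 * pi) :: (real^3) set"
  have Fm [measurable]: "(\<lambda>u. F (torus_point u)) \<in> borel_measurable borel" using F by (simp add: Laurent_l2_def)
  obtain a where a: "((\<lambda>K. L2_sqnorm (restrict_space lborel ?C)
      (\<lambda>u. F (torus_point u) - (\<Sum>k\<in>K. a k * zpow (torus_point u) k))) \<longlongrightarrow> 0) (finite_subsets_at_top UNIV)"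
    using F by (auto simp: Laurent_l2_def)
  have "\<forall>\<^sub>F K in finite_subsets_at_top UNIV. L2_sqnorm (restrict_space lborel ?C)
      (\<lambda>u. F (torus_point u) - (\<Sum>k\<in>K. a k * zpow (torus_point u) k)) < ennreal (e / 343)"
    using e by (intro order_tendstoD(2)[OF a]) simp
  then have "\<exists>K. L2_sqnorm (restrict_space lborel ?C)
      (\<lambda>u. F (torus_point u) - (\<Sum>k\<in>K. a k * zpow (torus_point u) k)) < ennreal (e / 343)"
    by (rule eventually_happens'[rotated]) simp
  then obtain K where K: "L2_sqnorm (restrict_space lborel ?C)
      (\<lambda>u. F (torus_point u) - (\<Sum>k\<in>K. a k * zpow (torus_point u) k)) < ennreal (e / 343)" ..
  define P where "P = (\<Sum>k\<in>K. Poly_Mapping.single k (a k))"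
  have P: "laurent_poly P \<zeta> = (\<Sum>k\<in>K. a k * zpow \<zeta> k)" for \<zeta>
    by (simp add: P_def laurent_poly_sum)
  define G where "G u = ennreal ((norm (F (torus_point u) - laurent_poly P (torus_point u)))\<^sup>2)" for u
  have Gm [measurable]: "G \<in> borel_measurable borel" unfolding G_def[abs_def] by measurable
  have "L2_sqnorm lborel (\<lambda>u. F (torus_point u) * fourier PL_box u - laurent_poly P (torus_point u) * fourier PL_box u)
     = (\<integral>\<^sup>+u. G u * ennreal ((norm (fourier PL_box u))\<^sup>2) \<partial>lborel)"
    unfolding L2_sqnorm_def G_def
    by (intro nn_integral_cong) (simp add: left_diff_distrib[symmetric] norm_mult power_mult_distrib ennreal_mult'')
  also have "\<dots> \<le> 343 * (\<integral>\<^sup>+u. G u * indicator ?C u \<partial>lborel)"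
    by (rule nn_integral_periodic_le[OF Gm]) (simp add: G_def torus_point_period)
  also have "(\<integral>\<^sup>+u. G u * indicator ?C u \<partial>lborel) = L2_sqnorm (restrict_space lborel ?C) (\<lambda>u. F (torus_point u) - (\<Sum>k\<in>K. a k * zpow (torus_point u) k))"
    unfolding L2_sqnorm_def G_def P by (subst nn_integral_restrict_space) auto
  also have "343 * \<dots> < 343 * ennreal (e / 343)"
    using K by (intro ennreal_mult_strict_left_mono) auto
  also have "\<dots> = ennreal e"
    using e by (simp add: ennreal_mult''[symmetric] ennreal_numeral[symmetric] del: ennreal_numeral)
  finally show ?thesis by (rule that)
qed

lemma ennreal_two_pi_mult_le: "x \<le> ennreal ((2 * pi) ^ n) * x"
proof -
  have "1 \<le> (2 * pi) ^ n" using pi_ge_two by (intro one_le_power) linarith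
  then have "1 * x \<le> ennreal ((2 * pi) ^ n) * x" by (intro mult_right_mono) auto
  then show ?thesis by simp
qed

section \<open>Density of finite combinations of translates in V_0 and V_-1\<close>

lemma has_fourier_L2_shift_sum:
  assumes b: "is_box_spline Xi \<phi>"
  shows "has_fourier_L2 (shift_sum \<phi> P) (\<lambda>u. laurent_poly P (torus_point u) * fourier \<phi> u)"
proof -
  have "has_fourier_L2 (shift_sum \<phi> P) (fourier (shift_sum \<phi> P))"
    using shift_sum_in_L2[OF b, of P] by (intro has_fourier_L2_fourier integrable_shift_sum box_spline_measurable(1)[OF b]) (simp add: L2_def)
  then show ?thesis by (simp add: fourier_shift_sum[OF box_spline_measurable(1)[OF b], abs_def])
qed

lemma has_fourier_L2_shift_sum_dist:
  assumes b: "is_box_spline Xi \<phi>" and f: "has_fourier_L2 f g"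
  shows "L2_sqnorm lborel (\<lambda>x. f x - shift_sum \<phi> P x) \<le> 16 * L2_sqnorm lborel (\<lambda>u. g u - laurent_poly P (torus_point u) * fourier \<phi> u)"
proof -
  have "L2_sqnorm lborel (\<lambda>x. f x - shift_sum \<phi> P x) \<le> ennreal ((2 * pi) ^ CARD(3)) * L2_sqnorm lborel (\<lambda>x. f x - shift_sum \<phi> P x)"
    by (rule ennreal_two_pi_mult_le)
  also have "\<dots> \<le> 16 * L2_sqnorm lborel (\<lambda>u. g u - fourier (shift_sum \<phi> P) u)"
    using shift_sum_in_L2[OF b, of P] by (intro has_fourier_L2_dist[OF f] integrable_shift_sum box_spline_measurable(1)[OF b]) (simp add: L2_def)
  finally show ?thesis by (simp add: fourier_shift_sum[OF box_spline_measurable(1)[OF b]])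
qed

lemma laurent_poly_in_Laurent_l2: "laurent_poly P \<in> Laurent_l2"
  unfolding Laurent_l2_def
proof (intro CollectI conjI exI)
  show "(\<lambda>u. laurent_poly P (torus_point u)) \<in> borel_measurable lborel" by measurable
  show "(\<lambda>k. (cmod (Poly_Mapping.lookup P k))\<^sup>2) summable_on UNIV"
    by (rule summable_on_cong_neutral[THEN iffD1, OF _ _ _ summable_on_finite[OF finite_keys[of P]]]) (auto simp: in_keys_iff)
  have "\<forall>\<^sub>F K in finite_subsets_at_top UNIV. finite K \<and> Poly_Mapping.keys P \<subseteq> K"
    by (subst eventually_finite_subsets_at_top) (auto intro!: exI[of _ "Poly_Mapping.keys P"])
  then show "((\<lambda>K. L2_sqnorm (restrict_space lborel (cbox 0 (\<chi> j. 2 * pi)))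
       (\<lambda>u. laurent_poly P (torus_point u) - (\<Sum>k\<in>K. Poly_Mapping.lookup P k * zpow (torus_point u) k))) \<longlongrightarrow> 0) (finite_subsets_at_top UNIV)"
    by (intro tendsto_eventually) (auto elim!: eventually_mono simp: laurent_poly_eq_sum[symmetric] L2_sqnorm_def)
qed

lemma has_mask_shift_sum:
  assumes b: "is_box_spline Xi \<phi>"
  shows "has_mask \<phi> (laurent_poly P) (shift_sum \<phi> P)"
  using has_fourier_L2_shift_sum[OF b] laurent_poly_in_Laurent_l2 by (simp add: has_mask_def)

text \<open>Distance 0 on the frequency side forces distance 0 between the functions. Claims about
  arbitrary functions with given polynomial masks thus reduce to explicit combinations of
  translates.\<close>

lemma has_mask_laurent_poly_AE:
  assumes b: "is_box_spline Xi \<phi>" and m: "has_mask \<phi> (laurent_poly P) f"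
  shows "AE x in lborel. f x = shift_sum \<phi> P x"
proof -
  have f: "has_fourier_L2 f (\<lambda>u. laurent_poly P (torus_point u) * fourier \<phi> u)" using m by (simp add: has_mask_def)
  have [measurable]: "f \<in> borel_measurable borel" "shift_sum \<phi> P \<in> borel_measurable borel"
    using f shift_sum_in_L2[OF b, of P] by (auto simp: has_fourier_L2_def L2_def)
  have "L2_sqnorm lborel (\<lambda>x. f x - shift_sum \<phi> P x) = 0"
    using has_fourier_L2_shift_sum_dist[OF b f, of P] by (simp add: L2_sqnorm_def)
  then show ?thesis by (simp add: L2_sqnorm_0_iff)
qed

lemma V_zero_approx:
  assumes b: "is_box_spline Xi \<phi>" and f: "f \<in> V_zero \<phi>" and e: "0 < e"
  obtains P where "L2_sqnorm lborel (\<lambda>x. f x - shift_sum \<phi> P x) < ennreal e"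
proof -
  obtain F where F: "F \<in> Laurent_l2" "has_fourier_L2 f (\<lambda>u. F (torus_point u) * fourier \<phi> u)"
    using f by (auto simp: V_zero_def has_mask_def)
  have "0 < e / 16" using e by simp
  from Laurent_l2_approx[OF F(1) this] obtain P where
    P: "L2_sqnorm lborel (\<lambda>u. F (torus_point u) * fourier PL_box u - laurent_poly P (torus_point u) * fourier PL_box u) < ennreal (e / 16)" .
  have "L2_sqnorm lborel (\<lambda>x. f x - shift_sum \<phi> P x) \<le> 16 * L2_sqnorm lborel (\<lambda>u. F (torus_point u) * fourier \<phi> u - laurent_poly P (torus_point u) * fourier \<phi> u)"
    by (rule has_fourier_L2_shift_sum_dist[OF b F(2)])
  also have "\<dots> < 16 * ennreal (e / 16)"
    using P unfolding fourier_box_spline[OF b] by (intro ennreal_mult_strict_left_mono) auto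
  also have "\<dots> = ennreal e"
    using e by (simp add: ennreal_mult''[symmetric] ennreal_numeral[symmetric] del: ennreal_numeral)
  finally show ?thesis by (rule that)
qed

lemma box_factor_double: "box_factor (2 * t) = (1 + exp (- \<i> * of_real t)) / 2 * box_factor t"
proof (cases "t = 0")
  case False
  have "1 - exp (- \<i> * of_real (2 * t)) = (1 + exp (- \<i> * of_real t)) * (1 - exp (- \<i> * of_real t))"
    by (simp add: algebra_simps exp_add[symmetric])
  then show ?thesis using False by (simp add: box_factor_def)
qed (simp add: box_factor_def)

lemma torus_point_double: "torus_point (2 *\<^sub>R u) = (\<chi> j. (torus_point u $ j)\<^sup>2)"
  by (simp add: torus_point_def vec_eq_iff exp_double[symmetric] mult_ac)

text \<open>The refinement equation: each of the four box factors doubles by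
  \<open>box_factor_double\<close>, and the four factors so produced multiply to
  \<open>H\<close>.\<close>

lemma fourier_PL_box_refine: "fourier PL_box (2 *\<^sub>R u) = laurent_poly (box_mask Xi) (torus_point u) * fourier PL_box u"
proof -
  have e: "exp (- \<i> * of_real (u $ 1 + u $ 2 + u $ 3)) = torus_point u $ 1 * torus_point u $ 2 * torus_point u $ 3"
    by (simp add: torus_point_def exp_add[symmetric] algebra_simps)
  have t: "torus_point u $ j = exp (- \<i> * of_real (u $ j))" for j by (simp add: torus_point_def)
  have s: "(2 *\<^sub>R u) $ j = 2 * u $ j" "2 * a + 2 * b + 2 * c = 2 * (a + b + c)" for j and a b c :: real
    by simp_all
  show ?thesis
    unfolding fourier_PL_box laurent_poly_box_mask[OF torus_point_in_torus] s box_factor_double e t[symmetric] H_fun_def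
    by simp
qed

lemma fourier_shift_sum_coarse:
  assumes b: "is_box_spline Xi \<phi>"
  shows "laurent_poly (laurent_up P * box_mask Xi) (torus_point u) * fourier \<phi> u = laurent_poly P (torus_point (2 *\<^sub>R u)) * fourier \<phi> (2 *\<^sub>R u)"
  unfolding fourier_box_spline[OF b] fourier_PL_box_refine
  by (simp add: laurent_poly_mult laurent_poly_up torus_point_double)

text \<open>If \<open>g\<close> has mask \<open>F\<close>, then \<open>f\<close> has mask
  F(\<zeta>^2) H, so an approximation \<open>P\<close> of \<open>F\<close> is dilated together with
  its error; the dilation by 2 divides integrals by 8. The given representative \<open>g'\<close> is
  tied to \<open>F\<close> only almost everywhere, by uniqueness of the L2 transform.\<close>

lemma V_minus_one_approx:
  assumes b: "is_box_spline Xi \<phi>" and f: "f \<in> V_minus_one \<phi>" and e: "0 < e"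
  obtains P where "L2_sqnorm lborel (\<lambda>x. f x - shift_sum \<phi> (laurent_up P * box_mask Xi) x) < ennreal e"
proof -
  obtain g g' where g: "g \<in> V_zero \<phi>" "has_fourier_L2 g g'" "has_fourier_L2 f (\<lambda>u. g' (2 *\<^sub>R u))"
    using f by (auto simp: V_minus_one_def)
  obtain F where F: "F \<in> Laurent_l2" "has_fourier_L2 g (\<lambda>u. F (torus_point u) * fourier \<phi> u)"
    using g by (auto simp: V_zero_def has_mask_def)
  have Fm [measurable]: "(\<lambda>u. F (torus_point u)) \<in> borel_measurable borel" using F by (simp add: Laurent_l2_def)
  have [measurable]: "fourier PL_box \<in> borel_measurable borel" by measurable
  have "0 < e / 16" using e by simp
  from Laurent_l2_approx[OF F(1) this] obtain P where
    P: "L2_sqnorm lborel (\<lambda>u. F (torus_point u) * fourier PL_box u - laurent_poly P (torus_point u) * fourier PL_box u) < ennreal (e / 16)" .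
  have "AE u in lborel. g' (2 *\<^sub>R u) = F (torus_point (2 *\<^sub>R u)) * fourier \<phi> (2 *\<^sub>R u)"
    using AE_lborel_affine[OF has_fourier_L2_unique[OF g(2) F(2)], of 2 0] by simp
  then have "L2_sqnorm lborel (\<lambda>u. g' (2 *\<^sub>R u) - laurent_poly (laurent_up P * box_mask Xi) (torus_point u) * fourier \<phi> u) =
     L2_sqnorm lborel (\<lambda>u. F (torus_point (2 *\<^sub>R u)) * fourier PL_box (2 *\<^sub>R u) - laurent_poly P (torus_point (2 *\<^sub>R u)) * fourier PL_box (2 *\<^sub>R u))"
    unfolding fourier_shift_sum_coarse[OF b]
    unfolding fourier_box_spline[OF b]
    by (intro L2_sqnorm_cong_AE) (auto elim: eventually_mono)
  also have "\<dots> \<le> L2_sqnorm lborel (\<lambda>u. F (torus_point u) * fourier PL_box u - laurent_poly P (torus_point u) * fourier PL_box u)"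
  proof -
    have "1 * (\<integral>\<^sup>+u. h (2 *\<^sub>R u) \<partial>lborel) \<le> (\<integral>\<^sup>+u. h u \<partial>lborel)" if [measurable]: "h \<in> borel_measurable borel" for h :: "real^3 \<Rightarrow> ennreal"
    proof -
      have "1 * (\<integral>\<^sup>+u. h (2 *\<^sub>R u) \<partial>lborel) \<le> ennreal (\<bar>2\<bar> ^ DIM(real^3)) * (\<integral>\<^sup>+u. h (0 + 2 *\<^sub>R u) \<partial>lborel)"
        unfolding add_0 by (intro mult_right_mono) auto
      also have "\<dots> = (\<integral>\<^sup>+u. h u \<partial>lborel)"
        by (rule nn_integral_lborel_affine[symmetric]) auto
      finally show ?thesis .
    qed
    from this[of "\<lambda>u. ennreal ((norm (F (torus_point u) * fourier PL_box u - laurent_poly P (torus_point u) * fourier PL_box u))\<^sup>2)"]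
    show ?thesis unfolding L2_sqnorm_def by simp
  qed
  finally have le: "L2_sqnorm lborel (\<lambda>u. g' (2 *\<^sub>R u) - laurent_poly (laurent_up P * box_mask Xi) (torus_point u) * fourier \<phi> u) < ennreal (e / 16)"
    using P by (rule le_less_trans)
  have "L2_sqnorm lborel (\<lambda>x. f x - shift_sum \<phi> (laurent_up P * box_mask Xi) x) \<le> 16 * L2_sqnorm lborel (\<lambda>u. g' (2 *\<^sub>R u) - laurent_poly (laurent_up P * box_mask Xi) (torus_point u) * fourier \<phi> u)"
    by (rule has_fourier_L2_shift_sum_dist[OF b g(3)])
  also have "\<dots> < 16 * ennreal (e / 16)"
    using le by (intro ennreal_mult_strict_left_mono) auto
  also have "\<dots> = ennreal e"
    using e by (simp add: ennreal_mult''[symmetric] ennreal_numeral[symmetric] del: ennreal_numeral)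
  finally show ?thesis by (rule that)
qed

lemma shift_sum_in_V_zero:
  assumes b: "is_box_spline Xi \<phi>"
  shows "shift_sum \<phi> P \<in> V_zero \<phi>"
  using shift_sum_in_L2[OF b] has_mask_shift_sum[OF b] by (auto simp: V_zero_def)

lemma shift_sum_in_V_minus_one:
  assumes b: "is_box_spline Xi \<phi>"
  shows "shift_sum \<phi> (laurent_up P * box_mask Xi) \<in> V_minus_one \<phi>"
  unfolding V_minus_one_def
proof (intro CollectI conjI bexI exI)
  show "has_fourier_L2 (shift_sum \<phi> P) (\<lambda>u. laurent_poly P (torus_point u) * fourier \<phi> u)"
    by (rule has_fourier_L2_shift_sum[OF b])
  show "has_fourier_L2 (shift_sum \<phi> (laurent_up P * box_mask Xi)) (\<lambda>u. laurent_poly P (torus_point (2 *\<^sub>R u)) * fourier \<phi> (2 *\<^sub>R u))"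
    using has_fourier_L2_shift_sum[OF b, of "laurent_up P * box_mask Xi"] by (simp only: fourier_shift_sum_coarse[OF b])
qed (auto intro: shift_sum_in_L2 shift_sum_in_V_zero b)

section \<open>The prewavelets\<close>

lemma integrable_L2_mult:
  assumes "f \<in> L2" "g \<in> L2"
  shows "integrable lborel (\<lambda>x. f x * cnj (g x))"
proof -
  have [measurable]: "f \<in> borel_measurable borel" "g \<in> borel_measurable borel" using assms by (auto simp: L2_def)
  have i: "integrable lborel (\<lambda>x. (norm (f x))\<^sup>2 + (norm (g x))\<^sup>2)"
    using assms L2_sqnorm_finite_iff[of f lborel] L2_sqnorm_finite_iff[of g lborel] by (auto simp: L2_def)
  show ?thesis
  proof (rule Bochner_Integration.integrable_bound[OF i])
    show "AE x in lborel. norm (f x * cnj (g x)) \<le> norm ((norm (f x))\<^sup>2 + (norm (g x))\<^sup>2)"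
    proof (rule AE_I2)
      fix x
      have "0 \<le> norm (f x) * norm (g x)" by simp
      then show "norm (f x * cnj (g x)) \<le> norm ((norm (f x))\<^sup>2 + (norm (g x))\<^sup>2)"
        using sum_squares_bound[of "norm (f x)" "norm (g x)"]
        unfolding norm_mult complex_mod_cnj mult.assoc real_norm_def by linarith
    qed
  qed measurable
qed

definition L2_real_sqnorm :: "(real^'d::finite \<Rightarrow> complex) \<Rightarrow> real" where
  "L2_real_sqnorm f = (LINT x|lborel. (norm (f x))\<^sup>2)"

lemma L2_sqnorm_eq_real: "f \<in> L2 \<Longrightarrow> L2_sqnorm lborel f = ennreal (L2_real_sqnorm f)"
  using L2_sqnorm_finite_iff[of f lborel] by (auto simp: L2_def L2_real_sqnorm_def intro!: L2_sqnorm_eq_integral)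

lemma L2_real_sqnorm_nonneg: "0 \<le> L2_real_sqnorm f"
  by (simp add: L2_real_sqnorm_def)

lemma L2_diff: "f \<in> L2 \<Longrightarrow> g \<in> L2 \<Longrightarrow> (\<lambda>x. f x - g x) \<in> L2"
  using L2_sqnorm_diff_le[of f lborel g]
  by (auto simp: L2_def ennreal_mult_less_top intro: le_less_trans)

lemma L2_inner_diff_right:
  assumes "f \<in> L2" "g \<in> L2" "h \<in> L2"
  shows "L2_inner f (\<lambda>x. g x - h x) = L2_inner f g - L2_inner f h"
  unfolding L2_inner_def complex_cnj_diff right_diff_distrib
  by (intro Bochner_Integration.integral_diff integrable_L2_mult assms)

lemma L2_inner_diff_left:
  assumes "f \<in> L2" "g \<in> L2" "h \<in> L2"
  shows "L2_inner (\<lambda>x. g x - h x) f = L2_inner g f - L2_inner h f"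
  unfolding L2_inner_def left_diff_distrib
  by (intro Bochner_Integration.integral_diff integrable_L2_mult assms)

lemma L2_inner_commute: "L2_inner g f = cnj (L2_inner f g)"
  unfolding L2_inner_def Bochner_Integration.integral_cnj[symmetric] by (simp add: mult.commute)

text \<open>A Cauchy-Schwarz estimate with a free weight, from the square of
  \<open>sqrt t * a - b / sqrt t\<close>. Choosing \<open>t\<close> at the point of use takes the
  place of square roots of norms.\<close>

lemma norm_L2_inner_le:
  assumes f: "f \<in> L2" and g: "g \<in> L2" and t: "0 < t"
  shows "norm (L2_inner f g) \<le> t * L2_real_sqnorm f + L2_real_sqnorm g / t"
proof -
  have i: "integrable lborel (\<lambda>x. (norm (f x))\<^sup>2)" "integrable lborel (\<lambda>x. (norm (g x))\<^sup>2)"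
    using assms L2_sqnorm_finite_iff[of f lborel] L2_sqnorm_finite_iff[of g lborel] by (auto simp: L2_def)
  have "norm (L2_inner f g) \<le> (LINT x|lborel. norm (f x * cnj (g x)))"
    unfolding L2_inner_def by (rule integral_norm_bound)
  also have "\<dots> \<le> (LINT x|lborel. t * (norm (f x))\<^sup>2 + (norm (g x))\<^sup>2 / t)"
  proof (rule integral_mono)
    show "integrable lborel (\<lambda>x. t * (norm (f x))\<^sup>2 + (norm (g x))\<^sup>2 / t)" using i by simp
    fix x
    have "0 \<le> (sqrt t * norm (f x) - norm (g x) / sqrt t)\<^sup>2" by simp
    also have "\<dots> = t * (norm (f x))\<^sup>2 + (norm (g x))\<^sup>2 / t - 2 * (norm (f x) * norm (g x))"
      using t by (simp add: power2_diff power_mult_distrib power_divide)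
    finally have "2 * (norm (f x) * norm (g x)) \<le> t * (norm (f x))\<^sup>2 + (norm (g x))\<^sup>2 / t" by simp
    moreover have "0 \<le> norm (f x) * norm (g x)" by simp
    ultimately show "norm (f x * cnj (g x)) \<le> t * (norm (f x))\<^sup>2 + (norm (g x))\<^sup>2 / t"
      unfolding norm_mult complex_mod_cnj by linarith
  qed (use integrable_L2_mult[OF f g] in simp)
  also have "\<dots> = t * L2_real_sqnorm f + L2_real_sqnorm g / t"
    using i by (simp add: L2_real_sqnorm_def)
  finally show ?thesis .
qed

lemma L2_inner_eq_0_by_approx:
  assumes f: "f \<in> L2" and g: "g \<in> L2"
    and approx: "\<And>e. 0 < e \<Longrightarrow> \<exists>h\<in>L2. L2_inner f h = 0 \<and> L2_sqnorm lborel (\<lambda>x. g x - h x) < ennreal e"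
  shows "L2_inner f g = 0"
proof -
  have "norm (L2_inner f g) \<le> e" if e: "0 < e" for e
  proof -
    \<comment> \<open>Makes the first term of \<open>norm_L2_inner_le\<close> at most
      \<open>e / 2\<close>; the summand 1 guards against an \<open>f\<close> of norm 0.\<close>
    define t where "t = e / (2 * (L2_real_sqnorm f + 1))"
    have f1: "0 < L2_real_sqnorm f + 1" using L2_real_sqnorm_nonneg[of f] by simp
    have t: "0 < t" using e f1 by (simp add: t_def)
    obtain h where h: "h \<in> L2" "L2_inner f h = 0" "L2_sqnorm lborel (\<lambda>x. g x - h x) < ennreal (e * t / 2)"
      using approx[of "e * t / 2"] e t by auto
    have "L2_real_sqnorm (\<lambda>x. g x - h x) \<le> e * t / 2"
      using h(3) e t unfolding L2_sqnorm_eq_real[OF L2_diff[OF g h(1)]]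
      by (simp add: ennreal_less_iff L2_real_sqnorm_nonneg)
    then have "L2_real_sqnorm (\<lambda>x. g x - h x) / t \<le> e / 2"
      using t by (simp add: field_simps)
    moreover have "t * L2_real_sqnorm f \<le> e / 2"
    proof -
      have "t * L2_real_sqnorm f \<le> t * (L2_real_sqnorm f + 1)" using t by (intro mult_left_mono) auto
      also have "\<dots> = e / 2" unfolding t_def using f1 by (auto simp: divide_simps simp del: distrib_left_numeral)
      finally show ?thesis .
    qed
    moreover have "norm (L2_inner f g) \<le> t * L2_real_sqnorm f + L2_real_sqnorm (\<lambda>x. g x - h x) / t"
      using norm_L2_inner_le[OF f L2_diff[OF g h(1)] t] L2_inner_diff_right[OF f g h(1)] h(2) by simp
    ultimately show ?thesis by linarith
  qed
  then have "norm (L2_inner f g) \<le> 0" by (rule field_le_epsilon[rotated]) simp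
  then show ?thesis by simp
qed

text \<open>Orthogonality is exact against the elements of V_-1 with polynomial masks; their density
  and continuity of the inner product give the rest.\<close>

lemma shift_sum_wavelet_in_W_zero:
  assumes b: "is_box_spline Xi \<phi>" and s: "s \<in> E01 - {0}"
  shows "shift_sum \<phi> (laurent_up Q * wavelet_mask s) \<in> W_zero \<phi>"
  unfolding W_zero_def
proof (intro CollectI conjI ballI)
  show "shift_sum \<phi> (laurent_up Q * wavelet_mask s) \<in> V_zero \<phi>" by (rule shift_sum_in_V_zero[OF b])
  fix g assume g: "g \<in> V_minus_one \<phi>"
  show "L2_inner (shift_sum \<phi> (laurent_up Q * wavelet_mask s)) g = 0"
  proof (rule L2_inner_eq_0_by_approx)
    show "g \<in> L2" using g by (simp add: V_minus_one_def)
    fix e :: real assume "0 < e"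
    then obtain P where "L2_sqnorm lborel (\<lambda>x. g x - shift_sum \<phi> (laurent_up P * box_mask Xi) x) < ennreal e"
      using V_minus_one_approx[OF b g] by blast
    moreover have "L2_inner (shift_sum \<phi> (laurent_up Q * wavelet_mask s)) (shift_sum \<phi> (laurent_up P * box_mask Xi)) = 0"
      by (subst L2_inner_commute) (simp add: L2_inner_coarse_wavelet[OF b s])
    ultimately show "\<exists>h\<in>L2. L2_inner (shift_sum \<phi> (laurent_up Q * wavelet_mask s)) h = 0 \<and> L2_sqnorm lborel (\<lambda>x. g x - h x) < ennreal e"
      using shift_sum_in_L2[OF b] by blast
  qed (rule shift_sum_in_L2[OF b])
qed

text \<open>Allows arbitrary functions with the prescribed masks to replace the explicit
  combinations of translates, from which they differ on null sets.\<close>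

lemma W_zero_cong_AE:
  assumes f: "f \<in> W_zero \<phi>" and eq: "AE x in lborel. f x = g x" and m: "g \<in> borel_measurable lborel"
  shows "g \<in> W_zero \<phi>"
proof -
  obtain F where fV: "f \<in> L2" "F \<in> Laurent_l2" "has_fourier_L2 f (\<lambda>u. F (torus_point u) * fourier \<phi> u)"
    and o: "\<And>h. h \<in> V_minus_one \<phi> \<Longrightarrow> L2_inner f h = 0"
    using f by (auto simp: W_zero_def V_zero_def has_mask_def)
  have gh: "has_fourier_L2 g (\<lambda>u. F (torus_point u) * fourier \<phi> u)"
    by (rule has_fourier_L2_cong_AE[OF fV(3) eq _ m]) (use fV(3) in \<open>auto simp: has_fourier_L2_def L2_def\<close>)
  have "L2_inner g h = 0" if h: "h \<in> V_minus_one \<phi>" for h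
  proof -
    have hm [measurable]: "h \<in> borel_measurable borel" "g \<in> borel_measurable borel" "f \<in> borel_measurable borel"
      using h m fV(1) by (auto simp: V_minus_one_def L2_def)
    have "L2_inner g h = L2_inner f h"
      unfolding L2_inner_def by (rule integral_cong_AE) (measurable, use eq in \<open>auto elim: eventually_mono\<close>)
    then show ?thesis using o[OF h] by simp
  qed
  then show ?thesis using gh fV(2) by (auto simp: W_zero_def V_zero_def has_mask_def has_fourier_L2_def)
qed

subsection \<open>Riesz bounds\<close>

definition wavelet_comb :: "(nat^3 \<Rightarrow> ((int^3) \<Rightarrow>\<^sub>0 complex)) \<Rightarrow> ((int^3) \<Rightarrow>\<^sub>0 complex)" where
  "wavelet_comb Q = (\<Sum>s\<in>E01 - {0}. laurent_up (Q s) * wavelet_mask s)"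

lemma laurent_poly_wavelet_comb:
  "\<zeta> \<in> torus \<Longrightarrow> laurent_poly (wavelet_comb Q) \<zeta> = (\<Sum>s\<in>E01 - {0}. laurent_poly (Q s) (sq \<zeta>) * laurent_poly (wavelet_mask s) \<zeta>)"
  by (simp add: wavelet_comb_def laurent_poly_sum laurent_poly_mult laurent_poly_up)

lemma laurent_poly_mult_star_self:
  "\<zeta> \<in> torus \<Longrightarrow> laurent_poly (P * laurent_star P) \<zeta> = of_real ((norm (laurent_poly P \<zeta>))\<^sup>2)"
  unfolding complex_norm_square by (simp add: laurent_poly_mult laurent_poly_star)

lemma laurent_poly_const_mult: "\<zeta> \<in> torus \<Longrightarrow> laurent_poly (Poly_Mapping.single 0 c * P) \<zeta> = c * laurent_poly P \<zeta>"
  by (simp add: laurent_poly_mult)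

lemma lookup_const_mult: "Poly_Mapping.lookup (Poly_Mapping.single 0 c * P) (k :: int^3) = (c :: complex) * Poly_Mapping.lookup P k"
  unfolding mult.commute[of "Poly_Mapping.single 0 c"] by (simp add: lookup_mult_single)

text \<open>The lower Riesz bound. Up to a monomial, the component of the combination in the class
  \<open>compl3 s\<close> is \<open>- 60 (1 + \<Phi>) Q_s\<close>, of modulus at least that of
  \<open>Q_s\<close>. Discarding the class \<open>one3\<close> and summing by Parseval gives the
  inequality at every point; the 8 is both the Parseval factor and the number of sign
  changes.\<close>

lemma sum_laurent_sqnorm_le_wavelet_comb:
  "(\<Sum>s\<in>E01 - {0}. laurent_sqnorm (Q s)) \<le> laurent_sqnorm (wavelet_comb Q)"
proof -
  let ?F = "wavelet_comb Q"
  let ?N = "\<Sum>s\<in>E01 - {0}. laurent_up (Q s) * laurent_star (laurent_up (Q s))"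
  have "0 \<le> Re (Poly_Mapping.lookup (- (Poly_Mapping.single 0 8 * ?N)) 0) + 8 * Re (Poly_Mapping.lookup (?F * laurent_star ?F) 0)"
  proof (rule lookup_0_nonneg_average)
    fix \<zeta> :: "complex^3" assume t: "\<zeta> \<in> torus"
    have ev: "laurent_poly (Q s) (sq (sign_change r \<zeta>)) = laurent_poly (Q s) (sq \<zeta>)" for s r
      by (simp add: sq_sign_change)
    obtain r where r: "Phi_vec (sq \<zeta>) = of_real r" "1 / 5 \<le> r" using Phi_vec_bounds[OF torus_square[OF t]] by blast
    have pp: "polyphase (laurent_poly ?F) (compl3 s) \<zeta> = laurent_poly (Q s) (sq \<zeta>) * (xmon (compl3 s) \<zeta> * (- 60 * (1 + Phi_vec (sq \<zeta>))))"
      if "s \<in> E01 - {0}" for s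
    proof -
      have "polyphase (laurent_poly ?F) (compl3 s) \<zeta> = polyphase (\<lambda>\<zeta>. \<Sum>i\<in>E01 - {0}. laurent_poly (Q i) (sq \<zeta>) * laurent_poly (wavelet_mask i) \<zeta>) (compl3 s) \<zeta>"
        unfolding polyphase_def by (simp add: laurent_poly_wavelet_comb sign_change_torus[OF t])
      then show ?thesis
        using polyphase_combination[where G = "\<lambda>i \<zeta>. laurent_poly (Q i) (sq \<zeta>)", OF t ev that] by simp
    qed
    have le: "(norm (laurent_poly (Q s) (sq \<zeta>)))\<^sup>2 \<le> (norm (polyphase (laurent_poly ?F) (compl3 s) \<zeta>))\<^sup>2" if "s \<in> E01 - {0}" for s
    proof -
      have "norm (1 + Phi_vec (sq \<zeta>)) = norm (complex_of_real (1 + r))" by (simp add: r)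
      also have "\<dots> = 1 + r" using r(2) by (simp only: norm_of_real)
      finally have n: "norm (1 + Phi_vec (sq \<zeta>)) = 1 + r" .
      have x: "norm (xmon e \<zeta>) = 1" for e using t by (simp add: xmon_def norm_mult norm_power torus_def)
      have "norm (laurent_poly (Q s) (sq \<zeta>)) * 1 \<le> norm (laurent_poly (Q s) (sq \<zeta>)) * (60 * (1 + r))"
        using r(2) by (intro mult_left_mono) auto
      also have "\<dots> = norm (polyphase (laurent_poly ?F) (compl3 s) \<zeta>)"
        unfolding pp[OF that] norm_mult x n by simp
      finally show ?thesis by (intro power_mono) auto
    qed
    have "8 * (\<Sum>s\<in>E01 - {0}. (norm (laurent_poly (Q s) (sq \<zeta>)))\<^sup>2) \<le> 8 * (\<Sum>s\<in>E01 - {0}. (norm (polyphase (laurent_poly ?F) (compl3 s) \<zeta>))\<^sup>2)"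
      by (intro mult_left_mono sum_mono le) auto
    also have "\<dots> \<le> 8 * (\<Sum>e\<in>E01. (norm (polyphase (laurent_poly ?F) e \<zeta>))\<^sup>2)"
    proof -
      have "inj_on compl3 (E01 - {0})" using compl3_E01(2) by (metis DiffD1 inj_onI)
      then have "(\<Sum>s\<in>E01 - {0}. (norm (polyphase (laurent_poly ?F) (compl3 s) \<zeta>))\<^sup>2) = (\<Sum>e\<in>compl3 ` (E01 - {0}). (norm (polyphase (laurent_poly ?F) e \<zeta>))\<^sup>2)"
        by (simp add: sum.reindex)
      also have "\<dots> \<le> (\<Sum>e\<in>E01. (norm (polyphase (laurent_poly ?F) e \<zeta>))\<^sup>2)"
        by (intro sum_mono2) (auto intro: compl3_E01(1))
      finally show ?thesis by simp
    qed
    also have "\<dots> = (\<Sum>s\<in>E01. (norm (laurent_poly ?F (sign_change s \<zeta>)))\<^sup>2)"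
    proof -
      have "complex_of_real (\<Sum>s\<in>E01. (norm (laurent_poly ?F (sign_change s \<zeta>)))\<^sup>2) = of_real (8 * (\<Sum>e\<in>E01. (norm (polyphase (laurent_poly ?F) e \<zeta>))\<^sup>2))"
        unfolding of_real_mult of_real_sum complex_norm_square polyphase_parseval by simp
      then show ?thesis by (simp only: of_real_eq_iff)
    qed
    finally have main: "8 * (\<Sum>s\<in>E01 - {0}. (norm (laurent_poly (Q s) (sq \<zeta>)))\<^sup>2) \<le> (\<Sum>s\<in>E01. (norm (laurent_poly ?F (sign_change s \<zeta>)))\<^sup>2)" .
    have "laurent_poly (- (Poly_Mapping.single 0 8 * ?N)) \<zeta> = of_real (- (8 * (\<Sum>s\<in>E01 - {0}. (norm (laurent_poly (Q s) (sq \<zeta>)))\<^sup>2)))"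
      unfolding laurent_poly_uminus laurent_poly_const_mult[OF t] laurent_poly_sum laurent_poly_mult_star_self[OF t] laurent_poly_up by simp
    moreover have "(\<Sum>s\<in>E01. laurent_poly (?F * laurent_star ?F) (sign_change s \<zeta>)) = of_real (\<Sum>s\<in>E01. (norm (laurent_poly ?F (sign_change s \<zeta>)))\<^sup>2)"
      by (simp add: laurent_poly_mult_star_self sign_change_torus[OF t])
    ultimately show "0 \<le> Re (laurent_poly (- (Poly_Mapping.single 0 8 * ?N)) \<zeta> + (\<Sum>s\<in>E01. laurent_poly (?F * laurent_star ?F) (sign_change s \<zeta>)))"
      using main by (simp only: plus_complex.sel Re_complex_of_real)
  qed
  moreover have "Poly_Mapping.lookup (Poly_Mapping.single 0 8 * ?N) 0 = of_real (8 * (\<Sum>s\<in>E01 - {0}. laurent_sqnorm (Q s)))"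
    unfolding lookup_const_mult lookup_sum lookup_mult_star_self laurent_sqnorm_up by simp
  ultimately show ?thesis
    unfolding lookup_uminus lookup_mult_star_self by simp
qed

definition laurent_l1norm :: "((int^3) \<Rightarrow>\<^sub>0 complex) \<Rightarrow> real" where
  "laurent_l1norm P = (\<Sum>k\<in>Poly_Mapping.keys P. cmod (Poly_Mapping.lookup P k))"

lemma norm_laurent_poly_le: "\<zeta> \<in> torus \<Longrightarrow> norm (laurent_poly P \<zeta>) \<le> laurent_l1norm P"
  unfolding laurent_poly_eq_sum[OF finite_keys order_refl] laurent_l1norm_def
  by (rule order_trans[OF norm_sum]) (simp add: norm_mult norm_zpow)

lemma laurent_sqnorm_add_le: "laurent_sqnorm (P + Q) \<le> 2 * laurent_sqnorm P + 2 * laurent_sqnorm (Q :: (int^3) \<Rightarrow>\<^sub>0 complex)"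
proof -
  have "0 \<le> Re (Poly_Mapping.lookup (Poly_Mapping.single 0 2 * (P * laurent_star P) + Poly_Mapping.single 0 2 * (Q * laurent_star Q) - (P + Q) * laurent_star (P + Q)) 0)"
  proof (rule lookup_0_nonneg)
    fix \<zeta> :: "complex^3" assume t: "\<zeta> \<in> torus"
    let ?p = "laurent_poly P \<zeta>" and ?q = "laurent_poly Q \<zeta>"
    have "laurent_poly (Poly_Mapping.single 0 2 * (P * laurent_star P) + Poly_Mapping.single 0 2 * (Q * laurent_star Q) - (P + Q) * laurent_star (P + Q)) \<zeta>
       = of_real (2 * (norm ?p)\<^sup>2 + 2 * (norm ?q)\<^sup>2 - (norm (?p + ?q))\<^sup>2)"
      by (simp only: laurent_poly_diff laurent_poly_add laurent_poly_mult_star_self[OF t] laurent_poly_const_mult[OF t]) simp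
    moreover have "(norm (?p + ?q))\<^sup>2 \<le> 2 * (norm ?p)\<^sup>2 + 2 * (norm ?q)\<^sup>2"
      using power_mono[OF norm_triangle_ineq[of ?p ?q], of 2] sum_squares_bound[of "norm ?p" "norm ?q"] by (simp add: power2_sum)
    ultimately show "0 \<le> Re (laurent_poly (Poly_Mapping.single 0 2 * (P * laurent_star P) + Poly_Mapping.single 0 2 * (Q * laurent_star Q) - (P + Q) * laurent_star (P + Q)) \<zeta>)"
      by (simp only: Re_complex_of_real)
  qed
  then show ?thesis
    unfolding lookup_minus lookup_add lookup_const_mult lookup_mult_star_self by simp
qed

text \<open>The constant \<open>2 ^ card A\<close> comes from iterating the inequality for two
  summands; it is applied to the seven wavelet masks.\<close>

lemma laurent_sqnorm_sum_le:
  "finite A \<Longrightarrow> laurent_sqnorm (\<Sum>i\<in>A. P i) \<le> 2 ^ card A * (\<Sum>i\<in>A. laurent_sqnorm (P i :: (int^3) \<Rightarrow>\<^sub>0 complex))"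
proof (induction A rule: finite_induct)
  case (insert a A)
  have "laurent_sqnorm (\<Sum>i\<in>insert a A. P i) \<le> 2 * laurent_sqnorm (P a) + 2 * (2 ^ card A * (\<Sum>i\<in>A. laurent_sqnorm (P i)))"
    using laurent_sqnorm_add_le[of "P a" "\<Sum>i\<in>A. P i"] insert by simp
  also have "\<dots> \<le> 2 * 2 ^ card A * laurent_sqnorm (P a) + 2 * (2 ^ card A * (\<Sum>i\<in>A. laurent_sqnorm (P i)))"
    using mult_right_mono[OF one_le_power[of "2::real" "card A"], of "laurent_sqnorm (P a)"] laurent_sqnorm_nonneg[of "P a"] by simp
  finally show ?case using insert by (simp add: algebra_simps)
qed (simp add: laurent_sqnorm_def)

text \<open>Multiplication by a fixed mask enlarges coefficient norms by at most its maximum on the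
  torus, which the l1 norm of its coefficients bounds. The summand 1 in \<open>C\<close> keeps the
  constant positive.\<close>

lemma laurent_sqnorm_wavelet_comb_le:
  obtains B where "0 < B" "\<And>Q. laurent_sqnorm (wavelet_comb Q) \<le> B * (\<Sum>s\<in>E01 - {0}. laurent_sqnorm (Q s))"
proof -
  define C where "C = (\<Sum>s\<in>E01 - {0}. laurent_l1norm (wavelet_mask s)) + 1"
  have l1: "0 \<le> laurent_l1norm P" for P by (simp add: laurent_l1norm_def sum_nonneg)
  have C1: "1 \<le> C" unfolding C_def using sum_nonneg[of "E01 - {0}" "\<lambda>s. laurent_l1norm (wavelet_mask s)"] l1 by simp
  have Cs: "laurent_l1norm (wavelet_mask s) \<le> C" if "s \<in> E01 - {0}" for s
    unfolding C_def using member_le_sum[OF that, of "\<lambda>s. laurent_l1norm (wavelet_mask s)"] l1 by simp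
  have part: "laurent_sqnorm (laurent_up (Q s) * wavelet_mask s) \<le> C\<^sup>2 * laurent_sqnorm (Q s)" if "s \<in> E01 - {0}" for Q s
  proof -
    have "laurent_sqnorm (laurent_up (Q s) * wavelet_mask s) \<le> C\<^sup>2 * laurent_sqnorm (laurent_up (Q s))"
    proof (rule laurent_sqnorm_le)
      fix \<zeta> :: "complex^3" assume t: "\<zeta> \<in> torus"
      have "norm (laurent_poly (wavelet_mask s) \<zeta>) \<le> C"
        using norm_laurent_poly_le[OF t] Cs[OF that] by (rule order_trans)
      then show "norm (laurent_poly (laurent_up (Q s) * wavelet_mask s) \<zeta>) \<le> C * norm (laurent_poly (laurent_up (Q s)) \<zeta>)"
        unfolding laurent_poly_mult[OF t] norm_mult by (subst mult.commute) (rule mult_right_mono, auto)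
    qed
    then show ?thesis by (simp only: laurent_sqnorm_up)
  qed
  define B where "B = 2 ^ card (E01 - {0} :: (nat^3) set) * C\<^sup>2"
  have "laurent_sqnorm (wavelet_comb Q) \<le> B * (\<Sum>s\<in>E01 - {0}. laurent_sqnorm (Q s))" for Q
  proof -
    have "laurent_sqnorm (wavelet_comb Q) \<le> 2 ^ card (E01 - {0} :: (nat^3) set) * (\<Sum>s\<in>E01 - {0}. laurent_sqnorm (laurent_up (Q s) * wavelet_mask s))"
      unfolding wavelet_comb_def by (rule laurent_sqnorm_sum_le) simp
    also have "\<dots> \<le> 2 ^ card (E01 - {0} :: (nat^3) set) * (\<Sum>s\<in>E01 - {0}. C\<^sup>2 * laurent_sqnorm (Q s))"
      by (intro mult_left_mono sum_mono part) auto
    finally show ?thesis by (simp add: B_def sum_distrib_left mult_ac)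
  qed
  moreover have "0 < B" using C1 by (simp add: B_def)
  ultimately show ?thesis using that by blast
qed

subsection \<open>Completeness\<close>

text \<open>Truncating a series with absolutely summable coefficients leaves a tail whose l1 norm
  bounds the error uniformly on the torus.\<close>

lemma Laurent_l1_down_approx:
  fixes G :: "complex^3 \<Rightarrow> complex"
  assumes "G \<in> Laurent_l1_down" and e: "0 < e"
  obtains Q where "\<And>\<zeta>. \<zeta> \<in> torus \<Longrightarrow> norm (G \<zeta> - laurent_poly (laurent_up Q) \<zeta>) \<le> e"
proof -
  obtain G' a where G': "\<And>\<zeta>. \<zeta> \<in> torus \<Longrightarrow> G \<zeta> = G' (sq \<zeta>)"
    and a: "(\<lambda>k. cmod (a k)) summable_on UNIV" "\<And>\<zeta>. \<zeta> \<in> torus \<Longrightarrow> G' \<zeta> = laurent_series a \<zeta>"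
    using assms(1) by (auto simp: Laurent_l1_down_def Laurent_l1_def)
  have "\<forall>\<^sub>F K in finite_subsets_at_top UNIV. dist (\<Sum>k\<in>K. cmod (a k)) (\<Sum>\<^sub>\<infinity>k. cmod (a k)) < e"
    using has_sum_infsum[OF a(1)] e unfolding has_sum_def by (rule tendstoD)
  moreover have "\<forall>\<^sub>F K in finite_subsets_at_top (UNIV :: (int^3) set). finite K"
    by (rule eventually_finite_subsets_at_top_weakI)
  ultimately have "\<forall>\<^sub>F K in finite_subsets_at_top UNIV. finite K \<and> dist (\<Sum>k\<in>K. cmod (a k)) (\<Sum>\<^sub>\<infinity>k. cmod (a k)) < e"
    by eventually_elim simp
  then obtain K where K: "finite K" "dist (\<Sum>k\<in>K. cmod (a k)) (\<Sum>\<^sub>\<infinity>k. cmod (a k)) < e"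
    by (metis (no_types, lifting) eventually_happens' finite_subsets_at_top_neq_bot)
  define Q where "Q = (\<Sum>k\<in>K. Poly_Mapping.single k (a k))"
  show ?thesis
  proof (rule that[of Q])
    fix \<zeta> :: "complex^3" assume t: "\<zeta> \<in> torus"
    note tq = torus_square[OF t]
    have aK: "(\<lambda>k. cmod (a k)) summable_on - K"
      using a(1) by (rule summable_on_subset_banach) simp
    have zK: "(\<lambda>k. a k * zpow (sq \<zeta>) k) summable_on - K"
      using has_sum_imp_summable[OF laurent_series_has_sum(1)[OF a(1) tq]] by (rule summable_on_subset_banach) simp
    have "laurent_series a (sq \<zeta>) = (\<Sum>k\<in>K. a k * zpow (sq \<zeta>) k) + (\<Sum>\<^sub>\<infinity>k\<in>- K. a k * zpow (sq \<zeta>) k)"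
      unfolding laurent_series_def using infsum_Un_disjoint[of "\<lambda>k. a k * zpow (sq \<zeta>) k" K "- K"] K(1) zK by simp
    then have "norm (G \<zeta> - laurent_poly (laurent_up Q) \<zeta>) = norm (\<Sum>\<^sub>\<infinity>k\<in>- K. a k * zpow (sq \<zeta>) k)"
      by (simp add: G'[OF t] a(2)[OF tq] laurent_poly_up Q_def laurent_poly_sum)
    also have "\<dots> \<le> (\<Sum>\<^sub>\<infinity>k\<in>- K. norm (a k * zpow (sq \<zeta>) k))"
      by (rule norm_infsum_bound) (use aK in \<open>simp add: norm_mult norm_zpow[OF tq]\<close>)
    also have "\<dots> = (\<Sum>\<^sub>\<infinity>k\<in>- K. cmod (a k))"
      by (simp add: norm_mult norm_zpow[OF tq])
    also have "\<dots> = (\<Sum>\<^sub>\<infinity>k. cmod (a k)) - (\<Sum>k\<in>K. cmod (a k))"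
      using infsum_Un_disjoint[of "\<lambda>k. cmod (a k)" K "- K"] K(1) aK by simp
    also have "\<dots> \<le> e" using K(2) by (simp add: dist_real_def)
    finally show "norm (G \<zeta> - laurent_poly (laurent_up Q) \<zeta>) \<le> e" .
  qed
qed

text \<open>The expansion in the basis is exact, with coefficients that are infinite series.
  Truncating these is the only source of error, estimated uniformly on the torus and then as a
  mean.\<close>

lemma laurent_poly_approx_by_masks:
  fixes P :: "(int^3) \<Rightarrow>\<^sub>0 complex"
  assumes e: "0 < e"
  obtains Q where "laurent_sqnorm (P - (laurent_up (Q 0) * box_mask Xi + wavelet_comb Q)) \<le> e"
proof -
  obtain G where G: "\<And>i. i \<in> E01 \<Longrightarrow> G i \<in> Laurent_l1_down"
    "\<And>\<zeta>. \<zeta> \<in> torus \<Longrightarrow> laurent_poly P \<zeta> = (\<Sum>i\<in>E01. G i \<zeta> * laurent_poly (basis_mask i) \<zeta>)"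
    by (rule masks_span[OF laurent_poly_in_Laurent_l1[of P]]) (rule that, assumption+)
  define C where "C = (\<Sum>i\<in>E01. laurent_l1norm (basis_mask i)) + 1"
  have C1: "0 < C" unfolding C_def laurent_l1norm_def
    by (intro add_nonneg_pos sum_nonneg) auto
  \<comment> \<open>\<open>C\<close> bounds the sum of the basis masks in absolute value, so
    coefficient errors of size \<open>d\<close> give at most \<open>sqrt e\<close> uniformly, hence
    \<open>e\<close> in the squared norm.\<close>
  define d where "d = sqrt e / C"
  have d: "0 < d" using e C1 by (simp add: d_def)
  have "\<exists>Q. \<forall>\<zeta>\<in>torus. norm (G i \<zeta> - laurent_poly (laurent_up Q) \<zeta>) \<le> d" if "i \<in> E01" for i
    using Laurent_l1_down_approx[OF G(1)[OF that] d] by metis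
  then obtain Q where Q: "\<And>i \<zeta>. i \<in> E01 \<Longrightarrow> \<zeta> \<in> torus \<Longrightarrow> norm (G i \<zeta> - laurent_poly (laurent_up (Q i)) \<zeta>) \<le> d"
    by metis
  let ?D = "P - (laurent_up (Q 0) * box_mask Xi + wavelet_comb Q)"
  have "laurent_sqnorm ?D \<le> (sqrt e)\<^sup>2 * laurent_sqnorm (1 :: (int^3) \<Rightarrow>\<^sub>0 complex)"
  proof (rule laurent_sqnorm_le)
    fix \<zeta> :: "complex^3" assume t: "\<zeta> \<in> torus"
    have "laurent_poly ?D \<zeta> = (\<Sum>i\<in>E01. (G i \<zeta> - laurent_poly (laurent_up (Q i)) \<zeta>) * laurent_poly (basis_mask i) \<zeta>)"
      unfolding sum_E01_0 left_diff_distrib sum_subtractf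
      using G(2)[OF t] unfolding sum_E01_0
      by (simp add: laurent_poly_mult[OF t] laurent_poly_wavelet_comb[OF t] laurent_poly_up algebra_simps)
    also have "norm \<dots> \<le> (\<Sum>i\<in>E01. d * laurent_l1norm (basis_mask i))"
      by (rule sum_norm_le) (use Q[OF _ t] norm_laurent_poly_le[OF t] d in \<open>auto simp: norm_mult intro!: mult_mono\<close>)
    also have "\<dots> \<le> d * C"
      using d by (simp add: sum_distrib_left[symmetric] C_def)
    also have "\<dots> = sqrt e" using C1 by (simp add: d_def)
    finally show "norm (laurent_poly ?D \<zeta>) \<le> sqrt e * norm (laurent_poly (1 :: (int^3) \<Rightarrow>\<^sub>0 complex) \<zeta>)" by simp
  qed
  then have "laurent_sqnorm ?D \<le> e"
    using e by (simp add: laurent_sqnorm_def[of 1])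
  then show ?thesis by (rule that)
qed

text \<open>Pythagoras, kept as the inequality by which dropping an orthogonal part improves an
  approximation.\<close>

lemma L2_sqnorm_le_orthogonal:
  assumes f: "f \<in> L2" and g: "g \<in> L2" and o: "L2_inner f g = 0"
  shows "L2_sqnorm lborel f \<le> L2_sqnorm lborel (\<lambda>x. f x - g x)"
proof -
  have i: "integrable lborel (\<lambda>x. (norm (f x))\<^sup>2)" "integrable lborel (\<lambda>x. (norm (g x))\<^sup>2)"
    using assms L2_sqnorm_finite_iff[of f lborel] L2_sqnorm_finite_iff[of g lborel] by (auto simp: L2_def)
  have fg: "integrable lborel (\<lambda>x. f x * cnj (g x))" by (rule integrable_L2_mult[OF f g])
  have "(norm (f x - g x))\<^sup>2 = (norm (f x))\<^sup>2 + (norm (g x))\<^sup>2 - 2 * Re (f x * cnj (g x))" for x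
    unfolding cmod_power2 by (simp add: power2_diff algebra_simps)
  then have "L2_real_sqnorm (\<lambda>x. f x - g x) = (LINT x|lborel. (norm (f x))\<^sup>2 + (norm (g x))\<^sup>2 - 2 * Re (f x * cnj (g x)))"
    by (simp only: L2_real_sqnorm_def)
  also have "\<dots> = L2_real_sqnorm f + L2_real_sqnorm g - 2 * Re (L2_inner f g)"
    unfolding L2_real_sqnorm_def L2_inner_def integral_Re[OF fg, symmetric]
    using i integrable_Re[OF fg] by (simp del: times_complex.sel)
  finally have "L2_real_sqnorm (\<lambda>x. f x - g x) = L2_real_sqnorm f + L2_real_sqnorm g - 2 * Re (L2_inner f g)" .
  then show ?thesis
    unfolding L2_sqnorm_eq_real[OF f] L2_sqnorm_eq_real[OF L2_diff[OF f g]]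
    using L2_real_sqnorm_nonneg[of g] o by (intro ennreal_leI) simp
qed

lemma W_zero_approx:
  assumes b: "is_box_spline Xi \<phi>" and f: "f \<in> W_zero \<phi>" and e: "0 < e"
  obtains Q where "L2_sqnorm lborel (\<lambda>x. f x - shift_sum \<phi> (wavelet_comb Q) x) < ennreal e"
proof -
  have fV: "f \<in> V_zero \<phi>" "f \<in> L2" and fo: "\<And>g. g \<in> V_minus_one \<phi> \<Longrightarrow> L2_inner f g = 0"
    using f by (auto simp: W_zero_def V_zero_def)
  \<comment> \<open>A quarter each, because the inequality for squared norms doubles both errors;
    the coefficient error passes to functions with constant 1, as \<Phi> \<le> 1.\<close>
  have "0 < e / 4" using e by simp
  from V_zero_approx[OF b fV(1) this] obtain P where P: "L2_sqnorm lborel (\<lambda>x. f x - shift_sum \<phi> P x) < ennreal (e / 4)" .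
  from laurent_poly_approx_by_masks[OF \<open>0 < e / 4\<close>, of P] obtain Q where
    Q: "laurent_sqnorm (P - (laurent_up (Q 0) * box_mask Xi + wavelet_comb Q)) \<le> e / 4" .
  let ?g = "shift_sum \<phi> (laurent_up (Q 0) * box_mask Xi)" and ?h = "shift_sum \<phi> (wavelet_comb Q)"
  note L = shift_sum_in_L2[OF b]
  have hg: "L2_inner ?h ?g = 0"
  proof -
    have "L2_inner ?h ?g = cnj (L2_inner ?g ?h)" by (rule L2_inner_commute)
    also have "L2_inner ?g ?h = (\<Sum>s\<in>E01 - {0}. L2_inner ?g (shift_sum \<phi> (laurent_up (Q s) * wavelet_mask s)))"
      unfolding L2_inner_def wavelet_comb_def shift_sum_sum cnj_sum sum_distrib_left
      by (rule Bochner_Integration.integral_sum) (rule integrable_L2_mult[OF L L])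
    also have "\<dots> = 0" by (intro sum.neutral ballI L2_inner_coarse_wavelet[OF b])
    finally show ?thesis by simp
  qed
  \<comment> \<open>Both terms are orthogonal to \<open>?g\<close>: \<open>f\<close> as an element
    of W_0, \<open>?h\<close> as a combination of wavelets.\<close>
  have o: "L2_inner (\<lambda>x. f x - ?h x) ?g = 0"
    unfolding L2_inner_diff_left[OF L fV(2) L] by (simp add: hg fo shift_sum_in_V_minus_one[OF b])
  have "L2_sqnorm lborel (\<lambda>x. f x - ?h x) \<le> L2_sqnorm lborel (\<lambda>x. f x - ?h x - ?g x)"
    by (rule L2_sqnorm_le_orthogonal[OF L2_diff[OF fV(2) L] L o])
  also have "\<dots> = L2_sqnorm lborel (\<lambda>x. (f x - shift_sum \<phi> P x) + shift_sum \<phi> (P - (laurent_up (Q 0) * box_mask Xi + wavelet_comb Q)) x)"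
    by (simp add: shift_sum_diff shift_sum_add algebra_simps)
  also have "\<dots> \<le> 2 * L2_sqnorm lborel (\<lambda>x. f x - shift_sum \<phi> P x) + 2 * L2_sqnorm lborel (shift_sum \<phi> (P - (laurent_up (Q 0) * box_mask Xi + wavelet_comb Q)))"
    using L2_diff[OF fV(2) L, of P] L by (intro L2_sqnorm_add_le) (auto simp: L2_def)
  also have "\<dots> \<le> 2 * L2_sqnorm lborel (\<lambda>x. f x - shift_sum \<phi> P x) + 2 * ennreal (e / 4)"
    using Q by (intro add_left_mono mult_left_mono order_trans[OF L2_sqnorm_shift_sum_bounds(2)[OF b]] ennreal_leI) auto
  also have "\<dots> < 2 * ennreal (e / 4) + 2 * ennreal (e / 4)"
  proof -
    have "2 * L2_sqnorm lborel (\<lambda>x. f x - shift_sum \<phi> P x) < 2 * ennreal (e / 4)"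
      using P by (intro ennreal_mult_strict_left_mono) auto
    then show ?thesis by (simp add: ennreal_mult_less_top ennreal_mult_eq_top_iff ennreal_add_left_cancel_less)
  qed
  also have "\<dots> = ennreal e"
    using e by (simp add: ennreal_plus[symmetric] ennreal_mult''[symmetric] ennreal_numeral[symmetric] del: ennreal_plus ennreal_numeral)
  finally show ?thesis by (rule that)
qed

subsection \<open>The numbers of coefficients\<close>

text \<open>Distinct exponents and nonzero coefficients exclude cancellation, so the terms can be
  counted in the list as written.\<close>

lemma card_keys_sum_single:
  assumes "distinct (map fst xs)" "\<forall>p\<in>set xs. snd p \<noteq> 0"
  shows "card (Poly_Mapping.keys (\<Sum>(k, c)\<leftarrow>xs. Poly_Mapping.single k c)) = length xs"
proof -
  have "Poly_Mapping.keys (\<Sum>(k, c)\<leftarrow>xs. Poly_Mapping.single k c) = fst ` set xs"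
    using assms
  proof (induction xs)
    case (Cons p xs)
    obtain k c where p: "p = (k, c)" by fastforce
    have "k \<notin> Poly_Mapping.keys (\<Sum>(k, c)\<leftarrow>xs. Poly_Mapping.single k c)" "c \<noteq> 0"
      using Cons p by auto
    then have "Poly_Mapping.keys (Poly_Mapping.single k c + (\<Sum>(k, c)\<leftarrow>xs. Poly_Mapping.single k c))
        = insert k (Poly_Mapping.keys (\<Sum>(k, c)\<leftarrow>xs. Poly_Mapping.single k c))"
      by (auto simp: in_keys_iff lookup_add lookup_single when_def split: if_splits)
    then show ?case using Cons p by simp
  qed simp
  then show ?thesis using distinct_card[OF assms(1)] by simp
qed

lemma numeral_mult_lmon:
  "numeral n * lmon i j k = Poly_Mapping.single (vector [i, j, k]) (numeral n)"
  "- numeral n * lmon i j k = Poly_Mapping.single (vector [i, j, k]) (- numeral n)"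
  by (simp_all add: lmon_def single_numeral[symmetric] mult_single single_uminus[symmetric] del: single_numeral)

lemma diff_single: "P - Poly_Mapping.single k (c :: complex) = P + Poly_Mapping.single k (- c)"
  by (simp add: single_uminus)

lemma card_keys_H100: "card (Poly_Mapping.keys H100) = 23"
proof -
  let ?xs = "[(vector [2, 3, 3], - 3), (vector [1, 3, 3], 5), (vector [2, 3, 1], - 2), (vector [2, 1, 3], - 2),
     (vector [0, 3, 3], - 2), (vector [1, 3, 1], 5), (vector [1, 1, 3], 5), (vector [2, 1, 1], - 3),
     (vector [0, 3, 1], - 3), (vector [0, 1, 3], - 3), (vector [1, 1, 1], 45), (vector [0, 1, 1], - 84),
     (vector [- 1, 1, 1], 45), (vector [0, 1, - 1], - 3), (vector [0, - 1, 1], - 3), (vector [- 2, 1, 1], - 3),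
     (vector [- 1, 1, - 1], 5), (vector [- 1, - 1, 1], 5), (vector [0, - 1, - 1], - 2), (vector [- 2, 1, - 1], - 2),
     (vector [- 2, - 1, 1], - 2), (vector [- 1, - 1, - 1], 5), (vector [- 2, - 1, - 1], - 3)] :: ((int^3) \<times> complex) list"
  have "H100 = (\<Sum>(k, c)\<leftarrow>?xs. Poly_Mapping.single k c)"
    by (simp only: H100_def numeral_mult_lmon diff_single list.map sum_list.Cons sum_list.Nil prod.case add.assoc add_0_right)
  from card_keys_sum_single[where xs = ?xs, folded this] show ?thesis
    by (simp add: vector3_eq_iff)
qed

lemma card_keys_H110: "card (Poly_Mapping.keys H110) = 21"
proof -
  let ?xs = "[(vector [2, 2, 3], - 3), (vector [2, 2, 1], - 2), (vector [2, 0, 3], - 2), (vector [1, 1, 3], 10),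
     (vector [0, 2, 3], - 2), (vector [2, 0, 1], - 3), (vector [1, 1, 1], 40), (vector [0, 2, 1], - 3),
     (vector [0, 0, 3], - 3), (vector [1, - 1, 1], 10), (vector [0, 0, 1], - 84), (vector [- 1, 1, 1], 10),
     (vector [0, 0, - 1], - 3), (vector [0, - 2, 1], - 3), (vector [- 1, - 1, 1], 40), (vector [- 2, 0, 1], - 3),
     (vector [0, - 2, - 1], - 2), (vector [- 1, - 1, - 1], 10), (vector [- 2, 0, - 1], - 2), (vector [- 2, - 2, 1], - 2),
     (vector [- 2, - 2, - 1], - 3)] :: ((int^3) \<times> complex) list"
  have "H110 = (\<Sum>(k, c)\<leftarrow>?xs. Poly_Mapping.single k c)"
    by (simp only: H110_def numeral_mult_lmon diff_single list.map sum_list.Cons sum_list.Nil prod.case add.assoc add_0_right)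
  from card_keys_sum_single[where xs = ?xs, folded this] show ?thesis
    by (simp add: vector3_eq_iff)
qed

lemma card_keys_H111: "card (Poly_Mapping.keys H111) = 23"
proof -
  let ?xs = "[(vector [2, 2, 2], - 3), (vector [2, 2, 0], - 2), (vector [2, 0, 2], - 2), (vector [0, 2, 2], - 2),
     (vector [1, 1, 1], 45), (vector [2, 0, 0], - 3), (vector [0, 2, 0], - 3), (vector [0, 0, 2], - 3),
     (vector [1, 1, - 1], 5), (vector [1, - 1, 1], 5), (vector [- 1, 1, 1], 5), (vector [0, 0, 0], - 84),
     (vector [1, - 1, - 1], 5), (vector [- 1, 1, - 1], 5), (vector [- 1, - 1, 1], 5), (vector [0, 0, - 2], - 3),
     (vector [0, - 2, 0], - 3), (vector [- 2, 0, 0], - 3), (vector [- 1, - 1, - 1], 45), (vector [0, - 2, - 2], - 2),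
     (vector [- 2, 0, - 2], - 2), (vector [- 2, - 2, 0], - 2), (vector [- 2, - 2, - 2], - 3)] :: ((int^3) \<times> complex) list"
  have "H111 = (\<Sum>(k, c)\<leftarrow>?xs. Poly_Mapping.single k c)"
    by (simp only: H111_def numeral_mult_lmon diff_single list.map sum_list.Cons sum_list.Nil prod.case add.assoc add_0_right)
  from card_keys_sum_single[where xs = ?xs, folded this] show ?thesis
    by (simp add: vector3_eq_iff)
qed

text \<open>An involutive permutation acts on exponents as a bijection that is its own inverse, so
  image and preimage of the support coincide.\<close>

lemma card_keys_permute_vars:
  assumes "\<And>j. \<pi> (\<pi> j) = j"
  shows "card (Poly_Mapping.keys (permute_vars \<pi> P)) = card (Poly_Mapping.keys P)"
proof -
  let ?f = "\<lambda>k::int^'a. \<chi> j. k $ \<pi> j"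
  have ff: "?f (?f k) = k" for k by (simp add: vec_eq_iff assms)
  have inj: "inj ?f" by (rule inj_on_inverseI[where g = ?f]) (rule ff)
  have "Poly_Mapping.keys (permute_vars \<pi> P) = ?f ` Poly_Mapping.keys P"
    unfolding permute_vars_def keys_map_key[OF inj]
  proof (intro equalityI subsetI)
    fix x assume "x \<in> ?f -` Poly_Mapping.keys P"
    then show "x \<in> ?f ` Poly_Mapping.keys P" by (intro image_eqI[of x ?f "?f x"]) (simp_all only: ff vimage_eq)
  next
    fix x assume "x \<in> ?f ` Poly_Mapping.keys P"
    then show "x \<in> ?f -` Poly_Mapping.keys P" by (auto simp: assms)
  qed
  then show ?thesis using inj by (simp add: card_image inj_on_subset)
qed

lemma card_keys_wavelet_masks:
  "\<forall>P\<in>{H100, H010, H001, H111}. card (Poly_Mapping.keys P) = 23"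
  "\<forall>P\<in>{H110, H101, H011}. card (Poly_Mapping.keys P) = 21"
  by (simp_all add: H010_def H001_def H101_def H011_def card_keys_permute_vars card_keys_H100 card_keys_H110 card_keys_H111)

lemma sum_card_keys_wavelet_mask:
  "(\<Sum>s\<in>E01 - {0}. card (Poly_Mapping.keys (wavelet_mask s))) = 155"
  using card_keys_wavelet_masks by (simp add: E01_minus_0 wavelet_mask_def vector3_eq_iff)

section \<open>Compact support and assembly of the prewavelet property\<close>

lemma shift_sum_translate:
  "shift_sum \<phi> (laurent_up (Poly_Mapping.single k c) * P) x = c * shift_sum \<phi> P (x - 2 *\<^sub>R int_point k)"
  by (cases "c = 0") (simp_all add: shift_sum_up_mult)

lemma compactly_supported_translate:
  assumes "compactly_supported f"
  shows "compactly_supported (\<lambda>x. f (x - a))"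
proof -
  obtain K where K: "compact K" "AE x in lborel. x \<notin> K \<longrightarrow> f x = 0" using assms by (auto simp: compactly_supported_def)
  have "AE x in lborel. x - a \<notin> K \<longrightarrow> f (x - a) = 0" using AE_lborel_affine[OF K(2), of 1 "- a"] by simp
  then have "AE x in lborel. x \<notin> (+) a ` K \<longrightarrow> f (x - a) = 0"
  proof eventually_elim
    case (elim x)
    have "x \<in> (+) a ` K" if "x - a \<in> K" using that by (intro image_eqI[of x "(+) a" "x - a"]) auto
    then show ?case using elim by blast
  qed
  moreover have "compact ((+) a ` K)" by (rule compact_translation[OF K(1)])
  ultimately show ?thesis by (auto simp: compactly_supported_def)
qed

lemma compactly_supported_sum:
  "finite A \<Longrightarrow> (\<And>i. i \<in> A \<Longrightarrow> compactly_supported (f i)) \<Longrightarrow> compactly_supported (\<lambda>x. \<Sum>i\<in>A. c i * f i x)"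
proof (induction A rule: finite_induct)
  case empty
  show ?case by (auto simp: compactly_supported_def intro!: exI[of _ "{}"])
next
  case (insert i A)
  then have "compactly_supported (f i)" "compactly_supported (\<lambda>x. \<Sum>i\<in>A. c i * f i x)" by auto
  then obtain K L where K: "compact K" "AE x in lborel. x \<notin> K \<longrightarrow> f i x = 0"
    and L: "compact L" "AE x in lborel. x \<notin> L \<longrightarrow> (\<Sum>i\<in>A. c i * f i x) = 0"
    unfolding compactly_supported_def by blast
  from K(2) L(2) have "AE x in lborel. x \<notin> K \<union> L \<longrightarrow> (\<Sum>j\<in>insert i A. c j * f j x) = 0"
    by eventually_elim (use insert in simp)
  then show ?case using compact_Un[OF K(1) L(1)] by (auto simp: compactly_supported_def)
qed

lemma compactly_supported_shift_sum:
  assumes "compactly_supported \<phi>"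
  shows "compactly_supported (shift_sum \<phi> P)"
  unfolding shift_sum_def[abs_def] by (intro compactly_supported_sum compactly_supported_translate assms) simp

lemma compactly_supported_cong_AE:
  assumes "compactly_supported f" "AE x in lborel. g x = f x"
  shows "compactly_supported g"
proof -
  obtain K where K: "compact K" "AE x in lborel. x \<notin> K \<longrightarrow> f x = 0" using assms by (auto simp: compactly_supported_def)
  from K(2) assms(2) have "AE x in lborel. x \<notin> K \<longrightarrow> g x = 0" by eventually_elim simp
  then show ?thesis using K(1) by (auto simp: compactly_supported_def)
qed

lemma compactly_supported_box_spline:
  assumes "is_box_spline Xi \<phi>"
  shows "compactly_supported \<phi>"
proof (rule compactly_supported_cong_AE)
  show "AE x in lborel. \<phi> x = PL_box x" by (rule is_box_spline_unique[OF assms is_box_spline_PL_box])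
  have "PL_box x = 0" if "x \<notin> cbox 0 (\<chi> j. 2)" for x
    using that by (intro PL_box_support) (simp add: mem_box_cart)
  then show "compactly_supported PL_box"
    unfolding compactly_supported_def by (intro exI[of _ "cbox 0 (\<chi> j. 2)"]) simp
qed

lemma shift_sum_wavelet_comb:
  "shift_sum \<phi> (wavelet_comb Q) x = (\<Sum>(s, k)\<in>(SIGMA s:E01 - {0}. Poly_Mapping.keys (Q s)).
     Poly_Mapping.lookup (Q s) k * shift_sum \<phi> (wavelet_mask s) (x - 2 *\<^sub>R int_point k))"
  unfolding wavelet_comb_def shift_sum_sum shift_sum_up_mult by (rule sum.Sigma) auto

text \<open>The Riesz condition speaks of an arbitrary finite set \<open>J\<close> of pairs.
  Coefficients are extended by 0 to a full rectangle, from which one polynomial \<open>Q s\<close>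
  is formed for each \<open>s\<close>; function and norm are then rearranged by the same
  \<open>sumJ\<close>.\<close>

lemma shift_sum_wavelet_comb_finite:
  assumes "finite J" "J \<subseteq> (E01 - {0}) \<times> UNIV"
  obtains Q where
    "\<And>x. shift_sum \<phi> (wavelet_comb Q) x = (\<Sum>(s, k)\<in>J. c (s, k) * shift_sum \<phi> (wavelet_mask s) (x - 2 *\<^sub>R int_point k))"
    "(\<Sum>s\<in>E01 - {0}. laurent_sqnorm (Q s)) = (\<Sum>i\<in>J. (cmod (c i))\<^sup>2)"
proof -
  define K where "K = snd ` J"
  define b where "b s k = (if (s, k) \<in> J then c (s, k) else 0)" for s k
  define Q where "Q s = (\<Sum>k\<in>K. Poly_Mapping.single k (b s k))" for s
  have K: "finite K" using assms(1) by (simp add: K_def)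
  have J: "J \<subseteq> (E01 - {0}) \<times> K" using assms(2) unfolding K_def by force
  have b0: "\<And>s k. (s, k) \<notin> J \<Longrightarrow> b s k = 0" "\<And>s k. (s, k) \<in> J \<Longrightarrow> b s k = c (s, k)" by (simp_all add: b_def)
  have sumJ: "(\<Sum>s\<in>E01 - {0}. \<Sum>k\<in>K. g s k (b s k)) = (\<Sum>(s, k)\<in>J. g s k (c (s, k)))"
    if "\<And>s k. g s k 0 = 0" for g :: "nat^3 \<Rightarrow> int^3 \<Rightarrow> complex \<Rightarrow> 'b::comm_monoid_add"
  proof -
    have "(\<Sum>s\<in>E01 - {0}. \<Sum>k\<in>K. g s k (b s k)) = (\<Sum>(s, k)\<in>(E01 - {0}) \<times> K. g s k (b s k))"
      by (rule sum.cartesian_product)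
    also have "\<dots> = (\<Sum>(s, k)\<in>J. g s k (b s k))"
      using K J by (intro sum.mono_neutral_right) (auto simp: that b0)
    also have "\<dots> = (\<Sum>(s, k)\<in>J. g s k (c (s, k)))"
      by (rule sum.cong) (auto simp: b0)
    finally show ?thesis .
  qed
  have lookup: "Poly_Mapping.lookup (Q s) k = (if k \<in> K then b s k else 0)" for s k
    unfolding Q_def lookup_sum lookup_single using K by (simp add: when_def)
  have keys: "Poly_Mapping.keys (Q s) \<subseteq> K" for s
    by (auto simp: in_keys_iff lookup split: if_splits)
  show ?thesis
  proof (rule that)
    fix x
    have "shift_sum \<phi> (wavelet_comb Q) x = (\<Sum>s\<in>E01 - {0}. \<Sum>k\<in>K. b s k * shift_sum \<phi> (wavelet_mask s) (x - 2 *\<^sub>R int_point k))"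
      unfolding wavelet_comb_def shift_sum_sum shift_sum_up_mult
      by (intro sum.cong refl sum.mono_neutral_cong_left) (use K keys in \<open>auto simp: in_keys_iff lookup\<close>)
    then show "shift_sum \<phi> (wavelet_comb Q) x = (\<Sum>(s, k)\<in>J. c (s, k) * shift_sum \<phi> (wavelet_mask s) (x - 2 *\<^sub>R int_point k))"
      by (simp only: sumJ[of "\<lambda>s k c. c * shift_sum \<phi> (wavelet_mask s) (x - 2 *\<^sub>R int_point k)", OF mult_zero_left])
  next
    have "(\<Sum>s\<in>E01 - {0}. laurent_sqnorm (Q s)) = (\<Sum>s\<in>E01 - {0}. \<Sum>k\<in>K. (cmod (b s k))\<^sup>2)"
      unfolding laurent_sqnorm_def
      by (intro sum.cong refl sum.mono_neutral_cong_left) (use K keys in \<open>auto simp: in_keys_iff lookup\<close>)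
    also have "\<dots> = (\<Sum>(s, k)\<in>J. (cmod (c (s, k)))\<^sup>2)"
      by (rule sumJ) simp
    finally show "(\<Sum>s\<in>E01 - {0}. laurent_sqnorm (Q s)) = (\<Sum>i\<in>J. (cmod (c i))\<^sup>2)"
      by (simp add: case_prod_unfold)
  qed
qed

text \<open>The functions \<psi>_s agree with combinations of translates of \<phi> only almost
  everywhere, so each norm is rewritten for the explicit combination before the bounds for masks
  apply.\<close>

lemma are_prewavelets_wavelet_mask:
  assumes b: "is_box_spline Xi \<phi>"
    and m: "\<And>s. s \<in> E01 - {0} \<Longrightarrow> has_mask \<phi> (laurent_poly (wavelet_mask s)) (\<psi> s)"
  shows "are_prewavelets \<phi> (E01 - {0}) \<psi>"
proof -
  let ?w = "\<lambda>s k x. shift_sum \<phi> (wavelet_mask s) (x - 2 *\<^sub>R int_point k)"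
  have meas [measurable]: "\<psi> s \<in> borel_measurable borel" if "s \<in> E01 - {0}" for s
    using m[OF that] by (auto simp: has_mask_def has_fourier_L2_def L2_def)
  have eq: "AE x in lborel. \<psi> s (x - 2 *\<^sub>R int_point k) = ?w s k x" if "s \<in> E01 - {0}" for s k
    using AE_lborel_affine[OF has_mask_laurent_poly_AE[OF b m[OF that]], of 1 "- (2 *\<^sub>R int_point k)"] by simp
  have W: "(\<lambda>x. \<psi> s (x - 2 *\<^sub>R int_point k)) \<in> W_zero \<phi>" if s: "s \<in> E01 - {0}" for s k
  proof (rule W_zero_cong_AE)
    show "?w s k \<in> W_zero \<phi>"
      using shift_sum_wavelet_in_W_zero[OF b s, of "Poly_Mapping.single k 1"] by (simp add: shift_sum_translate[abs_def])
    show "AE x in lborel. ?w s k x = \<psi> s (x - 2 *\<^sub>R int_point k)" using eq[OF s] by (simp add: eq_commute)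
    show "(\<lambda>x. \<psi> s (x - 2 *\<^sub>R int_point k)) \<in> borel_measurable lborel" using meas[OF s] by measurable
  qed
  let ?I = "(E01 - {0}) \<times> UNIV :: ((nat^3) \<times> (int^3)) set"
  let ?b = "\<lambda>(s, k) x. \<psi> s (x - 2 *\<^sub>R int_point k)"
  have comb: "AE x in lborel. (\<Sum>i\<in>J. c i * ?b i x) = (\<Sum>(s, k)\<in>J. c (s, k) * ?w s k x)"
    if "finite J" "J \<subseteq> ?I" for J and c :: "_ \<Rightarrow> complex"
  proof -
    have "AE x in lborel. \<forall>i\<in>J. ?b i x = ?w (fst i) (snd i) x"
      using that eq by (intro AE_finite_allI) (auto simp: case_prod_unfold subset_iff)
    then show ?thesis by eventually_elim (simp add: case_prod_unfold)
  qed
  obtain B where B: "0 < B" "\<And>Q. laurent_sqnorm (wavelet_comb Q) \<le> B * (\<Sum>s\<in>E01 - {0}. laurent_sqnorm (Q s))"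
    by (rule laurent_sqnorm_wavelet_comb_le) (rule that, assumption+)
  have "is_Riesz_basis (W_zero \<phi>) ?I ?b"
    unfolding is_Riesz_basis_def
  proof (intro conjI)
    show "\<forall>i\<in>?I. ?b i \<in> W_zero \<phi>" using W by auto
    show "\<exists>A>0. \<exists>B>0. \<forall>J c. finite J \<and> J \<subseteq> ?I \<longrightarrow>
        ennreal (A * (\<Sum>i\<in>J. (cmod (c i))\<^sup>2)) \<le> L2_sqnorm lborel (\<lambda>x. \<Sum>i\<in>J. c i * ?b i x) \<and>
        L2_sqnorm lborel (\<lambda>x. \<Sum>i\<in>J. c i * ?b i x) \<le> ennreal (B * (\<Sum>i\<in>J. (cmod (c i))\<^sup>2))"
    \<comment> \<open>The lower constant 1/5 is the lower bound of \<Phi>, because the passage from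
      coefficients to masks has constant 1.\<close>
    proof (rule exI[of _ "1 / 5"], rule conjI[rotated], rule exI[of _ B], intro conjI allI impI)
      fix J :: "((nat^3) \<times> (int^3)) set" and c :: "(nat^3) \<times> (int^3) \<Rightarrow> complex"
      assume J: "finite J \<and> J \<subseteq> ?I"
      obtain Q where Q: "\<And>x. shift_sum \<phi> (wavelet_comb Q) x = (\<Sum>(s, k)\<in>J. c (s, k) * ?w s k x)"
        "(\<Sum>s\<in>E01 - {0}. laurent_sqnorm (Q s)) = (\<Sum>i\<in>J. (cmod (c i))\<^sup>2)"
        by (rule shift_sum_wavelet_comb_finite[where \<phi> = \<phi> and c = c, OF conjunct1[OF J] conjunct2[OF J]])
          (rule that, assumption+)
      have n: "L2_sqnorm lborel (\<lambda>x. \<Sum>i\<in>J. c i * ?b i x) = L2_sqnorm lborel (shift_sum \<phi> (wavelet_comb Q))"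
        using comb[of J c] J by (intro L2_sqnorm_cong_AE) (simp add: Q(1))
      show "ennreal (1 / 5 * (\<Sum>i\<in>J. (cmod (c i))\<^sup>2)) \<le> L2_sqnorm lborel (\<lambda>x. \<Sum>i\<in>J. c i * ?b i x)"
        unfolding n using sum_laurent_sqnorm_le_wavelet_comb[of Q]
        by (intro order_trans[OF _ L2_sqnorm_shift_sum_bounds(1)[OF b]] ennreal_leI) (simp add: Q(2))
      show "L2_sqnorm lborel (\<lambda>x. \<Sum>i\<in>J. c i * ?b i x) \<le> ennreal (B * (\<Sum>i\<in>J. (cmod (c i))\<^sup>2))"
        unfolding n using B(2)[of Q]
        by (intro order_trans[OF L2_sqnorm_shift_sum_bounds(2)[OF b]] ennreal_leI) (simp add: Q(2))
    qed (use B(1) in auto)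
    show "\<forall>f\<in>W_zero \<phi>. \<forall>\<epsilon>>0. \<exists>J c. finite J \<and> J \<subseteq> ?I \<and>
        L2_sqnorm lborel (\<lambda>x. f x - (\<Sum>i\<in>J. c i * ?b i x)) < ennreal \<epsilon>"
    proof (intro ballI allI impI)
      fix f and e :: real assume f: "f \<in> W_zero \<phi>" and e: "0 < e"
      obtain Q where Q: "L2_sqnorm lborel (\<lambda>x. f x - shift_sum \<phi> (wavelet_comb Q) x) < ennreal e"
        by (rule W_zero_approx[OF b f e])
      define J where "J = (SIGMA s:E01 - {0}. Poly_Mapping.keys (Q s))"
      define c where "c = (\<lambda>(s, k). Poly_Mapping.lookup (Q s) k)"
      have J: "finite J" "J \<subseteq> ?I" by (auto simp: J_def)
      have "L2_sqnorm lborel (\<lambda>x. f x - (\<Sum>i\<in>J. c i * ?b i x)) = L2_sqnorm lborel (\<lambda>x. f x - shift_sum \<phi> (wavelet_comb Q) x)"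
        using comb[OF J, of c]
        by (intro L2_sqnorm_cong_AE, eventually_elim) (simp add: shift_sum_wavelet_comb J_def c_def)
      then show "\<exists>J c. finite J \<and> J \<subseteq> ?I \<and> L2_sqnorm lborel (\<lambda>x. f x - (\<Sum>i\<in>J. c i * ?b i x)) < ennreal e"
        using J Q by (intro exI[of _ J] exI[of _ c]) (simp only: simp_thms)
    qed
  qed
  moreover have "\<forall>s\<in>E01 - {0}. \<psi> s \<in> W_zero \<phi>" using W[of _ 0] by simp
  ultimately show ?thesis by (simp add: are_prewavelets_def)
qed

theorem mainTheorem6:
  fixes \<phi> :: "real^3 \<Rightarrow> complex"
  assumes "is_box_spline Xi \<phi>"
  shows
    "box_mask Xi = Poly_Mapping.single 0 (1 / 2 ^ 4) *
       ((1 + lmon 1 0 0) * (1 + lmon 0 1 0) * (1 + lmon 0 0 1) * (1 + lmon 1 1 1)) \<and>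
     is_Laurent_basis E01
       (\<lambda>s. laurent_poly (if s = 0 then box_mask Xi else wavelet_mask s)) \<and>
     (\<forall>s\<in>E01 - {0}. \<forall>\<zeta>\<in>torus.
       Phi_inner \<phi> (laurent_poly (box_mask Xi)) (laurent_poly (wavelet_mask s)) \<zeta> = 0) \<and>
     (\<exists>\<psi>. \<forall>s\<in>E01 - {0}. has_mask \<phi> (laurent_poly (wavelet_mask s)) (\<psi> s)) \<and>
     (\<forall>\<psi>. (\<forall>s\<in>E01 - {0}. has_mask \<phi> (laurent_poly (wavelet_mask s)) (\<psi> s)) \<longrightarrow>
       (\<forall>s\<in>E01 - {0}. compactly_supported (\<psi> s)) \<and> are_prewavelets \<phi> (E01 - {0}) \<psi>) \<and>
     (\<forall>P\<in>{H100, H010, H001, H111}. card (Poly_Mapping.keys P) = 23) \<and>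
     (\<forall>P\<in>{H110, H101, H011}. card (Poly_Mapping.keys P) = 21) \<and>
     (\<Sum>s\<in>E01 - {0}. card (Poly_Mapping.keys (wavelet_mask s))) = 155"
proof (intro conjI)
  \<comment> \<open>Functions with these masks exist, which keeps the universally quantified claim
    that follows from being vacuous.\<close>
  show "\<exists>\<psi>. \<forall>s\<in>E01 - {0}. has_mask \<phi> (laurent_poly (wavelet_mask s)) (\<psi> s)"
    by (intro exI[of _ "\<lambda>s. shift_sum \<phi> (wavelet_mask s)"] ballI has_mask_shift_sum[OF assms])
  show "\<forall>\<psi>. (\<forall>s\<in>E01 - {0}. has_mask \<phi> (laurent_poly (wavelet_mask s)) (\<psi> s)) \<longrightarrow>
       (\<forall>s\<in>E01 - {0}. compactly_supported (\<psi> s)) \<and> are_prewavelets \<phi> (E01 - {0}) \<psi>"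
  proof (intro allI impI conjI ballI)
    fix \<psi> assume m: "\<forall>s\<in>E01 - {0}. has_mask \<phi> (laurent_poly (wavelet_mask s)) (\<psi> s)"
    show "are_prewavelets \<phi> (E01 - {0}) \<psi>" using m by (intro are_prewavelets_wavelet_mask[OF assms]) simp
    fix s :: "nat^3" assume "s \<in> E01 - {0}"
    with m have "AE x in lborel. \<psi> s x = shift_sum \<phi> (wavelet_mask s) x" by (intro has_mask_laurent_poly_AE[OF assms]) simp
    then show "compactly_supported (\<psi> s)"
      by (rule compactly_supported_cong_AE[OF compactly_supported_shift_sum[OF compactly_supported_box_spline[OF assms]]])
  qed
  show "\<forall>s\<in>E01 - {0}. \<forall>\<zeta>\<in>torus.
       Phi_inner \<phi> (laurent_poly (box_mask Xi)) (laurent_poly (wavelet_mask s)) \<zeta> = 0"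
    by (intro ballI Phi_inner_eq_0[OF assms])
qed (rule box_mask_Xi is_Laurent_basis_masks card_keys_wavelet_masks sum_card_keys_wavelet_mask)+

end
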